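(* Let $l\ge2$ and $n\ge1$ be integers, and let $Z^n$ be the toric variety obtained from $\mathbf A^l$ through the sequence of $n$ blow-ups along the irreducible stable subvarieties associated successively to the cones $$\sigma(e_1,\dots,e_l),\quad \sigma\Big(e_1,\dots,e_{l-1},\,i\big(\textstyle\sum_{j=1}^{l-1}e_j\big)+e_l\Big)\quad\text{for } i=1,2,\dots,n-1 .$$ Let $L_h$ and $L_k$ be any two line bundles generated by global sections on $Z^n$. Then the product of sections $$m_{h,k}:H^0(Z^n,L_h)\otimes H^0(Z^n,L_k)\longrightarrow H^0(Z^n,L_{h}\otimes L_k)$$ is surjective.
   Context: Work over $\mathbf C$. Let $N=\mathbf Z^l$ with basis $e_1,\dots,e_l$; $\sigma(v_1,\dots,v_r)$ is the cone generated by $v_1,\dots,v_r$. $\mathbf A^l$ is the toric variety whose fan consists of the faces of $\sigma(e_1,\dots,e_l)$. In a smooth toric variety with fan $\Delta$, the irreducible stable (i.e. torus-stable) closed subvariety associated to a cone $\gamma\in\Delta$ is the closure of the torus orbit corresponding to $\gamma$; blowing it up is the star subdivision of $\Delta$ obtained by adding the ray spanned by the sum of the primitive generators of $\gamma$. At each step the cone named in the statement belongs to the fan of the variety obtained so far. *)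

theory Defs
  imports
    "HOL-Analysis.Analysis"
    "HOL-Library.Poly_Mapping"
    "HOL-Library.Function_Algebras"
begin

section \<open>Cones and fans in \<open>N = \<int>\<^sup>l\<close>\<close>

text \<open>
  The rank \<open>l\<close> is the cardinality of the finite index type \<open>'l\<close>. The lattice \<open>N\<close> and the dual
  lattice \<open>M\<close> are both \<^typ>\<open>int ^ 'l\<close>, paired by the standard inner product; cones are subsets of
  \<open>N\<^sub>\<real> = \<real>\<^sup>l\<close>.
\<close>

definition real_vec :: "int ^ 'l \<Rightarrow> real ^ ('l::finite)" where
  "real_vec v = (\<chi> i. of_int (v $ i))"

definition cone_gen :: "(int ^ 'l) set \<Rightarrow> (real ^ ('l::finite)) set" where
  "cone_gen A = convex_cone hull (real_vec ` A)"

definition primitive_vec :: "int ^ ('l::finite) \<Rightarrow> bool" where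
  "primitive_vec v \<longleftrightarrow> Gcd (range (\<lambda>i. v $ i)) = 1"

definition primitive_gens :: "(real ^ 'l) set \<Rightarrow> (int ^ ('l::finite)) set" where
  "primitive_gens \<sigma> = {v. primitive_vec v \<and> cone_gen {v} face_of \<sigma>}"

text \<open>
  Star subdivision of a smooth fan \<open>\<Delta>\<close> along \<open>\<gamma> \<in> \<Delta>\<close>: every cone \<open>\<sigma> \<supseteq> \<gamma>\<close> is replaced by the cones
  spanned by those subsets of \<open>\<sigma>(1) \<union> {u}\<close> which do not contain \<open>\<gamma>(1)\<close>, where \<open>u\<close> is the sum of
  the primitive generators of \<open>\<gamma>\<close>.
\<close>

definition star_subdivision ::
  "(real ^ 'l) set set \<Rightarrow> (real ^ 'l) set \<Rightarrow> (real ^ ('l::finite)) set set" where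
  "star_subdivision \<Delta> \<gamma> =
     {\<sigma> \<in> \<Delta>. \<not> \<gamma> \<subseteq> \<sigma>} \<union>
     {cone_gen A | A \<sigma>. \<sigma> \<in> \<Delta> \<and> \<gamma> \<subseteq> \<sigma> \<and>
        A \<subseteq> insert (\<Sum>v\<in>primitive_gens \<gamma>. v) (primitive_gens \<sigma>) \<and> \<not> primitive_gens \<gamma> \<subseteq> A}"

text \<open>The empty set is a face of every convex set in the library, but not a cone.\<close>

definition affine_space_fan :: "(real ^ ('l::finite)) set set" where
  "affine_space_fan = {\<tau>. \<tau> face_of cone_gen (range (\<lambda>j. axis j 1)) \<and> \<tau> \<noteq> {}}"

text \<open>
  The basis vector \<open>e\<^sub>l\<close> is \<open>axis q 1\<close> for a distinguished index \<open>q\<close>; the basis vectors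
  \<open>e\<^sub>1, \<dots>, e\<^bsub>l-1\<^esub>\<close> are the \<open>axis j 1\<close> with \<open>j \<noteq> q\<close>. For \<open>i = 0\<close> the centre is
  \<open>\<sigma>(e\<^sub>1, \<dots>, e\<^sub>l)\<close>, the centre of the first blow-up.
\<close>

definition centre_cone :: "'l \<Rightarrow> nat \<Rightarrow> (real ^ ('l::finite)) set" where
  "centre_cone q i =
     cone_gen (insert (int i *s (\<Sum>j\<in>UNIV - {q}. axis j 1) + axis q 1)
                      ((\<lambda>j. axis j 1) ` (UNIV - {q})))"

primrec blowup_fan :: "'l \<Rightarrow> nat \<Rightarrow> (real ^ ('l::finite)) set set" where
  "blowup_fan q 0 = affine_space_fan"
| "blowup_fan q (Suc i) = star_subdivision (blowup_fan q i) (centre_cone q i)"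


section \<open>The complex toric variety of a fan\<close>

definition dual_monoid :: "(real ^ 'l) set \<Rightarrow> (int ^ ('l::finite)) set" where
  "dual_monoid \<sigma> = {m. \<forall>v\<in>\<sigma>. 0 \<le> real_vec m \<bullet> v}"

text \<open>
  The closed points of \<open>U\<^sub>\<sigma> = Spec \<complex>[\<sigma>\<^sup>\<or> \<inter> M]\<close> are the monoid homomorphisms
  \<open>\<sigma>\<^sup>\<or> \<inter> M \<rightarrow> (\<complex>, \<cdot>)\<close>; the character \<open>\<chi>\<^sup>m\<close> is evaluation at \<open>m\<close>.
\<close>

definition affine_chart :: "(real ^ 'l) set \<Rightarrow> (int ^ ('l::finite) \<Rightarrow> complex) set" where
  "affine_chart \<sigma> = {x \<in> extensional (dual_monoid \<sigma>). x 0 = 1 \<and>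
     (\<forall>m\<in>dual_monoid \<sigma>. \<forall>m'\<in>dual_monoid \<sigma>. x (m + m') = x m * x m')}"

definition coordinate_ring ::
  "(real ^ 'l) set \<Rightarrow> ((int ^ ('l::finite) \<Rightarrow> complex) \<Rightarrow> complex) set" where
  "coordinate_ring \<sigma> =
     {(\<lambda>x. \<Sum>m\<in>F. c m * x m) | c F. finite F \<and> F \<subseteq> dual_monoid \<sigma>}"

definition open_chart ::
  "(real ^ 'l) set \<Rightarrow> (int ^ ('l::finite) \<Rightarrow> complex) set \<Rightarrow> bool" where
  "open_chart \<sigma> W \<longleftrightarrow>
     (\<exists>A \<subseteq> coordinate_ring \<sigma>. W = affine_chart \<sigma> - {x. \<forall>f\<in>A. f x = 0})"

definition regular_chart ::
  "(real ^ 'l) set \<Rightarrow> (int ^ ('l::finite) \<Rightarrow> complex) set \<Rightarrow>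
   ((int ^ 'l \<Rightarrow> complex) \<Rightarrow> complex) \<Rightarrow> bool" where
  "regular_chart \<sigma> W f \<longleftrightarrow>
     (\<forall>x\<in>W. \<exists>W' a b. open_chart \<sigma> W' \<and> x \<in> W' \<and> W' \<subseteq> W \<and>
        a \<in> coordinate_ring \<sigma> \<and> b \<in> coordinate_ring \<sigma> \<and>
        (\<forall>y\<in>W'. b y \<noteq> 0 \<and> f y = a y / b y))"

text \<open>
  The toric variety is glued from the charts \<open>U\<^sub>\<sigma>\<close>, \<open>\<sigma> \<in> \<Delta>\<close>, by identifying the images of
  \<open>U\<^bsub>\<sigma> \<inter> \<tau>\<^esub>\<close> in \<open>U\<^sub>\<sigma>\<close> and \<open>U\<^sub>\<tau>\<close> under the restriction maps. Its points are the closed points of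
  the corresponding scheme, and its structure sheaf is viewed as a sheaf of complex-valued functions.
\<close>

type_synonym 'l toric_point = "((real ^ 'l) set \<times> (int ^ 'l \<Rightarrow> complex)) set"

definition gluing ::
  "(real ^ 'l) set set \<Rightarrow>
   (((real ^ 'l) set \<times> (int ^ 'l \<Rightarrow> complex)) \<times>
    ((real ^ 'l) set \<times> (int ^ ('l::finite) \<Rightarrow> complex))) set" where
  "gluing \<Delta> = {((\<sigma>, x), (\<tau>, y)) | \<sigma> x \<tau> y. \<sigma> \<in> \<Delta> \<and> \<tau> \<in> \<Delta> \<and>
     (\<exists>z \<in> affine_chart (\<sigma> \<inter> \<tau>).
        x = restrict z (dual_monoid \<sigma>) \<and> y = restrict z (dual_monoid \<tau>))}"

definition toric_variety :: "(real ^ 'l) set set \<Rightarrow> ('l::finite) toric_point set" where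
  "toric_variety \<Delta> = (SIGMA \<sigma>:\<Delta>. affine_chart \<sigma>) // gluing \<Delta>"

definition chart_map ::
  "(real ^ 'l) set set \<Rightarrow> (real ^ 'l) set \<Rightarrow> (int ^ 'l \<Rightarrow> complex) \<Rightarrow>
   ('l::finite) toric_point" where
  "chart_map \<Delta> \<sigma> x = gluing \<Delta> `` {(\<sigma>, x)}"

definition chart_preimage ::
  "(real ^ 'l) set set \<Rightarrow> (real ^ 'l) set \<Rightarrow> ('l::finite) toric_point set \<Rightarrow>
   (int ^ 'l \<Rightarrow> complex) set" where
  "chart_preimage \<Delta> \<sigma> V = {x \<in> affine_chart \<sigma>. chart_map \<Delta> \<sigma> x \<in> V}"

definition zariski_open ::
  "(real ^ 'l) set set \<Rightarrow> ('l::finite) toric_point set \<Rightarrow> bool" where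
  "zariski_open \<Delta> V \<longleftrightarrow>
     V \<subseteq> toric_variety \<Delta> \<and> (\<forall>\<sigma>\<in>\<Delta>. open_chart \<sigma> (chart_preimage \<Delta> \<sigma> V))"

definition regular_on ::
  "(real ^ 'l) set set \<Rightarrow> ('l::finite) toric_point set \<Rightarrow>
   ('l toric_point \<Rightarrow> complex) \<Rightarrow> bool" where
  "regular_on \<Delta> V f \<longleftrightarrow>
     (\<forall>\<sigma>\<in>\<Delta>. regular_chart \<sigma> (chart_preimage \<Delta> \<sigma> V) (f \<circ> chart_map \<Delta> \<sigma>))"


section \<open>Line bundles and their global sections\<close>

text \<open>
  A line bundle is given by its transition functions \<open>g\<^bsub>ij\<^esub> \<in> \<O>\<^sup>*(U\<^sub>i \<inter> U\<^sub>j)\<close> with respect to a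
  trivializing Zariski-open cover \<open>(U\<^sub>i)\<close>. A section is a family \<open>s\<^sub>i \<in> \<O>(U\<^sub>i)\<close> with
  \<open>s\<^sub>i = g\<^bsub>ij\<^esub> s\<^sub>j\<close> on \<open>U\<^sub>i \<inter> U\<^sub>j\<close>.
\<close>

record ('p, 'i) cocycle =
  index :: "'i set"
  cover :: "'i \<Rightarrow> 'p set"
  transition :: "'i \<Rightarrow> 'i \<Rightarrow> 'p \<Rightarrow> complex"

definition line_bundle ::
  "(real ^ 'l) set set \<Rightarrow> (('l::finite) toric_point, 'i) cocycle \<Rightarrow> bool" where
  "line_bundle \<Delta> L \<longleftrightarrow>
     (\<forall>i\<in>index L. zariski_open \<Delta> (cover L i)) \<and>
     (\<Union>i\<in>index L. cover L i) = toric_variety \<Delta> \<and>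
     (\<forall>i\<in>index L. \<forall>j\<in>index L.
        regular_on \<Delta> (cover L i \<inter> cover L j) (transition L i j) \<and>
        (\<forall>x \<in> cover L i \<inter> cover L j. transition L i j x \<noteq> 0)) \<and>
     (\<forall>i\<in>index L. \<forall>j\<in>index L. \<forall>k\<in>index L. \<forall>x \<in> cover L i \<inter> cover L j \<inter> cover L k.
        transition L i j x * transition L j k x = transition L i k x)"

text \<open>
  The local representatives \<open>s\<^sub>i\<close> are extended by \<open>0\<close> outside \<open>U\<^sub>i\<close>, so that equality of sections is
  equality in HOL and sections form a subspace for the pointwise operations.
\<close>

definition global_sections ::
  "(real ^ 'l) set set \<Rightarrow> (('l::finite) toric_point, 'i) cocycle \<Rightarrow>
   ('i \<Rightarrow> 'l toric_point \<Rightarrow> complex) set" where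
  "global_sections \<Delta> L = {s.
     (\<forall>i\<in>index L. regular_on \<Delta> (cover L i) (s i)) \<and>
     (\<forall>i\<in>index L. \<forall>j\<in>index L. \<forall>x \<in> cover L i \<inter> cover L j.
        s i x = transition L i j x * s j x) \<and>
     (\<forall>i x. i \<notin> index L \<or> x \<notin> cover L i \<longrightarrow> s i x = 0)}"

definition globally_generated ::
  "(real ^ 'l) set set \<Rightarrow> (('l::finite) toric_point, 'i) cocycle \<Rightarrow> bool" where
  "globally_generated \<Delta> L \<longleftrightarrow>
     (\<forall>i\<in>index L. \<forall>x \<in> cover L i. \<exists>s \<in> global_sections \<Delta> L. s i x \<noteq> 0)"

definition bundle_tensor ::
  "('p, 'i) cocycle \<Rightarrow> ('p, 'j) cocycle \<Rightarrow> ('p, 'i \<times> 'j) cocycle" where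
  "bundle_tensor L K =
     \<lparr>index = index L \<times> index K,
      cover = (\<lambda>(i, j). cover L i \<inter> cover K j),
      transition = (\<lambda>(i, j) (i', j') x. transition L i i' x * transition K j j' x)\<rparr>"

definition section_scale ::
  "complex \<Rightarrow> ('i \<Rightarrow> 'p \<Rightarrow> complex) \<Rightarrow> 'i \<Rightarrow> 'p \<Rightarrow> complex" where
  "section_scale c s = (\<lambda>i x. c * s i x)"

definition section_prod ::
  "('i \<Rightarrow> 'p \<Rightarrow> complex) \<Rightarrow> ('j \<Rightarrow> 'p \<Rightarrow> complex) \<Rightarrow> 'i \<times> 'j \<Rightarrow> 'p \<Rightarrow> complex" where
  "section_prod s t = (\<lambda>(i, j) x. s i x * t j x)"


section \<open>Tensor products of spaces of sections\<close>

text \<open>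
  For subspaces \<open>V\<close>, \<open>W\<close> of spaces of families of functions, \<open>V \<otimes> W\<close> is the quotient of the free
  vector space on \<open>V \<times> W\<close> by the span of the bilinearity relations; its elements are cosets.
\<close>

definition free_scale :: "complex \<Rightarrow> ('a \<Rightarrow>\<^sub>0 complex) \<Rightarrow> ('a \<Rightarrow>\<^sub>0 complex)" where
  "free_scale c f = Poly_Mapping.map ((*) c) f"

lemma lookup_free_scale:
  "Poly_Mapping.lookup (free_scale c f) x = c * Poly_Mapping.lookup f x"
  by (simp add: free_scale_def map.rep_eq when_def)

lemma vector_space_free_scale: "vector_space free_scale"
  by unfold_locales
    (auto simp: poly_mapping_eq_iff fun_eq_iff lookup_add lookup_free_scale algebra_simps)

definition bilinear_relations ::
  "('i \<Rightarrow> 'p \<Rightarrow> complex) set \<Rightarrow> ('j \<Rightarrow> 'p \<Rightarrow> complex) set \<Rightarrow>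
   ((('i \<Rightarrow> 'p \<Rightarrow> complex) \<times> ('j \<Rightarrow> 'p \<Rightarrow> complex)) \<Rightarrow>\<^sub>0 complex) set" where
  "bilinear_relations V W =
     (let \<delta> = (\<lambda>s t. Poly_Mapping.single (s, t) 1) in
       {\<delta> (s + s') t - \<delta> s t - \<delta> s' t | s s' t. s \<in> V \<and> s' \<in> V \<and> t \<in> W} \<union>
       {\<delta> s (t + t') - \<delta> s t - \<delta> s t' | s t t'. s \<in> V \<and> t \<in> W \<and> t' \<in> W} \<union>
       {\<delta> (section_scale c s) t - free_scale c (\<delta> s t) | c s t. s \<in> V \<and> t \<in> W} \<union>
       {\<delta> s (section_scale c t) - free_scale c (\<delta> s t) | c s t. s \<in> V \<and> t \<in> W})"

definition tensor_space ::
  "('i \<Rightarrow> 'p \<Rightarrow> complex) set \<Rightarrow> ('j \<Rightarrow> 'p \<Rightarrow> complex) set \<Rightarrow>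
   ((('i \<Rightarrow> 'p \<Rightarrow> complex) \<times> ('j \<Rightarrow> 'p \<Rightarrow> complex)) \<Rightarrow>\<^sub>0 complex) set set" where
  "tensor_space V W =
     {(+) f ` module.span free_scale (bilinear_relations V W) | f. Poly_Mapping.keys f \<subseteq> V \<times> W}"

definition free_product_map ::
  "((('i \<Rightarrow> 'p \<Rightarrow> complex) \<times> ('j \<Rightarrow> 'p \<Rightarrow> complex)) \<Rightarrow>\<^sub>0 complex) \<Rightarrow>
   'i \<times> 'j \<Rightarrow> 'p \<Rightarrow> complex" where
  "free_product_map f =
     (\<Sum>(s, t)\<in>Poly_Mapping.keys f.
        section_scale (Poly_Mapping.lookup f (s, t)) (section_prod s t))"

text \<open>
  The map induced on the tensor product by \<open>(s, t) \<mapsto> s t\<close>: \<^const>\<open>free_product_map\<close> is constant on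
  each coset.
\<close>

definition product_of_sections ::
  "((('i \<Rightarrow> 'p \<Rightarrow> complex) \<times> ('j \<Rightarrow> 'p \<Rightarrow> complex)) \<Rightarrow>\<^sub>0 complex) set \<Rightarrow>
   'i \<times> 'j \<Rightarrow> 'p \<Rightarrow> complex" where
  "product_of_sections \<xi> = the_elem (free_product_map ` \<xi>)"

end

theory Submission
  imports Defs "HOL-Computational_Algebra.Fundamental_Theorem_Algebra"
begin

text \<open>Polynomial rings are factorial, so a line bundle is trivial on each affine chart; transition
  functions between charts are units on the torus, hence monomials up to a constant. A bundle is thus
  described by characters \<open>\<mu> B\<close>, one for each maximal cone \<open>B\<close>, and its sections are spanned by the
  characters in the polytope they cut out. Global generation makes each \<open>\<mu> B\<close> a point of the polytope,
  and surjectivity reduces to splitting a lattice point of the polytope of the product. All rays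
  other than the \<open>e\<^sub>j\<close> with \<open>j \<noteq> q\<close> pair with \<open>m\<close> through \<open>(\<Sum>\<^sub>j\<^sub>\<noteq>\<^sub>q m\<^sub>j, m\<^sub>q)\<close> only, so one
  splits first in the plane and then distributes the first coordinate over the \<open>m\<^sub>j\<close>.\<close>

section \<open>Unique factorization in subrings without zero divisors\<close>

text \<open>The rings involved consist of functions, and the full function type has zero divisors;
  factoriality is therefore developed for subsets of a commutative ring, with the variables forming
  a finite index set so that they can be adjoined one at a time. Frames on different charts are
  compared on the torus, where a unit is a monomial up to a scalar; Cox coordinates supply curves
  from the torus to every boundary point, and continuity carries the comparison there. The obstacle
  is the splitting step: for globally generated bundles on smooth toric varieties in general it
  fails. The segments from 0 to (1,0) and from 0 to (1,2) have a sum containing the lattice point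
  (1,1), which is no sum of lattice points of the two. Here it succeeds for two reasons. Consecutive
  blow-up rays induce the forms i x + y and (i+1) x + y, a lattice basis of the plane, so the
  polygon has a lattice vertex on both supporting lines, with abscissa the difference of the two
  bounds. And each e_j constrains m_j alone, so a prescribed value of the sum of the m_j can be
  distributed as soon as it lies between the sums of the bounds.\<close>

locale subdomain =
  fixes S :: "'a::comm_ring_1 set"
  assumes zero_mem [simp]: "0 \<in> S" and one_mem [simp]: "1 \<in> S"
    and add_mem: "a \<in> S \<Longrightarrow> b \<in> S \<Longrightarrow> a + b \<in> S"
    and mult_mem: "a \<in> S \<Longrightarrow> b \<in> S \<Longrightarrow> a * b \<in> S"
    and uminus_mem: "a \<in> S \<Longrightarrow> - a \<in> S"
    and no_zero_div: "a \<in> S \<Longrightarrow> b \<in> S \<Longrightarrow> a * b = 0 \<Longrightarrow> a = 0 \<or> b = 0"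

definition divides_in :: "'a::comm_ring_1 set \<Rightarrow> 'a \<Rightarrow> 'a \<Rightarrow> bool" where
  "divides_in S a b \<longleftrightarrow> (\<exists>c\<in>S. b = a * c)"

definition unit_in :: "'a::comm_ring_1 set \<Rightarrow> 'a \<Rightarrow> bool" where
  "unit_in S u \<longleftrightarrow> u \<in> S \<and> divides_in S u 1"

definition prime_in :: "'a::comm_ring_1 set \<Rightarrow> 'a \<Rightarrow> bool" where
  "prime_in S p \<longleftrightarrow> p \<in> S \<and> p \<noteq> 0 \<and> \<not> unit_in S p \<and>
     (\<forall>a\<in>S. \<forall>b\<in>S. divides_in S p (a * b) \<longrightarrow> divides_in S p a \<or> divides_in S p b)"

definition irreducible_in :: "'a::comm_ring_1 set \<Rightarrow> 'a \<Rightarrow> bool" where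
  "irreducible_in S p \<longleftrightarrow> p \<in> S \<and> p \<noteq> 0 \<and> \<not> unit_in S p \<and>
     (\<forall>a\<in>S. \<forall>b\<in>S. p = a * b \<longrightarrow> unit_in S a \<or> unit_in S b)"

text \<open>The index counts the primes of a factorization up to a unit; it is the measure on which
  the descents below run. Products of primes are used instead of irreducibles, so that uniqueness is
  built in.\<close>

inductive factors_in :: "'a::comm_ring_1 set \<Rightarrow> nat \<Rightarrow> 'a \<Rightarrow> bool" for S where
  factors_unit: "unit_in S u \<Longrightarrow> factors_in S 0 u"
| factors_prime: "prime_in S p \<Longrightarrow> factors_in S n a \<Longrightarrow> factors_in S (Suc n) (p * a)"

context subdomain
begin

lemma diff_mem: "a \<in> S \<Longrightarrow> b \<in> S \<Longrightarrow> a - b \<in> S"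
  using add_mem uminus_mem by fastforce

lemma power_mem: "a \<in> S \<Longrightarrow> a ^ k \<in> S"
  by (induction k) (auto intro: mult_mem)

lemma sum_mem: "(\<And>i. i \<in> I \<Longrightarrow> f i \<in> S) \<Longrightarrow> sum f I \<in> S"
  by (induction I rule: infinite_finite_induct) (auto intro: add_mem)

lemma prod_mem: "(\<And>i. i \<in> I \<Longrightarrow> f i \<in> S) \<Longrightarrow> prod f I \<in> S"
  by (induction I rule: infinite_finite_induct) (auto intro: mult_mem)

lemma cancel: "a \<in> S \<Longrightarrow> b \<in> S \<Longrightarrow> c \<in> S \<Longrightarrow> a \<noteq> 0 \<Longrightarrow> a * b = a * c \<Longrightarrow> b = c"
  using no_zero_div[of a "b - c"] by (auto simp: diff_mem right_diff_distrib)

lemma mult_nonzero: "a \<in> S \<Longrightarrow> b \<in> S \<Longrightarrow> a \<noteq> 0 \<Longrightarrow> b \<noteq> 0 \<Longrightarrow> a * b \<noteq> 0"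
  using no_zero_div by blast

lemma unit_nonzero: "unit_in S u \<Longrightarrow> u \<noteq> 0"
  by (auto simp: unit_in_def divides_in_def)

lemma unit_inverse: "unit_in S u \<Longrightarrow> \<exists>v. unit_in S v \<and> u * v = 1"
  unfolding unit_in_def divides_in_def by (auto simp: mult.commute)

lemma unit_mult: "unit_in S u \<Longrightarrow> unit_in S v \<Longrightarrow> unit_in S (u * v)"
proof -
  assume u: "unit_in S u" and v: "unit_in S v"
  obtain u' v' where "unit_in S u'" "u * u' = 1" "unit_in S v'" "v * v' = 1"
    using unit_inverse u v by blast
  moreover have "(u * v) * (u' * v') = (u * u') * (v * v')" by (simp add: mult_ac)
  ultimately show ?thesis using u v
    unfolding unit_in_def divides_in_def
    by (auto intro!: mult_mem bexI[of _ "u' * v'"])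
qed

lemma unit_of_mult: "a \<in> S \<Longrightarrow> b \<in> S \<Longrightarrow> unit_in S (a * b) \<Longrightarrow> unit_in S a"
  unfolding unit_in_def divides_in_def by (auto simp: mult.assoc intro: mult_mem)

lemma divides_mult_right: "divides_in S p a \<Longrightarrow> b \<in> S \<Longrightarrow> divides_in S p (a * b)"
  unfolding divides_in_def by (auto simp: mult.assoc intro: mult_mem)

lemma divides_mult_left: "divides_in S p a \<Longrightarrow> b \<in> S \<Longrightarrow> divides_in S p (b * a)"
  using divides_mult_right[of p a b] by (simp add: mult.commute)

lemma divides_add: "divides_in S p a \<Longrightarrow> divides_in S p b \<Longrightarrow> divides_in S p (a + b)"
  unfolding divides_in_def by (auto simp: distrib_left[symmetric] intro: add_mem)

lemma divides_diff: "divides_in S p a \<Longrightarrow> divides_in S p b \<Longrightarrow> divides_in S p (a - b)"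
  unfolding divides_in_def by (auto simp: right_diff_distrib[symmetric] intro: diff_mem)

lemma divides_sum: "(\<And>i. i \<in> I \<Longrightarrow> divides_in S p (f i)) \<Longrightarrow> divides_in S p (sum f I)"
proof (induction I rule: infinite_finite_induct)
  case (insert x F) then show ?case by (auto intro: divides_add)
qed (auto simp: divides_in_def intro!: bexI[of _ 0])

lemma divides_trans: "divides_in S a b \<Longrightarrow> divides_in S b c \<Longrightarrow> divides_in S a c"
  unfolding divides_in_def by (auto simp: mult.assoc intro: mult_mem)

lemma divides_refl: "divides_in S a a"
  unfolding divides_in_def by (auto intro: bexI[of _ 1])

lemma prime_irreducible: "prime_in S p \<Longrightarrow> irreducible_in S p"
proof -
  assume p: "prime_in S p"
  have unit: "unit_in S b" if ab: "a \<in> S" "b \<in> S" "p = a * b" and d: "divides_in S p a" for a b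
  proof -
    obtain c where c: "c \<in> S" "a = p * c" using d unfolding divides_in_def by blast
    have "p * (b * c) = (p * c) * b" by (simp add: mult_ac)
    also have "\<dots> = p * 1" using ab(3) c(2) by simp
    finally have "p * (b * c) = p * 1" .
    then have "b * c = 1" using cancel[of p "b * c" 1] p ab(2) c(1) by (auto simp: prime_in_def mult_mem)
    then show ?thesis using ab(2) c(1) unfolding unit_in_def divides_in_def by (auto intro: bexI[of _ c])
  qed
  have "divides_in S p a \<or> divides_in S p b" if "a \<in> S" "b \<in> S" "p = a * b" for a b
    using p that divides_refl[of p] unfolding prime_in_def by auto
  moreover have "unit_in S a" if "a \<in> S" "b \<in> S" "p = a * b" "divides_in S p b" for a b
    by (rule unit[OF that(2,1) that(3)[unfolded mult.commute[of a b]] that(4)])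
  ultimately show ?thesis using p unit unfolding prime_in_def irreducible_in_def by blast
qed

lemma factors_mem: "factors_in S n a \<Longrightarrow> a \<in> S \<and> a \<noteq> 0"
proof (induction rule: factors_in.induct)
  case (factors_unit u) then show ?case using unit_nonzero by (auto simp: unit_in_def)
next
  case (factors_prime p n a)
  then show ?case using mult_mem mult_nonzero by (auto simp: prime_in_def)
qed

lemma factors_mult_unit: "factors_in S n a \<Longrightarrow> unit_in S u \<Longrightarrow> factors_in S n (a * u)"
proof (induction rule: factors_in.induct)
  case (factors_unit u) then show ?case by (simp add: factors_in.factors_unit unit_mult)
next
  case (factors_prime p n a)
  then show ?case using factors_in.factors_prime[of S p n "a * u"] by (simp add: mult.assoc)
qed

text \<open>Each prime of \<open>c\<close> divides \<open>q\<close> or \<open>h\<close> and is moved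
  into \<open>c2\<close> or \<open>c1\<close> accordingly. Applied to constants of a polynomial
  ring, this clears the denominators left by division over the fraction field.\<close>

lemma factors_split:
  assumes "factors_in S n c" "f \<in> S" "q \<in> S" "h \<in> S" "c * f = q * h"
  shows "\<exists>c1\<in>S. \<exists>c2\<in>S. \<exists>q'\<in>S. \<exists>h'\<in>S. c = c1 * c2 \<and> q = c2 * q' \<and> h = c1 * h' \<and> f = q' * h'"
  using assms
proof (induction arbitrary: q h rule: factors_in.induct)
  case (factors_unit u)
  then obtain v where v: "unit_in S v" "u * v = 1" using unit_inverse by blast
  have "f = u * v * f" using v by simp
  also have "\<dots> = u * f * v" by (simp add: mult_ac)
  also have "\<dots> = q * (h * v)" using factors_unit by (simp add: mult_ac)
  finally have f: "f = q * (h * v)" .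
  have "h = u * v * h" using v by simp
  also have "\<dots> = u * (h * v)" by (simp add: mult_ac)
  finally have h: "h = u * (h * v)" .
  have "h * v \<in> S" "u \<in> S" using v factors_unit by (auto simp: unit_in_def intro: mult_mem)
  then show ?case using factors_unit f h
    by (intro bexI[of _ u] bexI[of _ 1] bexI[of _ q] bexI[of _ "h * v"]) auto
next
  case (factors_prime p n a)
  have pS: "p \<in> S" "p \<noteq> 0" using factors_prime.hyps unfolding prime_in_def by auto
  have aS: "a \<in> S" using factors_mem factors_prime by blast
  have "divides_in S p (q * h)" using factors_prime.prems aS unfolding divides_in_def
    by (metis mult.assoc mult_mem)
  then consider "divides_in S p q" | "divides_in S p h"
    using factors_prime unfolding prime_in_def by blast
  then show ?case
  proof cases
    case 1
    then obtain q0 where q0: "q0 \<in> S" "q = p * q0" unfolding divides_in_def by blast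
    have "p * (a * f) = p * (q0 * h)" using factors_prime.prems q0 by (simp add: mult.assoc)
    then have "a * f = q0 * h" using cancel pS aS q0 factors_prime.prems by (meson mult_mem)
    with factors_prime.IH factors_prime.prems q0 obtain c1 c2 q' h' where
      "c1 \<in> S" "c2 \<in> S" "q' \<in> S" "h' \<in> S" "a = c1 * c2" "q0 = c2 * q'" "h = c1 * h'" "f = q' * h'"
      by metis
    then show ?thesis using q0 pS
      by (intro bexI[of _ c1] bexI[of _ "p * c2"] bexI[of _ q'] bexI[of _ h'])
        (auto simp: mult_ac mult_mem)
  next
    case 2
    then obtain q0 where q0: "q0 \<in> S" "h = p * q0" unfolding divides_in_def by blast
    have "p * (a * f) = p * (q * q0)" using factors_prime.prems q0 by (simp add: mult_ac)
    then have "a * f = q * q0" using cancel pS aS q0 factors_prime.prems by (meson mult_mem)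
    with factors_prime.IH factors_prime.prems q0 obtain c1 c2 q' h' where
      "c1 \<in> S" "c2 \<in> S" "q' \<in> S" "h' \<in> S" "a = c1 * c2" "q = c2 * q'" "q0 = c1 * h'" "f = q' * h'"
      by metis
    then show ?thesis using q0 pS
      by (intro bexI[of _ "p * c1"] bexI[of _ c2] bexI[of _ q'] bexI[of _ h'])
        (simp_all add: mult_mem mult.assoc)
  qed
qed

text \<open>Each prime of \<open>c\<close> is cancelled against \<open>g\<close> or against
  \<open>h\<close>, and only the latter are counted. A non-unit \<open>g\<close> absorbs at least
  one prime, which gives the strict descent used later.\<close>

lemma factors_of_mult:
  assumes "factors_in S n c" "g \<in> S" "h \<in> S" "c = g * h"
  shows "\<exists>k\<le>n. factors_in S k h \<and> (\<not> unit_in S g \<longrightarrow> k < n)"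
  using assms
proof (induction arbitrary: g h rule: factors_in.induct)
  case (factors_unit u)
  then have "unit_in S h" using unit_of_mult[of h g] by (simp add: mult.commute)
  moreover have "unit_in S g" using factors_unit unit_of_mult[of g h] by simp
  ultimately show ?case using factors_in.factors_unit by blast
next
  case (factors_prime p n a)
  have pS: "p \<in> S" "p \<noteq> 0" using factors_prime.hyps unfolding prime_in_def by auto
  have aS: "a \<in> S" using factors_mem factors_prime by blast
  have "divides_in S p (g * h)" using factors_prime.prems(3) aS unfolding divides_in_def
    by (intro bexI[of _ a]) simp_all
  then consider "divides_in S p g" | "divides_in S p h"
    using factors_prime unfolding prime_in_def by blast
  then show ?case
  proof cases
    case 1
    then obtain q0 where q0: "q0 \<in> S" "g = p * q0" unfolding divides_in_def by blast
    have "p * a = p * (q0 * h)" using factors_prime.prems q0 by (simp add: mult.assoc)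
    then have "a = q0 * h" using cancel pS aS q0 factors_prime.prems by (meson mult_mem)
    then show ?thesis using factors_prime.IH[OF q0(1) factors_prime.prems(2)]
      by (meson le_Suc_eq less_Suc_eq_le)
  next
    case 2
    then obtain q0 where q0: "q0 \<in> S" "h = p * q0" unfolding divides_in_def by blast
    have "p * a = p * (g * q0)" using factors_prime.prems q0 by (simp add: mult_ac)
    then have "a = g * q0" using cancel pS aS q0 factors_prime.prems by (meson mult_mem)
    then obtain k where "k \<le> n" "factors_in S k q0" "\<not> unit_in S g \<longrightarrow> k < n"
      using factors_prime.IH[OF factors_prime.prems(1) q0(1)] by blast
    then show ?thesis using q0 factors_prime.hyps factors_in.factors_prime
      by (intro exI[of _ "Suc k"]) auto
  qed
qed

lemma factors_mult:
  "factors_in S n a \<Longrightarrow> factors_in S m b \<Longrightarrow> factors_in S (n + m) (a * b)"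
proof (induction rule: factors_in.induct)
  case (factors_unit u)
  then show ?case using factors_mult_unit[of m b u] by (simp add: mult.commute)
next
  case (factors_prime p n a)
  then show ?case using factors_in.factors_prime[of S p "n + m" "a * b"] by (simp add: mult.assoc)
qed

lemma factors_single: "prime_in S p \<Longrightarrow> factors_in S 1 p"
  using factors_in.factors_prime[of S p 0 1] factors_in.factors_unit[of S 1]
  by (simp add: unit_in_def divides_refl)

end

section \<open>Polynomial rings over factorial rings: Gauss's lemma\<close>

definition polys_over :: "'a::comm_ring_1 set \<Rightarrow> 'a poly set" where
  "polys_over S = {F. \<forall>k. coeff F k \<in> S}"

context subdomain
begin

lemma coeff_mem: "F \<in> polys_over S \<Longrightarrow> coeff F k \<in> S"
  by (simp add: polys_over_def)

lemma const_mem: "a \<in> S \<Longrightarrow> [:a:] \<in> polys_over S"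
  by (simp add: polys_over_def coeff_pCons split: nat.split)

lemma monom_mem: "a \<in> S \<Longrightarrow> monom a n \<in> polys_over S"
  by (simp add: polys_over_def)

text \<open>Coefficients in \<open>S\<close> matter: over the whole type the product of two leading
  coefficients may be zero, and degrees need not add.\<close>

lemma lead_coeff_mult:
  assumes "F \<in> polys_over S" "G \<in> polys_over S" "F \<noteq> 0" "G \<noteq> 0"
  shows "degree (F * G) = degree F + degree G" "lead_coeff (F * G) = lead_coeff F * lead_coeff G"
    "F * G \<noteq> 0"
proof -
  have nz: "coeff (F * G) (degree F + degree G) \<noteq> 0"
    using assms no_zero_div coeff_mem by (metis coeff_mult_degree_sum leading_coeff_0_iff)
  then show "degree (F * G) = degree F + degree G"
    using degree_mult_le le_antisym le_degree by blast
  then show "lead_coeff (F * G) = lead_coeff F * lead_coeff G" by (simp add: coeff_mult_degree_sum)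
  show "F * G \<noteq> 0" using nz by auto
qed

lemma subdomain_polys_over: "subdomain (polys_over S)"
proof
  show "0 \<in> polys_over S" "1 \<in> polys_over S"
    by (auto simp: polys_over_def coeff_1)
  show "a + b \<in> polys_over S" if "a \<in> polys_over S" "b \<in> polys_over S" for a b
    using that by (simp add: polys_over_def add_mem)
  show "a * b \<in> polys_over S" if "a \<in> polys_over S" "b \<in> polys_over S" for a b
    using that by (auto simp: polys_over_def coeff_mult intro!: sum_mem mult_mem)
  show "- a \<in> polys_over S" if "a \<in> polys_over S" for a
    using that by (simp add: polys_over_def uminus_mem)
  show "a = 0 \<or> b = 0" if "a \<in> polys_over S" "b \<in> polys_over S" "a * b = 0" for a b
    using that lead_coeff_mult(3) by blast
qed

interpretation poly: subdomain "polys_over S" by (rule subdomain_polys_over)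

lemma smult_mem: "a \<in> S \<Longrightarrow> F \<in> polys_over S \<Longrightarrow> smult a F \<in> polys_over S"
  using poly.mult_mem[of "[:a:]" F] by (simp add: const_mem)

lemma poly_unit_iff: "unit_in (polys_over S) U \<longleftrightarrow> (\<exists>u. unit_in S u \<and> U = [:u:])"
proof
  assume "unit_in (polys_over S) U"
  then obtain V where V: "U \<in> polys_over S" "V \<in> polys_over S" "U * V = 1"
    unfolding unit_in_def divides_in_def by auto
  have "U \<noteq> 0" "V \<noteq> 0" using V(3) by auto
  then have "degree U + degree V = 0" using V lead_coeff_mult(1) by (metis degree_1)
  then obtain u v where u: "U = [:u:]" and v: "V = [:v:]"
    by (metis add_is_0 degree_0_id)
  have "u \<in> S" "v \<in> S" using V coeff_mem[of U 0] coeff_mem[of V 0] u v by auto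
  moreover have "u * v = 1" using V(3) u v by (simp add: one_pCons mult.commute)
  ultimately have "unit_in S u" unfolding unit_in_def divides_in_def by (auto intro: bexI[of _ v])
  then show "\<exists>u. unit_in S u \<and> U = [:u:]" using u by blast
next
  assume "\<exists>u. unit_in S u \<and> U = [:u:]"
  then obtain u where u: "unit_in S u" "U = [:u:]" by blast
  then obtain v where v: "v \<in> S" "u * v = 1" unfolding unit_in_def divides_in_def by auto
  then have "1 = [:u:] * [:v:]" by (simp add: one_pCons mult.commute)
  then show "unit_in (polys_over S) U" using u v const_mem
    unfolding unit_in_def divides_in_def by (intro conjI bexI[of _ "[:v:]"]) simp_all
qed

lemma const_divides_iff:
  assumes "F \<in> polys_over S" "a \<in> S"
  shows "divides_in (polys_over S) [:a:] F \<longleftrightarrow> (\<forall>k. divides_in S a (coeff F k))"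
proof
  assume "divides_in (polys_over S) [:a:] F"
  then show "\<forall>k. divides_in S a (coeff F k)"
    unfolding divides_in_def by (auto intro: coeff_mem)
next
  assume d: "\<forall>k. divides_in S a (coeff F k)"
  then obtain g where g: "\<And>k. g k \<in> S \<and> coeff F k = a * g k"
    unfolding divides_in_def by metis
  define G where "G = (\<Sum>k\<le>degree F. monom (g k) k)"
  have "G \<in> polys_over S" unfolding G_def using g by (auto intro!: poly.sum_mem monom_mem)
  moreover have "F = [:a:] * G"
  proof -
    have "[:a:] * G = (\<Sum>k\<le>degree F. monom (coeff F k) k)"
      unfolding G_def sum_distrib_left using g by (simp add: smult_monom)
    then show ?thesis by (simp add: poly_as_sum_of_monoms)
  qed
  ultimately show "divides_in (polys_over S) [:a:] F" unfolding divides_in_def by blast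
qed

text \<open>Gauss's lemma. Take the first indices at which \<open>p\<close> fails to divide a
  coefficient of \<open>F\<close> and of \<open>G\<close>. In the coefficient of
  \<open>F * G\<close> at their sum every other term is divisible by \<open>p\<close>, so the
  remaining one is as well, against primality.\<close>

lemma const_prime:
  assumes "prime_in S p"
  shows "prime_in (polys_over S) [:p:]"
proof -
  have p: "p \<in> S" "p \<noteq> 0" "\<not> unit_in S p" using assms by (auto simp: prime_in_def)
  have False if FG: "F \<in> polys_over S" "G \<in> polys_over S"
    and dFG: "divides_in (polys_over S) [:p:] (F * G)"
    and nF: "\<not> divides_in (polys_over S) [:p:] F" and nG: "\<not> divides_in (polys_over S) [:p:] G" for F G
  proof -
    let ?i = "LEAST i. \<not> divides_in S p (coeff F i)" and ?j = "LEAST j. \<not> divides_in S p (coeff G j)"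
    have i: "\<not> divides_in S p (coeff F ?i)" "\<And>k. k < ?i \<Longrightarrow> divides_in S p (coeff F k)"
      using nF const_divides_iff[OF FG(1) p(1)] LeastI_ex[of "\<lambda>i. \<not> divides_in S p (coeff F i)"]
        not_less_Least[of _ "\<lambda>i. \<not> divides_in S p (coeff F i)"] by blast+
    have j: "\<not> divides_in S p (coeff G ?j)" "\<And>k. k < ?j \<Longrightarrow> divides_in S p (coeff G k)"
      using nG const_divides_iff[OF FG(2) p(1)] LeastI_ex[of "\<lambda>i. \<not> divides_in S p (coeff G i)"]
        not_less_Least[of _ "\<lambda>i. \<not> divides_in S p (coeff G i)"] by blast+
    let ?f = "\<lambda>k. coeff F k * coeff G (?i + ?j - k)"
    have "coeff (F * G) (?i + ?j) = (\<Sum>k\<le>?i + ?j. ?f k)" by (rule coeff_mult)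
    also have "\<dots> = ?f ?i + (\<Sum>k\<in>{..?i + ?j} - {?i}. ?f k)"
      by (subst sum.remove[of _ ?i]) auto
    finally have eq: "coeff (F * G) (?i + ?j) - (\<Sum>k\<in>{..?i + ?j} - {?i}. ?f k) = coeff F ?i * coeff G ?j"
      by simp
    have "divides_in S p (?f k)" if k: "k \<in> {..?i + ?j} - {?i}" for k
    proof (cases "k < ?i")
      case True then show ?thesis using i(2) FG by (intro divides_mult_right coeff_mem)
    next
      case False
      then have "?i + ?j - k < ?j" using k by auto
      then show ?thesis using j(2) FG by (intro divides_mult_left coeff_mem)
    qed
    then have "divides_in S p (\<Sum>k\<in>{..?i + ?j} - {?i}. ?f k)" by (rule divides_sum)
    moreover have "divides_in S p (coeff (F * G) (?i + ?j))"
      using dFG FG p const_divides_iff poly.mult_mem by blast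
    ultimately have "divides_in S p (coeff F ?i * coeff G ?j)"
      unfolding eq[symmetric] by (intro divides_diff)
    then show False using i(1) j(1) FG coeff_mem assms unfolding prime_in_def by blast
  qed
  moreover have "\<not> unit_in (polys_over S) [:p:]" using p poly_unit_iff by auto
  ultimately show ?thesis using p const_mem unfolding prime_in_def by (metis pCons_eq_0_iff)
qed

lemma const_factors: "factors_in S n a \<Longrightarrow> factors_in (polys_over S) n [:a:]"
proof (induction rule: factors_in.induct)
  case (factors_unit u) then show ?case using poly_unit_iff factors_in.factors_unit by blast
next
  case (factors_prime p n a)
  then show ?case using const_prime factors_in.factors_prime[of "polys_over S" "[:p:]" n "[:a:]"]
    by (simp add: mult.commute)
qed

text \<open>Long division without inverting the leading coefficient of \<open>G\<close>: each round
  multiplies the dividend by it, and \<open>c\<close> collects these factors.\<close>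

lemma pseudo_division:
  assumes "F \<in> polys_over S" "G \<in> polys_over S" "G \<noteq> 0"
  shows "\<exists>c\<in>S. c \<noteq> 0 \<and> (\<exists>Q\<in>polys_over S. \<exists>R\<in>polys_over S.
           smult c F = Q * G + R \<and> (R = 0 \<or> degree R < degree G))"
  using assms
proof (induction "degree F" arbitrary: F rule: less_induct)
  case less
  show ?case
  proof (cases "F = 0 \<or> degree F < degree G")
    case True
    then show ?thesis using less
      by (intro bexI[of _ 1] conjI bexI[of _ 0] bexI[of _ F]) auto
  next
    case False
    define M where "M = monom (lead_coeff F) (degree F - degree G)"
    define F' where "F' = smult (lead_coeff G) F - M * G"
    have MS: "M \<in> polys_over S" unfolding M_def using less coeff_mem monom_mem by blast
    have lcG: "lead_coeff G \<in> S" "lead_coeff G \<noteq> 0" using less coeff_mem by auto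
    have F'S: "F' \<in> polys_over S"
      unfolding F'_def using less MS lcG by (intro poly.diff_mem poly.mult_mem smult_mem) auto
    have M0: "M \<noteq> 0" "degree M = degree F - degree G" "lead_coeff M = lead_coeff F"
      using False by (auto simp: M_def degree_monom_eq monom_eq_0_iff)
    have dMG: "degree (M * G) = degree F" "lead_coeff (M * G) = lead_coeff F * lead_coeff G"
      using lead_coeff_mult[OF MS less.prems(2) M0(1) less.prems(3)] M0 False by auto
    have "degree F' \<le> degree F" unfolding F'_def using dMG by (intro degree_diff_le) (simp_all add: degree_smult_le)
    moreover have "coeff F' (degree F) = 0" unfolding F'_def using dMG by simp
    ultimately consider "F' = 0" | "degree F' < degree F" using eq_zero_or_degree_less by blast
    then obtain c Q R where c: "c \<in> S" "c \<noteq> 0" "Q \<in> polys_over S" "R \<in> polys_over S"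
      "smult c F' = Q * G + R" "R = 0 \<or> degree R < degree G"
    proof cases
      case 1
      then show ?thesis using that[of 1 0 0] by simp
    next
      case 2
      then show ?thesis using less.hyps[OF 2 F'S less.prems(2,3)] that by blast
    qed
    have "smult (c * lead_coeff G) F = smult c F' + smult c (M * G)"
      unfolding F'_def by (simp add: smult_diff_right)
    also have "\<dots> = (Q + smult c M) * G + R" using c by (simp add: algebra_simps)
    finally show ?thesis using c lcG MS mult_mem mult_nonzero poly.add_mem smult_mem
      by (intro bexI[of _ "c * lead_coeff G"] conjI bexI[of _ "Q + smult c M"] bexI[of _ R]) auto
  qed
qed

end

locale factorial_subdomain = subdomain +
  assumes factors_ex: "a \<in> S \<Longrightarrow> a \<noteq> 0 \<Longrightarrow> \<exists>n. factors_in S n a"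
begin

interpretation poly: subdomain "polys_over S" by (rule subdomain_polys_over)

text \<open>The gcd argument over the fraction field, with denominators kept in \<open>S\<close>. A
  nonzero element \<open>H\<close> of least degree in the ideal of \<open>P\<close> and
  \<open>F\<close> divides every element of the ideal up to a constant. Constants are removed by
  distributing their primes; irreducibility of \<open>P\<close> then leaves two possibilities:
  \<open>H\<close> is constant, or \<open>H\<close> is \<open>P\<close> up to constants and
  \<open>P\<close> divides \<open>F\<close>.\<close>

lemma bezout:
  assumes P: "irreducible_in (polys_over S) P" "degree P > 0"
    and F: "F \<in> polys_over S" "\<not> divides_in (polys_over S) P F"
  shows "\<exists>h\<in>S. h \<noteq> 0 \<and> (\<exists>U\<in>polys_over S. \<exists>V\<in>polys_over S. [:h:] = U * P + V * F)"
proof -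
  have PS: "P \<in> polys_over S" "P \<noteq> 0" using P by (auto simp: irreducible_in_def)
  define I where "I = {U * P + V * F | U V. U \<in> polys_over S \<and> V \<in> polys_over S}"
  have IS: "I \<subseteq> polys_over S" unfolding I_def using PS F by (auto intro!: poly.add_mem poly.mult_mem)
  have PI: "P \<in> I" unfolding I_def mem_Collect_eq by (rule exI[of _ 1], rule exI[of _ 0]) simp
  have FI: "F \<in> I" unfolding I_def mem_Collect_eq by (rule exI[of _ 0], rule exI[of _ 1]) simp
  have I_diff: "C * A - D * B \<in> I" if AB: "A \<in> I" "B \<in> I" and CD: "C \<in> polys_over S" "D \<in> polys_over S" for A B C D
  proof -
    obtain U V U' V' where UV: "U \<in> polys_over S" "V \<in> polys_over S" "A = U * P + V * F"
      "U' \<in> polys_over S" "V' \<in> polys_over S" "B = U' * P + V' * F"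
      using AB unfolding I_def by auto
    have "C * A - D * B = (C * U - D * U') * P + (C * V - D * V') * F"
      by (simp add: UV algebra_simps)
    then show ?thesis unfolding I_def using UV CD by (blast intro: poly.diff_mem poly.mult_mem)
  qed
  obtain H where H: "H \<in> I" "H \<noteq> 0" "\<And>G. G \<in> I \<Longrightarrow> G \<noteq> 0 \<Longrightarrow> degree H \<le> degree G"
    using PI PS(2) ex_has_least_nat[of "\<lambda>G. G \<in> I \<and> G \<noteq> 0" P degree] by blast
  have HS: "H \<in> polys_over S" using H IS by blast
  have H_div: "\<exists>c\<in>S. c \<noteq> 0 \<and> (\<exists>Q\<in>polys_over S. [:c:] * A = Q * H)" if A: "A \<in> I" for A
  proof -
    have AS: "A \<in> polys_over S" using A IS by blast
    obtain c Q R where c: "c \<in> S" "c \<noteq> 0" "Q \<in> polys_over S" "R \<in> polys_over S"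
      "smult c A = Q * H + R" "R = 0 \<or> degree R < degree H"
      using pseudo_division[OF AS HS H(2)] by blast
    have "[:c:] * A - Q * H = R" using c(5) by simp
    then have "R \<in> I" using I_diff[OF A H(1) const_mem[OF c(1)] c(3)] by simp
    then have "R = 0" using H(3) c(6) by fastforce
    then show ?thesis using c by (intro bexI[of _ c] conjI bexI[of _ Q]) auto
  qed
  obtain c Q where c: "c \<in> S" "c \<noteq> 0" "Q \<in> polys_over S" "[:c:] * P = Q * H"
    using H_div[OF PI] by blast
  obtain n where "factors_in S n c" using factors_ex c by blast
  from poly.factors_split[OF const_factors[OF this] PS(1) c(3) HS c(4)]
  obtain C1 C2 Q' H' where C: "C1 \<in> polys_over S" "C2 \<in> polys_over S" "Q' \<in> polys_over S"
    "H' \<in> polys_over S" "[:c:] = C1 * C2" "Q = C2 * Q'" "H = C1 * H'" "P = Q' * H'" by blast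
  have C12: "degree C1 = 0"
  proof -
    have "C1 \<noteq> 0" "C2 \<noteq> 0" using C(5) c(2) by auto
    then have "degree C1 + degree C2 = 0" using lead_coeff_mult(1)[OF C(1,2)] C(5) by (metis degree_pCons_0)
    then show ?thesis by simp
  qed
  consider "unit_in (polys_over S) Q'" | "unit_in (polys_over S) H'"
    using P C unfolding irreducible_in_def by blast
  then show ?thesis
  proof cases
    case 2
    then obtain u where u: "unit_in S u" "H' = [:u:]" using poly_unit_iff by blast
    then have "degree H = 0" using C12 C(7) by (metis degree_mult_le le_zero_eq degree_pCons_0 add_0)
    then obtain h where h: "H = [:h:]" by (metis degree_0_id)
    then have "h \<in> S" "h \<noteq> 0" using HS H(2) coeff_mem[of H 0] by auto
    moreover obtain U V where "U \<in> polys_over S" "V \<in> polys_over S" "H = U * P + V * F"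
      using H(1) unfolding I_def by auto
    ultimately show ?thesis using h
      by (intro bexI[of _ h] conjI bexI[of _ U] bexI[of _ V]) auto
  next
    case 1
    obtain W where W: "unit_in (polys_over S) W" "Q' * W = 1" using poly.unit_inverse[OF 1] by blast
    have "W * P = (Q' * W) * H'" unfolding C(8) by (simp add: mult_ac)
    then have H'P: "H' = W * P" unfolding W(2) by simp
    obtain c' Q'' where c': "c' \<in> S" "c' \<noteq> 0" "Q'' \<in> polys_over S" "[:c':] * F = Q'' * H"
      using H_div[OF FI] by blast
    have WS: "W \<in> polys_over S" using W by (simp add: unit_in_def)
    define G where "G = Q'' * C1 * W"
    have GS: "G \<in> polys_over S" using WS C c' by (simp add: G_def poly.mult_mem)
    have "[:c':] * F = Q'' * (C1 * (W * P))" unfolding c'(4) C(7) H'P ..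
    also have "\<dots> = P * G" by (simp add: G_def mult_ac)
    finally have eq: "[:c':] * F = P * G" .
    obtain n' where "factors_in S n' c'" using factors_ex c' by blast
    from poly.factors_split[OF const_factors[OF this] F(1) PS(1) GS eq]
    obtain D1 D2 P' G' where D: "D1 \<in> polys_over S" "D2 \<in> polys_over S" "P' \<in> polys_over S"
      "G' \<in> polys_over S" "[:c':] = D1 * D2" "P = D2 * P'" "G = D1 * G'" "F = P' * G'" by blast
    have "degree D2 = 0"
    proof -
      have "D1 \<noteq> 0" "D2 \<noteq> 0" using D(5) c'(2) by auto
      then have "degree D1 + degree D2 = 0" using lead_coeff_mult(1)[OF D(1,2)] D(5) by (metis degree_pCons_0)
      then show ?thesis by simp
    qed
    \<comment> \<open>A unit \<open>D2\<close> makes \<open>P\<close> divide \<open>F\<close>, a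
      unit \<open>P'\<close> makes \<open>P\<close> constant; both are excluded.\<close>
    consider "unit_in (polys_over S) D2" | "unit_in (polys_over S) P'"
      using P D unfolding irreducible_in_def by blast
    then have False
    proof cases
      case 1
      then obtain W2 where W2: "unit_in (polys_over S) W2" "D2 * W2 = 1" using poly.unit_inverse by blast
      have "P * (W2 * G') = (D2 * W2) * (P' * G')" using D(6) by (simp add: mult_ac)
      then have "F = P * (W2 * G')" using W2 D(8) by simp
      moreover have "W2 * G' \<in> polys_over S" using W2 D by (simp add: unit_in_def poly.mult_mem)
      ultimately show False using F(2) unfolding divides_in_def by blast
    next
      case 2
      then have "degree P' = 0" using poly_unit_iff by auto
      then have "degree P = 0" using \<open>degree D2 = 0\<close> D(6) by (metis degree_mult_le le_zero_eq add_0)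
      then show False using P(2) by simp
    qed
    then show ?thesis ..
  qed
qed

text \<open>Multiplying the relation \<open>[:h:] = U * P + V * F\<close> by \<open>G\<close> makes
  \<open>P\<close> divide \<open>[:h:] * G\<close>. Since \<open>P\<close> is irreducible of
  positive degree, it shares no prime with the constant \<open>h\<close>, which can be
  cancelled.\<close>

lemma irreducible_poly_prime:
  assumes "irreducible_in (polys_over S) P" "degree P > 0"
  shows "prime_in (polys_over S) P"
proof -
  have PS: "P \<in> polys_over S" "P \<noteq> 0" "\<not> unit_in (polys_over S) P"
    using assms by (auto simp: irreducible_in_def)
  have "divides_in (polys_over S) P G"
    if FG: "F \<in> polys_over S" "G \<in> polys_over S" "divides_in (polys_over S) P (F * G)"
      and nF: "\<not> divides_in (polys_over S) P F" for F G
  proof -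
    obtain h U V where h: "h \<in> S" "h \<noteq> 0" "U \<in> polys_over S" "V \<in> polys_over S" "[:h:] = U * P + V * F"
      using bezout[OF assms FG(1) nF] by blast
    obtain K where K: "K \<in> polys_over S" "F * G = P * K" using FG(3) unfolding divides_in_def by blast
    define L where "L = U * G + V * K"
    have LS: "L \<in> polys_over S" using h FG K by (simp add: L_def poly.add_mem poly.mult_mem)
    have "[:h:] * G = U * P * G + V * (F * G)" unfolding h(5) by (simp add: algebra_simps)
    also have "\<dots> = P * L" unfolding K(2) L_def by (simp add: algebra_simps)
    finally have eq: "[:h:] * G = P * L" .
    obtain n' where "factors_in S n' h" using factors_ex h by blast
    from poly.factors_split[OF const_factors[OF this] FG(2) PS(1) LS eq]
    obtain D1 D2 P' G' where D: "D1 \<in> polys_over S" "D2 \<in> polys_over S" "P' \<in> polys_over S"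
      "G' \<in> polys_over S" "[:h:] = D1 * D2" "P = D2 * P'" "L = D1 * G'" "G = P' * G'" by blast
    have "degree D2 = 0"
    proof -
      have "D1 \<noteq> 0" "D2 \<noteq> 0" using D(5) h(2) by auto
      then have "degree D1 + degree D2 = 0" using lead_coeff_mult(1)[OF D(1,2)] D(5) by (metis degree_pCons_0)
      then show ?thesis by simp
    qed
    have "\<not> unit_in (polys_over S) P'"
    proof
      assume "unit_in (polys_over S) P'"
      then have "degree P' = 0" using poly_unit_iff by auto
      then have "degree P = 0" using \<open>degree D2 = 0\<close> D(6) by (metis degree_mult_le le_zero_eq add_0)
      then show False using assms(2) by simp
    qed
    then have "unit_in (polys_over S) D2" using assms(1) D unfolding irreducible_in_def by blast
    then obtain W2 where W2: "unit_in (polys_over S) W2" "D2 * W2 = 1" using poly.unit_inverse by blast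
    have "P * (W2 * G') = (D2 * W2) * (P' * G')" using D(6) by (simp add: mult_ac)
    then have "G = P * (W2 * G')" using W2 D(8) by simp
    moreover have "W2 * G' \<in> polys_over S" using W2 D by (simp add: unit_in_def poly.mult_mem)
    ultimately show ?thesis unfolding divides_in_def by blast
  qed
  then show ?thesis using PS unfolding prime_in_def by blast
qed

text \<open>Descent on the degree and, for fixed degree, on the number of prime factors of the leading
  coefficient, which drops when a non-unit constant is split off.\<close>

lemma poly_factors_ex_aux:
  "F \<in> polys_over S \<Longrightarrow> F \<noteq> 0 \<Longrightarrow> degree F = d \<Longrightarrow> factors_in S n (lead_coeff F) \<Longrightarrow>
     \<exists>k. factors_in (polys_over S) k F"
proof (induction d arbitrary: n F rule: less_induct)
  case (less d)
  note outer = less.IH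
  have split_const: "\<exists>k. factors_in (polys_over S) k (A * B)"
    if AB: "A \<in> polys_over S" "B \<in> polys_over S" "A * B \<noteq> 0" "degree (A * B) = d"
      "factors_in S m (lead_coeff (A * B))" "degree A = 0" "\<not> unit_in (polys_over S) A"
      and IH: "\<And>m' F. m' < m \<Longrightarrow> F \<in> polys_over S \<Longrightarrow> F \<noteq> 0 \<Longrightarrow> degree F = d \<Longrightarrow>
         factors_in S m' (lead_coeff F) \<Longrightarrow> \<exists>k. factors_in (polys_over S) k F" for A B m
  proof -
    obtain a where a: "A = [:a:]" using AB(6) by (metis degree_0_id)
    have nz: "A \<noteq> 0" "B \<noteq> 0" using AB(3) by auto
    have aS: "a \<in> S" "a \<noteq> 0" "\<not> unit_in S a" using a AB(1,7) nz coeff_mem[of A 0] poly_unit_iff by auto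
    have lc: "lead_coeff (A * B) = a * lead_coeff B"
      using lead_coeff_mult(2)[OF AB(1,2) nz] a by simp
    obtain m' where "m' < m" "factors_in S m' (lead_coeff B)"
      using factors_of_mult[OF AB(5) aS(1) coeff_mem[OF AB(2)] lc] aS(3) by blast
    moreover have "degree B = d" using lead_coeff_mult(1)[OF AB(1,2) nz] AB(4,6) by simp
    ultimately obtain k where k: "factors_in (polys_over S) k B" using IH AB(2) nz by blast
    obtain k' where "factors_in S k' a" using factors_ex aS by blast
    then show ?thesis using poly.factors_mult[OF const_factors k] a by blast
  qed
  from less.prems show ?case
  proof (induction n arbitrary: F rule: less_induct)
    case (less n)
    show ?case
    proof (cases "unit_in (polys_over S) F \<or> irreducible_in (polys_over S) F")
      case True
      then consider "unit_in (polys_over S) F" | "irreducible_in (polys_over S) F" "degree F > 0"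
        | "irreducible_in (polys_over S) F" "degree F = 0" by blast
      then show ?thesis
      proof cases
        case 1 then show ?thesis using factors_in.factors_unit by blast
      next
        case 2 then show ?thesis using irreducible_poly_prime poly.factors_single by blast
      next
        case 3
        then obtain a where a: "F = [:a:]" by (metis degree_0_id)
        then have "a \<in> S" "a \<noteq> 0" using less.prems coeff_mem[of F 0] by auto
        then show ?thesis using factors_ex a const_factors by blast
      qed
    next
      case False
      then obtain A B where AB: "A \<in> polys_over S" "B \<in> polys_over S" "F = A * B"
        "\<not> unit_in (polys_over S) A" "\<not> unit_in (polys_over S) B"
        using less.prems unfolding irreducible_in_def by blast
      have nz: "A \<noteq> 0" "B \<noteq> 0" using AB less.prems by auto
      have deg: "degree A + degree B = d" using lead_coeff_mult(1)[OF AB(1,2) nz] AB less.prems by simp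
      consider "degree A = 0" | "degree B = 0" | "degree A < d" "degree B < d" using deg by linarith
      then show ?thesis
      proof cases
        case 1
        show ?thesis unfolding AB(3)
          by (rule split_const[of A B n]) (use AB less 1 in auto)
      next
        case 2
        show ?thesis unfolding AB(3) mult.commute[of A B]
          by (rule split_const[of B A n]) (use AB less 2 in \<open>auto simp: mult.commute[of A B]\<close>)
      next
        case 3
        have "\<exists>n. factors_in S n (lead_coeff A)" "\<exists>n. factors_in S n (lead_coeff B)"
          using nz AB coeff_mem factors_ex by auto
        then show ?thesis using outer[OF 3(1) AB(1) nz(1)] outer[OF 3(2) AB(2) nz(2)] AB(3)
            poly.factors_mult by blast
      qed
    qed
  qed
qed

lemma factorial_polys_over: "factorial_subdomain (polys_over S)"
proof
  show "\<exists>n. factors_in (polys_over S) n a" if "a \<in> polys_over S" "a \<noteq> 0" for a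
    using poly_factors_ex_aux[OF that refl] factors_ex coeff_mem that by (meson leading_coeff_0_iff)
qed

end

section \<open>Transport of factorizations along embeddings\<close>

text \<open>Injectivity is demanded on \<open>S\<close> only. The intended \<open>h\<close>
  substitutes the function \<open>coord j\<close> for the indeterminate; on all polynomials with
  function coefficients it is not injective, since X - \<open>coord j\<close> goes to zero, but it
  is on those whose coefficients do not involve the variable \<open>j\<close>.\<close>

locale subdomain_embedding = subdomain S for S :: "'a::comm_ring_1 set" +
  fixes h :: "'a \<Rightarrow> 'b::comm_ring_1"
  assumes h_add: "h (a + b) = h a + h b" and h_mult: "h (a * b) = h a * h b" and h_one: "h 1 = 1"
    and h_inj: "a \<in> S \<Longrightarrow> h a = 0 \<Longrightarrow> a = 0"
begin

lemma h_zero: "h 0 = 0"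
  using h_add[of 0 0] by simp

lemma h_uminus: "h (- a) = - h a"
  using h_add[of a "- a"] h_zero by (simp add: eq_neg_iff_add_eq_0 add.commute)

lemma h_eq_iff: "a \<in> S \<Longrightarrow> b \<in> S \<Longrightarrow> h a = h b \<longleftrightarrow> a = b"
  using h_inj[of "a - b"] h_add[of a "- b"] by (auto simp: diff_mem h_uminus)

lemma subdomain_image: "subdomain (h ` S)"
proof
  show "0 \<in> h ` S" using h_zero by (metis image_eqI zero_mem)
  show "1 \<in> h ` S" using h_one by (metis image_eqI one_mem)
  show "a + b \<in> h ` S" if "a \<in> h ` S" "b \<in> h ` S" for a b
    using that h_add add_mem by (auto simp: image_iff) metis
  show "a * b \<in> h ` S" if "a \<in> h ` S" "b \<in> h ` S" for a b
    using that h_mult mult_mem by (auto simp: image_iff) metis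
  show "- a \<in> h ` S" if "a \<in> h ` S" for a
    using that h_uminus uminus_mem by (auto simp: image_iff) metis
  show "a = 0 \<or> b = 0" if "a \<in> h ` S" "b \<in> h ` S" "a * b = 0" for a b
    using that h_mult h_inj no_zero_div mult_mem h_zero by (auto simp: image_iff) metis
qed

lemma divides_image_iff:
  "a \<in> S \<Longrightarrow> b \<in> S \<Longrightarrow> divides_in (h ` S) (h a) (h b) \<longleftrightarrow> divides_in S a b"
  unfolding divides_in_def by (auto simp: h_mult[symmetric] h_eq_iff mult_mem)

lemma unit_image_iff: "a \<in> S \<Longrightarrow> unit_in (h ` S) (h a) \<longleftrightarrow> unit_in S a"
  unfolding unit_in_def using divides_image_iff[of a 1] by (simp add: h_one)

lemma prime_image_iff: "p \<in> S \<Longrightarrow> prime_in (h ` S) (h p) \<longleftrightarrow> prime_in S p"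
  unfolding prime_in_def using h_inj[of p]
  by (simp add: unit_image_iff divides_image_iff h_mult[symmetric] mult_mem h_zero) (metis h_zero)

lemma factors_image: "factors_in S n a \<Longrightarrow> factors_in (h ` S) n (h a)"
proof (induction rule: factors_in.induct)
  case (factors_unit u)
  then show ?case using unit_image_iff[of u] by (auto simp: unit_in_def intro: factors_in.factors_unit)
next
  case (factors_prime p n a)
  then show ?case using prime_image_iff[of p] factors_in.factors_prime[of "h ` S" "h p" n "h a"]
    by (simp add: prime_in_def h_mult)
qed

end

section \<open>Polynomial functions in finitely many complex variables\<close>

text \<open>Polynomials are taken as functions of points that may have coordinates outside
  \<open>J\<close>; over the infinite field of complex numbers nothing is lost, and a growing
  \<open>J\<close> stays within one type.\<close>

inductive_set polyfun :: "'v set \<Rightarrow> (('v \<Rightarrow> complex) \<Rightarrow> complex) set" for J where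
  polyfun_const: "(\<lambda>_. c) \<in> polyfun J"
| polyfun_var: "j \<in> J \<Longrightarrow> (\<lambda>w. w j) \<in> polyfun J"
| polyfun_add: "f \<in> polyfun J \<Longrightarrow> g \<in> polyfun J \<Longrightarrow> f + g \<in> polyfun J"
| polyfun_mult: "f \<in> polyfun J \<Longrightarrow> g \<in> polyfun J \<Longrightarrow> f * g \<in> polyfun J"

lemma polyfun_cong: "f \<in> polyfun J \<Longrightarrow> (\<And>j. j \<in> J \<Longrightarrow> w j = w' j) \<Longrightarrow> f w = f w'"
  by (induction rule: polyfun.induct) auto

lemma polyfun_mono: "f \<in> polyfun J \<Longrightarrow> J \<subseteq> J' \<Longrightarrow> f \<in> polyfun J'"
  by (induction rule: polyfun.induct) (auto intro: polyfun.intros)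

lemma polyfun_zero: "0 \<in> polyfun J" and polyfun_one: "1 \<in> polyfun J"
  using polyfun_const[of 0 J] polyfun_const[of 1 J] by (simp_all add: zero_fun_def one_fun_def)

lemma polyfun_power: "f \<in> polyfun J \<Longrightarrow> f ^ n \<in> polyfun J"
  by (induction n) (auto intro: polyfun_one polyfun_mult)

lemma polyfun_sum: "(\<And>i. i \<in> I \<Longrightarrow> f i \<in> polyfun J) \<Longrightarrow> (\<Sum>i\<in>I. f i) \<in> polyfun J"
  by (induction I rule: infinite_finite_induct) (auto intro: polyfun_zero polyfun_add)

lemma polyfun_fix:
  assumes "f \<in> polyfun (insert j J)" shows "(\<lambda>w. f (w(j := c))) \<in> polyfun J"
  using assms
proof (induction rule: polyfun.induct)
  case (polyfun_const d)
  show ?case by (rule polyfun.polyfun_const)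
next
  case (polyfun_var i)
  then show ?case by (cases "i = j") (auto intro: polyfun.polyfun_const polyfun.polyfun_var)
next
  case (polyfun_add f g)
  have "(\<lambda>w. (f + g) (w(j := c))) = (\<lambda>w. f (w(j := c))) + (\<lambda>w. g (w(j := c)))"
    by (simp add: fun_eq_iff)
  then show ?case using polyfun.polyfun_add[OF polyfun_add.IH] by (simp only:)
next
  case (polyfun_mult f g)
  have "(\<lambda>w. (f * g) (w(j := c))) = (\<lambda>w. f (w(j := c))) * (\<lambda>w. g (w(j := c)))"
    by (simp add: fun_eq_iff)
  then show ?case using polyfun.polyfun_mult[OF polyfun_mult.IH] by (simp only:)
qed

abbreviation (input) coord :: "'v \<Rightarrow> ('v \<Rightarrow> complex) \<Rightarrow> complex" where
  "coord j \<equiv> (\<lambda>w. w j)"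

lemma power_fun_apply: "(f ^ n) w = f w ^ n" for f :: "'b \<Rightarrow> complex"
  by (induction n) auto

lemma poly_coord_eval:
  "poly F (coord j) w = poly (map_poly (\<lambda>f. f w) F) (w j)"
  by (induction F) (auto simp: map_poly_pCons)

text \<open>With the other coordinates frozen at \<open>w\<close>, a polynomial function becomes a
  complex polynomial in the single value \<open>z\<close>; root counting and the fundamental theorem
  of algebra enter through this identity.\<close>

lemma poly_coord_upd:
  assumes "F \<in> polys_over (polyfun J)" "j \<notin> J"
  shows "poly F (coord j) (w(j := z)) = poly (map_poly (\<lambda>f. f w) F) z"
proof -
  have "map_poly (\<lambda>f. f (w(j := z))) F = map_poly (\<lambda>f. f w) F"
  proof (rule poly_eqI)
    fix n
    have "coeff F n (w(j := z)) = coeff F n w"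
      by (rule polyfun_cong[of _ J]) (use assms in \<open>auto simp: polys_over_def\<close>)
    then show "coeff (map_poly (\<lambda>f. f (w(j := z))) F) n = coeff (map_poly (\<lambda>f. f w) F) n"
      by (simp add: coeff_map_poly)
  qed
  then show ?thesis by (simp add: poly_coord_eval)
qed

lemma poly_coord_zero:
  assumes "F \<in> polys_over (polyfun J)" "j \<notin> J" "poly F (coord j) = 0"
  shows "F = 0"
proof (rule poly_eqI, rule ext)
  fix k w
  have "poly (map_poly (\<lambda>f. f w) F) z = 0" for z
    using poly_coord_upd[OF assms(1,2), of w z] assms(3) by simp
  then have "map_poly (\<lambda>f. f w) F = 0" using poly_all_0_iff_0 by blast
  then have "coeff (map_poly (\<lambda>f. f w) F) k = 0" by simp
  then show "coeff F k w = coeff 0 k w" by (simp add: coeff_map_poly)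
qed

lemma polyfun_insert:
  assumes "subdomain (polyfun J)"
  shows "polyfun (insert j J) = (\<lambda>F. poly F (coord j)) ` polys_over (polyfun J)"
proof (intro equalityI subsetI)
  interpret subdomain "polyfun J" by fact
  interpret poly: subdomain "polys_over (polyfun J)" by (rule subdomain_polys_over)
  fix f assume "f \<in> polyfun (insert j J)"
  then show "f \<in> (\<lambda>F. poly F (coord j)) ` polys_over (polyfun J)"
  proof (induction rule: polyfun.induct)
    case (polyfun_const c)
    show ?case
      by (rule image_eqI[of _ _ "[:(\<lambda>_. c):]"]) (auto intro!: const_mem polyfun.polyfun_const)
  next
    case (polyfun_var i)
    show ?case
    proof (cases "i = j")
      case True
      have "coord i = poly (monom 1 1) (coord j)" using True by (simp add: poly_monom)
      then show ?thesis using monom_mem[OF one_mem, of 1] by (simp only: image_eqI)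
    next
      case False
      then have "coord i \<in> polyfun J" using polyfun_var by (intro polyfun.polyfun_var) simp
      then show ?thesis by (intro image_eqI[of _ _ "[:coord i:]"]) (auto intro!: const_mem)
    qed
  next
    case (polyfun_add f g)
    then obtain F G where FG: "F \<in> polys_over (polyfun J)" "f = poly F (coord j)"
      "G \<in> polys_over (polyfun J)" "g = poly G (coord j)" by blast
    then show ?case using poly.add_mem by (intro image_eqI[of _ _ "F + G"]) auto
  next
    case (polyfun_mult f g)
    then obtain F G where FG: "F \<in> polys_over (polyfun J)" "f = poly F (coord j)"
      "G \<in> polys_over (polyfun J)" "g = poly G (coord j)" by blast
    then show ?case using poly.mult_mem by (intro image_eqI[of _ _ "F * G"]) auto
  qed
next
  fix f assume "f \<in> (\<lambda>F. poly F (coord j)) ` polys_over (polyfun J)"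
  then obtain F where F: "F \<in> polys_over (polyfun J)" "f = poly F (coord j)" by blast
  have "coeff F i \<in> polyfun (insert j J)" for i
    by (rule polyfun_mono[of _ J]) (use F in \<open>auto simp: polys_over_def\<close>)
  then show "f \<in> polyfun (insert j J)"
    unfolding F(2) poly_altdef
    by (intro polyfun_sum polyfun_mult polyfun_power) (auto intro: polyfun_var)
qed

lemma polyfun_embedding:
  assumes "subdomain (polyfun J)" "j \<notin> J"
  shows "subdomain_embedding (polys_over (polyfun J)) (\<lambda>F. poly F (coord j))"
proof -
  interpret subdomain "polyfun J" by fact
  interpret poly: subdomain "polys_over (polyfun J)" by (rule subdomain_polys_over)
  show ?thesis by unfold_locales (auto intro: poly_coord_zero[OF _ assms(2)])
qed

lemma polyfun_empty: "polyfun {} = range (\<lambda>c _. c)"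
proof (intro equalityI subsetI)
  fix f :: "('a \<Rightarrow> complex) \<Rightarrow> complex" assume "f \<in> polyfun {}"
  then have "f w = f (\<lambda>_. 0)" for w using polyfun_cong[of f "{}" w] by blast
  then have "f = (\<lambda>_. f (\<lambda>_. 0))" by (rule ext)
  then show "f \<in> range (\<lambda>c _. c)" by blast
qed (auto intro: polyfun_const)

text \<open>Induction on the variables. Without variables the ring is the field of complex numbers;
  a further variable gives the polynomial ring, which is factorial by Gauss and is mapped onto
  \<open>polyfun (insert j J)\<close> by evaluation at \<open>coord j\<close>.\<close>

lemma factorial_polyfun:
  assumes "finite J" shows "factorial_subdomain (polyfun J)"
  using assms
proof (induction J)
  case empty
  have sub: "subdomain (polyfun {} :: (('a \<Rightarrow> complex) \<Rightarrow> complex) set)"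
    by unfold_locales
      (auto intro: polyfun_zero polyfun_one polyfun_add polyfun_mult
        simp: polyfun_empty zero_fun_def times_fun_def fun_eq_iff)
  interpret subdomain "polyfun {} :: (('a \<Rightarrow> complex) \<Rightarrow> complex) set" by fact
  have "unit_in (polyfun {}) f" if f: "f \<in> polyfun {}" "f \<noteq> 0" for f :: "('a \<Rightarrow> complex) \<Rightarrow> complex"
  proof -
    obtain c where c: "f = (\<lambda>_. c)" using f polyfun_empty by blast
    then have "c \<noteq> 0" using f by (auto simp: zero_fun_def)
    then have "1 = f * (\<lambda>_. inverse c)" using c by (simp add: fun_eq_iff)
    then show ?thesis using f(1) polyfun_const[of "inverse c" "{}"]
      unfolding unit_in_def divides_in_def by blast
  qed
  then show ?case by unfold_locales (blast intro: factors_in.factors_unit)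
next
  case (insert j J)
  interpret factorial_subdomain "polyfun J" by (rule insert.IH)
  interpret poly: factorial_subdomain "polys_over (polyfun J)" by (rule factorial_polys_over)
  interpret emb: subdomain_embedding "polys_over (polyfun J)" "\<lambda>F. poly F (coord j)"
    by (rule polyfun_embedding[OF subdomain_axioms insert.hyps(2)])
  interpret img: subdomain "polyfun (insert j J)"
    unfolding polyfun_insert[OF subdomain_axioms] by (rule emb.subdomain_image)
  show ?case
  proof
    fix f assume f: "f \<in> polyfun (insert j J)" "f \<noteq> 0"
    then obtain F where F: "F \<in> polys_over (polyfun J)" "f = poly F (coord j)"
      using polyfun_insert[OF subdomain_axioms] by blast
    then have "F \<noteq> 0" using f by auto
    then obtain n where "factors_in (polys_over (polyfun J)) n F" using F poly.factors_ex by blast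
    then show "\<exists>n. factors_in (polyfun (insert j J)) n f"
      using emb.factors_image F(2) polyfun_insert[OF subdomain_axioms] by metis
  qed
qed

text \<open>Nullstellensatz for a principal prime ideal: if \<open>p\<close> did not divide \<open>f\<close>, eliminating a
  variable would produce a nonzero polynomial in the remaining variables vanishing wherever the
  leading coefficient of \<open>p\<close> does not.\<close>

lemma nullstellensatz_prime:
  assumes "finite J" "prime_in (polyfun J) p" "f \<in> polyfun J" "\<And>w. p w = 0 \<Longrightarrow> f w = 0"
  shows "divides_in (polyfun J) p f"
  using assms
proof (induction J arbitrary: p f)
  case empty
  interpret factorial_subdomain "polyfun {} :: (('a \<Rightarrow> complex) \<Rightarrow> complex) set"
    by (rule factorial_polyfun) simp
  obtain c where c: "p = (\<lambda>_. c)" using empty by (auto simp: polyfun_empty prime_in_def)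
  then have "c \<noteq> 0" using empty by (auto simp: prime_in_def zero_fun_def)
  then have "1 = p * (\<lambda>_. inverse c)" using c by (simp add: fun_eq_iff)
  then have "unit_in (polyfun {}) p" using empty(1) polyfun_const[of "inverse c" "{}"]
    unfolding unit_in_def divides_in_def prime_in_def by blast
  then show ?case using empty by (simp add: prime_in_def)
next
  case (insert j J)
  interpret factorial_subdomain "polyfun J" using factorial_polyfun insert by blast
  interpret poly: factorial_subdomain "polys_over (polyfun J)" by (rule factorial_polys_over)
  interpret emb: subdomain_embedding "polys_over (polyfun J)" "\<lambda>F. poly F (coord j)"
    by (rule polyfun_embedding[OF subdomain_axioms insert.hyps(2)])
  note ins = polyfun_insert[OF subdomain_axioms, of j]
  obtain P where P: "P \<in> polys_over (polyfun J)" "p = poly P (coord j)"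
    using insert ins by (auto simp: prime_in_def)
  obtain F where F: "F \<in> polys_over (polyfun J)" "f = poly F (coord j)" using insert ins by auto
  have prP: "prime_in (polys_over (polyfun J)) P"
    using insert.prems(1) P emb.prime_image_iff ins by metis
  have P0: "P \<noteq> 0" using prP by (simp add: prime_in_def)
  have "divides_in (polys_over (polyfun J)) P F"
  proof (cases "degree P = 0")
    case True
    then obtain a where a: "P = [:a:]" by (metis degree_0_id)
    have aJ: "a \<in> polyfun J" using coeff_mem[OF P(1), of 0] a by simp
    have pa: "p = a" using P a by simp
    have "prime_in (polyfun J) a"
    proof -
      have "a \<noteq> 0" "\<not> unit_in (polyfun J) a" using prP a poly_unit_iff by (auto simp: prime_in_def)
      moreover have "divides_in (polyfun J) a b \<or> divides_in (polyfun J) a c"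
        if bc: "b \<in> polyfun J" "c \<in> polyfun J" "divides_in (polyfun J) a (b * c)" for b c
      proof -
        have *: "divides_in (polys_over (polyfun J)) P [:x:] \<longleftrightarrow> divides_in (polyfun J) a x"
          if "x \<in> polyfun J" for x
        proof -
          have "divides_in (polyfun J) a 0" unfolding divides_in_def by (intro bexI[of _ 0]) simp_all
          then have "(\<forall>k. divides_in (polyfun J) a (coeff [:x:] k)) \<longleftrightarrow> divides_in (polyfun J) a x"
            by (auto simp: coeff_pCons split: nat.splits)
          then show ?thesis unfolding a using const_divides_iff[OF const_mem[OF that] aJ] by blast
        qed
        have "divides_in (polys_over (polyfun J)) P ([:b:] * [:c:])"
          using *[OF mult_mem[OF bc(1,2)]] bc(3) by (simp add: mult.commute)
        then show ?thesis using prP * bc const_mem unfolding prime_in_def by blast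
      qed
      ultimately show ?thesis using aJ by (simp add: prime_in_def)
    qed
    \<comment> \<open>\<open>p\<close> does not involve the coordinate \<open>j\<close> here, so a
      zero of \<open>a\<close> yields a whole line of zeros of \<open>f\<close>, and every
      coefficient of \<open>F\<close> vanishes there; the induction hypothesis then applies
      coefficientwise.\<close>
    have "coeff F k w = 0" if "a w = 0" for k w
    proof -
      have "a (w(j := z)) = 0" for z
        using that aJ polyfun_cong[OF aJ, of "w(j := z)" w] insert.hyps by (metis fun_upd_other)
      then have "poly (map_poly (\<lambda>f. f w) F) z = 0" for z
        using insert.prems(3) poly_coord_upd[OF F(1) insert.hyps(2), of w z] F(2) pa by metis
      then have "map_poly (\<lambda>f. f w) F = 0" using poly_all_0_iff_0 by blast
      then have "coeff (map_poly (\<lambda>f. f w) F) k = 0" by simp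
      then show ?thesis by (simp add: coeff_map_poly)
    qed
    then have "divides_in (polyfun J) a (coeff F k)" for k
      using insert.IH[OF \<open>prime_in (polyfun J) a\<close>] coeff_mem[OF F(1)] by blast
    then show ?thesis using const_divides_iff[OF F(1) aJ] a by blast
  next
    case False
    show ?thesis
    proof (rule ccontr)
      assume "\<not> ?thesis"
      then obtain h U V where h: "h \<in> polyfun J" "h \<noteq> 0" "[:h:] = U * P + V * F"
        using bezout[OF poly.prime_irreducible[OF prP] _ F(1)] False by blast
      have lc: "lead_coeff P \<in> polyfun J" "lead_coeff P \<noteq> 0" using P coeff_mem P0 by auto
      obtain w where w: "h w \<noteq> 0" "lead_coeff P w \<noteq> 0"
        using mult_nonzero[OF h(1) lc(1) h(2) lc(2)] by (auto simp: fun_eq_iff)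
      let ?Pw = "map_poly (\<lambda>f. f w) P"
      have "coeff ?Pw (degree P) \<noteq> 0" using w by (simp add: coeff_map_poly)
      then have "degree ?Pw \<ge> degree P" by (rule le_degree)
      then have "degree ?Pw \<noteq> 0" using False by simp
      then have "\<not> constant (poly ?Pw)" by (simp add: constant_degree)
      then obtain z where z: "poly ?Pw z = 0" using fundamental_theorem_of_algebra by blast
      let ?w = "w(j := z)"
      have "p ?w = 0" using z poly_coord_upd[OF P(1) insert.hyps(2)] P(2) by simp
      then have "f ?w = 0" using insert.prems by blast
      have "h = poly [:h:] (coord j)" by simp
      also have "\<dots> = poly U (coord j) * p + poly V (coord j) * f" unfolding h(3) using P F by simp
      finally have "h ?w = (poly U (coord j) * p + poly V (coord j) * f) ?w" by (rule arg_cong)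
      then have "h ?w = 0" using \<open>p ?w = 0\<close> \<open>f ?w = 0\<close> by simp
      moreover have "h ?w = h w"
        by (rule polyfun_cong[OF h(1)]) (use insert.hyps in auto)
      ultimately show False using w by simp
    qed
  qed
  then show ?case using emb.divides_image_iff[OF P(1) F(1)] P F ins by simp
qed

section \<open>Reduced fractions and orders at primes\<close>

definition coprime_in :: "'a::comm_ring_1 set \<Rightarrow> 'a \<Rightarrow> 'a \<Rightarrow> bool" where
  "coprime_in S a b \<longleftrightarrow> (\<forall>p. prime_in S p \<longrightarrow> divides_in S p a \<longrightarrow> \<not> divides_in S p b)"

text \<open>Says that \<open>a / b\<close> is a unit in the local ring at \<open>p\<close>, that is,
  equals \<open>c / d\<close> with neither \<open>c\<close> nor \<open>d\<close> divisible by
  \<open>p\<close>; cross-multiplication avoids a fraction field.\<close>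

definition unit_at :: "'a::comm_ring_1 set \<Rightarrow> 'a \<Rightarrow> 'a \<Rightarrow> 'a \<Rightarrow> bool" where
  "unit_at S p a b \<longleftrightarrow> (\<exists>c\<in>S. \<exists>d\<in>S. \<not> divides_in S p c \<and> \<not> divides_in S p d \<and> a * d = c * b)"

context factorial_subdomain
begin

lemma prime_mem: "prime_in S p \<Longrightarrow> p \<in> S"
  by (simp add: prime_in_def)

lemma prime_divides_mult_iff:
  "prime_in S p \<Longrightarrow> a \<in> S \<Longrightarrow> b \<in> S \<Longrightarrow> divides_in S p (a * b) \<longleftrightarrow> divides_in S p a \<or> divides_in S p b"
  using divides_mult_left divides_mult_right unfolding prime_in_def by blast

lemma reduce_fraction_aux:
  assumes "factors_in S n b" "a \<in> S"
  shows "\<exists>d\<in>S. \<exists>a'\<in>S. \<exists>b'\<in>S. d \<noteq> 0 \<and> a = d * a' \<and> b = d * b' \<and> coprime_in S a' b'"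
  using assms
proof (induction n arbitrary: a b rule: less_induct)
  case (less n)
  have bS: "b \<in> S" using factors_mem less.prems by blast
  show ?case
  proof (cases "coprime_in S a b")
    case True
    then show ?thesis using less bS by (intro bexI[of _ 1] bexI[of _ a] bexI[of _ b]) auto
  next
    case False
    then obtain p where p: "prime_in S p" "divides_in S p a" "divides_in S p b"
      unfolding coprime_in_def by blast
    obtain a1 b1 where ab: "a1 \<in> S" "a = p * a1" "b1 \<in> S" "b = p * b1"
      using p unfolding divides_in_def by blast
    have "\<not> unit_in S p" using p by (simp add: prime_in_def)
    then obtain k where "k < n" "factors_in S k b1"
      using factors_of_mult[OF less.prems(1) prime_mem[OF p(1)] ab(3,4)] by blast
    then obtain d a' b' where d: "d \<in> S" "a' \<in> S" "b' \<in> S" "d \<noteq> 0" "a1 = d * a'" "b1 = d * b'"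
      "coprime_in S a' b'" using less.IH ab by metis
    moreover have "p * d \<noteq> 0" using p d mult_nonzero by (auto simp: prime_in_def)
    moreover have "p * d \<in> S" using p d mult_mem prime_mem by blast
    ultimately show ?thesis using ab
      by (intro bexI[of _ "p * d"] bexI[of _ a'] bexI[of _ b']) (auto simp: mult.assoc)
  qed
qed

lemma reduce_fraction:
  assumes "a \<in> S" "b \<in> S" "b \<noteq> 0"
  obtains d a' b' where "d \<in> S" "a' \<in> S" "b' \<in> S" "d \<noteq> 0" "a = d * a'" "b = d * b'" "coprime_in S a' b'"
  using reduce_fraction_aux[of _ b a] factors_ex[OF assms(2,3)] assms(1) by blast

text \<open>Euclid's lemma: the primes of \<open>b\<close> are cancelled one by one against
  \<open>h\<close>, none of them dividing \<open>a\<close>.\<close>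

lemma coprime_divides_mult:
  assumes "factors_in S n b" "a \<in> S" "h \<in> S" "coprime_in S a b" "divides_in S b (a * h)"
  shows "divides_in S b h"
  using assms
proof (induction arbitrary: h rule: factors_in.induct)
  case (factors_unit u)
  then obtain v where v: "unit_in S v" "u * v = 1" using unit_inverse by blast
  have "u * (v * h) = (u * v) * h" by (simp add: mult.assoc)
  then have "h = u * (v * h)" using v by simp
  moreover have "v * h \<in> S" using v factors_unit by (simp add: unit_in_def mult_mem)
  ultimately show ?case unfolding divides_in_def by blast
next
  case (factors_prime p n b)
  have pS: "p \<in> S" "p \<noteq> 0" using factors_prime.hyps by (auto simp: prime_in_def)
  have bS: "b \<in> S" using factors_mem factors_prime.hyps by blast
  have "divides_in S p (p * b)" using bS unfolding divides_in_def by blast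
  then have "divides_in S p (a * h)" "\<not> divides_in S p a"
    using factors_prime divides_trans unfolding coprime_in_def by blast+
  then have "divides_in S p h" using factors_prime prime_divides_mult_iff by blast
  then obtain h1 where h1: "h1 \<in> S" "h = p * h1" unfolding divides_in_def by blast
  obtain e where e: "e \<in> S" "a * h = p * b * e" using factors_prime.prems unfolding divides_in_def by blast
  have "p * (a * h1) = p * (b * e)" using e(2) h1(2) by (simp add: mult_ac)
  then have "a * h1 = b * e" using cancel pS bS h1 e factors_prime.prems by (meson mult_mem)
  then have "divides_in S b (a * h1)" using e unfolding divides_in_def by blast
  moreover have "coprime_in S a b"
    using factors_prime.prems(3) pS divides_mult_left unfolding coprime_in_def by blast
  ultimately have "divides_in S b h1" using factors_prime.IH factors_prime.prems h1 by blast
  then show ?case using h1 unfolding divides_in_def by (auto simp: mult.assoc)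
qed

lemma prime_power_part:
  assumes "prime_in S p" "a \<in> S" "a \<noteq> 0"
  obtains k a' where "a' \<in> S" "a = p ^ k * a'" "\<not> divides_in S p a'"
proof -
  have "\<exists>k. \<exists>a'\<in>S. a = p ^ k * a' \<and> \<not> divides_in S p a'" if "factors_in S n a" for n
    using that
  proof (induction n arbitrary: a rule: less_induct)
    case (less n)
    have aS: "a \<in> S" using factors_mem less.prems by blast
    show ?case
    proof (cases "divides_in S p a")
      case False
      then show ?thesis using aS by (intro exI[of _ 0] bexI[of _ a]) auto
    next
      case True
      then obtain a1 where a1: "a1 \<in> S" "a = p * a1" unfolding divides_in_def by blast
      have "\<not> unit_in S p" using assms by (simp add: prime_in_def)
      then obtain m where "m < n" "factors_in S m a1"
        using factors_of_mult[OF less.prems prime_mem[OF assms(1)] a1] by blast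
      then obtain k a' where "a' \<in> S" "a1 = p ^ k * a'" "\<not> divides_in S p a'" using less.IH by blast
      then show ?thesis using a1 by (intro exI[of _ "Suc k"] bexI[of _ a']) (auto simp: mult.assoc)
    qed
  qed
  then show ?thesis using that factors_ex[OF assms(2,3)] by blast
qed

lemma prime_divides_prime:
  assumes "prime_in S p" "prime_in S q" "divides_in S p q"
  obtains u where "unit_in S u" "q = p * u"
  using assms prime_irreducible[OF assms(2)] unfolding divides_in_def irreducible_in_def prime_in_def
  by blast

end

section \<open>Regular functions and line bundles on affine space\<close>

text \<open>The implication from \<open>h y \<noteq> 0\<close> to \<open>y \<in> V\<close> makes
  \<open>V\<close> a union of basic open sets, so openness is part of regularity;
  \<open>a / h\<close> represents \<open>f\<close> on such a set, in a form free of
  division.\<close>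

definition regular_poly :: "'v set \<Rightarrow> ('v \<Rightarrow> complex) set \<Rightarrow> (('v \<Rightarrow> complex) \<Rightarrow> complex) \<Rightarrow> bool" where
  "regular_poly J V f \<longleftrightarrow> (\<forall>x\<in>V. \<exists>a\<in>polyfun J. \<exists>h\<in>polyfun J.
     h x \<noteq> 0 \<and> (\<forall>y. h y \<noteq> 0 \<longrightarrow> y \<in> V \<and> h y * f y = a y))"

locale polynomial_functions =
  fixes J :: "'v set"
  assumes finite_J: "finite J"
begin

sublocale factorial_subdomain "polyfun J"
  using factorial_polyfun finite_J .

lemma unit_nonvanishing: "unit_in (polyfun J) u \<Longrightarrow> u x \<noteq> 0"
  using unit_inverse by (metis mult_zero_left one_fun_apply times_fun_apply zero_neq_one)

lemma divides_vanish: "divides_in (polyfun J) p a \<Longrightarrow> p x = 0 \<Longrightarrow> a x = 0"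
  unfolding divides_in_def by auto

lemma prime_zero: "prime_in (polyfun J) p \<Longrightarrow> \<exists>x. p x = 0"
  using nullstellensatz_prime[OF finite_J, of p 1] polyfun_one
  by (auto simp: prime_in_def unit_in_def)

text \<open>Irreducibility of the hypersurface \<open>p = 0\<close>: two nonempty open subsets of
  it, cut out by \<open>f\<close> and \<open>g\<close>, meet. The Nullstellensatz turns vanishing on
  the hypersurface into divisibility by \<open>p\<close>.\<close>

lemma common_point:
  assumes "prime_in (polyfun J) p" "f \<in> polyfun J" "g \<in> polyfun J"
    "\<not> divides_in (polyfun J) p f" "\<not> divides_in (polyfun J) p g"
  obtains x where "p x = 0" "f x \<noteq> 0" "g x \<noteq> 0"
proof -
  have "\<not> divides_in (polyfun J) p (f * g)" using assms unfolding prime_in_def by blast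
  then have "\<exists>x. p x = 0 \<and> (f * g) x \<noteq> 0"
    using nullstellensatz_prime[OF finite_J assms(1) mult_mem[OF assms(2,3)]] by blast
  then show ?thesis using that by auto
qed

lemma vanishing_prime_factor:
  assumes "a \<in> polyfun J" "a \<noteq> 0" "a x = 0"
  obtains p where "prime_in (polyfun J) p" "divides_in (polyfun J) p a" "p x = 0"
proof -
  have "\<exists>p. prime_in (polyfun J) p \<and> divides_in (polyfun J) p a \<and> p x = 0"
    if "factors_in (polyfun J) n a" for n
    using that assms(3)
  proof (induction rule: factors_in.induct)
    case (factors_unit u) then show ?case using unit_nonvanishing by blast
  next
    case (factors_prime p n a)
    have "a \<in> polyfun J" "p \<in> polyfun J" using factors_mem factors_prime prime_mem by blast+
    then have pa: "divides_in (polyfun J) p (p * a)" "divides_in (polyfun J) a (p * a)"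
      using divides_mult_left divides_mult_right divides_refl by blast+
    consider "p x = 0" | "a x = 0" using factors_prime.prems by auto
    then show ?case
    proof cases
      case 1 then show ?thesis using factors_prime.hyps pa by blast
    next
      case 2
      then obtain q where "prime_in (polyfun J) q" "divides_in (polyfun J) q a" "q x = 0"
        using factors_prime.IH by blast
      then show ?thesis using pa(2) divides_trans by blast
    qed
  qed
  then show ?thesis using that factors_ex[OF assms(1,2)] by blast
qed

lemma nonvanishing_unit:
  assumes "a \<in> polyfun J" "\<And>x. a x \<noteq> 0" shows "unit_in (polyfun J) a"
proof -
  have "a \<noteq> 0" using assms by auto
  then obtain n where "factors_in (polyfun J) n a" using factors_ex assms by blast
  then show ?thesis
  proof cases
    case (factors_prime p n b)
    then obtain x where "p x = 0" using prime_zero by blast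
    then show ?thesis using assms(2)[of x] factors_prime by simp
  qed simp
qed

text \<open>Nonempty basic open sets are dense: \<open>h * (f - g)\<close> is identically zero and
  there are no zero divisors.\<close>

lemma eq_on_nonvanishing:
  assumes "f \<in> polyfun J" "g \<in> polyfun J" "h \<in> polyfun J" "h \<noteq> 0"
    and "\<And>x. h x \<noteq> 0 \<Longrightarrow> f x = g x"
  shows "f = g"
proof -
  have "h * (f - g) = 0"
  proof
    fix x show "(h * (f - g)) x = 0 x"
      using assms(5)[of x] by (cases "h x = 0") (auto simp: fun_diff_def)
  qed
  then show ?thesis using no_zero_div[OF assms(3) diff_mem[OF assms(1,2)]] assms(4) by simp
qed

text \<open>One reduced fraction serves on all of \<open>V\<close>. Against any other local fraction
  \<open>a1 / h1\<close> the identity \<open>a1 * b = a * h1\<close> holds on a dense open set,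
  hence everywhere; \<open>b\<close> is coprime to \<open>a\<close>, so it divides \<open>h1\<close>
  and cannot vanish where \<open>h1\<close> does not.\<close>

lemma regular_fraction:
  assumes "regular_poly J V f" "x0 \<in> V"
  obtains a b where "a \<in> polyfun J" "b \<in> polyfun J" "coprime_in (polyfun J) a b"
    "\<And>y. y \<in> V \<Longrightarrow> b y \<noteq> 0 \<and> b y * f y = a y"
proof -
  obtain a0 h0 where 0: "a0 \<in> polyfun J" "h0 \<in> polyfun J" "h0 x0 \<noteq> 0"
    "\<And>y. h0 y \<noteq> 0 \<Longrightarrow> y \<in> V \<and> h0 y * f y = a0 y"
    using assms unfolding regular_poly_def by blast
  have "h0 \<noteq> 0" using 0 by auto
  then obtain d a b where d: "d \<in> polyfun J" "a \<in> polyfun J" "b \<in> polyfun J" "d \<noteq> 0" "a0 = d * a"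
    "h0 = d * b" "coprime_in (polyfun J) a b" using reduce_fraction 0 by metis
  have b0: "b \<noteq> 0" using d \<open>h0 \<noteq> 0\<close> by auto
  have "b y \<noteq> 0 \<and> b y * f y = a y" if y: "y \<in> V" for y
  proof -
    obtain a1 h1 where 1: "a1 \<in> polyfun J" "h1 \<in> polyfun J" "h1 y \<noteq> 0"
      "\<And>y. h1 y \<noteq> 0 \<Longrightarrow> y \<in> V \<and> h1 y * f y = a1 y"
      using assms(1) y unfolding regular_poly_def by blast
    have "h1 \<noteq> 0" using 1 by auto
    then have nz: "h0 * h1 \<noteq> 0" using mult_nonzero 0 1 \<open>h0 \<noteq> 0\<close> by blast
    have eq: "a1 * b = a * h1"
    proof (rule eq_on_nonvanishing[OF _ _ _ nz])
      fix x assume "(h0 * h1) x \<noteq> 0"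
      then have "h0 x \<noteq> 0" "h1 x \<noteq> 0" by auto
      then have *: "h0 x * f x = a0 x" "h1 x * f x = a1 x" using 0(4)[of x] 1(4)[of x] by auto
      have dx: "d x \<noteq> 0" using \<open>h0 x \<noteq> 0\<close> d by auto
      have "b x * f x = a x" using *(1) d(5,6) dx by (simp add: mult.assoc)
      then show "(a1 * b) x = (a * h1) x" using *(2)
        by (metis mult.assoc mult.commute times_fun_apply)
    qed (use d 0 1 in \<open>auto intro: mult_mem\<close>)
    then have "divides_in (polyfun J) b (a * h1)" using 1 unfolding divides_in_def
      by (metis mult.commute)
    moreover obtain n where "factors_in (polyfun J) n b" using factors_ex d b0 by blast
    ultimately have "divides_in (polyfun J) b h1" using coprime_divides_mult d 1 by blast
    then have by0: "b y \<noteq> 0" using divides_vanish 1(3) by blast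
    have "a1 y * b y = a y * h1 y" using eq by (metis times_fun_apply)
    then have "h1 y * (b y * f y) = h1 y * a y" using 1(3) 1(4)[of y] by (simp add: mult_ac)
    then show ?thesis using by0 1(3) by simp
  qed
  then show ?thesis using that d by blast
qed

lemma regular_UNIV:
  assumes "regular_poly J UNIV f" shows "f \<in> polyfun J"
proof -
  obtain a b where ab: "a \<in> polyfun J" "b \<in> polyfun J" "\<And>y. b y \<noteq> 0 \<and> b y * f y = a y"
    using regular_fraction[OF assms UNIV_I] by (metis UNIV_I)
  then obtain v where v: "unit_in (polyfun J) v" "b * v = 1"
    using nonvanishing_unit unit_inverse by blast
  have "f = a * v"
  proof
    fix x
    have "b x * v x = 1" using v(2) by (metis one_fun_apply times_fun_apply)
    then have "f x = (b x * f x) * v x" by (simp add: mult_ac)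
    then show "f x = (a * v) x" using ab(3)[of x] by simp
  qed
  then show ?thesis using ab v by (simp add: unit_in_def mult_mem)
qed

text \<open>The bad primes of a rational trivialization, those at which some local representative
  \<open>a i / b i\<close> fails to be a unit, divide a fixed polynomial; they are removed one at a time.\<close>

lemma remove_bad_primes:
  fixes s t :: "'i \<Rightarrow> ('v \<Rightarrow> complex) \<Rightarrow> complex"
  assumes "factors_in (polyfun J) n f"
    and "\<forall>i\<in>I. s i \<in> polyfun J \<and> t i \<in> polyfun J \<and> s i \<noteq> 0 \<and> t i \<noteq> 0"
    and "\<forall>i\<in>I. \<forall>j\<in>I. \<forall>p. \<forall>x\<in>V i. \<forall>y\<in>V j. prime_in (polyfun J) p \<longrightarrow> p x = 0 \<longrightarrow> p y = 0 \<longrightarrow>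
        unit_at (polyfun J) p (s i * t j) (s j * t i)"
    and "\<forall>i\<in>I. \<forall>p. \<forall>x\<in>V i. prime_in (polyfun J) p \<longrightarrow> p x = 0 \<longrightarrow>
        \<not> unit_at (polyfun J) p (s i) (t i) \<longrightarrow> divides_in (polyfun J) p f"
  shows "\<exists>\<alpha>\<in>polyfun J. \<exists>\<beta>\<in>polyfun J. \<alpha> \<noteq> 0 \<and> \<beta> \<noteq> 0 \<and>
    (\<forall>i\<in>I. \<forall>p. \<forall>x\<in>V i. prime_in (polyfun J) p \<longrightarrow> p x = 0 \<longrightarrow> unit_at (polyfun J) p (\<alpha> * s i) (\<beta> * t i))"
proof -
  let ?H1 = "\<lambda>s t. \<forall>i\<in>I. s i \<in> polyfun J \<and> t i \<in> polyfun J \<and> s i \<noteq> 0 \<and> t i \<noteq> 0"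
  let ?H2 = "\<lambda>s t. \<forall>i\<in>I. \<forall>j\<in>I. \<forall>p. \<forall>x\<in>V i. \<forall>y\<in>V j. prime_in (polyfun J) p \<longrightarrow> p x = 0 \<longrightarrow>
    p y = 0 \<longrightarrow> unit_at (polyfun J) p (s i * t j) (s j * t i)"
  let ?H3 = "\<lambda>f s t. \<forall>i\<in>I. \<forall>p. \<forall>x\<in>V i. prime_in (polyfun J) p \<longrightarrow> p x = 0 \<longrightarrow>
    \<not> unit_at (polyfun J) p (s i) (t i) \<longrightarrow> divides_in (polyfun J) p f"
  let ?C = "\<lambda>s t. \<exists>\<alpha>\<in>polyfun J. \<exists>\<beta>\<in>polyfun J. \<alpha> \<noteq> 0 \<and> \<beta> \<noteq> 0 \<and>
    (\<forall>i\<in>I. \<forall>p. \<forall>x\<in>V i. prime_in (polyfun J) p \<longrightarrow> p x = 0 \<longrightarrow> unit_at (polyfun J) p (\<alpha> * s i) (\<beta> * t i))"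
  \<comment> \<open>The family changes when a prime is removed, so the induction runs on a statement
    quantified over \<open>s\<close> and \<open>t\<close>.\<close>
  define P where "P = (\<lambda>f. \<forall>s t. ?H1 s t \<longrightarrow> ?H2 s t \<longrightarrow> ?H3 f s t \<longrightarrow> ?C s t)"
  have "P f"
    using assms(1)
  proof (induction rule: factors_in.induct)
    case (factors_unit u)
    show ?case
      unfolding P_def
    proof (intro allI impI)
      fix s t assume prems: "?H1 s t" "?H2 s t" "?H3 u s t"
  have "unit_at (polyfun J) p (s i) (t i)"
    if "i \<in> I" "prime_in (polyfun J) p" "x \<in> V i" "p x = 0" for i p x
  proof (rule ccontr)
    assume "\<not> ?thesis"
    then have "divides_in (polyfun J) p u" using prems(3) that by blast
    then show False using divides_vanish that unit_nonvanishing factors_unit.hyps by blast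
  qed
  then show "?C s t" by (intro bexI[of _ 1]) auto
    qed
next
  case (factors_prime p0 n f)
  show ?case
    unfolding P_def
  proof (intro allI impI)
    fix s t assume prems: "?H1 s t" "?H2 s t" "?H3 (p0 * f) s t"
    have IH: "?C s t" if "?H1 s t" "?H2 s t" "?H3 f s t" for s t
      using factors_prime.IH that unfolding P_def by blast
  note pr0 = factors_prime.hyps(1)
  have ab: "s i \<in> polyfun J \<and> t i \<in> polyfun J \<and> s i \<noteq> 0 \<and> t i \<noteq> 0" if "i \<in> I" for i
    using prems(1) that by blast
  have compat: "unit_at (polyfun J) p (s i * t j) (s j * t i)"
    if "i \<in> I" "j \<in> I" "prime_in (polyfun J) p" "x \<in> V i" "p x = 0" "y \<in> V j" "p y = 0" for i j p x y
    using prems(2) that by blast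
  have fS: "f \<in> polyfun J" using factors_mem factors_prime.hyps by blast
  have p0: "p0 \<in> polyfun J" "p0 \<noteq> 0" using pr0 by (auto simp: prime_in_def)
  have p0_pow: "p0 ^ k \<in> polyfun J \<and> p0 ^ k \<noteq> 0" for k
    using p0 by (induction k) (simp_all add: mult_mem mult_nonzero)
  have assoc: "divides_in (polyfun J) p0 p \<and> (\<forall>x. p x = 0 \<longleftrightarrow> p0 x = 0)"
    if p: "prime_in (polyfun J) p" "divides_in (polyfun J) p p0" for p
  proof -
    obtain u where u: "unit_in (polyfun J) u" "p0 = p * u" using prime_divides_prime[OF p(1) pr0 p(2)] .
    obtain v where v: "unit_in (polyfun J) v" "u * v = 1" using unit_inverse u by blast
    have "p0 * v = p * (u * v)" unfolding u(2) by (simp add: mult.assoc)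
    then have "p = p0 * v" using v by simp
    then show ?thesis using u v unit_nonvanishing[OF u(1)] unfolding divides_in_def
      by (auto simp: unit_in_def)
  qed
  show "?C s t"
  proof (cases "\<exists>i\<in>I. \<exists>x\<in>V i. p0 x = 0")
    \<comment> \<open>A prime whose zeros avoid every \<open>V i\<close> cannot be bad and is
      dropped from the product at no cost.\<close>
    case False
    have "divides_in (polyfun J) p f"
      if "i \<in> I" "prime_in (polyfun J) p" "x \<in> V i" "p x = 0" "\<not> unit_at (polyfun J) p (s i) (t i)" for i p x
    proof -
      have "divides_in (polyfun J) p (p0 * f)" by (rule prems(3)[rule_format, OF that(1,3,2,4,5)])
      moreover have "\<not> divides_in (polyfun J) p p0" using False that divides_vanish by blast
      ultimately show ?thesis using that fS p0 prime_divides_mult_iff by blast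
    qed
    then have H3: "?H3 f s t" by blast
    show ?thesis by (rule IH[OF prems(1,2) H3])
  next
    case True
    then obtain i0 x0 where i0: "i0 \<in> I" "x0 \<in> V i0" "p0 x0 = 0" by blast
    obtain k s' where s': "s' \<in> polyfun J" "s i0 = p0 ^ k * s'" "\<not> divides_in (polyfun J) p0 s'"
      using prime_power_part[OF pr0] ab[OF i0(1)] by metis
    obtain l t' where t': "t' \<in> polyfun J" "t i0 = p0 ^ l * t'" "\<not> divides_in (polyfun J) p0 t'"
      using prime_power_part[OF pr0] ab[OF i0(1)] by metis
    \<comment> \<open>\<open>k\<close> and \<open>l\<close> are the orders of \<open>s i0\<close>
      and \<open>t i0\<close> at \<open>p0\<close>. The crossed powers make the fraction at
      \<open>i0\<close> a unit at \<open>p0\<close>; compatibility transfers this to every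
      \<open>i\<close> whose \<open>V i\<close> meets \<open>p0 = 0\<close>, and the other primes do
      not notice the change.\<close>
    let ?s = "\<lambda>i. p0 ^ l * s i" and ?t = "\<lambda>i. p0 ^ k * t i"
    have "\<exists>\<alpha>\<in>polyfun J. \<exists>\<beta>\<in>polyfun J. \<alpha> \<noteq> 0 \<and> \<beta> \<noteq> 0 \<and> (\<forall>i\<in>I. \<forall>p. \<forall>x\<in>V i.
        prime_in (polyfun J) p \<longrightarrow> p x = 0 \<longrightarrow> unit_at (polyfun J) p (\<alpha> * ?s i) (\<beta> * ?t i))"
    proof (rule IH; (intro ballI allI impI)?)
      show "?s i \<in> polyfun J \<and> ?t i \<in> polyfun J \<and> ?s i \<noteq> 0 \<and> ?t i \<noteq> 0" if "i \<in> I" for i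
        using ab[OF that] p0_pow mult_mem mult_nonzero by meson
      show "unit_at (polyfun J) p (?s i * ?t j) (?s j * ?t i)"
        if ij: "i \<in> I" "j \<in> I" "prime_in (polyfun J) p" "x \<in> V i" "p x = 0" "y \<in> V j" "p y = 0" for i j p x y
      proof -
        obtain c d where c: "c \<in> polyfun J" "d \<in> polyfun J" "\<not> divides_in (polyfun J) p c"
          "\<not> divides_in (polyfun J) p d" "s i * t j * d = c * (s j * t i)"
          using compat[OF ij] unfolding unit_at_def by blast
        have "?s i * ?t j * d = p0 ^ l * p0 ^ k * (s i * t j * d)" by (simp add: mult_ac)
        also have "\<dots> = c * (?s j * ?t i)" unfolding c(5) by (simp add: mult_ac)
        finally show ?thesis using c unfolding unit_at_def by blast
      qed
      show "divides_in (polyfun J) p f"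
        if i: "i \<in> I" and p: "prime_in (polyfun J) p" and x: "x \<in> V i" "p x = 0"
          and bad: "\<not> unit_at (polyfun J) p (?s i) (?t i)" for i p x
      proof -
        have "\<not> divides_in (polyfun J) p p0"
        proof
          assume pp0: "divides_in (polyfun J) p p0"
          have "p x0 = 0" using assoc[OF p pp0] i0 by blast
          then obtain c d where c: "c \<in> polyfun J" "d \<in> polyfun J" "\<not> divides_in (polyfun J) p c"
            "\<not> divides_in (polyfun J) p d" "s i * t i0 * d = c * (s i0 * t i)"
            using compat[OF i i0(1) p x i0(2)] unfolding unit_at_def by blast
          have "?s i * (t' * d) = s i * t i0 * d" unfolding t'(2) by (simp add: mult_ac)
          also have "\<dots> = (c * s') * ?t i" unfolding c(5) s'(2) by (simp add: mult_ac)
          finally have "?s i * (t' * d) = (c * s') * ?t i" .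
          moreover have "\<not> divides_in (polyfun J) p (t' * d)" "\<not> divides_in (polyfun J) p (c * s')"
            using prime_divides_mult_iff[OF p] c s' t' assoc[OF p pp0] divides_trans by blast+
          ultimately show False using bad c s' t' mult_mem unfolding unit_at_def by blast
        qed
        moreover have "\<not> unit_at (polyfun J) p (s i) (t i)"
        proof
          assume "unit_at (polyfun J) p (s i) (t i)"
          then obtain c d where c: "c \<in> polyfun J" "d \<in> polyfun J" "\<not> divides_in (polyfun J) p c"
            "\<not> divides_in (polyfun J) p d" "s i * d = c * t i" unfolding unit_at_def by blast
          have pw: "\<not> divides_in (polyfun J) p (p0 ^ m)" for m
          proof (induction m)
            case 0
            have "(p0 ^ 0) x \<noteq> 0" unfolding power_fun_apply by simp
            then show ?case using x divides_vanish by blast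
          next
            case (Suc m)
            then show ?case unfolding power_Suc
              using prime_divides_mult_iff[OF p p0(1)] p0_pow \<open>\<not> divides_in (polyfun J) p p0\<close> by blast
          qed
          have "?s i * (p0 ^ k * d) = p0 ^ l * p0 ^ k * (s i * d)" by (simp add: mult_ac)
          also have "\<dots> = (p0 ^ l * c) * ?t i" unfolding c(5) by (simp add: mult_ac)
          finally have "?s i * (p0 ^ k * d) = (p0 ^ l * c) * ?t i" .
          moreover have "\<not> divides_in (polyfun J) p (p0 ^ k * d)" "\<not> divides_in (polyfun J) p (p0 ^ l * c)"
            using prime_divides_mult_iff[OF p] c pw p0_pow by blast+
          ultimately show False using bad c p0_pow mult_mem unfolding unit_at_def by blast
        qed
        then have "divides_in (polyfun J) p (p0 * f)" by (rule prems(3)[rule_format, OF i x(1) p x(2)])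
        ultimately show ?thesis using prime_divides_mult_iff[OF p p0(1) fS] by blast
      qed
    qed
    then obtain \<alpha> \<beta> where \<alpha>\<beta>: "\<alpha> \<in> polyfun J" "\<beta> \<in> polyfun J" "\<alpha> \<noteq> 0" "\<beta> \<noteq> 0"
      "\<And>i p x. i \<in> I \<Longrightarrow> x \<in> V i \<Longrightarrow> prime_in (polyfun J) p \<Longrightarrow> p x = 0 \<Longrightarrow>
         unit_at (polyfun J) p (\<alpha> * p0 ^ l * s i) (\<beta> * p0 ^ k * t i)"
      unfolding mult.assoc by blast
    moreover have "\<alpha> * p0 ^ l \<in> polyfun J" "\<beta> * p0 ^ k \<in> polyfun J" "\<alpha> * p0 ^ l \<noteq> 0" "\<beta> * p0 ^ k \<noteq> 0"
      using \<alpha>\<beta> p0_pow mult_mem mult_nonzero by meson+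
    ultimately show ?thesis
      by (intro bexI[of _ "\<alpha> * p0 ^ l"] bexI[of _ "\<beta> * p0 ^ k"] conjI ballI allI impI) assumption+
  qed
    qed
  qed
  then show ?thesis using assms(2-4) unfolding P_def by blast
qed

text \<open>Relative to one chart \<open>i0\<close> the transition functions \<open>G i i0\<close>
  are fractions \<open>a i / b i\<close>, a rational trivialization. At each prime the fractions of
  two charts meeting its zero set differ by a unit, so their orders define a divisor; by
  factoriality it is principal, and a suitable factor \<open>\<alpha> / \<beta>\<close> removes it.
  After reduction, numerators and denominators have no zeros on \<open>V i\<close>.\<close>

theorem affine_space_picard_trivial:
  assumes cover: "(\<Union>i\<in>I. V i) = UNIV"
    and reg: "\<And>i j. i \<in> I \<Longrightarrow> j \<in> I \<Longrightarrow> regular_poly J (V i \<inter> V j) (G i j)"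
    and nonzero: "\<And>i j x. i \<in> I \<Longrightarrow> j \<in> I \<Longrightarrow> x \<in> V i \<inter> V j \<Longrightarrow> G i j x \<noteq> 0"
    and cocycle: "\<And>i j k x. i \<in> I \<Longrightarrow> j \<in> I \<Longrightarrow> k \<in> I \<Longrightarrow> x \<in> V i \<inter> V j \<inter> V k \<Longrightarrow>
      G i j x * G j k x = G i k x"
  shows "\<exists>\<phi>. \<forall>i\<in>I. regular_poly J (V i) (\<phi> i) \<and> (\<forall>x\<in>V i. \<phi> i x \<noteq> 0) \<and>
    (\<forall>j\<in>I. \<forall>x\<in>V i \<inter> V j. \<phi> i x = G i j x * \<phi> j x)"
proof -
  have ex_h: "\<exists>h\<in>polyfun J. h x \<noteq> 0 \<and> (\<forall>y. h y \<noteq> 0 \<longrightarrow> y \<in> V i)" if "i \<in> I" "x \<in> V i" for i x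
    using reg[of i i] that unfolding regular_poly_def by (metis Int_iff)
  obtain i0 x0 where i0: "i0 \<in> I" "x0 \<in> V i0" using cover by blast
  obtain h0 where h0: "h0 \<in> polyfun J" "h0 x0 \<noteq> 0" "\<And>y. h0 y \<noteq> 0 \<Longrightarrow> y \<in> V i0"
    using ex_h[OF i0] by blast
  have h0nz: "h0 \<noteq> 0" using h0 by auto
  \<comment> \<open>An empty \<open>V i\<close> offers no point at which to represent
    \<open>G i i0\<close> by a fraction.\<close>
  define I' where "I' = {i \<in> I. V i \<noteq> {}}"
  have "\<exists>a b. a \<in> polyfun J \<and> b \<in> polyfun J \<and> a \<noteq> 0 \<and> b \<noteq> 0 \<and>
      (\<forall>y\<in>V i \<inter> V i0. a y \<noteq> 0 \<and> b y \<noteq> 0 \<and> b y * G i i0 y = a y)" if i: "i \<in> I'" for i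
  proof -
    obtain x where x: "i \<in> I" "x \<in> V i" using i unfolding I'_def by blast
    obtain h where h: "h \<in> polyfun J" "h x \<noteq> 0" "\<And>y. h y \<noteq> 0 \<Longrightarrow> y \<in> V i" using ex_h[OF x] by blast
    have "h \<noteq> 0" using h by auto
    then have "h * h0 \<noteq> 0" using mult_nonzero h h0 h0nz by blast
    then obtain z where "h z \<noteq> 0" "h0 z \<noteq> 0" by (auto simp: fun_eq_iff)
    then have z: "z \<in> V i \<inter> V i0" using h h0 by blast
    obtain a b where ab: "a \<in> polyfun J" "b \<in> polyfun J"
      "\<And>y. y \<in> V i \<inter> V i0 \<Longrightarrow> b y \<noteq> 0 \<and> b y * G i i0 y = a y"
      using regular_fraction[OF reg[OF x(1) i0(1)] z] by metis
    have "\<forall>y\<in>V i \<inter> V i0. a y \<noteq> 0 \<and> b y \<noteq> 0 \<and> b y * G i i0 y = a y"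
      using ab(3) nonzero[OF x(1) i0(1)] by (metis mult_eq_0_iff)
    moreover have "a \<noteq> 0" "b \<noteq> 0" using calculation z by auto
    ultimately show ?thesis using ab by blast
  qed
  then obtain a b where ab: "\<And>i. i \<in> I' \<Longrightarrow> a i \<in> polyfun J \<and> b i \<in> polyfun J \<and> a i \<noteq> 0 \<and> b i \<noteq> 0"
    and ab_G: "\<And>i y. i \<in> I' \<Longrightarrow> y \<in> V i \<Longrightarrow> y \<in> V i0 \<Longrightarrow> a i y \<noteq> 0 \<and> b i y \<noteq> 0 \<and> b i y * G i i0 y = a i y"
    by (metis IntI)
  \<comment> \<open>Cleared form of \<open>G i j = (a i / b i) / (a j / b j)\<close>. The cocycle
    rule gives it on a basic open set inside the chart \<open>i0\<close>, and density extends it to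
    all points.\<close>
  have identity: "a i * b j * h = c * (a j * b i)"
    if ij: "i \<in> I'" "j \<in> I'" and ch: "c \<in> polyfun J" "h \<in> polyfun J" "h \<noteq> 0"
      and D: "\<And>y. h y \<noteq> 0 \<Longrightarrow> y \<in> V i \<inter> V j \<and> h y * G i j y = c y" for i j c h
  proof (rule eq_on_nonvanishing[of _ _ "h * h0"])
    fix y assume "(h * h0) y \<noteq> 0"
    then have y: "h y \<noteq> 0" "h0 y \<noteq> 0" by auto
    then have yV: "y \<in> V i" "y \<in> V j" "y \<in> V i0" "h y * G i j y = c y" using D h0(3) by auto
    have G: "G i i0 y = G i j y * G j i0 y" using cocycle[of i j i0 y] ij i0 yV unfolding I'_def by auto
    have i: "b i y * G i i0 y = a i y" and j: "b j y * G j i0 y = a j y" using ab_G ij yV by blast+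
    have "a i y * b j y * h y = (b i y * (G i j y * G j i0 y)) * b j y * h y" using i G by simp
    also have "\<dots> = (h y * G i j y) * ((b j y * G j i0 y) * b i y)" by (simp add: mult_ac)
    also have "\<dots> = c y * (a j y * b i y)" using yV(4) j by simp
    finally show "(a i * b j * h) y = (c * (a j * b i)) y" by simp
  qed (use ab ij ch h0 h0nz in \<open>simp_all add: mult_mem mult_nonzero\<close>)
  \<comment> \<open>The two zeros \<open>x\<close> and \<open>y\<close> of \<open>p\<close> may
    differ; irreducibility of \<open>p = 0\<close> replaces them by a common point \<open>z\<close>,
    where \<open>G i j\<close> is defined and nonzero.\<close>
  have compat: "unit_at (polyfun J) p (a i * b j) (a j * b i)"
    if ij: "i \<in> I'" "j \<in> I'" and p: "prime_in (polyfun J) p" and xy: "x \<in> V i" "p x = 0" "y \<in> V j" "p y = 0"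
    for i j p x y
  proof -
    obtain hi where hi: "hi \<in> polyfun J" "hi x \<noteq> 0" "\<And>y. hi y \<noteq> 0 \<Longrightarrow> y \<in> V i"
      using ex_h ij xy unfolding I'_def by blast
    obtain hj where hj: "hj \<in> polyfun J" "hj y \<noteq> 0" "\<And>y. hj y \<noteq> 0 \<Longrightarrow> y \<in> V j"
      using ex_h ij xy unfolding I'_def by blast
    obtain z where z: "p z = 0" "hi z \<noteq> 0" "hj z \<noteq> 0"
      using common_point[OF p hi(1) hj(1)] divides_vanish hi(2) hj(2) xy by metis
    then have zV: "z \<in> V i \<inter> V j" using hi hj by blast
    obtain c h where ch: "c \<in> polyfun J" "h \<in> polyfun J" "h z \<noteq> 0"
      "\<And>y. h y \<noteq> 0 \<Longrightarrow> y \<in> V i \<inter> V j \<and> h y * G i j y = c y"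
      using reg[of i j] ij zV unfolding regular_poly_def I'_def by blast
    have "c z \<noteq> 0" using ch(3) ch(4)[OF ch(3)] nonzero[of i j z] ij zV unfolding I'_def by auto
    then have "\<not> divides_in (polyfun J) p c" "\<not> divides_in (polyfun J) p h"
      using divides_vanish z(1) ch(3) by blast+
    moreover have "h \<noteq> 0" using ch by auto
    ultimately show ?thesis using identity[OF ij ch(1,2) _ ch(4)] ch(1,2) unfolding unit_at_def by blast
  qed
  \<comment> \<open>Only primes of \<open>h0\<close> can be bad: for any other, \<open>p = 0\<close>
    has a point in both \<open>V i\<close> and the chart \<open>i0\<close>, where \<open>a i\<close>
    and \<open>b i\<close> are nonzero.\<close>
  have bad: "divides_in (polyfun J) p h0"
    if i: "i \<in> I'" and p: "prime_in (polyfun J) p" and x: "x \<in> V i" "p x = 0"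
      and b: "\<not> unit_at (polyfun J) p (a i) (b i)" for i p x
  proof (rule ccontr)
    assume n: "\<not> divides_in (polyfun J) p h0"
    obtain hi where hi: "hi \<in> polyfun J" "hi x \<noteq> 0" "\<And>y. hi y \<noteq> 0 \<Longrightarrow> y \<in> V i"
      using ex_h i x unfolding I'_def by blast
    obtain z where z: "p z = 0" "hi z \<noteq> 0" "h0 z \<noteq> 0"
      using common_point[OF p hi(1) h0(1) _ n] divides_vanish hi(2) x by metis
    then have "a i z \<noteq> 0" "b i z \<noteq> 0" using ab_G[OF i] hi h0 by blast+
    then have "\<not> divides_in (polyfun J) p (a i)" "\<not> divides_in (polyfun J) p (b i)"
      using divides_vanish z(1) by blast+
    then show False using b ab[OF i] unfolding unit_at_def by blast
  qed
  obtain n where "factors_in (polyfun J) n h0" using factors_ex h0(1) h0nz by blast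
  then have "\<exists>\<alpha>\<in>polyfun J. \<exists>\<beta>\<in>polyfun J. \<alpha> \<noteq> 0 \<and> \<beta> \<noteq> 0 \<and> (\<forall>i\<in>I'. \<forall>p. \<forall>x\<in>V i.
      prime_in (polyfun J) p \<longrightarrow> p x = 0 \<longrightarrow> unit_at (polyfun J) p (\<alpha> * a i) (\<beta> * b i))"
    by (rule remove_bad_primes; intro ballI allI impI) (rule ab compat bad; assumption)+
  then obtain \<alpha> \<beta> where \<alpha>\<beta>: "\<alpha> \<in> polyfun J" "\<beta> \<in> polyfun J" "\<alpha> \<noteq> 0" "\<beta> \<noteq> 0"
    "\<And>i p x. i \<in> I' \<Longrightarrow> x \<in> V i \<Longrightarrow> prime_in (polyfun J) p \<Longrightarrow> p x = 0 \<Longrightarrow>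
       unit_at (polyfun J) p (\<alpha> * a i) (\<beta> * b i)"
    by blast
  have "\<exists>A B d. A \<in> polyfun J \<and> B \<in> polyfun J \<and> d \<in> polyfun J \<and> d \<noteq> 0 \<and> \<alpha> * a i = d * A \<and>
      \<beta> * b i = d * B \<and> (\<forall>x\<in>V i. A x \<noteq> 0 \<and> B x \<noteq> 0)" if i: "i \<in> I'" for i
  proof -
    have nz: "\<alpha> * a i \<noteq> 0" "\<beta> * b i \<noteq> 0" "\<alpha> * a i \<in> polyfun J" "\<beta> * b i \<in> polyfun J"
      using ab[OF i] \<alpha>\<beta> mult_nonzero mult_mem by blast+
    obtain d A B where d: "d \<in> polyfun J" "A \<in> polyfun J" "B \<in> polyfun J" "d \<noteq> 0" "\<alpha> * a i = d * A"
      "\<beta> * b i = d * B" "coprime_in (polyfun J) A B" using reduce_fraction[OF nz(3,4,2)] .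
    have AB0: "A \<noteq> 0" "B \<noteq> 0" using d nz by auto
    have "A x \<noteq> 0 \<and> B x \<noteq> 0" if x: "x \<in> V i" for x
    proof (rule ccontr)
      assume "\<not> ?thesis"
      then obtain p where p: "prime_in (polyfun J) p" "p x = 0"
        "divides_in (polyfun J) p A \<or> divides_in (polyfun J) p B"
        using vanishing_prime_factor[OF d(2) AB0(1), of x] vanishing_prime_factor[OF d(3) AB0(2), of x] by metis
      obtain c e where ce: "c \<in> polyfun J" "e \<in> polyfun J" "\<not> divides_in (polyfun J) p c"
        "\<not> divides_in (polyfun J) p e" "\<alpha> * a i * e = c * (\<beta> * b i)"
        using \<alpha>\<beta>(5)[OF i x p(1,2)] unfolding unit_at_def by blast
      have "d * (A * e) = d * (c * B)" using ce(5) unfolding d(5,6) by (simp add: mult_ac)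
      then have eq: "A * e = c * B" using cancel[OF d(1) _ _ d(4)] d ce mult_mem by meson
      have "divides_in (polyfun J) p (A * e) \<longleftrightarrow> divides_in (polyfun J) p A"
        "divides_in (polyfun J) p (c * B) \<longleftrightarrow> divides_in (polyfun J) p B"
        using prime_divides_mult_iff[OF p(1)] d ce by blast+
      then have "divides_in (polyfun J) p A \<and> divides_in (polyfun J) p B" using p(3) eq by simp
      then show False using d(7) p(1) unfolding coprime_in_def by blast
    qed
    then show ?thesis using d by blast
  qed
  then obtain A B d where AB: "\<And>i. i \<in> I' \<Longrightarrow> A i \<in> polyfun J \<and> B i \<in> polyfun J \<and> d i \<in> polyfun J \<and> d i \<noteq> 0"
    and AB_eq: "\<And>i. i \<in> I' \<Longrightarrow> \<alpha> * a i = d i * A i \<and> \<beta> * b i = d i * B i"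
    and AB_nz: "\<And>i x. i \<in> I' \<Longrightarrow> x \<in> V i \<Longrightarrow> A i x \<noteq> 0 \<and> B i x \<noteq> 0" by metis
  define \<phi> where "\<phi> = (\<lambda>i x. A i x / B i x)"
  have "regular_poly J (V i) (\<phi> i) \<and> (\<forall>x\<in>V i. \<phi> i x \<noteq> 0) \<and>
    (\<forall>j\<in>I. \<forall>x\<in>V i \<inter> V j. \<phi> i x = G i j x * \<phi> j x)" if i: "i \<in> I" for i
  proof (intro conjI ballI)
    show "regular_poly J (V i) (\<phi> i)" unfolding regular_poly_def
    proof
      fix x assume x: "x \<in> V i"
      then have i': "i \<in> I'" using i unfolding I'_def by blast
      obtain h where h: "h \<in> polyfun J" "h x \<noteq> 0" "\<And>y. h y \<noteq> 0 \<Longrightarrow> y \<in> V i" using ex_h[OF i x] by blast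
      show "\<exists>a\<in>polyfun J. \<exists>h\<in>polyfun J. h x \<noteq> 0 \<and> (\<forall>y. h y \<noteq> 0 \<longrightarrow> y \<in> V i \<and> h y * \<phi> i y = a y)"
        using h AB[OF i'] AB_nz[OF i' x]
        by (intro bexI[of _ "h * A i"] bexI[of _ "h * B i"]) (auto simp: \<phi>_def mult_mem)
    qed
  next
    fix x assume "x \<in> V i"
    then show "\<phi> i x \<noteq> 0" using AB_nz[of i x] i by (auto simp: \<phi>_def I'_def)
  next
    fix j x assume j: "j \<in> I" and x: "x \<in> V i \<inter> V j"
    then have ij: "i \<in> I'" "j \<in> I'" using i unfolding I'_def by blast+
    obtain c h where ch: "c \<in> polyfun J" "h \<in> polyfun J" "h x \<noteq> 0"
      "\<And>y. h y \<noteq> 0 \<Longrightarrow> y \<in> V i \<inter> V j \<and> h y * G i j y = c y"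
      using reg[OF i j] x unfolding regular_poly_def by blast
    have "h \<noteq> 0" using ch by auto
    then have "a i * b j * h = c * (a j * b i)" using identity[OF ij ch(1,2) _ ch(4)] by blast
    then have "\<alpha> * \<beta> * (a i * b j * h) = \<alpha> * \<beta> * (c * (a j * b i))" by simp
    then have "(\<alpha> * a i) * (\<beta> * b j) * h = c * ((\<alpha> * a j) * (\<beta> * b i))" by (simp add: mult_ac)
    then have "(d i * A i) * (d j * B j) * h = c * ((d j * A j) * (d i * B i))"
      using AB_eq[OF ij(1)] AB_eq[OF ij(2)] by simp
    then have "(d i * d j) * (A i * B j * h) = (d i * d j) * (c * (A j * B i))" by (simp add: mult_ac)
    moreover have "d i * d j \<noteq> 0" using AB ij mult_nonzero by blast
    ultimately have "A i * B j * h = c * (A j * B i)"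
      using cancel AB[OF ij(1)] AB[OF ij(2)] ch(1,2) mult_mem by meson
    then have "(A i * B j * h) x = (c * (A j * B i)) x" by simp
    then have "A i x * B j x * h x = c x * (A j x * B i x)" by simp
    also have "c x = h x * G i j x" using ch(4)[OF ch(3)] by simp
    finally have "h x * (A i x * B j x) = h x * (G i j x * (A j x * B i x))" by (simp add: mult_ac)
    then have "A i x * B j x = G i j x * (A j x * B i x)" using ch(3) by simp
    then show "\<phi> i x = G i j x * \<phi> j x"
      using AB_nz[OF ij(1)] AB_nz[OF ij(2)] x by (auto simp: \<phi>_def field_simps)
  qed
  then show ?thesis by blast
qed

section \<open>Coordinate primes and units on the torus\<close>

text \<open>Every polynomial function is its restriction to \<open>w j = 0\<close> plus a multiple
  of \<open>coord j\<close>, by induction over its formation.\<close>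

lemma coord_divides_iff:
  assumes "j \<in> J" "f \<in> polyfun J"
  shows "divides_in (polyfun J) (coord j) f \<longleftrightarrow> (\<forall>w. f (w(j := 0)) = 0)"
proof
  assume "divides_in (polyfun J) (coord j) f"
  then show "\<forall>w. f (w(j := 0)) = 0" unfolding divides_in_def by auto
next
  have "\<exists>g\<in>polyfun J. \<forall>w. f w = f (w(j := 0)) + w j * g w" using assms(2)
  proof (induction rule: polyfun.induct)
    case (polyfun_const c) then show ?case by (intro bexI[of _ 0]) auto
  next
    case (polyfun_var i)
    show ?case
    proof (cases "i = j")
      case True
      then show ?thesis by (intro bexI[of _ 1]) auto
    next
      case False
      then show ?thesis using polyfun_var by (intro bexI[of _ 0]) auto
    qed
  next
    case (polyfun_add f1 f2)
    then obtain g1 g2 where g: "g1 \<in> polyfun J" "g2 \<in> polyfun J"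
      and eq: "\<And>w. f1 w = f1 (w(j := 0)) + w j * g1 w" "\<And>w. f2 w = f2 (w(j := 0)) + w j * g2 w" by blast
    have "(f1 + f2) w = (f1 + f2) (w(j := 0)) + w j * (g1 + g2) w" for w
      using eq(1)[of w] eq(2)[of w] by (simp add: algebra_simps)
    then show ?case using add_mem[OF g] by blast
  next
    case (polyfun_mult f1 f2)
    then obtain g1 g2 where g: "g1 \<in> polyfun J" "g2 \<in> polyfun J"
      and eq: "\<And>w. f1 w = f1 (w(j := 0)) + w j * g1 w" "\<And>w. f2 w = f2 (w(j := 0)) + w j * g2 w" by blast
    define f2' where "f2' = (\<lambda>w. f2 (w(j := 0)))"
    have f2': "f2' \<in> polyfun J" unfolding f2'_def using polyfun_fix[of f2 j J 0] polyfun_mult assms(1)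
      by (simp add: insert_absorb)
    have "(f1 * f2) w = (f1 * f2) (w(j := 0)) + w j * (f1 * g2 + g1 * f2') w" for w
    proof -
      have "(f1 * f2) w = f1 w * (f2 (w(j := 0)) + w j * g2 w)" using eq(2)[of w] by simp
      also have "\<dots> = f1 w * f2 (w(j := 0)) + w j * (f1 w * g2 w)" by (simp add: algebra_simps)
      also have "f1 w * f2 (w(j := 0)) = f1 (w(j := 0)) * f2 (w(j := 0)) + w j * (g1 w * f2' w)"
        unfolding f2'_def by (subst eq(1)) (simp add: algebra_simps)
      finally show ?thesis by (simp add: algebra_simps)
    qed
    moreover have "f1 * g2 + g1 * f2' \<in> polyfun J"
      using g f2' polyfun_mult.hyps by (intro add_mem mult_mem)
    ultimately show ?case by blast
  qed
  then obtain g where g: "g \<in> polyfun J" "\<forall>w. f w = f (w(j := 0)) + w j * g w" by blast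
  assume "\<forall>w. f (w(j := 0)) = 0"
  then have "f w = w j * g w" for w using g(2)[rule_format, of w] by simp
  then have "f = coord j * g" by (simp add: fun_eq_iff)
  then show "divides_in (polyfun J) (coord j) f" using g(1) unfolding divides_in_def by blast
qed

text \<open>Restriction to the hyperplane \<open>w j = 0\<close> is a ring homomorphism into a ring
  without zero divisors, and its kernel consists of the multiples of \<open>coord j\<close>.\<close>

lemma coord_prime:
  assumes "j \<in> J" shows "prime_in (polyfun J) (coord j)"
proof -
  have c: "coord j \<in> polyfun J" using assms by (rule polyfun_var)
  have "coord j (\<lambda>_. 1) \<noteq> 0 (\<lambda>_. 1)" by simp
  then have "coord j \<noteq> 0" by metis
  moreover have "\<not> unit_in (polyfun J) (coord j)" using unit_nonvanishing[of "coord j" "\<lambda>_. 0"] by auto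
  moreover have "divides_in (polyfun J) (coord j) f \<or> divides_in (polyfun J) (coord j) g"
    if fg: "f \<in> polyfun J" "g \<in> polyfun J" "divides_in (polyfun J) (coord j) (f * g)" for f g
  proof -
    let ?f = "\<lambda>w. f (w(j := 0))" and ?g = "\<lambda>w. g (w(j := 0))"
    have S: "?f \<in> polyfun J" "?g \<in> polyfun J"
      using polyfun_fix[of f j J 0] polyfun_fix[of g j J 0] fg assms by (simp_all add: insert_absorb)
    have "?f * ?g = 0" using fg coord_divides_iff[OF assms] mult_mem by (auto simp: fun_eq_iff)
    then have "?f = 0 \<or> ?g = 0" using no_zero_div S by blast
    then show ?thesis using coord_divides_iff[OF assms] fg by (auto simp: fun_eq_iff)
  qed
  ultimately show ?thesis using c unfolding prime_in_def by blast
qed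

end

text \<open>In each variable separately, a polynomial function without zeros is a complex polynomial
  without roots, hence constant.\<close>

lemma nonvanishing_const:
  assumes "finite J" "f \<in> polyfun J" "\<And>w. f w \<noteq> 0"
  shows "\<exists>c. f = (\<lambda>_. c)"
  using assms
proof (induction J arbitrary: f)
  case empty then show ?case using polyfun_empty by blast
next
  case (insert j J)
  interpret factorial_subdomain "polyfun J" using factorial_polyfun insert by blast
  obtain F where F: "F \<in> polys_over (polyfun J)" "f = poly F (coord j)"
    using insert.prems polyfun_insert[OF subdomain_axioms] by blast
  have f0: "f w = f (w(j := 0))" for w
  proof -
    let ?F = "map_poly (\<lambda>g. g w) F"
    have eq: "f (w(j := z)) = poly ?F z" for z
      using poly_coord_upd[OF F(1) insert.hyps(2)] F(2) by simp
    then have "\<nexists>z. poly ?F z = 0" using insert.prems(2) by metis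
    then have "constant (poly ?F)" using fundamental_theorem_of_algebra by blast
    then have "poly ?F (w j) = poly ?F 0" unfolding constant_def by blast
    then show ?thesis using eq[of "w j"] eq[of 0] by simp
  qed
  obtain c where "(\<lambda>w. f (w(j := 0))) = (\<lambda>_. c)"
    using insert.IH[OF polyfun_fix[OF insert.prems(1)]] insert.prems(2) by blast
  then have "f w = c" for w using f0[of w] by (metis (no_types))
  then show ?case by blast
qed

text \<open>A prime factor of \<open>a\<close> vanishes only where the product of all coordinates
  does. By the Nullstellensatz it divides that product, hence a coordinate, and so it is that
  coordinate up to a nonzero scalar.\<close>

lemma (in polynomial_functions) torus_unit_monomial:
  assumes "a \<in> polyfun J" "\<And>x. (\<And>j. j \<in> J \<Longrightarrow> x j \<noteq> 0) \<Longrightarrow> a x \<noteq> 0"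
  shows "\<exists>c k. c \<noteq> 0 \<and> a = (\<lambda>w. c * (\<Prod>j\<in>J. w j ^ k j))"
proof -
  have "a \<noteq> 0" using assms(2)[of "\<lambda>_. 1"] by auto
  then obtain n where "factors_in (polyfun J) n a" using factors_ex assms by blast
  then show ?thesis using assms(2)
  proof (induction rule: factors_in.induct)
    case (factors_unit u)
    then obtain c where "u = (\<lambda>_. c)"
      using nonvanishing_const[OF finite_J, of u] unit_nonvanishing by (auto simp: unit_in_def)
    moreover have "c \<noteq> 0" using calculation unit_nonvanishing[OF factors_unit.hyps] by simp
    ultimately show ?case by (intro exI[of _ c] exI[of _ "\<lambda>_. 0"]) simp
  next
    case (factors_prime p n a)
    have "(\<And>j. j \<in> J \<Longrightarrow> x j \<noteq> 0) \<Longrightarrow> p x \<noteq> 0 \<and> a x \<noteq> 0" for x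
      using factors_prime.prems[of x] by auto
    then have nz: "(\<And>j. j \<in> J \<Longrightarrow> x j \<noteq> 0) \<Longrightarrow> p x \<noteq> 0" "(\<And>j. j \<in> J \<Longrightarrow> x j \<noteq> 0) \<Longrightarrow> a x \<noteq> 0" for x
      by blast+
    obtain c k where ck: "c \<noteq> 0" "a = (\<lambda>w. c * (\<Prod>j\<in>J. w j ^ k j))" using factors_prime.IH nz(2) by blast
    have prod_apply: "(\<Prod>j\<in>K. coord j) w = (\<Prod>j\<in>K. w j)" for K and w :: "'v \<Rightarrow> complex"
      by (induction K rule: infinite_finite_induct) auto
    have "divides_in (polyfun J) p (\<Prod>j\<in>J. coord j)"
    proof (rule nullstellensatz_prime[OF finite_J factors_prime.hyps(1)])
      show "(\<Prod>j\<in>J. coord j) \<in> polyfun J" by (rule prod_mem) (rule polyfun_var)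
      show "(\<Prod>j\<in>J. coord j) w = 0" if "p w = 0" for w
        using nz(1)[of w] that finite_J by (auto simp: prod_apply)
    qed
    moreover have "\<exists>j\<in>K. divides_in (polyfun J) p (coord j)"
      if "K \<subseteq> J" "divides_in (polyfun J) p (\<Prod>j\<in>K. coord j)" for K
      using finite_subset[OF that(1) finite_J] that
    proof (induction K)
      case empty
      then have "divides_in (polyfun J) p 1" by (simp add: one_fun_def)
      then have "unit_in (polyfun J) p" using prime_mem[OF factors_prime.hyps(1)] by (simp add: unit_in_def)
      then show ?case using factors_prime.hyps by (simp add: prime_in_def)
    next
      case (insert j K)
      have "coord j \<in> polyfun J" "(\<Prod>j\<in>K. coord j) \<in> polyfun J"
        using insert.prems by (auto intro!: prod_mem polyfun_var)
      moreover have "divides_in (polyfun J) p (coord j * (\<Prod>j\<in>K. coord j))"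
        using insert.prems(2) prod.insert[OF insert.hyps, of coord] by (simp only:)
      ultimately have "divides_in (polyfun J) p (coord j) \<or> divides_in (polyfun J) p (\<Prod>j\<in>K. coord j)"
        using prime_divides_mult_iff[OF factors_prime.hyps(1)] by blast
      then show ?case using insert.IH insert.prems by blast
    qed
    ultimately obtain j where j: "j \<in> J" "divides_in (polyfun J) p (coord j)" by blast
    obtain u where u: "unit_in (polyfun J) u" "coord j = p * u"
      using prime_divides_prime[OF factors_prime.hyps(1) coord_prime[OF j(1)] j(2)] .
    obtain d where d: "u = (\<lambda>_. d)"
      using nonvanishing_const[OF finite_J, of u] unit_nonvanishing u(1) by (auto simp: unit_in_def)
    have d0: "d \<noteq> 0" using d unit_nonvanishing[OF u(1)] by simp
    have p: "p w = w j / d" for w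
    proof -
      have "w j = (p * u) w" using u(2) by (rule fun_cong)
      then show ?thesis using d d0 by (simp add: field_simps)
    qed
    have "(p * a) w = (c / d) * (\<Prod>i\<in>J. w i ^ (k(j := Suc (k j))) i)" for w
    proof -
      have "(\<Prod>i\<in>J. w i ^ (k(j := Suc (k j))) i) = w j ^ Suc (k j) * (\<Prod>i\<in>J - {j}. w i ^ k i)"
        by (subst prod.remove[OF finite_J j(1)]) (auto intro!: prod.cong)
      also have "\<dots> = w j * (\<Prod>i\<in>J. w i ^ k i)"
        by (subst prod.remove[OF finite_J j(1)]) (simp add: mult_ac)
      finally show ?thesis using p ck by simp
    qed
    then show ?case using ck(1) d0 by (intro exI[of _ "c / d"] exI[of _ "k(j := Suc (k j))"]) auto
  qed
qed

section \<open>Smooth fans and Cox coordinates\<close>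

definition pairing :: "int ^ 'l \<Rightarrow> int ^ ('l::finite) \<Rightarrow> int" where
  "pairing m r = (\<Sum>i\<in>UNIV. m $ i * r $ i)"

lemma pairing_add: "pairing (m + m') r = pairing m r + pairing m' r"
  and pairing_diff: "pairing (m - m') r = pairing m r - pairing m' r"
  and pairing_uminus: "pairing (- m) r = - pairing m r"
  and pairing_smult: "pairing (k *s m) r = k * pairing m r"
  and pairing_zero [simp]: "pairing 0 r = 0"
  by (simp_all add: pairing_def algebra_simps sum.distrib sum_subtractf sum_negf sum_distrib_left)

lemma pairing_sum: "pairing (\<Sum>i\<in>I. f i) r = (\<Sum>i\<in>I. pairing (f i) r)"
  by (induction I rule: infinite_finite_induct) (auto simp: pairing_add)

lemma inner_real_vec: "real_vec m \<bullet> real_vec r = of_int (pairing m r)"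
  by (simp add: real_vec_def pairing_def inner_vec_def)

lemma mem_cone_gen_iff:
  assumes "finite A"
  shows "x \<in> cone_gen A \<longleftrightarrow> (\<exists>c. (\<forall>r\<in>A. 0 \<le> c r) \<and> x = (\<Sum>r\<in>A. c r *\<^sub>R real_vec r))"
proof -
  define C where "C = {x. \<exists>c. (\<forall>r\<in>A. 0 \<le> c r) \<and> x = (\<Sum>r\<in>A. c r *\<^sub>R real_vec r)}"
  have "convex_cone C" unfolding convex_cone_iff
  proof (intro conjI ballI allI impI)
    show "0 \<in> C" unfolding C_def by (auto intro!: exI[of _ "\<lambda>_. 0"])
    show "x + y \<in> C" if xy: "x \<in> C" "y \<in> C" for x y
    proof -
      obtain c d where "\<forall>r\<in>A. 0 \<le> c r" "x = (\<Sum>r\<in>A. c r *\<^sub>R real_vec r)"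
        "\<forall>r\<in>A. 0 \<le> d r" "y = (\<Sum>r\<in>A. d r *\<^sub>R real_vec r)" using xy unfolding C_def by blast
      then show ?thesis unfolding C_def
        by (auto intro!: exI[of _ "\<lambda>r. c r + d r"] simp: scaleR_add_left sum.distrib)
    qed
    show "k *\<^sub>R x \<in> C" if x: "x \<in> C" "0 \<le> k" for x k
    proof -
      obtain c where "\<forall>r\<in>A. 0 \<le> c r" "x = (\<Sum>r\<in>A. c r *\<^sub>R real_vec r)" using x unfolding C_def by blast
      then show ?thesis unfolding C_def using x
        by (auto intro!: exI[of _ "\<lambda>r. k * c r"] simp: scaleR_sum_right)
    qed
  qed
  moreover have "real_vec ` A \<subseteq> C"
  proof
    fix x assume "x \<in> real_vec ` A"
    then obtain r where r: "r \<in> A" "x = real_vec r" by blast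
    have "(\<Sum>s\<in>A. (if s = r then 1 else 0) *\<^sub>R real_vec s) = (\<Sum>s\<in>A. if s = r then real_vec s else 0)"
      by (rule sum.cong) auto
    then have "x = (\<Sum>s\<in>A. (if s = r then 1 else 0) *\<^sub>R real_vec s)" using r assms by simp
    then show "x \<in> C" unfolding C_def by (intro CollectI exI[of _ "\<lambda>s. if s = r then 1 else 0"]) simp
  qed
  ultimately have "cone_gen A \<subseteq> C" unfolding cone_gen_def by (simp add: hull_minimal)
  moreover have "(\<Sum>r\<in>B. c r *\<^sub>R real_vec r) \<in> cone_gen A"
    if "finite B" "B \<subseteq> A" "\<forall>r\<in>A. 0 \<le> c r" for B c
    using that
  proof (induction B)
    case empty
    then show ?case by (simp add: cone_gen_def convex_cone_hull_contains_0)
  next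
    case (insert r B)
    have "real_vec r \<in> cone_gen A" using insert by (auto simp: cone_gen_def intro: hull_inc)
    then show ?case using insert
      by (auto simp: cone_gen_def intro!: convex_cone_hull_add convex_cone_hull_mul)
  qed
  then have "C \<subseteq> cone_gen A" unfolding C_def using assms by auto
  ultimately show ?thesis unfolding C_def by blast
qed

lemma dual_monoid_cone_gen:
  assumes "finite A" shows "dual_monoid (cone_gen A) = {m. \<forall>r\<in>A. 0 \<le> pairing m r}"
proof (intro equalityI subsetI)
  fix m assume m: "m \<in> dual_monoid (cone_gen A)"
  have "real_vec r \<in> cone_gen A" if "r \<in> A" for r
    using that by (auto simp: cone_gen_def intro: hull_inc)
  then show "m \<in> {m. \<forall>r\<in>A. 0 \<le> pairing m r}"
    using m by (fastforce simp: dual_monoid_def inner_real_vec)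
next
  fix m assume "m \<in> {m. \<forall>r\<in>A. 0 \<le> pairing m r}"
  then show "m \<in> dual_monoid (cone_gen A)"
    by (auto simp: dual_monoid_def mem_cone_gen_iff[OF assms] inner_sum_right inner_real_vec
        intro!: sum_nonneg mult_nonneg_nonneg)
qed

text \<open>\<open>d\<close> is the basis of the dual lattice that is dual to \<open>B\<close>. The
  expansion of every \<open>m\<close> says that it spans, so \<open>B\<close> is a lattice basis and
  the cone on \<open>B\<close> is smooth of full dimension.\<close>

definition dual_family :: "(int ^ 'l) set \<Rightarrow> (int ^ 'l \<Rightarrow> int ^ ('l::finite)) \<Rightarrow> bool" where
  "dual_family B d \<longleftrightarrow> (\<forall>r\<in>B. \<forall>s\<in>B. pairing (d r) s = (if r = s then 1 else 0)) \<and>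
     (\<forall>m. m = (\<Sum>r\<in>B. pairing m r *s d r))"

text \<open>Cones are handled through their sets of generators, so that faces are subsets and
  \<open>K\<close> is a simplicial complex on the rays \<open>R\<close>. By \<open>K_basis\<close>
  every cone is a face of a smooth full-dimensional one; the charts of the latter are affine spaces
  and cover the variety.\<close>

locale smooth_fan =
  fixes R :: "(int ^ ('l::finite)) set" and K :: "(int ^ 'l) set set"
    and \<Delta> :: "(real ^ 'l) set set"
  assumes finite_R: "finite R"
    and K_rays: "A \<in> K \<Longrightarrow> A \<subseteq> R"
    and K_subset: "A \<in> K \<Longrightarrow> B \<subseteq> A \<Longrightarrow> B \<in> K"
    and K_basis: "A \<in> K \<Longrightarrow> \<exists>B\<in>K. A \<subseteq> B \<and> (\<exists>d. dual_family B d)"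
    and K_inter: "A \<in> K \<Longrightarrow> B \<in> K \<Longrightarrow> cone_gen A \<inter> cone_gen B = cone_gen (A \<inter> B)"
    and fan_eq: "\<Delta> = cone_gen ` K"
    and K_nonempty: "K \<noteq> {}"
begin

definition max_cones :: "(int ^ 'l) set set" where
  "max_cones = {B \<in> K. \<exists>d. dual_family B d}"

definition dual :: "(int ^ 'l) set \<Rightarrow> int ^ 'l \<Rightarrow> int ^ 'l" where
  "dual B = (SOME d. dual_family B d)"

abbreviation dm :: "(int ^ 'l) set \<Rightarrow> (int ^ 'l) set" where
  "dm A \<equiv> {m. \<forall>r\<in>A. 0 \<le> pairing m r}"

text \<open>A point of the variety is given by Cox coordinates \<open>w\<close>, one for each ray, whose vanishing set
  spans a cone; the character \<open>m\<close> takes the value \<open>char_val w m\<close> there.\<close>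

definition char_val :: "(int ^ 'l \<Rightarrow> complex) \<Rightarrow> int ^ 'l \<Rightarrow> complex" where
  "char_val w m = (\<Prod>r\<in>R. w r powi pairing m r)"

definition zeros :: "(int ^ 'l \<Rightarrow> complex) \<Rightarrow> (int ^ 'l) set" where
  "zeros w = {r \<in> R. w r = 0}"

text \<open>The chart of a maximal cone is the slice of Cox space on which the rays outside the cone
  have coordinate 1.\<close>

definition extend1 :: "(int ^ 'l) set \<Rightarrow> (int ^ 'l \<Rightarrow> complex) \<Rightarrow> int ^ 'l \<Rightarrow> complex" where
  "extend1 B z = (\<lambda>r. if r \<in> B then z r else 1)"

definition coords :: "(int ^ 'l) set \<Rightarrow> (int ^ 'l \<Rightarrow> complex) \<Rightarrow> int ^ 'l \<Rightarrow> complex" where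
  "coords B w = (\<lambda>r. char_val w (dual B r))"

text \<open>The point is placed in the smallest chart containing it, that of the cone on its
  vanishing rays; \<open>cox_pt_eq\<close> shows that every larger chart gives the same
  point.\<close>

definition cox_pt :: "(int ^ 'l \<Rightarrow> complex) \<Rightarrow> 'l toric_point" where
  "cox_pt w = chart_map \<Delta> (cone_gen (zeros w)) (restrict (char_val w) (dm (zeros w)))"

definition chart_pt :: "(int ^ 'l) set \<Rightarrow> (int ^ 'l \<Rightarrow> complex) \<Rightarrow> 'l toric_point" where
  "chart_pt B z = cox_pt (extend1 B z)"

lemma max_conesD: "B \<in> max_cones \<Longrightarrow> B \<in> K \<and> B \<subseteq> R \<and> finite B"
  unfolding max_cones_def using K_rays finite_R finite_subset by blast

lemma finite_cone: "A \<in> K \<Longrightarrow> finite A"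
  using K_rays finite_R finite_subset by blast

lemma max_above: "A \<in> K \<Longrightarrow> \<exists>B\<in>max_cones. A \<subseteq> B"
  using K_basis unfolding max_cones_def by blast

lemma dual_family_dual: "B \<in> max_cones \<Longrightarrow> dual_family B (dual B)"
  unfolding max_cones_def dual_def using someI_ex by (metis (mono_tags, lifting) mem_Collect_eq)

lemma pairing_dual:
  "B \<in> max_cones \<Longrightarrow> r \<in> B \<Longrightarrow> s \<in> B \<Longrightarrow> pairing (dual B r) s = (if r = s then 1 else 0)"
  using dual_family_dual unfolding dual_family_def by blast

lemma dual_expand: "B \<in> max_cones \<Longrightarrow> m = (\<Sum>r\<in>B. pairing m r *s dual B r)"
  using dual_family_dual unfolding dual_family_def by blast

lemma dual_monoid_eq: "A \<in> K \<Longrightarrow> dual_monoid (cone_gen A) = dm A"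
  using dual_monoid_cone_gen finite_cone by blast

lemma dual_in_dm: "B \<in> max_cones \<Longrightarrow> A \<subseteq> B \<Longrightarrow> r \<in> B \<Longrightarrow> dual B r \<in> dm A"
  using pairing_dual by fastforce

lemma char_val_zero [simp]: "char_val w 0 = 1"
  by (simp add: char_val_def)

text \<open>At a vanishing coordinate, exponents of opposite sign would break the law:
  \<open>0 powi 1 * 0 powi (- 1)\<close> is 0, while \<open>0 powi 0\<close> is 1.\<close>

lemma char_val_add:
  assumes "\<And>r. r \<in> zeros w \<Longrightarrow> 0 \<le> pairing m r \<and> 0 \<le> pairing m' r"
  shows "char_val w (m + m') = char_val w m * char_val w m'"
  unfolding char_val_def prod.distrib[symmetric]
proof (rule prod.cong)
  fix r assume r: "r \<in> R"
  show "w r powi pairing (m + m') r = w r powi pairing m r * w r powi pairing m' r"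
  proof (cases "w r = 0")
    case True
    then have "0 \<le> pairing m r" "0 \<le> pairing m' r" using assms r by (auto simp: zeros_def)
    then have "pairing m r = 0 \<and> pairing m' r = 0 \<or> pairing m r + pairing m' r \<noteq> 0" by linarith
    then show ?thesis unfolding pairing_add by (elim disjE) (simp, intro power_int_add, simp)
  next
    case False
    then show ?thesis unfolding pairing_add by (intro power_int_add) auto
  qed
qed simp

lemma char_val_nonzero_iff:
  "char_val w m \<noteq> 0 \<longleftrightarrow> (\<forall>r\<in>zeros w. pairing m r = 0)"
  using finite_R by (auto simp: char_val_def zeros_def)

lemma char_val_extend1:
  assumes "B \<subseteq> R" shows "char_val (extend1 B z) m = (\<Prod>r\<in>B. z r powi pairing m r)"
proof -
  have "char_val (extend1 B z) m = (\<Prod>r\<in>B. extend1 B z r powi pairing m r)"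
    unfolding char_val_def by (rule prod.mono_neutral_right) (auto simp: finite_R assms extend1_def)
  also have "\<dots> = (\<Prod>r\<in>B. z r powi pairing m r)" by (rule prod.cong) (auto simp: extend1_def)
  finally show ?thesis .
qed

lemma zeros_extend1: "zeros (extend1 B z) = {r \<in> B \<inter> R. z r = 0}"
  by (auto simp: zeros_def extend1_def)

lemma char_val_in_chart:
  assumes "A \<in> K" "zeros w \<subseteq> A"
  shows "restrict (char_val w) (dm A) \<in> affine_chart (cone_gen A)"
proof -
  have "char_val w (m + m') = char_val w m * char_val w m'" if "m \<in> dm A" "m' \<in> dm A" for m m'
    using that assms(2) by (intro char_val_add) auto
  then show ?thesis using assms unfolding affine_chart_def
    by (auto simp: dual_monoid_eq pairing_add)
qed

lemma affine_chart_sum: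
  assumes "A \<in> K" "x \<in> affine_chart (cone_gen A)" "finite F" "\<And>i. i \<in> F \<Longrightarrow> f i \<in> dm A"
  shows "(\<Sum>i\<in>F. f i) \<in> dm A \<and> x (\<Sum>i\<in>F. f i) = (\<Prod>i\<in>F. x (f i))"
  using assms(3,4)
proof (induction F)
  case empty then show ?case using assms by (auto simp: affine_chart_def)
next
  case (insert i F)
  then have "f i \<in> dm A" "(\<Sum>i\<in>F. f i) \<in> dm A" by auto
  then show ?case using insert assms(1,2)
    by (auto simp: affine_chart_def dual_monoid_eq pairing_add)
qed

lemma affine_chart_power:
  assumes "A \<in> K" "x \<in> affine_chart (cone_gen A)" "m \<in> dm A"
  shows "int n *s m \<in> dm A \<and> x (int n *s m) = x m ^ n"
proof -
  have "int n *s m = (\<Sum>i<n. m)"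
    by (induction n) (auto simp: vec_eq_iff algebra_simps)
  then show ?thesis using affine_chart_sum[OF assms(1,2), of "{..<n}" "\<lambda>_. m"] assms(3) by simp
qed

lemma affine_chart_inverse:
  assumes "A \<in> K" "x \<in> affine_chart (cone_gen A)" "\<And>r. r \<in> A \<Longrightarrow> pairing m r = 0"
  shows "x m \<noteq> 0" "x (- m) = inverse (x m)"
proof -
  have "m \<in> dm A" "- m \<in> dm A" using assms(3) by (auto simp: pairing_uminus)
  then have "x (m + - m) = x m * x (- m)"
    using assms(1,2) unfolding affine_chart_def dual_monoid_eq[OF assms(1)] by blast
  moreover have "x 0 = 1" using assms by (simp add: affine_chart_def)
  ultimately have "x m * x (- m) = 1" by simp
  then show "x m \<noteq> 0" "x (- m) = inverse (x m)" by (auto simp: inverse_unique)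
qed

text \<open>A point of the chart is a monoid homomorphism and is fixed by its values at the dual
  basis of \<open>B\<close>. The dual vectors of rays outside \<open>A\<close> are invertible in the
  monoid of \<open>A\<close>, so their values are nonzero and may be raised to negative
  powers.\<close>

lemma affine_chart_eq_mono:
  assumes A: "A \<in> K" and B: "B \<in> max_cones" "A \<subseteq> B" and x: "x \<in> affine_chart (cone_gen A)"
  defines "w \<equiv> extend1 B (\<lambda>r. x (dual B r))"
  shows "zeros w \<subseteq> A" "x = restrict (char_val w) (dm A)"
proof -
  have zero0: "pairing (dual B r) s = 0" if "r \<in> B - A" "s \<in> A" for r s
    using pairing_dual[OF B(1)] that B(2) by auto
  have nz: "x (dual B r) \<noteq> 0" "x (- dual B r) = inverse (x (dual B r))" if "r \<in> B - A" for r
    using affine_chart_inverse[OF A x] zero0[OF that] by blast+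
  then show "zeros w \<subseteq> A" unfolding w_def zeros_extend1 by auto
  have pow: "pairing m r *s dual B r \<in> dm A \<and> x (pairing m r *s dual B r) = x (dual B r) powi pairing m r"
    if m: "m \<in> dm A" and r: "r \<in> B" for m r
  proof (cases "0 \<le> pairing m r")
    case True
    then show ?thesis using affine_chart_power[OF A x dual_in_dm[OF B r], of "nat (pairing m r)"]
      by (simp add: power_int_def)
  next
    case False
    then have rA: "r \<in> B - A" using m r by auto
    then have "- dual B r \<in> dm A" using zero0 by (auto simp: pairing_uminus)
    moreover have "pairing m r *s dual B r = int (nat (- pairing m r)) *s (- dual B r)"
      using False by (simp add: vec_eq_iff)
    ultimately show ?thesis using affine_chart_power[OF A x, of "- dual B r" "nat (- pairing m r)"] nz[OF rA] False
      by (simp add: power_int_def)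
  qed
  have "x m = char_val w m" if m: "m \<in> dm A" for m
  proof -
    have "x m = x (\<Sum>r\<in>B. pairing m r *s dual B r)" using dual_expand[OF B(1)] by metis
    also have "\<dots> = (\<Prod>r\<in>B. x (pairing m r *s dual B r))"
      using affine_chart_sum[OF A x, of B "\<lambda>r. pairing m r *s dual B r"] pow[OF m] max_conesD[OF B(1)]
      by blast
    also have "\<dots> = char_val w m" unfolding w_def
      using pow[OF m] max_conesD[OF B(1)] by (simp add: char_val_extend1)
    finally show ?thesis .
  qed
  moreover have "x \<in> extensional (dm A)" using x A by (simp add: affine_chart_def dual_monoid_eq)
  ultimately show "x = restrict (char_val w) (dm A)"
    by (intro extensionalityI[of _ "dm A"]) auto
qed

text \<open>The monoid of the face \<open>C\<close> is that of \<open>A\<close> with one element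
  \<open>m0\<close> inverted, which vanishes on \<open>C\<close> and is 1 on the other rays of
  \<open>A\<close>. As \<open>z\<close> is nonzero at \<open>m0\<close>, the vanishing rays of
  \<open>w\<close> lie in \<open>C\<close>, and agreement on the monoid of \<open>A\<close> extends
  to that of \<open>C\<close>.\<close>

lemma face_unique:
  assumes A: "A \<in> K" "C \<subseteq> A" and z: "z \<in> affine_chart (cone_gen C)" and w: "zeros w \<subseteq> A"
    and eq: "\<And>m. m \<in> dm A \<Longrightarrow> z m = char_val w m"
  shows "zeros w \<subseteq> C" "z = restrict (char_val w) (dm C)"
proof -
  have C: "C \<in> K" using K_subset A by blast
  obtain B where B: "B \<in> max_cones" "A \<subseteq> B" using max_above A by blast
  define m0 where "m0 = (\<Sum>r\<in>A - C. dual B r)"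
  have finA: "finite (A - C)" using finite_cone A by blast
  have m0: "pairing m0 s = (if s \<in> A - C then 1 else 0)" if s: "s \<in> A" for s
  proof -
    have "pairing m0 s = (\<Sum>r\<in>A - C. if r = s then 1 else 0)" unfolding m0_def pairing_sum
      using pairing_dual[OF B(1)] B(2) s by (intro sum.cong) (auto simp: subset_eq)
    then show ?thesis using finA by simp
  qed
  have m0A: "m0 \<in> dm A" using m0 by auto
  have m0C: "pairing m0 s = 0" if "s \<in> C" for s using m0[of s] that A by auto
  have zm0: "z m0 \<noteq> 0" using affine_chart_inverse(1)[OF C z] m0C by blast
  then have "char_val w m0 \<noteq> 0" using eq[OF m0A] by simp
  then have "\<forall>r\<in>zeros w. pairing m0 r = 0" by (simp add: char_val_nonzero_iff)
  then show zw: "zeros w \<subseteq> C" using m0 w by (metis DiffI subsetD subsetI zero_neq_one)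
  have "z m = char_val w m" if m: "m \<in> dm C" for m
  proof -
    \<comment> \<open>A multiple of \<open>m0\<close> this large makes
      \<open>m + int N *s m0\<close> nonnegative on all rays of \<open>A\<close>.\<close>
    define N where "N = (\<Sum>s\<in>A. nat \<bar>pairing m s\<bar>)"
    have N: "\<bar>pairing m s\<bar> \<le> int N" if "s \<in> A" for s
    proof -
      have "nat \<bar>pairing m s\<bar> \<le> N" unfolding N_def
        by (rule member_le_sum) (use finite_cone[OF A(1)] that in auto)
      then show ?thesis by linarith
    qed
    have NA: "int N *s m0 \<in> dm A" "int N *s m0 \<in> dm C"
      using m0 m0C by (auto simp: pairing_smult)
    have "m + int N *s m0 \<in> dm A"
    proof (clarsimp simp: pairing_add pairing_smult)
      fix s assume s: "s \<in> A"
      show "0 \<le> pairing m s + int N * pairing m0 s"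
        using m0[OF s] N[OF s] m s by (cases "s \<in> C") auto
    qed
    then have "z (m + int N *s m0) = char_val w (m + int N *s m0)" using eq by blast
    moreover have "z (m + int N *s m0) = z m * z (int N *s m0)"
      using z m NA C by (auto simp: affine_chart_def dual_monoid_eq)
    moreover have "char_val w (m + int N *s m0) = char_val w m * char_val w (int N *s m0)"
      using m NA(2) zw by (intro char_val_add) auto
    moreover have "z (int N *s m0) = char_val w (int N *s m0)" using eq NA by blast
    moreover have "z (int N *s m0) \<noteq> 0"
      using affine_chart_inverse(1)[OF C z, of "int N *s m0"] m0C by (auto simp: pairing_smult)
    ultimately show ?thesis by simp
  qed
  moreover have "z \<in> extensional (dm C)" using z C by (simp add: affine_chart_def dual_monoid_eq)
  ultimately show "z = restrict (char_val w) (dm C)"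
    by (intro extensionalityI[of _ "dm C"]) auto
qed

section \<open>The gluing relation in Cox coordinates\<close>

lemma gluing_iff:
  assumes "A \<in> K" "B \<in> K"
  shows "((cone_gen A, x), (cone_gen B, y)) \<in> gluing \<Delta> \<longleftrightarrow>
    (\<exists>z\<in>affine_chart (cone_gen (A \<inter> B)). x = restrict z (dm A) \<and> y = restrict z (dm B))"
proof -
  have "cone_gen A \<in> \<Delta>" "cone_gen B \<in> \<Delta>" using assms fan_eq by auto
  then show ?thesis unfolding gluing_def using assms by (auto simp: K_inter dual_monoid_eq)
qed

lemma gluing_mono:
  assumes "A \<in> K" "B \<in> K" "zeros w \<subseteq> A \<inter> B"
  shows "((cone_gen A, restrict (char_val w) (dm A)), (cone_gen B, restrict (char_val w) (dm B))) \<in> gluing \<Delta>"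
proof -
  have "A \<inter> B \<in> K" using assms K_subset by blast
  then have "restrict (char_val w) (dm (A \<inter> B)) \<in> affine_chart (cone_gen (A \<inter> B))"
    using char_val_in_chart assms by blast
  then show ?thesis unfolding gluing_iff[OF assms(1,2)]
    by (intro bexI[of _ "restrict (char_val w) (dm (A \<inter> B))"]) (auto simp: restrict_def fun_eq_iff)
qed

lemma gluing_monoE:
  assumes "A \<in> K" "B \<in> K" "zeros w \<subseteq> A"
    and "((cone_gen A, restrict (char_val w) (dm A)), (cone_gen B, y)) \<in> gluing \<Delta>"
  shows "zeros w \<subseteq> B" "y = restrict (char_val w) (dm B)"
proof -
  obtain z where z: "z \<in> affine_chart (cone_gen (A \<inter> B))"
    "restrict (char_val w) (dm A) = restrict z (dm A)" "y = restrict z (dm B)"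
    using assms(4) gluing_iff[OF assms(1,2)] by blast
  have "z m = char_val w m" if "m \<in> dm A" for m using fun_cong[OF z(2), of m] that by simp
  note * = face_unique[OF assms(1) _ z(1) assms(3) this, simplified]
  show "zeros w \<subseteq> B" using *(1) by auto
  show "y = restrict (char_val w) (dm B)" unfolding z(3) *(2) by (auto simp: restrict_def fun_eq_iff)
qed

text \<open>The class of a point has one representative for each cone containing its vanishing rays.
  The right side is independent of \<open>A\<close>, so points given in different charts can be
  compared through their Cox coordinates.\<close>

lemma gluing_classes:
  assumes "A \<in> K" "zeros w \<subseteq> A"
  shows "chart_map \<Delta> (cone_gen A) (restrict (char_val w) (dm A)) =
    {(cone_gen B, restrict (char_val w) (dm B)) | B. B \<in> K \<and> zeros w \<subseteq> B}"
proof -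
  have "(\<tau>, y) \<in> gluing \<Delta> `` {(cone_gen A, restrict (char_val w) (dm A))} \<longleftrightarrow>
    (\<exists>B. \<tau> = cone_gen B \<and> y = restrict (char_val w) (dm B) \<and> B \<in> K \<and> zeros w \<subseteq> B)" for \<tau> y
  proof
    assume l: "(\<tau>, y) \<in> gluing \<Delta> `` {(cone_gen A, restrict (char_val w) (dm A))}"
    then have "\<tau> \<in> \<Delta>" by (auto simp: gluing_def)
    then obtain B where B: "B \<in> K" "\<tau> = cone_gen B" using fan_eq by blast
    have "((cone_gen A, restrict (char_val w) (dm A)), (cone_gen B, y)) \<in> gluing \<Delta>" using l B(2) by simp
    from gluing_monoE[OF assms(1) B(1) assms(2) this] B
    show "\<exists>B. \<tau> = cone_gen B \<and> y = restrict (char_val w) (dm B) \<and> B \<in> K \<and> zeros w \<subseteq> B" by blast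
  next
    assume "\<exists>B. \<tau> = cone_gen B \<and> y = restrict (char_val w) (dm B) \<and> B \<in> K \<and> zeros w \<subseteq> B"
    then show "(\<tau>, y) \<in> gluing \<Delta> `` {(cone_gen A, restrict (char_val w) (dm A))}"
      using gluing_mono assms by auto
  qed
  then show ?thesis unfolding chart_map_def by auto
qed

lemma cox_pt_eq:
  assumes "A \<in> K" "zeros w \<subseteq> A"
  shows "cox_pt w = chart_map \<Delta> (cone_gen A) (restrict (char_val w) (dm A))"
  unfolding cox_pt_def using gluing_classes assms K_subset[OF assms] by simp

lemma chart_map_eq:
  assumes "A \<in> K" "B \<in> max_cones" "A \<subseteq> B" "x \<in> affine_chart (cone_gen A)"
  shows "chart_map \<Delta> (cone_gen A) x = chart_pt B (\<lambda>r. x (dual B r))"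
proof -
  note e = affine_chart_eq_mono[OF assms]
  show ?thesis unfolding chart_pt_def cox_pt_eq[OF assms(1) e(1)] e(2)[symmetric] ..
qed

lemma cox_pt_coords:
  assumes "B \<in> max_cones" "zeros w \<subseteq> B"
  shows "cox_pt w = chart_pt B (coords B w)"
proof -
  have B: "B \<in> K" using max_conesD assms by blast
  have "cox_pt w = chart_pt B (\<lambda>r. restrict (char_val w) (dm B) (dual B r))"
    using cox_pt_eq[OF B assms(2)] chart_map_eq[OF B assms(1) order.refl char_val_in_chart[OF B assms(2)]] by simp
  also have "extend1 B (\<lambda>r. restrict (char_val w) (dm B) (dual B r)) = extend1 B (coords B w)"
    using dual_in_dm[OF assms(1) order.refl] by (auto simp: extend1_def coords_def fun_eq_iff)
  then have "chart_pt B (\<lambda>r. restrict (char_val w) (dm B) (dual B r)) = chart_pt B (coords B w)"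
    unfolding chart_pt_def by simp
  finally show ?thesis .
qed

lemma zeros_extend1_subset: "zeros (extend1 B z) \<subseteq> B"
  by (auto simp: zeros_extend1)

lemma char_val_extend1_dual:
  assumes "B \<in> max_cones" "r \<in> B" shows "char_val (extend1 B z) (dual B r) = z r"
proof -
  have B: "B \<subseteq> R" "finite B" using assms max_conesD by blast+
  have "char_val (extend1 B z) (dual B r) = (\<Prod>s\<in>B. if s = r then z r else 1)"
    unfolding char_val_extend1[OF B(1)] using assms by (intro prod.cong) (auto simp: pairing_dual)
  then show ?thesis using assms B by simp
qed

lemma chart_pt_inj:
  assumes "B \<in> max_cones" "chart_pt B z = chart_pt B z'" "r \<in> B"
  shows "z r = z' r"
proof -
  have B: "B \<in> K" using max_conesD assms by blast
  note zs = zeros_extend1_subset[of B z] and zs' = zeros_extend1_subset[of B z']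
  have "(cone_gen B, restrict (char_val (extend1 B z)) (dm B)) \<in> chart_pt B z"
    unfolding chart_pt_def cox_pt_eq[OF B zs] gluing_classes[OF B zs] using B zs by blast
  then have "((cone_gen B, restrict (char_val (extend1 B z')) (dm B)),
      (cone_gen B, restrict (char_val (extend1 B z)) (dm B))) \<in> gluing \<Delta>"
    unfolding assms(2) unfolding chart_pt_def cox_pt_eq[OF B zs'] chart_map_def by blast
  then have "restrict (char_val (extend1 B z)) (dm B) = restrict (char_val (extend1 B z')) (dm B)"
    by (rule gluing_monoE(2)[OF B B zs'])
  from fun_cong[OF this, of "dual B r"]
  have "char_val (extend1 B z) (dual B r) = char_val (extend1 B z') (dual B r)"
    using dual_in_dm[OF assms(1) order.refl assms(3)] by simp
  then show ?thesis using char_val_extend1_dual assms by simp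
qed

lemma toric_variety_eq: "toric_variety \<Delta> = (\<Union>B\<in>max_cones. range (chart_pt B))"
proof (intro equalityI subsetI)
  fix p assume "p \<in> toric_variety \<Delta>"
  then obtain \<sigma> x where "\<sigma> \<in> \<Delta>" "x \<in> affine_chart \<sigma>" "p = chart_map \<Delta> \<sigma> x"
    unfolding toric_variety_def chart_map_def by (auto elim!: quotientE)
  then obtain A where A: "A \<in> K" "x \<in> affine_chart (cone_gen A)" "p = chart_map \<Delta> (cone_gen A) x"
    using fan_eq by blast
  obtain B where B: "B \<in> max_cones" "A \<subseteq> B" using max_above[OF A(1)] by blast
  have "p \<in> range (chart_pt B)" unfolding A(3) chart_map_eq[OF A(1) B A(2)] by (rule rangeI)
  then show "p \<in> (\<Union>B\<in>max_cones. range (chart_pt B))" using B(1) by blast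
next
  fix p assume "p \<in> (\<Union>B\<in>max_cones. range (chart_pt B))"
  then obtain B z where B: "B \<in> max_cones" "p = chart_pt B z" by blast
  then have BK: "B \<in> K" using max_conesD by blast
  have "p = chart_map \<Delta> (cone_gen B) (restrict (char_val (extend1 B z)) (dm B))"
    using B cox_pt_eq[OF BK zeros_extend1_subset] by (simp add: chart_pt_def)
  moreover have "restrict (char_val (extend1 B z)) (dm B) \<in> affine_chart (cone_gen B)"
    using char_val_in_chart[OF BK zeros_extend1_subset] .
  ultimately show "p \<in> toric_variety \<Delta>"
    unfolding toric_variety_def chart_map_def using BK fan_eq by (auto intro!: quotientI)
qed

section \<open>Regular functions in chart coordinates\<close>

text \<open>For a maximal cone the coordinate ring is the polynomial ring in the coordinates indexed
  by \<open>B\<close>: a character of the dual monoid becomes the monomial whose exponents are its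
  pairings with the rays.\<close>

lemma coordinate_ring_polyfun:
  assumes "B \<in> max_cones" "g \<in> coordinate_ring (cone_gen B)"
  shows "(\<lambda>z. g (restrict (char_val (extend1 B z)) (dm B))) \<in> polyfun B"
proof -
  obtain c F where F: "finite F" "F \<subseteq> dm B" "g = (\<lambda>x. \<Sum>m\<in>F. c m * x m)"
    using assms max_conesD unfolding coordinate_ring_def by (auto simp: dual_monoid_eq)
  have BR: "B \<subseteq> R" "finite B" using assms max_conesD by auto
  interpret polynomial_functions B using BR by unfold_locales
  have prod_apply: "(\<Prod>r\<in>B'. coord r ^ k r) z = (\<Prod>r\<in>B'. z r ^ k r)" for B' and k and z :: "int ^ 'l \<Rightarrow> complex"
    by (induction B' rule: infinite_finite_induct) (auto simp: power_fun_apply)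
  have sum_apply: "(\<Sum>m\<in>F'. h m) z = (\<Sum>m\<in>F'. h m z)" for F' and h :: "int ^ 'l \<Rightarrow> (int ^ 'l \<Rightarrow> complex) \<Rightarrow> complex" and z
    by (induction F' rule: infinite_finite_induct) auto
  have "(\<lambda>z. g (restrict (char_val (extend1 B z)) (dm B))) =
      (\<Sum>m\<in>F. (\<lambda>_. c m) * (\<Prod>r\<in>B. coord r ^ nat (pairing m r)))"
  proof
    fix z
    have "char_val (extend1 B z) m = (\<Prod>r\<in>B. z r ^ nat (pairing m r))" if "m \<in> F" for m
      unfolding char_val_extend1[OF BR(1)] using that F(2) by (intro prod.cong) (auto simp: power_int_def)
    then show "g (restrict (char_val (extend1 B z)) (dm B)) = (\<Sum>m\<in>F. (\<lambda>_. c m) * (\<Prod>r\<in>B. coord r ^ nat (pairing m r))) z"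
      unfolding F(3) sum_apply times_fun_apply prod_apply using F(2) by (intro sum.cong) auto
  qed
  also have "\<dots> \<in> polyfun B"
    by (intro sum_mem mult_mem prod_mem power_mem polyfun_const polyfun_var)
  finally show ?thesis .
qed

text \<open>Stated for all faces \<open>A\<close> of \<open>B\<close>, because regularity is tested
  on the charts of all cones; the coordinates of \<open>B\<close> restrict to characters on the
  smaller chart.\<close>

lemma polyfun_coordinate_ring:
  assumes "A \<in> K" "B \<in> max_cones" "A \<subseteq> B" "f \<in> polyfun B"
  shows "\<exists>g\<in>coordinate_ring (cone_gen A). \<forall>x\<in>affine_chart (cone_gen A). g x = f (\<lambda>r. x (dual B r))"
  using assms(4)
proof (induction rule: polyfun.induct)
  case (polyfun_const c)
  show ?case
    by (rule bexI[of _ "\<lambda>x. \<Sum>m\<in>{0}. c * x m"])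
      (auto simp: coordinate_ring_def affine_chart_def dual_monoid_eq[OF assms(1)] intro!: exI[of _ "\<lambda>_. c"] exI[of _ "{0}"])
next
  case (polyfun_var r)
  then have "dual B r \<in> dm A" using dual_in_dm assms by blast
  then show ?case
    by (intro bexI[of _ "\<lambda>x. \<Sum>m\<in>{dual B r}. 1 * x m"])
      (auto simp: coordinate_ring_def dual_monoid_eq[OF assms(1)] intro!: exI[of _ "\<lambda>_. 1"] exI[of _ "{dual B r}"])
next
  case (polyfun_add f1 f2)
  obtain g1 g2 where g1: "g1 \<in> coordinate_ring (cone_gen A)"
      "\<forall>x\<in>affine_chart (cone_gen A). g1 x = f1 (\<lambda>r. x (dual B r))"
    and g2: "g2 \<in> coordinate_ring (cone_gen A)"
      "\<forall>x\<in>affine_chart (cone_gen A). g2 x = f2 (\<lambda>r. x (dual B r))"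
    using polyfun_add.IH by blast
  obtain c F where F1: "finite F" "F \<subseteq> dm A" "g1 = (\<lambda>x. \<Sum>m\<in>F. c m * x m)"
    using g1(1) unfolding coordinate_ring_def dual_monoid_eq[OF assms(1)] by blast
  obtain c' F' where F2: "finite F'" "F' \<subseteq> dm A" "g2 = (\<lambda>x. \<Sum>m\<in>F'. c' m * x m)"
    using g2(1) unfolding coordinate_ring_def dual_monoid_eq[OF assms(1)] by blast
  have F: "finite F" "F \<subseteq> dm A" "finite F'" "F' \<subseteq> dm A"
    "\<And>x. x \<in> affine_chart (cone_gen A) \<Longrightarrow> (\<Sum>m\<in>F. c m * x m) = f1 (\<lambda>r. x (dual B r))"
    "\<And>x. x \<in> affine_chart (cone_gen A) \<Longrightarrow> (\<Sum>m\<in>F'. c' m * x m) = f2 (\<lambda>r. x (dual B r))"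
    using F1 F2 g1(2) g2(2) by auto
  define e where "e = (\<lambda>m. (if m \<in> F then c m else 0) + (if m \<in> F' then c' m else 0))"
  have "(\<Sum>m\<in>F \<union> F'. e m * x m) = (\<Sum>m\<in>F. c m * x m) + (\<Sum>m\<in>F'. c' m * x m)" for x :: "int ^ 'l \<Rightarrow> complex"
  proof -
    have "(\<Sum>m\<in>F \<union> F'. e m * x m) = (\<Sum>m\<in>F \<union> F'. (if m \<in> F then c m * x m else 0)) +
        (\<Sum>m\<in>F \<union> F'. (if m \<in> F' then c' m * x m else 0))"
      unfolding e_def sum.distrib[symmetric] by (intro sum.cong) (auto simp: algebra_simps)
    also have "\<dots> = (\<Sum>m\<in>F. c m * x m) + (\<Sum>m\<in>F'. c' m * x m)"
      using F by (simp add: sum.If_cases Int_absorb1)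
    finally show ?thesis .
  qed
  then show ?case using F
    by (intro bexI[of _ "\<lambda>x. \<Sum>m\<in>F \<union> F'. e m * x m"])
      (auto simp: coordinate_ring_def dual_monoid_eq[OF assms(1)] intro!: exI[of _ e] exI[of _ "F \<union> F'"])
next
  case (polyfun_mult f1 f2)
  obtain g1 g2 where g1: "g1 \<in> coordinate_ring (cone_gen A)"
      "\<forall>x\<in>affine_chart (cone_gen A). g1 x = f1 (\<lambda>r. x (dual B r))"
    and g2: "g2 \<in> coordinate_ring (cone_gen A)"
      "\<forall>x\<in>affine_chart (cone_gen A). g2 x = f2 (\<lambda>r. x (dual B r))"
    using polyfun_mult.IH by blast
  obtain c F where F1: "finite F" "F \<subseteq> dm A" "g1 = (\<lambda>x. \<Sum>m\<in>F. c m * x m)"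
    using g1(1) unfolding coordinate_ring_def dual_monoid_eq[OF assms(1)] by blast
  obtain c' F' where F2: "finite F'" "F' \<subseteq> dm A" "g2 = (\<lambda>x. \<Sum>m\<in>F'. c' m * x m)"
    using g2(1) unfolding coordinate_ring_def dual_monoid_eq[OF assms(1)] by blast
  have F: "finite F" "F \<subseteq> dm A" "finite F'" "F' \<subseteq> dm A"
    "\<And>x. x \<in> affine_chart (cone_gen A) \<Longrightarrow> (\<Sum>m\<in>F. c m * x m) = f1 (\<lambda>r. x (dual B r))"
    "\<And>x. x \<in> affine_chart (cone_gen A) \<Longrightarrow> (\<Sum>m\<in>F'. c' m * x m) = f2 (\<lambda>r. x (dual B r))"
    using F1 F2 g1(2) g2(2) by auto
  define G where "G = (\<lambda>(m, m'). m + m') ` (F \<times> F')"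
  \<comment> \<open>Convolution: \<open>e n\<close> gathers the coefficient products of all pairs of
    exponents with sum \<open>n\<close>.\<close>
  define e where "e = (\<lambda>n. \<Sum>(m, m')\<in>{p \<in> F \<times> F'. (\<lambda>(m, m'). m + m') p = n}. c m * c' m')"
  have G: "finite G" "G \<subseteq> dm A" unfolding G_def using F by (auto simp: pairing_add subset_iff)
  have "(\<Sum>n\<in>G. e n * x n) = (\<Sum>m\<in>F. c m * x m) * (\<Sum>m\<in>F'. c' m * x m)"
    if x: "x \<in> affine_chart (cone_gen A)" for x
  proof -
    have "(\<Sum>n\<in>G. e n * x n) =
        (\<Sum>n\<in>G. \<Sum>p\<in>{p \<in> F \<times> F'. (\<lambda>(m, m'). m + m') p = n}. (\<lambda>(m, m'). c m * c' m' * x (m + m')) p)"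
      unfolding e_def sum_distrib_right by (intro sum.cong) auto
    also have "\<dots> = (\<Sum>(m, m')\<in>F \<times> F'. c m * c' m' * x (m + m'))"
      unfolding G_def using F by (intro sum.image_gen[symmetric]) auto
    also have "\<dots> = (\<Sum>(m, m')\<in>F \<times> F'. (c m * x m) * (c' m' * x m'))"
      using x F by (intro sum.cong) (auto simp: affine_chart_def dual_monoid_eq[OF assms(1)] subset_iff)
    also have "\<dots> = (\<Sum>m\<in>F. c m * x m) * (\<Sum>m\<in>F'. c' m * x m)"
      by (simp add: sum_product sum.cartesian_product)
    finally show ?thesis .
  qed
  then show ?case using F G
    by (intro bexI[of _ "\<lambda>x. \<Sum>n\<in>G. e n * x n"])
      (auto simp: coordinate_ring_def dual_monoid_eq[OF assms(1)] intro!: exI[of _ e] exI[of _ G])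
qed

lemma regular_on_chart:
  assumes "regular_on \<Delta> V f" "B \<in> max_cones"
  shows "regular_poly B (chart_pt B -` V) (f \<circ> chart_pt B)"
  unfolding regular_poly_def
proof
  have B: "B \<in> K" "finite B" using max_conesD assms by blast+
  interpret polynomial_functions B using B by unfold_locales
  let ?x = "\<lambda>z. restrict (char_val (extend1 B z)) (dm B)"
  have x: "?x z \<in> affine_chart (cone_gen B)" for z using char_val_in_chart[OF B(1) zeros_extend1_subset] .
  have cm: "chart_map \<Delta> (cone_gen B) (?x z) = chart_pt B z" for z
    using cox_pt_eq[OF B(1) zeros_extend1_subset] by (simp add: chart_pt_def)
  fix z assume "z \<in> chart_pt B -` V"
  then have "?x z \<in> chart_preimage \<Delta> (cone_gen B) V" using x cm by (simp add: chart_preimage_def)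
  moreover have "regular_chart (cone_gen B) (chart_preimage \<Delta> (cone_gen B) V) (f \<circ> chart_map \<Delta> (cone_gen B))"
    using assms(1) B fan_eq unfolding regular_on_def by blast
  ultimately obtain W a b where W: "open_chart (cone_gen B) W" "?x z \<in> W"
    "W \<subseteq> chart_preimage \<Delta> (cone_gen B) V" "a \<in> coordinate_ring (cone_gen B)"
    "b \<in> coordinate_ring (cone_gen B)" "\<forall>y\<in>W. b y \<noteq> 0 \<and> (f \<circ> chart_map \<Delta> (cone_gen B)) y = a y / b y"
    unfolding regular_chart_def by blast
  obtain g where g: "g \<in> coordinate_ring (cone_gen B)" "g (?x z) \<noteq> 0"
    "\<And>y. y \<in> affine_chart (cone_gen B) \<Longrightarrow> g y \<noteq> 0 \<Longrightarrow> y \<in> W"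
    using W(1,2) unfolding open_chart_def by blast
  note poly = coordinate_ring_polyfun[OF assms(2)]
  let ?a = "(\<lambda>z. g (?x z)) * (\<lambda>z. a (?x z))" and ?h = "(\<lambda>z. g (?x z)) * (\<lambda>z. b (?x z))"
  have "y \<in> chart_pt B -` V \<and> ?h y * (f \<circ> chart_pt B) y = ?a y" if "?h y \<noteq> 0" for y
  proof -
    have "?x y \<in> W" using that g(3)[OF x] by auto
    then have "?x y \<in> chart_preimage \<Delta> (cone_gen B) V" "b (?x y) \<noteq> 0" "f (chart_pt B y) = a (?x y) / b (?x y)"
      using W(3,6) cm by auto
    then show ?thesis using cm by (auto simp: chart_preimage_def)
  qed
  moreover have "?a \<in> polyfun B" "?h \<in> polyfun B" using poly g W by (auto intro!: mult_mem)
  moreover have "?h z \<noteq> 0" using W(2,6) g by auto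
  ultimately show "\<exists>a\<in>polyfun B. \<exists>h\<in>polyfun B. h z \<noteq> 0 \<and> (\<forall>y. h y \<noteq> 0 \<longrightarrow>
      y \<in> chart_pt B -` V \<and> h y * (f \<circ> chart_pt B) y = a y)" by blast
qed

text \<open>Maximal charts suffice. A point of a smaller chart is read in a maximal chart above it,
  and the local numerator and denominator found there are pulled back along the restriction of
  coordinates.\<close>

lemma regular_onI:
  assumes "\<And>B. B \<in> max_cones \<Longrightarrow> regular_poly B (chart_pt B -` V) (f \<circ> chart_pt B)"
  shows "regular_on \<Delta> V f"
  unfolding regular_on_def regular_chart_def
proof (intro ballI)
  fix \<sigma> x assume \<sigma>: "\<sigma> \<in> \<Delta>" and "x \<in> chart_preimage \<Delta> \<sigma> V"
  then obtain A where A: "A \<in> K" "\<sigma> = cone_gen A" using fan_eq by blast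
  obtain B where B: "B \<in> max_cones" "A \<subseteq> B" using max_above A by blast
  note cm = chart_map_eq[OF A(1) B]
  have x: "x \<in> affine_chart (cone_gen A)" "chart_pt B (\<lambda>r. x (dual B r)) \<in> V"
    using \<open>x \<in> chart_preimage \<Delta> \<sigma> V\<close> A cm by (auto simp: chart_preimage_def)
  then obtain a h where ah: "a \<in> polyfun B" "h \<in> polyfun B" "h (\<lambda>r. x (dual B r)) \<noteq> 0"
    "\<And>y. h y \<noteq> 0 \<Longrightarrow> y \<in> chart_pt B -` V \<and> h y * (f \<circ> chart_pt B) y = a y"
    using assms[OF B(1)] unfolding regular_poly_def by blast
  obtain a' where a': "a' \<in> coordinate_ring \<sigma>" "\<forall>x\<in>affine_chart \<sigma>. a' x = a (\<lambda>r. x (dual B r))"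
    using polyfun_coordinate_ring[OF A(1) B ah(1)] A by blast
  obtain h' where h': "h' \<in> coordinate_ring \<sigma>" "\<forall>x\<in>affine_chart \<sigma>. h' x = h (\<lambda>r. x (dual B r))"
    using polyfun_coordinate_ring[OF A(1) B ah(2)] A by blast
  define W where "W = affine_chart \<sigma> - {x. \<forall>f\<in>{h'}. f x = 0}"
  have oW: "open_chart \<sigma> W" unfolding open_chart_def W_def using h' by blast
  have xW: "x \<in> W" unfolding W_def using x A h' ah by auto
  have yW: "y \<in> chart_preimage \<Delta> \<sigma> V \<and> h' y \<noteq> 0 \<and> (f \<circ> chart_map \<Delta> \<sigma>) y = a' y / h' y" if "y \<in> W" for y
  proof -
    have y: "y \<in> affine_chart \<sigma>" "h (\<lambda>r. y (dual B r)) \<noteq> 0" using that h' by (auto simp: W_def)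
    then show ?thesis using ah(4)[OF y(2)] a' h' cm[of y] A
      by (auto simp: chart_preimage_def field_simps)
  qed
  show "\<exists>W' a b. open_chart \<sigma> W' \<and> x \<in> W' \<and> W' \<subseteq> chart_preimage \<Delta> \<sigma> V \<and>
      a \<in> coordinate_ring \<sigma> \<and> b \<in> coordinate_ring \<sigma> \<and>
      (\<forall>y\<in>W'. b y \<noteq> 0 \<and> (f \<circ> chart_map \<Delta> \<sigma>) y = a y / b y)"
  proof (rule exI[of _ W], rule exI[of _ a'], rule exI[of _ h'], intro conjI ballI subsetI)
  qed (simp_all add: oW xW yW a'(1) h'(1) del: o_apply)
qed

end

section \<open>Equivariant trivializations of line bundles\<close>

lemma regular_polyE:
  assumes "regular_poly J V f" "x \<in> V"
  obtains a h where "a \<in> polyfun J" "h \<in> polyfun J" "h x \<noteq> 0"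
    "\<And>y. h y \<noteq> 0 \<Longrightarrow> y \<in> V \<and> h y * f y = a y"
  using assms unfolding regular_poly_def by blast

text \<open>Near \<open>x\<close> the function is a quotient of polynomial functions in the
  coordinates \<open>J\<close>; hence a choice among representatives that agree on \<open>J\<close>
  does not affect its values.\<close>

lemma regular_poly_cong_point:
  assumes "regular_poly J V f" "x \<in> V" "\<And>j. j \<in> J \<Longrightarrow> x j = y j"
  shows "f x = f y"
proof -
  obtain a h where ah: "a \<in> polyfun J" "h \<in> polyfun J" "h x \<noteq> 0"
    "\<And>y. h y \<noteq> 0 \<Longrightarrow> y \<in> V \<and> h y * f y = a y"
    using regular_polyE[OF assms(1,2)] by blast
  have eq: "h x = h y" "a x = a y" using polyfun_cong[OF ah(2)] polyfun_cong[OF ah(1)] assms(3) by blast+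
  have "h y * f x = h y * f y" using ah(3) ah(4)[of x] ah(4)[of y] eq by simp
  then show ?thesis using ah(3) eq by simp
qed

lemma regular_poly_cong:
  assumes "regular_poly J V f" "\<And>x. x \<in> V \<Longrightarrow> f x = g x"
  shows "regular_poly J V g"
  unfolding regular_poly_def
proof
  fix x assume "x \<in> V"
  from regular_polyE[OF assms(1) this] obtain a h where ah: "a \<in> polyfun J" "h \<in> polyfun J" "h x \<noteq> 0"
    "\<And>y. h y \<noteq> 0 \<Longrightarrow> y \<in> V \<and> h y * f y = a y" by blast
  then have "y \<in> V \<and> h y * g y = a y" if "h y \<noteq> 0" for y using assms(2)[of y] ah(4)[OF that] by simp
  then show "\<exists>a\<in>polyfun J. \<exists>h\<in>polyfun J. h x \<noteq> 0 \<and> (\<forall>y. h y \<noteq> 0 \<longrightarrow> y \<in> V \<and> h y * g y = a y)"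
    using ah by blast
qed

lemma regular_poly_mult:
  assumes "regular_poly J V f" "regular_poly J V' g"
  shows "regular_poly J (V \<inter> V') (\<lambda>x. f x * g x)"
  unfolding regular_poly_def
proof
  fix x assume x: "x \<in> V \<inter> V'"
  obtain a h where ah: "a \<in> polyfun J" "h \<in> polyfun J" "h x \<noteq> 0"
    "\<And>y. h y \<noteq> 0 \<Longrightarrow> y \<in> V \<and> h y * f y = a y" using regular_polyE[OF assms(1) IntD1[OF x]] by blast
  obtain a' h' where ah': "a' \<in> polyfun J" "h' \<in> polyfun J" "h' x \<noteq> 0"
    "\<And>y. h' y \<noteq> 0 \<Longrightarrow> y \<in> V' \<and> h' y * g y = a' y" using regular_polyE[OF assms(2) IntD2[OF x]] by blast
  have "y \<in> V \<inter> V' \<and> (h * h') y * (f y * g y) = (a * a') y" if "(h * h') y \<noteq> 0" for y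
  proof -
    have "h y \<noteq> 0" "h' y \<noteq> 0" using that by auto
    then have "y \<in> V" "h y * f y = a y" "y \<in> V'" "h' y * g y = a' y" using ah(4) ah'(4) by blast+
    moreover have "(h * h') y * (f y * g y) = (h y * f y) * (h' y * g y)" by (simp add: mult_ac)
    ultimately show ?thesis by simp
  qed
  then show "\<exists>a\<in>polyfun J. \<exists>h\<in>polyfun J. h x \<noteq> 0 \<and>
      (\<forall>y. h y \<noteq> 0 \<longrightarrow> y \<in> V \<inter> V' \<and> h y * (f y * g y) = a y)"
    using ah ah' by (intro bexI[of _ "a * a'"] bexI[of _ "h * h'"]) (auto intro: polyfun_mult)
qed

lemma regular_poly_add:
  assumes "regular_poly J V f" "regular_poly J V g"
  shows "regular_poly J V (\<lambda>x. f x + g x)"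
  unfolding regular_poly_def
proof
  fix x assume x: "x \<in> V"
  obtain a h where ah: "a \<in> polyfun J" "h \<in> polyfun J" "h x \<noteq> 0"
    "\<And>y. h y \<noteq> 0 \<Longrightarrow> y \<in> V \<and> h y * f y = a y" using regular_polyE[OF assms(1) x] by blast
  obtain a' h' where ah': "a' \<in> polyfun J" "h' \<in> polyfun J" "h' x \<noteq> 0"
    "\<And>y. h' y \<noteq> 0 \<Longrightarrow> y \<in> V \<and> h' y * g y = a' y" using regular_polyE[OF assms(2) x] by blast
  have "y \<in> V \<and> (h * h') y * (f y + g y) = (a * h' + a' * h) y" if "(h * h') y \<noteq> 0" for y
  proof -
    have "h y \<noteq> 0" "h' y \<noteq> 0" using that by auto
    then have "y \<in> V" "h y * f y = a y" "h' y * g y = a' y" using ah(4) ah'(4) by blast+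
    moreover have "(h * h') y * (f y + g y) = h y * f y * h' y + h' y * g y * h y"
      by (simp add: algebra_simps)
    ultimately show ?thesis by simp
  qed
  then show "\<exists>a\<in>polyfun J. \<exists>h\<in>polyfun J. h x \<noteq> 0 \<and>
      (\<forall>y. h y \<noteq> 0 \<longrightarrow> y \<in> V \<and> h y * (f y + g y) = a y)"
    using ah ah' by (intro bexI[of _ "a * h' + a' * h"] bexI[of _ "h * h'"])
      (auto intro: polyfun_mult polyfun_add)
qed

lemma regular_poly_scale:
  assumes "regular_poly J V f" "g \<in> polyfun J"
  shows "regular_poly J V (\<lambda>x. g x * f x)"
proof -
  have "regular_poly J UNIV g" unfolding regular_poly_def
    using assms(2) polyfun_one[of J] by (intro ballI bexI[of _ g] bexI[of _ 1]) auto
  then show ?thesis using regular_poly_mult[OF _ assms(1), of UNIV g] by simp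
qed

lemma polyfun_tendsto:
  assumes "f \<in> polyfun J" "\<And>j. j \<in> J \<Longrightarrow> ((\<lambda>t. w t j) \<longlongrightarrow> v j) F"
  shows "((\<lambda>t. f (w t)) \<longlongrightarrow> f v) F"
  using assms
  by (induction rule: polyfun.induct) (auto intro: tendsto_add tendsto_mult)

text \<open>Zariski-regular functions are continuous for the classical topology, and a classical
  limit in \<open>V\<close> is approached through \<open>V\<close>; this is what extends torus
  identities to the boundary.\<close>

lemma regular_poly_tendsto:
  assumes "regular_poly J V f" "v \<in> V" "\<And>j. j \<in> J \<Longrightarrow> ((\<lambda>t. w t j) \<longlongrightarrow> v j) F"
  shows "((\<lambda>t. f (w t)) \<longlongrightarrow> f v) F" "\<forall>\<^sub>F t in F. w t \<in> V"
proof -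
  obtain a h where ah: "a \<in> polyfun J" "h \<in> polyfun J" "h v \<noteq> 0"
    "\<And>y. h y \<noteq> 0 \<Longrightarrow> y \<in> V \<and> h y * f y = a y"
    using regular_polyE[OF assms(1,2)] by blast
  have lim: "((\<lambda>t. h (w t)) \<longlongrightarrow> h v) F" "((\<lambda>t. a (w t)) \<longlongrightarrow> a v) F"
    using polyfun_tendsto ah assms(3) by blast+
  have ev: "\<forall>\<^sub>F t in F. h (w t) \<noteq> 0" using tendsto_imp_eventually_ne[OF lim(1) ah(3)] .
  then show "\<forall>\<^sub>F t in F. w t \<in> V" using ah(4) by (auto elim: eventually_mono)
  have "((\<lambda>t. a (w t) / h (w t)) \<longlongrightarrow> a v / h v) F" using lim ah(3) by (intro tendsto_divide)
  moreover have "a v / h v = f v" using ah(3) ah(4)[OF ah(3)] by (auto simp: field_simps)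
  moreover have "\<forall>\<^sub>F t in F. a (w t) / h (w t) = f (w t)"
    using ev by eventually_elim (use ah(4) in \<open>auto simp: field_simps\<close>)
  ultimately show "((\<lambda>t. f (w t)) \<longlongrightarrow> f v) F" using tendsto_cong by fastforce
qed

context smooth_fan
begin

text \<open>\<open>\<Phi> B\<close> is a nowhere vanishing section over the chart of
  \<open>B\<close>, written in the given trivializing cover. The last condition, cross-multiplied,
  says that \<open>\<Phi> B\<close> divided by the character \<open>\<mu> B\<close> is the same
  section over the torus for all \<open>B\<close>; the \<open>\<mu> B\<close> are the local
  characters of an invariant Cartier divisor.\<close>

definition trivialization ::
  "('l toric_point, 'i) cocycle \<Rightarrow> ((int ^ 'l) set \<Rightarrow> 'i \<Rightarrow> 'l toric_point \<Rightarrow> complex) \<Rightarrow>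
   ((int ^ 'l) set \<Rightarrow> int ^ 'l) \<Rightarrow> bool" where
  "trivialization L \<Phi> \<mu> \<longleftrightarrow>
     (\<Union>i\<in>index L. cover L i) = toric_variety \<Delta> \<and>
     (\<forall>B\<in>max_cones. \<forall>i\<in>index L.
        regular_poly B (chart_pt B -` cover L i) (\<Phi> B i \<circ> chart_pt B) \<and>
        (\<forall>z. chart_pt B z \<in> cover L i \<longrightarrow> \<Phi> B i (chart_pt B z) \<noteq> 0) \<and>
        (\<forall>j\<in>index L. \<forall>z. chart_pt B z \<in> cover L i \<inter> cover L j \<longrightarrow>
           \<Phi> B i (chart_pt B z) = transition L i j (chart_pt B z) * \<Phi> B j (chart_pt B z))) \<and>
     (\<forall>A\<in>max_cones. \<forall>B\<in>max_cones. \<forall>i\<in>index L. \<forall>w. zeros w = {} \<longrightarrow> cox_pt w \<in> cover L i \<longrightarrow>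
        char_val w (\<mu> B) * \<Phi> A i (cox_pt w) = char_val w (\<mu> A) * \<Phi> B i (cox_pt w))"

lemma trivializationD:
  assumes "trivialization L \<Phi> \<mu>"
  shows "(\<Union>i\<in>index L. cover L i) = toric_variety \<Delta>"
    and "B \<in> max_cones \<Longrightarrow> i \<in> index L \<Longrightarrow>
      regular_poly B (chart_pt B -` cover L i) (\<Phi> B i \<circ> chart_pt B)"
    and "B \<in> max_cones \<Longrightarrow> i \<in> index L \<Longrightarrow> chart_pt B z \<in> cover L i \<Longrightarrow> \<Phi> B i (chart_pt B z) \<noteq> 0"
    and "B \<in> max_cones \<Longrightarrow> i \<in> index L \<Longrightarrow> j \<in> index L \<Longrightarrow> chart_pt B z \<in> cover L i \<Longrightarrow>
      chart_pt B z \<in> cover L j \<Longrightarrow>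
      \<Phi> B i (chart_pt B z) = transition L i j (chart_pt B z) * \<Phi> B j (chart_pt B z)"
    and "A \<in> max_cones \<Longrightarrow> B \<in> max_cones \<Longrightarrow> i \<in> index L \<Longrightarrow> zeros w = {} \<Longrightarrow>
      cox_pt w \<in> cover L i \<Longrightarrow> char_val w (\<mu> B) * \<Phi> A i (cox_pt w) = char_val w (\<mu> A) * \<Phi> B i (cox_pt w)"
proof -
  note t = assms[unfolded trivialization_def]
  note 1 = conjunct1[OF t] and 2 = conjunct1[OF conjunct2[OF t]] and 3 = conjunct2[OF conjunct2[OF t]]
  show "(\<Union>i\<in>index L. cover L i) = toric_variety \<Delta>" by (rule 1)
  show "B \<in> max_cones \<Longrightarrow> i \<in> index L \<Longrightarrow>
      regular_poly B (chart_pt B -` cover L i) (\<Phi> B i \<circ> chart_pt B)"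
    by (rule conjunct1[OF 2[rule_format]])
  show "B \<in> max_cones \<Longrightarrow> i \<in> index L \<Longrightarrow> chart_pt B z \<in> cover L i \<Longrightarrow> \<Phi> B i (chart_pt B z) \<noteq> 0"
    by (rule conjunct1[OF conjunct2[OF 2[rule_format]], rule_format])
  show "B \<in> max_cones \<Longrightarrow> i \<in> index L \<Longrightarrow> j \<in> index L \<Longrightarrow> chart_pt B z \<in> cover L i \<Longrightarrow>
      chart_pt B z \<in> cover L j \<Longrightarrow>
      \<Phi> B i (chart_pt B z) = transition L i j (chart_pt B z) * \<Phi> B j (chart_pt B z)"
    by (rule conjunct2[OF conjunct2[OF 2[rule_format]], rule_format]) simp_all
  show "A \<in> max_cones \<Longrightarrow> B \<in> max_cones \<Longrightarrow> i \<in> index L \<Longrightarrow> zeros w = {} \<Longrightarrow>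
      cox_pt w \<in> cover L i \<Longrightarrow> char_val w (\<mu> B) * \<Phi> A i (cox_pt w) = char_val w (\<mu> A) * \<Phi> B i (cox_pt w)"
    by (rule 3[rule_format])
qed

lemma trivializationI:
  assumes "(\<Union>i\<in>index L. cover L i) = toric_variety \<Delta>"
    and "\<And>B i. B \<in> max_cones \<Longrightarrow> i \<in> index L \<Longrightarrow>
      regular_poly B (chart_pt B -` cover L i) (\<Phi> B i \<circ> chart_pt B)"
    and "\<And>B i z. B \<in> max_cones \<Longrightarrow> i \<in> index L \<Longrightarrow> chart_pt B z \<in> cover L i \<Longrightarrow> \<Phi> B i (chart_pt B z) \<noteq> 0"
    and "\<And>B i j z. B \<in> max_cones \<Longrightarrow> i \<in> index L \<Longrightarrow> j \<in> index L \<Longrightarrow>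
      chart_pt B z \<in> cover L i \<inter> cover L j \<Longrightarrow>
      \<Phi> B i (chart_pt B z) = transition L i j (chart_pt B z) * \<Phi> B j (chart_pt B z)"
    and "\<And>A B i w. A \<in> max_cones \<Longrightarrow> B \<in> max_cones \<Longrightarrow> i \<in> index L \<Longrightarrow> zeros w = {} \<Longrightarrow>
      cox_pt w \<in> cover L i \<Longrightarrow> char_val w (\<mu> B) * \<Phi> A i (cox_pt w) = char_val w (\<mu> A) * \<Phi> B i (cox_pt w)"
  shows "trivialization L \<Phi> \<mu>"
  unfolding trivialization_def by (intro conjI ballI allI impI assms)

lemma chart_trivialization:
  assumes L: "line_bundle \<Delta> L" and B: "B \<in> max_cones"
  shows "\<exists>\<Phi>. \<forall>i\<in>index L. regular_poly B (chart_pt B -` cover L i) (\<Phi> i \<circ> chart_pt B) \<and>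
        (\<forall>z. chart_pt B z \<in> cover L i \<longrightarrow> \<Phi> i (chart_pt B z) \<noteq> 0) \<and>
        (\<forall>j\<in>index L. \<forall>z. chart_pt B z \<in> cover L i \<inter> cover L j \<longrightarrow>
           \<Phi> i (chart_pt B z) = transition L i j (chart_pt B z) * \<Phi> j (chart_pt B z))"
proof -
  interpret polynomial_functions B using max_conesD[OF B] by unfold_locales simp
  let ?V = "\<lambda>i. chart_pt B -` cover L i"
  have cov: "(\<Union>i\<in>index L. cover L i) = toric_variety \<Delta>"
    and reg: "\<And>i j. i \<in> index L \<Longrightarrow> j \<in> index L \<Longrightarrow> regular_on \<Delta> (cover L i \<inter> cover L j) (transition L i j)"
    and nz: "\<And>i j x. i \<in> index L \<Longrightarrow> j \<in> index L \<Longrightarrow> x \<in> cover L i \<inter> cover L j \<Longrightarrow> transition L i j x \<noteq> 0"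
    and coc: "\<And>i j k x. i \<in> index L \<Longrightarrow> j \<in> index L \<Longrightarrow> k \<in> index L \<Longrightarrow>
      x \<in> cover L i \<inter> cover L j \<inter> cover L k \<Longrightarrow> transition L i j x * transition L j k x = transition L i k x"
    using L unfolding line_bundle_def by (simp, simp, blast, blast)
  have "\<exists>\<phi>. \<forall>i\<in>index L. regular_poly B (?V i) (\<phi> i) \<and> (\<forall>x\<in>?V i. \<phi> i x \<noteq> 0) \<and>
    (\<forall>j\<in>index L. \<forall>x\<in>?V i \<inter> ?V j. \<phi> i x = (transition L i j \<circ> chart_pt B) x * \<phi> j x)"
  proof (rule affine_space_picard_trivial)
    have "chart_pt B z \<in> toric_variety \<Delta>" for z unfolding toric_variety_eq using B by blast
    then show "(\<Union>i\<in>index L. ?V i) = UNIV" using cov by blast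
    show "regular_poly B (?V i \<inter> ?V j) (transition L i j \<circ> chart_pt B)"
      if "i \<in> index L" "j \<in> index L" for i j
      using regular_on_chart[OF reg[OF that] B] by simp
    show "(transition L i j \<circ> chart_pt B) x \<noteq> 0" if "i \<in> index L" "j \<in> index L" "x \<in> ?V i \<inter> ?V j" for i j x
      using nz that by simp
    show "(transition L i j \<circ> chart_pt B) x * (transition L j k \<circ> chart_pt B) x = (transition L i k \<circ> chart_pt B) x"
      if "i \<in> index L" "j \<in> index L" "k \<in> index L" "x \<in> ?V i \<inter> ?V j \<inter> ?V k" for i j k x
      using coc that by simp
  qed
  then obtain \<phi> where \<phi>: "\<forall>i\<in>index L. regular_poly B (?V i) (\<phi> i) \<and> (\<forall>x\<in>?V i. \<phi> i x \<noteq> 0) \<and>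
    (\<forall>j\<in>index L. \<forall>x\<in>?V i \<inter> ?V j. \<phi> i x = (transition L i j \<circ> chart_pt B) x * \<phi> j x)" ..
  have reg': "\<And>i. i \<in> index L \<Longrightarrow> regular_poly B (?V i) (\<phi> i)"
    and nz': "\<And>i x. i \<in> index L \<Longrightarrow> x \<in> ?V i \<Longrightarrow> \<phi> i x \<noteq> 0"
    and tr: "\<And>i j x. i \<in> index L \<Longrightarrow> j \<in> index L \<Longrightarrow> x \<in> ?V i \<inter> ?V j \<Longrightarrow>
      \<phi> i x = transition L i j (chart_pt B x) * \<phi> j x"
    using \<phi> unfolding comp_apply by (blast, blast, blast)
  \<comment> \<open>Functions of chart coordinates become functions of points by choosing
    coordinates; the choice is harmless, since a point determines its coordinates on
    \<open>B\<close> and \<open>\<phi>\<close> depends on nothing else.\<close>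
  define \<Phi> where "\<Phi> = (\<lambda>i p. \<phi> i (SOME z. chart_pt B z = p))"
  have \<Phi>: "\<Phi> i (chart_pt B z) = \<phi> i z" if i: "i \<in> index L" and z: "z \<in> ?V i" for i z
  proof -
    define z' where "z' = (SOME y. chart_pt B y = chart_pt B z)"
    have "chart_pt B z' = chart_pt B z" unfolding z'_def by (rule someI[of _ z]) simp
    then have "z r = z' r" if "r \<in> B" for r using chart_pt_inj[OF B _ that] by metis
    then have "\<phi> i z = \<phi> i z'" using regular_poly_cong_point[OF reg'[OF i] z] by blast
    then show ?thesis by (simp add: \<Phi>_def z'_def)
  qed
  have "regular_poly B (?V i) (\<Phi> i \<circ> chart_pt B)" if "i \<in> index L" for i
    using regular_poly_cong[OF reg'[OF that]] \<Phi>[OF that] by simp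
  moreover have "\<Phi> i (chart_pt B z) \<noteq> 0" if "i \<in> index L" "chart_pt B z \<in> cover L i" for i z
    using nz' \<Phi> that by simp
  moreover have "\<Phi> i (chart_pt B z) = transition L i j (chart_pt B z) * \<Phi> j (chart_pt B z)"
    if "i \<in> index L" "j \<in> index L" "chart_pt B z \<in> cover L i \<inter> cover L j" for i j z
    using tr[OF that(1,2), of z] \<Phi>[OF that(1), of z] \<Phi>[OF that(2), of z] that(3) by simp
  ultimately show ?thesis by (intro exI[of _ \<Phi>]) blast
qed

text \<open>Passing to the slice of the chart \<open>B\<close> changes the Cox coordinates of a
  point, not the values of characters that are regular there.\<close>

lemma char_val_coords:
  assumes "B \<in> max_cones" "C \<subseteq> B" "zeros w \<subseteq> C" "m \<in> dm C"
  shows "char_val (extend1 B (coords B w)) m = char_val w m"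
proof -
  have C: "C \<in> K" using K_subset max_conesD assms by blast
  let ?x = "restrict (char_val w) (dm C)"
  have "extend1 B (\<lambda>r. ?x (dual B r)) = extend1 B (coords B w)"
    using dual_in_dm[OF assms(1,2)] by (auto simp: extend1_def coords_def fun_eq_iff)
  then have "?x = restrict (char_val (extend1 B (coords B w))) (dm C)"
    using affine_chart_eq_mono(2)[OF C assms(1,2) char_val_in_chart[OF C assms(3)]] by simp
  from fun_cong[OF this, of m] show ?thesis using assms(4) by simp
qed

lemma char_val_uminus: "zeros w = {} \<Longrightarrow> char_val w (- m) = inverse (char_val w m)"
  using char_val_add[of w m "- m"] by (simp add: inverse_unique)

lemma char_val_diff: "zeros w = {} \<Longrightarrow> char_val w (m - m') = char_val w m / char_val w m'"
  using char_val_add[of w m "- m'"] char_val_uminus[of w m'] by (simp add: divide_inverse)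

lemma char_val_torus_nonzero: "zeros w = {} \<Longrightarrow> char_val w m \<noteq> 0"
  by (simp add: char_val_nonzero_iff)

text \<open>Between two charts the coordinates change by Laurent monomials; a power of the product
  of all coordinates clears their negative exponents.\<close>

lemma polyfun_coords_laurent:
  assumes A: "A \<in> max_cones" and f: "f \<in> polyfun B"
  shows "\<exists>N. \<exists>g\<in>polyfun A. \<forall>z. (\<forall>s\<in>A. z s \<noteq> 0) \<longrightarrow>
    f (coords B (extend1 A z)) * (\<Prod>s\<in>A. z s) ^ N = g z"
  using f
proof (induction rule: polyfun.induct)
  case (polyfun_const c)
  show ?case by (intro exI[of _ 0] bexI[of _ "\<lambda>_. c"]) (auto intro: polyfun.polyfun_const)
next
  case (polyfun_var r)
  have A': "A \<subseteq> R" "finite A" using max_conesD A by blast+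
  interpret polynomial_functions A using A' by unfold_locales
  define N where "N = (\<Sum>s\<in>A. nat \<bar>pairing (dual B r) s\<bar>)"
  have N: "0 \<le> pairing (dual B r) s + int N" if "s \<in> A" for s
  proof -
    have "nat \<bar>pairing (dual B r) s\<bar> \<le> N" unfolding N_def
      by (rule member_le_sum) (use A' that in auto)
    then show ?thesis by linarith
  qed
  let ?g = "\<Prod>s\<in>A. coord s ^ nat (pairing (dual B r) s + int N)"
  have prod_apply: "?g z = (\<Prod>s\<in>A. z s ^ nat (pairing (dual B r) s + int N))" for z
    using A'(2) by (induction A rule: finite_induct) (auto simp: power_fun_apply)
  have "coords B (extend1 A z) r * (\<Prod>s\<in>A. z s) ^ N = ?g z" if z: "\<forall>s\<in>A. z s \<noteq> 0" for z
  proof -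
    have "coords B (extend1 A z) r * (\<Prod>s\<in>A. z s) ^ N =
        (\<Prod>s\<in>A. z s powi pairing (dual B r) s * z s powi int N)"
      by (simp add: coords_def char_val_extend1[OF A'(1)] prod_power_distrib prod.distrib)
    also have "\<dots> = (\<Prod>s\<in>A. z s ^ nat (pairing (dual B r) s + int N))"
    proof (rule prod.cong)
      fix s assume s: "s \<in> A"
      then have "z s powi pairing (dual B r) s * z s powi int N = z s powi (pairing (dual B r) s + int N)"
        using z power_int_add[of "z s"] by metis
      then show "z s powi pairing (dual B r) s * z s powi int N = z s ^ nat (pairing (dual B r) s + int N)"
        using N[OF s] by (simp add: power_int_def)
    qed simp
    finally show ?thesis by (simp add: prod_apply)
  qed
  moreover have "?g \<in> polyfun A" by (intro prod_mem power_mem polyfun.polyfun_var)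
  ultimately show ?case by blast
next
  case (polyfun_add f1 f2)
  interpret polynomial_functions A using max_conesD A by unfold_locales blast
  let ?\<pi> = "\<Prod>s\<in>A. coord s"
  obtain N1 g1 N2 g2 where g: "g1 \<in> polyfun A" "g2 \<in> polyfun A"
    "\<And>z. (\<forall>s\<in>A. z s \<noteq> 0) \<Longrightarrow> f1 (coords B (extend1 A z)) * (\<Prod>s\<in>A. z s) ^ N1 = g1 z"
    "\<And>z. (\<forall>s\<in>A. z s \<noteq> 0) \<Longrightarrow> f2 (coords B (extend1 A z)) * (\<Prod>s\<in>A. z s) ^ N2 = g2 z"
    using polyfun_add.IH by blast
  have \<pi>: "?\<pi> z = (\<Prod>s\<in>A. z s)" for z
    using finite_J by (induction A rule: finite_induct) auto
  have "(f1 + f2) (coords B (extend1 A z)) * (\<Prod>s\<in>A. z s) ^ (N1 + N2) = (g1 * ?\<pi> ^ N2 + g2 * ?\<pi> ^ N1) z"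
    if "\<forall>s\<in>A. z s \<noteq> 0" for z
    using g(3,4)[OF that, symmetric] by (simp add: power_fun_apply \<pi> algebra_simps power_add)
  moreover have "g1 * ?\<pi> ^ N2 + g2 * ?\<pi> ^ N1 \<in> polyfun A"
    using g by (intro add_mem mult_mem power_mem prod_mem polyfun_var)
  ultimately show ?case by blast
next
  case (polyfun_mult f1 f2)
  interpret polynomial_functions A using max_conesD A by unfold_locales blast
  obtain N1 g1 N2 g2 where g: "g1 \<in> polyfun A" "g2 \<in> polyfun A"
    "\<And>z. (\<forall>s\<in>A. z s \<noteq> 0) \<Longrightarrow> f1 (coords B (extend1 A z)) * (\<Prod>s\<in>A. z s) ^ N1 = g1 z"
    "\<And>z. (\<forall>s\<in>A. z s \<noteq> 0) \<Longrightarrow> f2 (coords B (extend1 A z)) * (\<Prod>s\<in>A. z s) ^ N2 = g2 z"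
    using polyfun_mult.IH by blast
  have "(f1 * f2) (coords B (extend1 A z)) * (\<Prod>s\<in>A. z s) ^ (N1 + N2) = (g1 * g2) z"
    if "\<forall>s\<in>A. z s \<noteq> 0" for z
    using g(3,4)[OF that, symmetric] by (simp add: algebra_simps power_add)
  then show ?case using mult_mem[OF g(1,2)] by blast
qed

lemma torus_cox_pt:
  assumes "zeros w = {}" "B \<in> max_cones"
  shows "cox_pt w = chart_pt B (coords B w)"
  using cox_pt_coords assms by simp

text \<open>The ratio \<open>H\<close> of the two frames does not depend on the member of the cover
  in which it is formed, so it is a regular function without zeros on the torus. Numerator and
  denominator of its fraction are nonzero there, hence monomials up to a scalar.\<close>

lemma transition_monomial:
  assumes cov: "(\<Union>i\<in>index L. cover L i) = toric_variety \<Delta>"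
    and AB: "A \<in> max_cones" "B \<in> max_cones"
    and reg: "\<And>C i. C \<in> {A, B} \<Longrightarrow> i \<in> index L \<Longrightarrow>
       regular_poly C (chart_pt C -` cover L i) (\<Phi> C i \<circ> chart_pt C)"
    and nz: "\<And>C i z. C \<in> {A, B} \<Longrightarrow> i \<in> index L \<Longrightarrow> chart_pt C z \<in> cover L i \<Longrightarrow> \<Phi> C i (chart_pt C z) \<noteq> 0"
    and tr: "\<And>C i j z. C \<in> {A, B} \<Longrightarrow> i \<in> index L \<Longrightarrow> j \<in> index L \<Longrightarrow>
       chart_pt C z \<in> cover L i \<inter> cover L j \<Longrightarrow>
       \<Phi> C i (chart_pt C z) = transition L i j (chart_pt C z) * \<Phi> C j (chart_pt C z)"
  shows "\<exists>c m. c \<noteq> 0 \<and> (\<forall>i\<in>index L. \<forall>w. zeros w = {} \<longrightarrow> cox_pt w \<in> cover L i \<longrightarrow>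
    \<Phi> A i (cox_pt w) = c * char_val w m * \<Phi> B i (cox_pt w))"
proof -
  have A': "A \<subseteq> R" "finite A" using max_conesD AB by blast+
  interpret polynomial_functions A using A' by unfold_locales
  define T where "T = {z :: int ^ 'l \<Rightarrow> complex. \<forall>s\<in>A. z s \<noteq> 0}"
  let ?y = "\<lambda>z. coords B (extend1 A z)"
  have zT: "zeros (extend1 A z) = {}" if "z \<in> T" for z using that by (auto simp: T_def zeros_extend1)
  have yB: "chart_pt A z = chart_pt B (?y z)" if "z \<in> T" for z
    using torus_cox_pt[OF zT[OF that] AB(2)] by (simp add: chart_pt_def)
  have ex_i: "\<exists>i. i \<in> index L \<and> chart_pt A z \<in> cover L i" for z
    using cov AB(1) unfolding toric_variety_eq by blast
  define I where "I = (\<lambda>z. SOME i. i \<in> index L \<and> chart_pt A z \<in> cover L i)"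
  have I: "I z \<in> index L" "chart_pt A z \<in> cover L (I z)" for z
    using someI_ex[OF ex_i[of z]] by (auto simp: I_def)
  define H where "H = (\<lambda>z. \<Phi> A (I z) (chart_pt A z) / \<Phi> B (I z) (chart_pt A z))"
  have H: "\<Phi> A i (chart_pt A z) = H z * \<Phi> B i (chart_pt A z)" "\<Phi> B i (chart_pt A z) \<noteq> 0"
    if z: "z \<in> T" and i: "i \<in> index L" "chart_pt A z \<in> cover L i" for z i
  proof -
    have 1: "\<Phi> A i (chart_pt A z) = transition L i (I z) (chart_pt A z) * \<Phi> A (I z) (chart_pt A z)"
      using tr[of A i "I z" z] i I by simp
    have 2: "\<Phi> B i (chart_pt A z) = transition L i (I z) (chart_pt A z) * \<Phi> B (I z) (chart_pt A z)"
      using tr[of B i "I z" "?y z"] i I[of z] unfolding yB[OF z, symmetric] by simp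
    have 3: "\<Phi> B (I z) (chart_pt A z) \<noteq> 0"
      using nz[of B "I z" "?y z"] I[of z] unfolding yB[OF z, symmetric] by simp
    show "\<Phi> A i (chart_pt A z) = H z * \<Phi> B i (chart_pt A z)"
      unfolding 1 2 H_def using 3 by simp
    show "\<Phi> B i (chart_pt A z) \<noteq> 0"
      using nz[of B i "?y z"] i unfolding yB[OF z, symmetric] by simp
  qed
  have "regular_poly A T H" unfolding regular_poly_def
  proof
    fix z0 assume z0: "z0 \<in> T"
    let ?i = "I z0" and ?\<pi> = "\<Prod>s\<in>A. coord s"
    have \<pi>: "?\<pi> z = (\<Prod>s\<in>A. z s)" for z using A'(2) by (induction A rule: finite_induct) auto
    obtain a1 h1 where 1: "a1 \<in> polyfun A" "h1 \<in> polyfun A" "h1 z0 \<noteq> 0"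
      "\<And>z. h1 z \<noteq> 0 \<Longrightarrow> chart_pt A z \<in> cover L ?i \<and> h1 z * \<Phi> A ?i (chart_pt A z) = a1 z"
      using regular_polyE[OF reg[of A ?i], of z0] I by auto
    have "?y z0 \<in> chart_pt B -` cover L ?i" using I yB[OF z0] by (metis vimageI2)
    then obtain a2 h2 where 2: "a2 \<in> polyfun B" "h2 \<in> polyfun B" "h2 (?y z0) \<noteq> 0"
      "\<And>z. h2 z \<noteq> 0 \<Longrightarrow> chart_pt B z \<in> cover L ?i \<and> h2 z * \<Phi> B ?i (chart_pt B z) = a2 z"
      using regular_polyE[OF reg[of B ?i], of "?y z0"] I by auto
    obtain N1 g1 where g1: "g1 \<in> polyfun A" "\<And>z. z \<in> T \<Longrightarrow> a2 (?y z) * (\<Prod>s\<in>A. z s) ^ N1 = g1 z"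
      using polyfun_coords_laurent[OF AB(1) 2(1)] unfolding T_def by blast
    obtain N2 g2 where g2: "g2 \<in> polyfun A" "\<And>z. z \<in> T \<Longrightarrow> h2 (?y z) * (\<Prod>s\<in>A. z s) ^ N2 = g2 z"
      using polyfun_coords_laurent[OF AB(1) 2(2)] unfolding T_def by blast
    \<comment> \<open>\<open>H\<close> is \<open>a1 * h2 / (h1 * a2)\<close> with \<open>a2\<close>
      and \<open>h2\<close> taken at the coordinates of \<open>B\<close>; \<open>g1\<close> and
      \<open>g2\<close> are these two with denominators cleared. The extra factor
      \<open>?\<pi>\<close> makes \<open>d\<close> vanish off the torus, as the domain
      \<open>T\<close> requires.\<close>
    define h where "h = h1 * (g1 * g2 * ?\<pi>)"
    define a where "a = a1 * (g2 * g2 * ?\<pi> * ?\<pi> ^ N1)"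
    define d where "d = h * ?\<pi> ^ N2"
    have \<pi>S: "?\<pi> \<in> polyfun A" by (intro prod_mem polyfun_var)
    have S: "a \<in> polyfun A" "d \<in> polyfun A"
      unfolding a_def d_def h_def by (intro mult_mem power_mem 1(1,2) g1(1) g2(1) \<pi>S)+
    have \<pi>z: "?\<pi> z \<noteq> 0 \<longleftrightarrow> z \<in> T" for z unfolding \<pi> T_def using A'(2) by simp
    have g1nz: "g1 z0 \<noteq> 0"
    proof -
      have "\<Phi> B ?i (chart_pt B (?y z0)) \<noteq> 0" using nz[of B ?i "?y z0"] 2(3,4) I by blast
      then have "a2 (?y z0) \<noteq> 0" using 2(3) 2(4)[OF 2(3)] by auto
      then show ?thesis using g1(2)[OF z0] \<pi>z[of z0] z0 \<pi> by auto
    qed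
    have g2nz: "g2 z0 \<noteq> 0" using g2(2)[OF z0] 2(3) \<pi>z[of z0] z0 \<pi> by auto
    have "d z0 \<noteq> 0" unfolding d_def h_def using 1(3) g1nz g2nz \<pi>z z0 by (simp add: power_fun_apply)
    moreover have "z \<in> T \<and> d z * H z = a z" if dz: "d z \<noteq> 0" for z
    proof -
      have zT: "z \<in> T" using dz \<pi>z[of z] by (auto simp: d_def h_def)
      let ?P = "\<Prod>s\<in>A. z s"
      have P0: "?P \<noteq> 0" using zT \<pi>z[of z] \<pi> by simp
      have h1z: "h1 z \<noteq> 0" and g2z: "g2 z \<noteq> 0" using dz by (auto simp: d_def h_def)
      have h2z: "h2 (?y z) \<noteq> 0" using g2(2)[OF zT] g2z by auto
      have e1: "chart_pt A z \<in> cover L ?i" "h1 z * \<Phi> A ?i (chart_pt A z) = a1 z" using 1(4)[OF h1z] by auto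
      have e2: "h2 (?y z) * \<Phi> B ?i (chart_pt A z) = a2 (?y z)" using 2(4)[OF h2z] yB[OF zT] by simp
      note HH = H[OF zT I(1) e1(1)]
      define b where "b = \<Phi> B ?i (chart_pt A z)"
      have "a1 z = h1 z * (H z * b)" using e1(2) HH(1) b_def by simp
      moreover have "g1 z = h2 (?y z) * b * ?P ^ N1" using g1(2)[OF zT] e2 b_def by simp
      moreover have "g2 z = h2 (?y z) * ?P ^ N2" using g2(2)[OF zT] by simp
      ultimately have "d z * H z = a z"
        unfolding d_def h_def a_def times_fun_apply power_fun_apply \<pi>
        by (simp add: mult_ac)
      then show ?thesis using zT by blast
    qed
    ultimately show "\<exists>a\<in>polyfun A. \<exists>h\<in>polyfun A. h z0 \<noteq> 0 \<and>
        (\<forall>y. h y \<noteq> 0 \<longrightarrow> y \<in> T \<and> h y * H y = a y)" using S by blast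
  qed
  moreover have T1: "(\<lambda>_. 1) \<in> T" by (simp add: T_def)
  ultimately obtain a b where ab: "a \<in> polyfun A" "b \<in> polyfun A"
    "\<And>z. z \<in> T \<Longrightarrow> b z \<noteq> 0 \<and> b z * H z = a z" using regular_fraction by metis
  have H0: "H z \<noteq> 0" if "z \<in> T" for z
    using H(1)[OF that I] nz[of A "I z" z] I by auto
  have "a z \<noteq> 0" "b z \<noteq> 0" if "\<And>s. s \<in> A \<Longrightarrow> z s \<noteq> 0" for z
  proof -
    have "z \<in> T" using that by (simp add: T_def)
    then have "b z \<noteq> 0" "b z * H z = a z" "H z \<noteq> 0" using ab(3) H0 by blast+
    then show "a z \<noteq> 0" "b z \<noteq> 0" by auto
  qed
  note nz_ab = this
  obtain c k where ck: "c \<noteq> 0" "a = (\<lambda>w. c * (\<Prod>j\<in>A. w j ^ k j))"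
    using torus_unit_monomial[OF ab(1) nz_ab(1)] by blast
  obtain c' k' where ck': "c' \<noteq> 0" "b = (\<lambda>w. c' * (\<Prod>j\<in>A. w j ^ k' j))"
    using torus_unit_monomial[OF ab(2) nz_ab(2)] by blast
  \<comment> \<open>The dual basis turns the exponents of the Laurent monomial \<open>a / b\<close>
    into a lattice vector with exactly these pairings.\<close>
  define m where "m = (\<Sum>s\<in>A. (int (k s) - int (k' s)) *s dual A s)"
  have pm: "pairing m s = int (k s) - int (k' s)" if s: "s \<in> A" for s
  proof -
    have "pairing m s = (\<Sum>r\<in>A. if r = s then int (k s) - int (k' s) else 0)"
      unfolding m_def pairing_sum pairing_smult using pairing_dual[OF AB(1)] s
      by (intro sum.cong) auto
    then show ?thesis using A'(2) s by simp
  qed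
  have Hm: "H z = (c / c') * char_val (extend1 A z) m" if z: "z \<in> T" for z
  proof -
    have zs: "z s \<noteq> 0" if "s \<in> A" for s using z that by (simp add: T_def)
    have "char_val (extend1 A z) m = (\<Prod>s\<in>A. z s ^ k s / z s ^ k' s)"
      unfolding char_val_extend1[OF A'(1)] using zs by (intro prod.cong) (auto simp: pm power_int_diff)
    then have "char_val (extend1 A z) m = (\<Prod>s\<in>A. z s ^ k s) / (\<Prod>s\<in>A. z s ^ k' s)"
      by (simp add: prod_dividef)
    moreover have "H z = a z / b z" using ab(3)[OF z] by (auto simp: field_simps)
    ultimately show ?thesis by (simp add: ck ck')
  qed
  have "\<Phi> A i (cox_pt w) = (c / c') * char_val w m * \<Phi> B i (cox_pt w)"
    if i: "i \<in> index L" and w: "zeros w = {}" "cox_pt w \<in> cover L i" for i w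
  proof -
    have p: "cox_pt w = chart_pt A (coords A w)" using torus_cox_pt[OF w(1) AB(1)] .
    have "coords A w \<in> T" unfolding T_def coords_def using char_val_torus_nonzero[OF w(1)] by simp
    moreover have "char_val (extend1 A (coords A w)) m = char_val w m"
      using char_val_coords[OF AB(1), of "{}" w m] w by simp
    ultimately show ?thesis using H(1)[of "coords A w" i] Hm[of "coords A w"] i w p by simp
  qed
  then show ?thesis using ck ck' by (intro exI[of _ "c / c'"] exI[of _ m]) auto
qed

text \<open>All frames are compared with the frame of one fixed cone \<open>A0\<close>, so their
  characters fit together without a further choice.\<close>

theorem trivialization_exists:
  fixes L :: "('l toric_point, 'i) cocycle"
  assumes L: "line_bundle \<Delta> L"
  shows "\<exists>\<Phi> \<mu>. trivialization L \<Phi> \<mu>"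
proof -
  have cov: "(\<Union>i\<in>index L. cover L i) = toric_variety \<Delta>" using L unfolding line_bundle_def by blast
  from bchoice[OF ballI[OF chart_trivialization[OF L]]]
  obtain \<Phi> where \<Phi>: "\<forall>B\<in>max_cones. \<forall>i\<in>index L. regular_poly B (chart_pt B -` cover L i) (\<Phi> B i \<circ> chart_pt B) \<and>
        (\<forall>z. chart_pt B z \<in> cover L i \<longrightarrow> \<Phi> B i (chart_pt B z) \<noteq> 0) \<and>
        (\<forall>j\<in>index L. \<forall>z. chart_pt B z \<in> cover L i \<inter> cover L j \<longrightarrow>
           \<Phi> B i (chart_pt B z) = transition L i j (chart_pt B z) * \<Phi> B j (chart_pt B z))" ..
  obtain A0 where A0: "A0 \<in> max_cones" using K_nonempty max_above by blast
  have "\<exists>c m. c \<noteq> 0 \<and> (\<forall>i\<in>index L. \<forall>w. zeros w = {} \<longrightarrow> cox_pt w \<in> cover L i \<longrightarrow>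
    \<Phi> B i (cox_pt w) = c * char_val w m * \<Phi> A0 i (cox_pt w))" if B: "B \<in> max_cones" for B
  proof (rule transition_monomial[OF cov B A0])
    fix C i assume C: "C \<in> {B, A0}" and i: "i \<in> index L"
    then have C': "C \<in> max_cones" using B A0 by blast
    note * = \<Phi>[rule_format, OF C' i]
    show "regular_poly C (chart_pt C -` cover L i) (\<Phi> C i \<circ> chart_pt C)" using * by blast
    show "\<Phi> C i (chart_pt C z) \<noteq> 0" if "chart_pt C z \<in> cover L i" for z using * that by blast
    show "\<Phi> C i (chart_pt C z) = transition L i j (chart_pt C z) * \<Phi> C j (chart_pt C z)"
      if "j \<in> index L" "chart_pt C z \<in> cover L i \<inter> cover L j" for j z using * that by blast
  qed
  then obtain c \<mu> where c: "\<And>B. B \<in> max_cones \<Longrightarrow> c B \<noteq> 0"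
    and \<mu>: "\<And>B i w. B \<in> max_cones \<Longrightarrow> i \<in> index L \<Longrightarrow> zeros w = {} \<Longrightarrow> cox_pt w \<in> cover L i \<Longrightarrow>
      \<Phi> B i (cox_pt w) = c B * char_val w (\<mu> B) * \<Phi> A0 i (cox_pt w)" by metis
  \<comment> \<open>Rescaling by a nonzero constant leaves a frame a frame and removes the scalar
    from the comparison.\<close>
  define \<Psi> where "\<Psi> = (\<lambda>B i p. inverse (c B) * \<Phi> B i p)"
  have P1: "regular_poly B (chart_pt B -` cover L i) (\<Psi> B i \<circ> chart_pt B)" if "B \<in> max_cones" "i \<in> index L" for B i
  proof -
    have "regular_poly B (chart_pt B -` cover L i) (\<Phi> B i \<circ> chart_pt B)"
      using \<Phi>[rule_format, OF that] by blast
    from regular_poly_scale[OF this polyfun_const[of "inverse (c B)"]] show ?thesis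
      by (simp add: \<Psi>_def comp_def)
  qed
  have P2: "\<Psi> B i (chart_pt B z) \<noteq> 0" if "B \<in> max_cones" "i \<in> index L" "chart_pt B z \<in> cover L i" for B i z
    using \<Phi>[rule_format, OF that(1,2)] c[OF that(1)] that(3) by (simp add: \<Psi>_def)
  have P3: "\<Psi> B i (chart_pt B z) = transition L i j (chart_pt B z) * \<Psi> B j (chart_pt B z)"
    if that: "B \<in> max_cones" "i \<in> index L" "j \<in> index L" "chart_pt B z \<in> cover L i \<inter> cover L j" for B i j z
  proof -
    have "\<Phi> B i (chart_pt B z) = transition L i j (chart_pt B z) * \<Phi> B j (chart_pt B z)"
      by (rule conjunct2[OF conjunct2[OF \<Phi>[rule_format, OF that(1,2)]], rule_format, OF that(3,4)])
    then show ?thesis unfolding \<Psi>_def by simp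
  qed
  have P4: "char_val w (\<mu> B) * \<Psi> A i (cox_pt w) = char_val w (\<mu> A) * \<Psi> B i (cox_pt w)"
    if "A \<in> max_cones" "B \<in> max_cones" "i \<in> index L" "zeros w = {}" "cox_pt w \<in> cover L i" for A B i w
    using \<mu>[OF that(1,3-5)] \<mu>[OF that(2-5)] c[OF that(1)] c[OF that(2)] unfolding \<Psi>_def by simp
  have "trivialization L \<Psi> \<mu>"
    by (rule trivializationI[OF cov]) (rule P1 P2 P3 P4; assumption)+
  then show ?thesis by blast
qed

lemma trivialization_tensor:
  assumes "trivialization L \<Phi> \<mu>" "trivialization L' \<Psi> \<nu>"
  shows "trivialization (bundle_tensor L L') (\<lambda>B (i, j) p. \<Phi> B i p * \<Psi> B j p) (\<lambda>B. \<mu> B + \<nu> B)"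
proof (rule trivializationI)
  note l = trivializationD[OF assms(1)] and k = trivializationD[OF assms(2)]
  have "(\<Union>ij\<in>index (bundle_tensor L L'). cover (bundle_tensor L L') ij) =
      (\<Union>i\<in>index L. cover L i) \<inter> (\<Union>j\<in>index L'. cover L' j)"
    unfolding bundle_tensor_def by auto
  then show "(\<Union>ij\<in>index (bundle_tensor L L'). cover (bundle_tensor L L') ij) = toric_variety \<Delta>"
    by (simp only: l(1) k(1) Int_absorb)
  fix B and ij :: "'a \<times> 'b" assume B: "B \<in> max_cones" and "ij \<in> index (bundle_tensor L L')"
  then obtain i j where ij: "ij = (i, j)" "i \<in> index L" "j \<in> index L'" by (auto simp: bundle_tensor_def)
  have cov: "cover (bundle_tensor L L') ij = cover L i \<inter> cover L' j" by (simp add: bundle_tensor_def ij)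
  show "regular_poly B (chart_pt B -` cover (bundle_tensor L L') ij)
      ((case ij of (i, j) \<Rightarrow> \<lambda>p. \<Phi> B i p * \<Psi> B j p) \<circ> chart_pt B)"
    using regular_poly_mult[OF l(2)[OF B ij(2)] k(2)[OF B ij(3)]] unfolding cov
    by (simp add: comp_def ij(1))
  show "(case ij of (i, j) \<Rightarrow> \<lambda>p. \<Phi> B i p * \<Psi> B j p) (chart_pt B z) \<noteq> 0"
    if "chart_pt B z \<in> cover (bundle_tensor L L') ij" for z
    using l(3)[OF B ij(2)] k(3)[OF B ij(3)] that unfolding cov by (simp add: ij(1))
  show "(case ij of (i, j) \<Rightarrow> \<lambda>p. \<Phi> B i p * \<Psi> B j p) (chart_pt B z) =
      transition (bundle_tensor L L') ij ij' (chart_pt B z) *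
      (case ij' of (i, j) \<Rightarrow> \<lambda>p. \<Phi> B i p * \<Psi> B j p) (chart_pt B z)"
    if ij'_mem: "ij' \<in> index (bundle_tensor L L')" and
      z_mem: "chart_pt B z \<in> cover (bundle_tensor L L') ij \<inter> cover (bundle_tensor L L') ij'" for ij' z
  proof -
    obtain i' j' where ij': "ij' = (i', j')" "i' \<in> index L" "j' \<in> index L'"
      using ij'_mem by (auto simp: bundle_tensor_def)
    have z: "chart_pt B z \<in> cover L i" "chart_pt B z \<in> cover L i'" "chart_pt B z \<in> cover L' j"
      "chart_pt B z \<in> cover L' j'" using z_mem by (auto simp: bundle_tensor_def ij(1) ij'(1))
    show ?thesis
      using l(4)[OF B ij(2) ij'(2) z(1,2)] k(4)[OF B ij(3) ij'(3) z(3,4)]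
      by (simp add: bundle_tensor_def ij(1) ij'(1) mult_ac)
  qed
  show "char_val w (\<mu> B + \<nu> B) * (case ij of (i, j) \<Rightarrow> \<lambda>p. \<Phi> A i p * \<Psi> A j p) (cox_pt w) =
      char_val w (\<mu> A + \<nu> A) * (case ij of (i, j) \<Rightarrow> \<lambda>p. \<Phi> B i p * \<Psi> B j p) (cox_pt w)"
    if A: "A \<in> max_cones" and w: "zeros w = {}" "cox_pt w \<in> cover (bundle_tensor L L') ij" for A w
  proof -
    have w': "cox_pt w \<in> cover L i" "cox_pt w \<in> cover L' j" using w(2) cov by auto
    have add: "char_val w (m + m') = char_val w m * char_val w m'" for m m' using char_val_add[of w] w(1) by simp
    have "char_val w (\<mu> B + \<nu> B) * (\<Phi> A i (cox_pt w) * \<Psi> A j (cox_pt w)) =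
        (char_val w (\<mu> B) * \<Phi> A i (cox_pt w)) * (char_val w (\<nu> B) * \<Psi> A j (cox_pt w))"
      unfolding add by (simp only: mult_ac)
    also have "\<dots> = (char_val w (\<mu> A) * \<Phi> B i (cox_pt w)) * (char_val w (\<nu> A) * \<Psi> B j (cox_pt w))"
      by (simp only: l(5)[OF A B ij(2) w(1) w'(1)] k(5)[OF A B ij(3) w(1) w'(2)])
    also have "\<dots> = char_val w (\<mu> A + \<nu> A) * (\<Phi> B i (cox_pt w) * \<Psi> B j (cox_pt w))"
      unfolding add by (simp only: mult_ac)
    finally show ?thesis by (simp add: ij(1))
  qed
qed

end

section \<open>Global sections and characters\<close>

lemma global_sectionsD:
  assumes "s \<in> global_sections \<Delta> L"
  shows "i \<in> index L \<Longrightarrow> regular_on \<Delta> (cover L i) (s i)"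
    and "i \<in> index L \<Longrightarrow> j \<in> index L \<Longrightarrow> x \<in> cover L i \<Longrightarrow> x \<in> cover L j \<Longrightarrow>
      s i x = transition L i j x * s j x"
    and "i \<notin> index L \<or> x \<notin> cover L i \<Longrightarrow> s i x = 0"
proof -
  note g = assms[unfolded global_sections_def, THEN CollectD]
  show "i \<in> index L \<Longrightarrow> regular_on \<Delta> (cover L i) (s i)" by (rule conjunct1[OF g, rule_format])
  show "i \<in> index L \<Longrightarrow> j \<in> index L \<Longrightarrow> x \<in> cover L i \<Longrightarrow> x \<in> cover L j \<Longrightarrow>
      s i x = transition L i j x * s j x"
    by (rule conjunct1[OF conjunct2[OF g], rule_format]) simp_all
  show "i \<notin> index L \<or> x \<notin> cover L i \<Longrightarrow> s i x = 0" by (rule conjunct2[OF conjunct2[OF g], rule_format])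
qed

context smooth_fan
begin

text \<open>These are the \<open>m\<close> for which the character \<open>m\<close>, times the
  common section of the frames over the torus, has no pole on any chart.\<close>

definition section_polytope :: "((int ^ 'l) set \<Rightarrow> int ^ 'l) \<Rightarrow> (int ^ 'l) set" where
  "section_polytope \<mu> = {m. \<forall>B\<in>max_cones. m - \<mu> B \<in> dm B}"

lemma section_polytopeD: "m \<in> section_polytope \<mu> \<Longrightarrow> B \<in> max_cones \<Longrightarrow> m - \<mu> B \<in> dm B"
  by (simp add: section_polytope_def)

lemma char_val_perturb_tendsto:
  assumes "m \<in> dm (zeros w)"
  shows "((\<lambda>t. char_val (\<lambda>r. if w r = 0 then t else w r) m) \<longlongrightarrow> char_val w m) (at 0)"
  unfolding char_val_def
proof (rule tendsto_prod)
  fix r assume r: "r \<in> R"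
  show "((\<lambda>t. (if w r = 0 then t else w r) powi pairing m r) \<longlongrightarrow> w r powi pairing m r) (at 0)"
  proof (cases "w r = 0")
    case True
    then have "0 \<le> pairing m r" using assms r by (simp add: zeros_def)
    then show ?thesis using True tendsto_power[OF tendsto_ident_at[of 0 UNIV], of "nat (pairing m r)"]
      by (simp add: power_int_def)
  qed simp
qed

lemma perturb_chart:
  assumes t: "trivialization L \<Phi> \<mu>" and B: "B \<in> max_cones" and w: "zeros w \<subseteq> B"
    and i: "i \<in> index L" "cox_pt w \<in> cover L i"
  defines "w' \<equiv> \<lambda>t r. if w r = 0 then t else w r"
  shows "((\<lambda>t. \<Phi> B i (cox_pt (w' t))) \<longlongrightarrow> \<Phi> B i (cox_pt w)) (at 0)"
    and "\<forall>\<^sub>F t in at 0. cox_pt (w' t) \<in> cover L i"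
    and "\<forall>\<^sub>F t in at 0. zeros (w' t) = {}"
proof -
  have ne: "\<forall>\<^sub>F t in at (0::complex). t \<noteq> 0" by (simp add: eventually_at_filter)
  have z: "zeros (w' t) = {}" if "t \<noteq> 0" for t using that by (auto simp: w'_def zeros_def)
  then show "\<forall>\<^sub>F t in at 0. zeros (w' t) = {}" using ne by (auto elim: eventually_mono)
  have lim: "((\<lambda>t. coords B (w' t) r) \<longlongrightarrow> coords B w r) (at 0)" if "r \<in> B" for r
    unfolding coords_def w'_def using char_val_perturb_tendsto dual_in_dm[OF B w that] by blast
  have p: "cox_pt w = chart_pt B (coords B w)" using cox_pt_coords[OF B w] .
  have p': "\<forall>\<^sub>F t in at 0. cox_pt (w' t) = chart_pt B (coords B (w' t))"
    using ne by eventually_elim (rule torus_cox_pt[OF z B])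
  note r = regular_poly_tendsto[OF trivializationD(2)[OF t B i(1)], of "coords B w" "\<lambda>t. coords B (w' t)" "at 0"]
  have mem: "coords B w \<in> chart_pt B -` cover L i" using i p by simp
  have "((\<lambda>t. (\<Phi> B i \<circ> chart_pt B) (coords B (w' t))) \<longlongrightarrow> (\<Phi> B i \<circ> chart_pt B) (coords B w)) (at 0)"
    using r(1)[OF mem lim] .
  moreover have "\<forall>\<^sub>F t in at 0. (\<Phi> B i \<circ> chart_pt B) (coords B (w' t)) = \<Phi> B i (cox_pt (w' t))"
    using p' by eventually_elim simp
  ultimately show "((\<lambda>t. \<Phi> B i (cox_pt (w' t))) \<longlongrightarrow> \<Phi> B i (cox_pt w)) (at 0)"
    using tendsto_cong p by fastforce
  have "\<forall>\<^sub>F t in at 0. coords B (w' t) \<in> chart_pt B -` cover L i" using r(2)[OF mem lim] .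
  then show "\<forall>\<^sub>F t in at 0. cox_pt (w' t) \<in> cover L i"
    using p' by eventually_elim simp
qed

text \<open>The identity holds on the torus and extends by continuity along the curve that replaces the
  vanishing Cox coordinates by a parameter \<open>t\<close> tending to \<open>0\<close>.\<close>

lemma trivialization_compatible:
  assumes t: "trivialization L \<Phi> \<mu>" and AB: "A \<in> max_cones" "B \<in> max_cones"
    and w: "zeros w \<subseteq> A \<inter> B" and i: "i \<in> index L" "cox_pt w \<in> cover L i"
    and m: "m - \<mu> A \<in> dm (zeros w)" "m - \<mu> B \<in> dm (zeros w)"
  shows "char_val w (m - \<mu> A) * \<Phi> A i (cox_pt w) = char_val w (m - \<mu> B) * \<Phi> B i (cox_pt w)"
proof -
  let ?w = "\<lambda>t r. if w r = 0 then t else w r"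
  have wA: "zeros w \<subseteq> A" and wB: "zeros w \<subseteq> B" using w by auto
  note pA = perturb_chart[OF t AB(1) wA i] and pB = perturb_chart[OF t AB(2) wB i]
  have limA: "((\<lambda>t. char_val (?w t) (m - \<mu> A) * \<Phi> A i (cox_pt (?w t))) \<longlongrightarrow> char_val w (m - \<mu> A) * \<Phi> A i (cox_pt w)) (at 0)"
    by (intro tendsto_mult char_val_perturb_tendsto m pA(1))
  have limB: "((\<lambda>t. char_val (?w t) (m - \<mu> B) * \<Phi> B i (cox_pt (?w t))) \<longlongrightarrow> char_val w (m - \<mu> B) * \<Phi> B i (cox_pt w)) (at 0)"
    by (intro tendsto_mult char_val_perturb_tendsto m pB(1))
  have ev: "\<forall>\<^sub>F t in at 0. char_val (?w t) (m - \<mu> A) * \<Phi> A i (cox_pt (?w t)) =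
      char_val (?w t) (m - \<mu> B) * \<Phi> B i (cox_pt (?w t))"
    using pA(2,3)
  proof eventually_elim
    case (elim s)
    have "char_val (?w s) (\<mu> B) * \<Phi> A i (cox_pt (?w s)) = char_val (?w s) (\<mu> A) * \<Phi> B i (cox_pt (?w s))"
      using trivializationD(5)[OF t AB i(1) elim(2,1)] .
    then show ?case using char_val_torus_nonzero[OF elim(2)]
      unfolding char_val_diff[OF elim(2)] by (simp add: field_simps)
  qed
  show ?thesis by (rule LIM_unique[OF iffD1[OF tendsto_cong[OF ev] limA] limB])
qed

lemma trivialization_cover:
  assumes "trivialization L \<Phi> \<mu>" "B \<in> max_cones"
  obtains i where "i \<in> index L" "chart_pt B z \<in> cover L i"
  using trivializationD(1)[OF assms(1)] assms(2) unfolding toric_variety_eq by blast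

text \<open>Test at a general point of the divisor of \<open>r\<close>, with
  \<open>m = \<mu> B\<close>. If \<open>\<mu> B\<close> had the larger pairing with
  \<open>r\<close>, its quotient by \<open>\<mu> A\<close> would vanish there and force the frame
  \<open>\<Phi> B\<close> to vanish.\<close>

lemma trivialization_weight_le:
  assumes t: "trivialization L \<Phi> \<mu>" and AB: "A \<in> max_cones" "B \<in> max_cones" and r: "r \<in> A" "r \<in> B"
  shows "pairing (\<mu> B) r \<le> pairing (\<mu> A) r"
proof (rule ccontr)
  assume n: "\<not> ?thesis"
  define w where "w = (\<lambda>s. if s = r then 0 else 1 :: complex)"
  have rR: "r \<in> R" using max_conesD AB r by blast
  have zw: "zeros w = {r}" using rR by (auto simp: zeros_def w_def)
  have p: "cox_pt w = chart_pt A (coords A w)" "cox_pt w = chart_pt B (coords B w)"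
    by (rule cox_pt_coords[OF AB(1)], simp add: zw r, rule cox_pt_coords[OF AB(2)], simp add: zw r)
  obtain i where i: "i \<in> index L" "cox_pt w \<in> cover L i" using trivialization_cover[OF t AB(1)] p(1) by metis
  have "char_val w (\<mu> B - \<mu> A) * \<Phi> A i (cox_pt w) = char_val w (\<mu> B - \<mu> B) * \<Phi> B i (cox_pt w)"
    using trivialization_compatible[OF t AB _ i] n zw r by (simp add: pairing_diff)
  moreover have "char_val w (\<mu> B - \<mu> A) = 0"
    using char_val_nonzero_iff[of w "\<mu> B - \<mu> A"] n zw by (auto simp: pairing_diff)
  ultimately have "\<Phi> B i (cox_pt w) = 0" by simp
  then show False using trivializationD(3)[OF t AB(2) i(1)] i(2) p(2) by metis
qed

lemma trivialization_weight_eq: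
  assumes "trivialization L \<Phi> \<mu>" "A \<in> max_cones" "B \<in> max_cones" "r \<in> A" "r \<in> B"
  shows "pairing (\<mu> A) r = pairing (\<mu> B) r"
  using trivialization_weight_le[OF assms(1,2,3,4,5)] trivialization_weight_le[OF assms(1,3,2,5,4)] by simp

text \<open>The chart and coordinates of \<open>p\<close> are chosen; for \<open>m\<close> in the
  section polytope, \<open>char_section_chart\<close> shows that any maximal chart containing
  \<open>p\<close> gives the same value.\<close>

definition char_section ::
  "('l toric_point, 'i) cocycle \<Rightarrow> ((int ^ 'l) set \<Rightarrow> 'i \<Rightarrow> 'l toric_point \<Rightarrow> complex) \<Rightarrow>
   ((int ^ 'l) set \<Rightarrow> int ^ 'l) \<Rightarrow> int ^ 'l \<Rightarrow> 'i \<Rightarrow> 'l toric_point \<Rightarrow> complex" where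
  "char_section L \<Phi> \<mu> m = (\<lambda>i p. if i \<in> index L \<and> p \<in> cover L i
     then (case SOME (B, z). B \<in> max_cones \<and> p = chart_pt B z of
             (B, z) \<Rightarrow> char_val (extend1 B z) (m - \<mu> B) * \<Phi> B i p)
     else 0)"

lemma cox_pt_zeros:
  assumes "A \<in> K" "zeros w \<subseteq> A" "B \<in> K" "cox_pt w = chart_pt B z"
  shows "zeros w \<subseteq> B"
proof -
  note zs = zeros_extend1_subset[of B z]
  have "(cone_gen B, restrict (char_val (extend1 B z)) (dm B)) \<in> chart_pt B z"
    unfolding chart_pt_def cox_pt_eq[OF assms(3) zs] gluing_classes[OF assms(3) zs] using assms(3) zs by blast
  then have "((cone_gen A, restrict (char_val w) (dm A)), (cone_gen B, restrict (char_val (extend1 B z)) (dm B))) \<in> gluing \<Delta>"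
    unfolding assms(4)[symmetric] cox_pt_eq[OF assms(1,2)] chart_map_def by blast
  then show ?thesis by (rule gluing_monoE(1)[OF assms(1,3,2)])
qed

lemma char_section_chart:
  assumes t: "trivialization L \<Phi> \<mu>" and m: "m \<in> section_polytope \<mu>" and B: "B \<in> max_cones"
    and i: "i \<in> index L" "chart_pt B z \<in> cover L i"
  shows "char_section L \<Phi> \<mu> m i (chart_pt B z) = char_val (extend1 B z) (m - \<mu> B) * \<Phi> B i (chart_pt B z)"
proof -
  let ?p = "chart_pt B z"
  let ?P = "\<lambda>(B, z). B \<in> max_cones \<and> ?p = chart_pt B z"
  obtain B' z' where S: "(SOME x. ?P x) = (B', z')" by (cases "SOME x. ?P x") auto
  have "?P (SOME x. ?P x)" by (rule someI[of ?P "(B, z)"]) (use B in simp)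
  then have B': "B' \<in> max_cones" "?p = chart_pt B' z'" unfolding S by auto
  define w where "w = extend1 B z"
  have wp: "?p = cox_pt w" by (simp add: w_def chart_pt_def)
  have wB: "zeros w \<subseteq> B" unfolding w_def by (rule zeros_extend1_subset)
  have BK: "B \<in> K" "B' \<in> K" using max_conesD B B' by blast+
  have wB': "zeros w \<subseteq> B'" using cox_pt_zeros[OF BK(1) wB BK(2)] B'(2) wp by simp
  have "chart_pt B' z' = chart_pt B' (coords B' w)" using cox_pt_coords[OF B'(1) wB'] B'(2) wp by simp
  then have "extend1 B' z' = extend1 B' (coords B' w)"
    using chart_pt_inj[OF B'(1)] by (auto simp: extend1_def fun_eq_iff)
  then have "char_val (extend1 B' z') (m - \<mu> B') = char_val w (m - \<mu> B')"
    using char_val_coords[OF B'(1) order.refl wB' section_polytopeD[OF m B'(1)]] by simp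
  moreover have "char_val w (m - \<mu> B') * \<Phi> B' i ?p = char_val w (m - \<mu> B) * \<Phi> B i ?p"
    unfolding wp using wB wB' section_polytopeD[OF m B'(1)] section_polytopeD[OF m B] i
    by (intro trivialization_compatible[OF t B'(1) B]) (auto simp: wp)
  moreover have "char_section L \<Phi> \<mu> m i ?p = char_val (extend1 B' z') (m - \<mu> B') * \<Phi> B' i ?p"
    unfolding char_section_def using i S by simp
  ultimately show ?thesis by (simp add: w_def)
qed

lemma char_val_polyfun:
  assumes "B \<in> max_cones" "m \<in> dm B"
  shows "(\<lambda>z. char_val (extend1 B z) m) \<in> polyfun B"
proof -
  have "(\<lambda>x. \<Sum>n\<in>{m}. 1 * x n) \<in> coordinate_ring (cone_gen B)"
    using assms max_conesD unfolding coordinate_ring_def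
    by (auto simp: dual_monoid_eq intro!: exI[of _ "\<lambda>_. 1"] exI[of _ "{m}"])
  from coordinate_ring_polyfun[OF assms(1) this] show ?thesis using assms(2) by simp
qed

lemma char_section_global:
  assumes t: "trivialization L \<Phi> \<mu>" and m: "m \<in> section_polytope \<mu>"
  shows "char_section L \<Phi> \<mu> m \<in> global_sections \<Delta> L"
  unfolding global_sections_def
proof (intro CollectI conjI ballI allI impI)
  fix i assume i: "i \<in> index L"
  show "regular_on \<Delta> (cover L i) (char_section L \<Phi> \<mu> m i)"
  proof (rule regular_onI)
    fix B assume B: "B \<in> max_cones"
    have "regular_poly B (chart_pt B -` cover L i)
        (\<lambda>z. char_val (extend1 B z) (m - \<mu> B) * (\<Phi> B i \<circ> chart_pt B) z)"
      using regular_poly_scale[OF trivializationD(2)[OF t B i] char_val_polyfun[OF B section_polytopeD[OF m B]]] .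
    then show "regular_poly B (chart_pt B -` cover L i) (char_section L \<Phi> \<mu> m i \<circ> chart_pt B)"
      by (rule regular_poly_cong) (simp add: char_section_chart[OF t m B i])
  qed
next
  fix i j p assume ij: "i \<in> index L" "j \<in> index L" and p: "p \<in> cover L i \<inter> cover L j"
  then have "p \<in> toric_variety \<Delta>" using trivializationD(1)[OF t] by blast
  then obtain B z where B: "B \<in> max_cones" "p = chart_pt B z" unfolding toric_variety_eq by blast
  show "char_section L \<Phi> \<mu> m i p = transition L i j p * char_section L \<Phi> \<mu> m j p"
    using p trivializationD(4)[OF t B(1) ij, of z]
    unfolding B(2) by (simp add: char_section_chart[OF t m B(1)] ij)
next
  fix i p assume "i \<notin> index L \<or> p \<notin> cover L i"
  then show "char_section L \<Phi> \<mu> m i p = 0" by (auto simp: char_section_def)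
qed

section \<open>Sections as combinations of characters\<close>

lemma char_val_mult: "char_val (\<lambda>r. w r * w' r) m = char_val w m * char_val w' m"
  by (simp add: char_val_def power_int_mult_distrib prod.distrib)

text \<open>Two characters differ on some ray of a maximal cone. Setting its coordinate to 2 and the
  others to 1 separates them, because distinct powers of 2 are distinct.\<close>

lemma characters_separate:
  assumes "m \<noteq> m'" obtains w where "zeros w = {}" "char_val w m \<noteq> char_val w m'"
proof -
  obtain A where A: "A \<in> max_cones" using K_nonempty max_above by blast
  have "\<exists>r\<in>A. pairing m r \<noteq> pairing m' r"
  proof (rule ccontr)
    assume "\<not> ?thesis"
    then have "(\<Sum>r\<in>A. pairing m r *s dual A r) = (\<Sum>r\<in>A. pairing m' r *s dual A r)"
      by (intro sum.cong) auto
    then show False using dual_expand[OF A] assms by metis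
  qed
  then obtain r where r: "r \<in> A" "pairing m r \<noteq> pairing m' r" by blast
  define w where "w = (\<lambda>s. if s = r then 2 else 1 :: complex)"
  have rR: "r \<in> R" using r A max_conesD by blast
  have char_val_w: "char_val w n = 2 powi pairing n r" for n
    unfolding char_val_def by (subst prod.remove[OF finite_R rR]) (simp add: w_def)
  have "a = b" if "(2::complex) powi a = 2 powi b" for a b
  proof -
    have "(2::complex) powi (a - b) = 1" "(2::complex) powi (b - a) = 1"
      using that by (simp_all add: power_int_diff)
    then have "(2::complex) ^ nat \<bar>a - b\<bar> = 1" by (cases "a \<le> b") (auto simp: power_int_def split: if_splits)
    then have "of_nat (2 ^ nat \<bar>a - b\<bar>) = (of_nat 1 :: complex)" by simp
    then have "(2::nat) ^ nat \<bar>a - b\<bar> = 1" by (simp only: of_nat_eq_iff)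
    then show ?thesis by simp
  qed
  then have "char_val w m \<noteq> char_val w m'" using r char_val_w by metis
  moreover have "zeros w = {}" by (auto simp: zeros_def w_def)
  ultimately show ?thesis using that by blast
qed

text \<open>Artin's argument: evaluate at the product of \<open>w\<close> with a point
  \<open>v\<close> that separates \<open>n\<close> from \<open>k\<close>, and subtract
  \<open>char_val v n\<close> times the original relation. The term at \<open>n\<close> disappears,
  and the one at \<open>k\<close> is multiplied by a nonzero factor.\<close>

lemma characters_independent:
  assumes "finite S" "\<And>w. zeros w = {} \<Longrightarrow> (\<Sum>m\<in>S. c m * char_val w m) = 0" "m \<in> S"
  shows "c m = 0"
  using assms
proof (induction S arbitrary: c m)
  case (insert n S)
  have *: "c k = 0" if k: "k \<in> S" for k
  proof -
    have "n \<noteq> k" using insert k by blast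
    then obtain v where v: "zeros v = {}" "char_val v n \<noteq> char_val v k" using characters_separate by blast
    have "(\<Sum>m\<in>S. (c m * (char_val v m - char_val v n)) * char_val w m) = 0" if w: "zeros w = {}" for w
    proof -
      have "zeros (\<lambda>r. w r * v r) = {}" using w v by (auto simp: zeros_def)
      from insert.prems(1)[OF this] have 1: "c n * (char_val w n * char_val v n) + (\<Sum>m\<in>S. c m * (char_val w m * char_val v m)) = 0"
        using insert.hyps by (simp add: char_val_mult)
      have 2: "c n * char_val w n + (\<Sum>m\<in>S. c m * char_val w m) = 0"
        using insert.prems(1)[OF w] insert.hyps by simp
      have "(\<Sum>m\<in>S. (c m * (char_val v m - char_val v n)) * char_val w m) =
          (\<Sum>m\<in>S. c m * (char_val w m * char_val v m)) - char_val v n * (\<Sum>m\<in>S. c m * char_val w m)"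
        by (simp add: sum_distrib_left sum_subtractf[symmetric] algebra_simps)
      also have "\<dots> = (c n * (char_val w n * char_val v n) + (\<Sum>m\<in>S. c m * (char_val w m * char_val v m))) -
          char_val v n * (c n * char_val w n + (\<Sum>m\<in>S. c m * char_val w m))"
        by (simp add: algebra_simps)
      finally show ?thesis unfolding 1 2 by simp
    qed
    from insert.IH[OF this k] show ?thesis using v by simp
  qed
  have "c n * char_val (\<lambda>_. 1) n = 0"
    using insert.prems(1)[of "\<lambda>_. 1"] insert.hyps * by (simp add: zeros_def)
  then have "c n = 0" by (simp add: char_val_def)
  then show ?case using * insert.prems by blast
qed simp

text \<open>Divided by the frame of \<open>B\<close>, a section is a regular function on a whole
  affine space, hence a polynomial and so a combination of characters.\<close>

lemma section_chart_expansion: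
  assumes t: "trivialization L \<Phi> \<mu>" and s: "s \<in> global_sections \<Delta> L" and B: "B \<in> max_cones"
  shows "\<exists>S c. finite S \<and> (\<forall>m\<in>S. m - \<mu> B \<in> dm B) \<and> (\<forall>i\<in>index L. \<forall>z. chart_pt B z \<in> cover L i \<longrightarrow>
    s i (chart_pt B z) = (\<Sum>m\<in>S. c m * char_val (extend1 B z) (m - \<mu> B)) * \<Phi> B i (chart_pt B z))"
proof -
  have BK: "B \<in> K" using max_conesD B by blast
  interpret polynomial_functions B using max_conesD[OF B] by unfold_locales blast
  have s_reg: "\<And>i. i \<in> index L \<Longrightarrow> regular_on \<Delta> (cover L i) (s i)"
    and s_tr: "\<And>i j x. i \<in> index L \<Longrightarrow> j \<in> index L \<Longrightarrow> x \<in> cover L i \<Longrightarrow> x \<in> cover L j \<Longrightarrow>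
      s i x = transition L i j x * s j x"
    using global_sectionsD[OF s] by blast+
  have "\<exists>i. i \<in> index L \<and> chart_pt B z \<in> cover L i" for z by (rule trivialization_cover[OF t B]) blast
  then have ex_i: "\<forall>z. \<exists>i. i \<in> index L \<and> chart_pt B z \<in> cover L i" by blast
  from choice[OF ex_i] obtain I where "\<forall>z. I z \<in> index L \<and> chart_pt B z \<in> cover L (I z)" ..
  then have I: "\<And>z. I z \<in> index L" "\<And>z. chart_pt B z \<in> cover L (I z)" by blast+
  define F where "F = (\<lambda>z. s (I z) (chart_pt B z) / \<Phi> B (I z) (chart_pt B z))"
  have F: "s i (chart_pt B z) = F z * \<Phi> B i (chart_pt B z)"
    if i: "i \<in> index L" "chart_pt B z \<in> cover L i" for i z
  proof -
    have "\<Phi> B (I z) (chart_pt B z) \<noteq> 0" using trivializationD(3)[OF t B I] .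
    then show ?thesis unfolding F_def s_tr[OF i(1) I(1) i(2) I(2)]
        trivializationD(4)[OF t B i(1) I(1) i(2) I(2)] by simp
  qed
  have "regular_poly B UNIV F" unfolding regular_poly_def
  proof
    fix z0
    let ?i = "I z0"
    have z0: "z0 \<in> chart_pt B -` cover L ?i" using I by simp
    obtain a1 h1 where 1: "a1 \<in> polyfun B" "h1 \<in> polyfun B" "h1 z0 \<noteq> 0"
      "\<And>z. h1 z \<noteq> 0 \<Longrightarrow> z \<in> chart_pt B -` cover L ?i \<and> h1 z * (s ?i \<circ> chart_pt B) z = a1 z"
      using regular_polyE[OF regular_on_chart[OF s_reg[OF I(1)] B] z0] by blast
    obtain a2 h2 where 2: "a2 \<in> polyfun B" "h2 \<in> polyfun B" "h2 z0 \<noteq> 0"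
      "\<And>z. h2 z \<noteq> 0 \<Longrightarrow> z \<in> chart_pt B -` cover L ?i \<and> h2 z * (\<Phi> B ?i \<circ> chart_pt B) z = a2 z"
      using regular_polyE[OF trivializationD(2)[OF t B I(1)] z0] by blast
    let ?h = "h1 * (a2 * h2)" and ?a = "a1 * (h2 * h2)"
    have "a2 z0 \<noteq> 0" using 2(3) 2(4)[OF 2(3)] trivializationD(3)[OF t B I] by auto
    then have "?h z0 \<noteq> 0" using 1(3) 2(3) by simp
    moreover have "?h z * F z = ?a z" if "?h z \<noteq> 0" for z
    proof -
      have nz: "h1 z \<noteq> 0" "h2 z \<noteq> 0" using that by auto
      have e1: "chart_pt B z \<in> cover L ?i" "h1 z * s ?i (chart_pt B z) = a1 z" using 1(4)[OF nz(1)] by auto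
      have e2: "h2 z * \<Phi> B ?i (chart_pt B z) = a2 z" using 2(4)[OF nz(2)] by auto
      have "a1 z = h1 z * (F z * \<Phi> B ?i (chart_pt B z))" using F[OF I(1) e1(1)] e1(2) by simp
      then show ?thesis unfolding times_fun_apply e2[symmetric] by (simp add: mult_ac)
    qed
    moreover have "?h \<in> polyfun B" "?a \<in> polyfun B" using 1 2 by (auto intro!: mult_mem)
    ultimately show "\<exists>a\<in>polyfun B. \<exists>h\<in>polyfun B. h z0 \<noteq> 0 \<and> (\<forall>y. h y \<noteq> 0 \<longrightarrow> y \<in> UNIV \<and> h y * F y = a y)"
      by blast
  qed
  then have Fp: "F \<in> polyfun B" by (rule regular_UNIV)
  obtain g where g: "g \<in> coordinate_ring (cone_gen B)"
    "\<forall>x\<in>affine_chart (cone_gen B). g x = F (\<lambda>r. x (dual B r))"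
    using polyfun_coordinate_ring[OF BK B order.refl Fp] by blast
  obtain c S where S: "finite S" "S \<subseteq> dm B" "g = (\<lambda>x. \<Sum>m\<in>S. c m * x m)"
    using g(1) unfolding coordinate_ring_def dual_monoid_eq[OF BK] by blast
  have Fz: "F z = (\<Sum>m\<in>S. c m * char_val (extend1 B z) m)" for z
  proof -
    let ?x = "restrict (char_val (extend1 B z)) (dm B)"
    have "F z = F (\<lambda>r. ?x (dual B r))"
      by (rule polyfun_cong[OF Fp])
        (use dual_in_dm[OF B order.refl] char_val_extend1_dual[OF B] in simp)
    also have "\<dots> = g ?x" using g(2) char_val_in_chart[OF BK zeros_extend1_subset] by simp
    also have "\<dots> = (\<Sum>m\<in>S. c m * char_val (extend1 B z) m)"
      unfolding S(3) using S(2) by (intro sum.cong) auto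
    finally show ?thesis .
  qed
  \<comment> \<open>The shift by \<open>\<mu> B\<close> gives a character the same label in all
    charts, which the comparison of charts relies on.\<close>
  let ?S = "(\<lambda>m. m + \<mu> B) ` S"
  have "F z = (\<Sum>m\<in>?S. c (m - \<mu> B) * char_val (extend1 B z) (m - \<mu> B))" for z
    unfolding Fz by (subst sum.reindex) (auto simp: inj_on_def)
  then show ?thesis using F S(1,2)
    by (intro exI[of _ ?S] exI[of _ "\<lambda>m. c (m - \<mu> B)"]) auto
qed

lemma sum_extend:
  fixes c :: "'b \<Rightarrow> complex"
  assumes "finite T" "S \<subseteq> T"
  shows "(\<Sum>m\<in>T. (if m \<in> S then c m else 0) * f m) = (\<Sum>m\<in>S. c m * f m)"
proof -
  have "(\<Sum>m\<in>S. c m * f m) = (\<Sum>m\<in>S. (if m \<in> S then c m else 0) * f m)" by (rule sum.cong) auto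
  also have "\<dots> = (\<Sum>m\<in>T. (if m \<in> S then c m else 0) * f m)"
    by (rule sum.mono_neutral_left) (use assms in auto)
  finally show ?thesis by simp
qed

text \<open>The expansions in different charts agree on the torus, and independence of characters
  forces equal coefficients. A character with nonzero coefficient is therefore regular on every
  chart.\<close>

theorem section_expansion:
  assumes t: "trivialization L \<Phi> \<mu>" and s: "s \<in> global_sections \<Delta> L"
  obtains S c where "finite S" "S \<subseteq> section_polytope \<mu>"
    "\<And>i p. s i p = (\<Sum>m\<in>S. c m * char_section L \<Phi> \<mu> m i p)"
proof -
  from bchoice[OF ballI[OF section_chart_expansion[OF t s]]]
  obtain S where "\<forall>B\<in>max_cones. \<exists>c. finite (S B) \<and> (\<forall>m\<in>S B. m - \<mu> B \<in> dm B) \<and>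
    (\<forall>i\<in>index L. \<forall>z. chart_pt B z \<in> cover L i \<longrightarrow> s i (chart_pt B z) =
      (\<Sum>m\<in>S B. c m * char_val (extend1 B z) (m - \<mu> B)) * \<Phi> B i (chart_pt B z))" ..
  from bchoice[OF this]
  obtain c where c: "\<forall>B\<in>max_cones. finite (S B) \<and> (\<forall>m\<in>S B. m - \<mu> B \<in> dm B) \<and>
    (\<forall>i\<in>index L. \<forall>z. chart_pt B z \<in> cover L i \<longrightarrow> s i (chart_pt B z) =
      (\<Sum>m\<in>S B. c B m * char_val (extend1 B z) (m - \<mu> B)) * \<Phi> B i (chart_pt B z))" ..
  have S: "finite (S B)" if "B \<in> max_cones" for B
    by (rule conjunct1[OF c[rule_format, OF that]])
  have Sd: "m - \<mu> B \<in> dm B" if "B \<in> max_cones" "m \<in> S B" for B m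
    by (rule conjunct1[OF conjunct2[OF c[rule_format, OF that(1)]], rule_format, OF that(2)])
  have sc: "s i (chart_pt B z) = (\<Sum>m\<in>S B. c B m * char_val (extend1 B z) (m - \<mu> B)) * \<Phi> B i (chart_pt B z)"
    if "B \<in> max_cones" "i \<in> index L" "chart_pt B z \<in> cover L i" for B i z
    by (rule conjunct2[OF conjunct2[OF c[rule_format, OF that(1)]], rule_format, OF that(2,3)])
  define d where "d = (\<lambda>B m. if m \<in> S B then c B m else 0)"
  obtain A where A: "A \<in> max_cones" using K_nonempty max_above by blast
  have torus: "s i (cox_pt w) * char_val w (\<mu> B) = (\<Sum>m\<in>S B. c B m * char_val w m) * \<Phi> B i (cox_pt w)"
    if B: "B \<in> max_cones" and w: "zeros w = {}" and i: "i \<in> index L" "cox_pt w \<in> cover L i" for B w i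
  proof -
    have p: "cox_pt w = chart_pt B (coords B w)" using torus_cox_pt[OF w B] .
    have "char_val (extend1 B (coords B w)) m = char_val w m" for m
      using char_val_coords[OF B, of "{}" w m] w by simp
    then have "s i (cox_pt w) = (\<Sum>m\<in>S B. c B m * char_val w (m - \<mu> B)) * \<Phi> B i (cox_pt w)"
      using sc[OF B i(1)] i(2) p by simp
    then show ?thesis unfolding char_val_diff[OF w] using char_val_torus_nonzero[OF w]
      by (simp add: sum_divide_distrib[symmetric])
  qed
  have d_eq: "d B m = d A m" if B: "B \<in> max_cones" for B m
  proof -
    let ?T = "insert m (S A \<union> S B)"
    have fin: "finite ?T" using S A B by simp
    have "(\<Sum>n\<in>?T. (d B n - d A n) * char_val w n) = 0" if w: "zeros w = {}" for w
    proof -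
      obtain i where i: "i \<in> index L" "cox_pt w \<in> cover L i"
        using trivialization_cover[OF t A] torus_cox_pt[OF w A] by metis
      let ?p = "cox_pt w"
      define a b where "a = (\<Sum>m\<in>S A. c A m * char_val w m)" and "b = (\<Sum>m\<in>S B. c B m * char_val w m)"
      have nz: "\<Phi> A i ?p \<noteq> 0" "\<Phi> B i ?p \<noteq> 0"
        using trivializationD(3)[OF t A i(1)] trivializationD(3)[OF t B i(1)] i(2)
          torus_cox_pt[OF w A] torus_cox_pt[OF w B] by metis+
      have eA: "s i ?p * char_val w (\<mu> A) = a * \<Phi> A i ?p" and eB: "s i ?p * char_val w (\<mu> B) = b * \<Phi> B i ?p"
        using torus[OF A w i] torus[OF B w i] by (auto simp: a_def b_def)
      have eAB: "char_val w (\<mu> B) * \<Phi> A i ?p = char_val w (\<mu> A) * \<Phi> B i ?p"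
        using trivializationD(5)[OF t A B i(1) w i(2)] .
      have "a * (char_val w (\<mu> B) * \<Phi> A i ?p) = (a * \<Phi> A i ?p) * char_val w (\<mu> B)" by (simp add: mult_ac)
      also have "\<dots> = (s i ?p * char_val w (\<mu> B)) * char_val w (\<mu> A)" unfolding eA[symmetric] by (simp add: mult_ac)
      also have "\<dots> = b * (char_val w (\<mu> B) * \<Phi> A i ?p)" unfolding eB eAB by (simp add: mult_ac)
      finally have "a = b" using nz char_val_torus_nonzero[OF w] by simp
      then have "(\<Sum>n\<in>?T. d A n * char_val w n) = (\<Sum>n\<in>?T. d B n * char_val w n)"
      proof -
        have "S A \<subseteq> ?T" "S B \<subseteq> ?T" by auto
        from sum_extend[OF fin this(1), of "c A" "char_val w"] sum_extend[OF fin this(2), of "c B" "char_val w"]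
        show ?thesis unfolding d_def using \<open>a = b\<close> a_def b_def by (simp only:)
      qed
      then show ?thesis by (simp add: left_diff_distrib sum_subtractf)
    qed
    from characters_independent[OF fin this, of m] show ?thesis by simp
  qed
  \<comment> \<open>The supports \<open>S B\<close> may contain characters with coefficient zero,
    which need not be admissible in other charts; they are discarded.\<close>
  define S0 where "S0 = {m \<in> S A. c A m \<noteq> 0}"
  have S0B: "m \<in> S B" if "m \<in> S0" "B \<in> max_cones" for m B
    using d_eq[OF that(2), of m] that(1) unfolding d_def S0_def by (auto split: if_splits)
  have S0P: "S0 \<subseteq> section_polytope \<mu>" unfolding section_polytope_def using S0B Sd by blast
  have fin0: "finite S0" unfolding S0_def using S A by simp
  have sum_eq: "(\<Sum>m\<in>S B. c B m * f m) = (\<Sum>m\<in>S0. c A m * f m)" if B: "B \<in> max_cones" for B and f :: "_ \<Rightarrow> complex"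
  proof (rule sum.mono_neutral_cong_right)
    show "finite (S B)" "S0 \<subseteq> S B" using S[OF B] S0B B by auto
    show "\<forall>i\<in>S B - S0. c B i * f i = 0" using d_eq[OF B] unfolding d_def S0_def
      by (metis (mono_tags, lifting) DiffE mem_Collect_eq mult_zero_left)
    show "c B x * f x = c A x * f x" if "x \<in> S0" for x
      using d_eq[OF B, of x] S0B[OF that B] that unfolding d_def S0_def by auto
  qed
  have "s i p = (\<Sum>m\<in>S0. c A m * char_section L \<Phi> \<mu> m i p)" for i p
  proof (cases "i \<in> index L \<and> p \<in> cover L i")
    case False
    then have "s i p = 0" using global_sectionsD(3)[OF s] by blast
    moreover have "char_section L \<Phi> \<mu> m i p = 0" for m using False by (auto simp: char_section_def)
    ultimately show ?thesis by simp
  next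
    case True
    then have "p \<in> toric_variety \<Delta>" using trivializationD(1)[OF t] by blast
    then obtain B z where B: "B \<in> max_cones" "p = chart_pt B z" unfolding toric_variety_eq by blast
    have "s i p = (\<Sum>m\<in>S0. c A m * char_val (extend1 B z) (m - \<mu> B)) * \<Phi> B i p"
      using sc[OF B(1)] True B sum_eq[OF B(1)] by simp
    also have "\<dots> = (\<Sum>m\<in>S0. c A m * char_section L \<Phi> \<mu> m i p)"
      unfolding sum_distrib_right B(2)
      using char_section_chart[OF t _ B(1)] True B(2) S0P by (intro sum.cong) (auto simp: mult_ac)
    finally show ?thesis .
  qed
  then show ?thesis using that fin0 S0P by blast
qed

text \<open>At the origin of the chart of \<open>B\<close>, a torus-fixed point, the only character
  section that can be nonzero is that of \<open>\<mu> B\<close>. A section that is nonzero there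
  must involve it.\<close>

lemma globally_generated_vertex:
  assumes t: "trivialization L \<Phi> \<mu>" and g: "globally_generated \<Delta> L" and B: "B \<in> max_cones"
  shows "\<mu> B \<in> section_polytope \<mu>"
proof -
  have B': "B \<subseteq> R" "finite B" using max_conesD B by blast+
  let ?p = "chart_pt B (\<lambda>_. 0)"
  obtain i where i: "i \<in> index L" "?p \<in> cover L i" using trivialization_cover[OF t B] .
  obtain s where s: "s \<in> global_sections \<Delta> L" "s i ?p \<noteq> 0" using g i unfolding globally_generated_def by blast
  obtain S c where S: "finite S" "S \<subseteq> section_polytope \<mu>"
    "\<And>i p. s i p = (\<Sum>m\<in>S. c m * char_section L \<Phi> \<mu> m i p)"
    using section_expansion[OF t s(1)] by blast
  have "\<exists>m\<in>S. char_section L \<Phi> \<mu> m i ?p \<noteq> 0"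
  proof (rule ccontr)
    assume "\<not> ?thesis"
    then have "s i ?p = 0" unfolding S(3) by (intro sum.neutral) auto
    then show False using s by simp
  qed
  then obtain m where m: "m \<in> S" "m \<in> section_polytope \<mu>" "char_section L \<Phi> \<mu> m i ?p \<noteq> 0" using S by blast
  then have "char_val (extend1 B (\<lambda>_. 0)) (m - \<mu> B) \<noteq> 0" using char_section_chart[OF t m(2) B i] by auto
  then have "pairing (m - \<mu> B) r = 0" if "r \<in> B" for r
    using that B' unfolding char_val_nonzero_iff zeros_extend1 by auto
  then have "m - \<mu> B = (\<Sum>r\<in>B. 0 *s dual B r)" using dual_expand[OF B, of "m - \<mu> B"] by simp
  then have "m = \<mu> B" by simp
  then show ?thesis using m by simp
qed

lemma char_section_mult:
  fixes L :: "('l toric_point, 'i) cocycle" and L' :: "('l toric_point, 'j) cocycle"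
  assumes t: "trivialization L \<Phi> \<mu>" and t': "trivialization L' \<Psi> \<nu>"
    and m: "m \<in> section_polytope \<mu>" "m' \<in> section_polytope \<nu>"
  shows "section_prod (char_section L \<Phi> \<mu> m) (char_section L' \<Psi> \<nu> m') =
    char_section (bundle_tensor L L') (\<lambda>B (i, j) p. \<Phi> B i p * \<Psi> B j p) (\<lambda>B. \<mu> B + \<nu> B) (m + m')"
proof (intro ext)
  fix ij :: "'i \<times> 'j" and p
  obtain i j where ij: "ij = (i, j)" by (cases ij)
  note tt = trivialization_tensor[OF t t']
  have mm: "m + m' \<in> section_polytope (\<lambda>B. \<mu> B + \<nu> B)"
    using m by (fastforce simp: section_polytope_def pairing_add pairing_diff)
  show "section_prod (char_section L \<Phi> \<mu> m) (char_section L' \<Psi> \<nu> m') ij p =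
    char_section (bundle_tensor L L') (\<lambda>B (i, j) p. \<Phi> B i p * \<Psi> B j p) (\<lambda>B. \<mu> B + \<nu> B) (m + m') ij p"
  proof (cases "i \<in> index L \<and> p \<in> cover L i \<and> j \<in> index L' \<and> p \<in> cover L' j")
    case False
    then show ?thesis unfolding section_prod_def char_section_def ij by (auto simp: bundle_tensor_def)
  next
    case True
    then have "p \<in> toric_variety \<Delta>" using trivializationD(1)[OF t] by blast
    then obtain B z where B: "B \<in> max_cones" "p = chart_pt B z" unfolding toric_variety_eq by blast
    have idx: "(i, j) \<in> index (bundle_tensor L L')" "chart_pt B z \<in> cover (bundle_tensor L L') (i, j)"
      using True B by (auto simp: bundle_tensor_def)
    let ?x = "char_val (extend1 B z)"
    have "?x (m + m' - (\<mu> B + \<nu> B)) = ?x (m - \<mu> B) * ?x (m' - \<nu> B)"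
    proof -
      have "m + m' - (\<mu> B + \<nu> B) = (m - \<mu> B) + (m' - \<nu> B)" by simp
      moreover have "0 \<le> pairing (m - \<mu> B) r \<and> 0 \<le> pairing (m' - \<nu> B) r" if "r \<in> zeros (extend1 B z)" for r
        using section_polytopeD[OF m(1) B(1)] section_polytopeD[OF m(2) B(1)] zeros_extend1_subset[of B z] that by blast
      ultimately show ?thesis using char_val_add by metis
    qed
    moreover have "char_section L \<Phi> \<mu> m i p = ?x (m - \<mu> B) * \<Phi> B i p"
      "char_section L' \<Psi> \<nu> m' j p = ?x (m' - \<nu> B) * \<Psi> B j p"
      using char_section_chart[OF t m(1) B(1)] char_section_chart[OF t' m(2) B(1)] True B(2) by auto
    moreover have "char_section (bundle_tensor L L') (\<lambda>B (i, j) p. \<Phi> B i p * \<Psi> B j p) (\<lambda>B. \<mu> B + \<nu> B) (m + m') (i, j) p =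
        ?x (m + m' - (\<mu> B + \<nu> B)) * (\<Phi> B i p * \<Psi> B j p)"
      using char_section_chart[OF tt mm B(1) idx] B(2) by simp
    ultimately show ?thesis unfolding section_prod_def ij by (simp add: mult_ac)
  qed
qed

end

section \<open>The product of sections\<close>

lemma sum_fun_apply: "(\<Sum>x\<in>T. f x) y = (\<Sum>x\<in>T. f x y)"
  for f :: "'a \<Rightarrow> 'b \<Rightarrow> 'c::comm_monoid_add"
  by (induction T rule: infinite_finite_induct) auto

lemma free_product_map_superset:
  assumes "finite T" "Poly_Mapping.keys f \<subseteq> T"
  shows "free_product_map f (i, j) p = (\<Sum>x\<in>T. Poly_Mapping.lookup f x * (fst x i p * snd x j p))"
proof -
  have "free_product_map f (i, j) p =
      (\<Sum>x\<in>Poly_Mapping.keys f. Poly_Mapping.lookup f x * (fst x i p * snd x j p))"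
    unfolding free_product_map_def sum_fun_apply
    by (rule sum.cong) (auto simp: section_scale_def section_prod_def split: prod.split)
  also have "\<dots> = (\<Sum>x\<in>T. Poly_Mapping.lookup f x * (fst x i p * snd x j p))"
    by (rule sum.mono_neutral_left) (use assms in \<open>auto simp: in_keys_iff\<close>)
  finally show ?thesis .
qed

lemma free_product_map_add:
  fixes f g :: "((('i \<Rightarrow> 'p \<Rightarrow> complex) \<times> ('j \<Rightarrow> 'p \<Rightarrow> complex)) \<Rightarrow>\<^sub>0 complex)"
  shows "free_product_map (f + g) = free_product_map f + free_product_map g"
proof (intro ext)
  fix ij :: "'i \<times> 'j" and p
  obtain i j where ij: "ij = (i, j)" by (cases ij)
  let ?T = "Poly_Mapping.keys f \<union> Poly_Mapping.keys g"
  have fin: "finite ?T" by simp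
  have "free_product_map (f + g) (i, j) p = free_product_map f (i, j) p + free_product_map g (i, j) p"
    unfolding free_product_map_superset[OF fin keys_add] free_product_map_superset[OF fin Un_upper1]
      free_product_map_superset[OF fin Un_upper2]
    by (simp add: lookup_add sum.distrib algebra_simps)
  then show "free_product_map (f + g) ij p = (free_product_map f + free_product_map g) ij p"
    by (simp add: ij)
qed

lemma free_product_map_scale:
  fixes f :: "((('i \<Rightarrow> 'p \<Rightarrow> complex) \<times> ('j \<Rightarrow> 'p \<Rightarrow> complex)) \<Rightarrow>\<^sub>0 complex)"
  shows "free_product_map (free_scale c f) = section_scale c (free_product_map f)"
proof (intro ext)
  fix ij :: "'i \<times> 'j" and p
  obtain i j where ij: "ij = (i, j)" by (cases ij)
  have sub: "Poly_Mapping.keys (free_scale c f) \<subseteq> Poly_Mapping.keys f"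
    by (auto simp: in_keys_iff lookup_free_scale)
  show "free_product_map (free_scale c f) ij p = section_scale c (free_product_map f) ij p"
    using free_product_map_superset[OF finite_keys sub, of i j p]
      free_product_map_superset[OF finite_keys order.refl, of f i j p]
    by (simp add: ij section_scale_def lookup_free_scale sum_distrib_left mult_ac)
qed

lemma free_product_map_single:
  fixes s :: "'i \<Rightarrow> 'p \<Rightarrow> complex" and t :: "'j \<Rightarrow> 'p \<Rightarrow> complex"
  shows "free_product_map (Poly_Mapping.single (s, t) c) = section_scale c (section_prod s t)"
proof (intro ext)
  fix ij :: "'i \<times> 'j" and p
  obtain i j where ij: "ij = (i, j)" by (cases ij)
  show "free_product_map (Poly_Mapping.single (s, t) c) ij p = section_scale c (section_prod s t) ij p"
    unfolding ij using free_product_map_superset[of "{(s, t)}" "Poly_Mapping.single (s, t) c" i j p]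
    by (simp add: section_scale_def section_prod_def)
qed

lemma free_product_map_zero: "free_product_map 0 = 0"
  by (simp add: free_product_map_def)

lemma free_product_map_diff: "free_product_map (f - g) = free_product_map f - free_product_map g"
  using free_product_map_add[of "f - g" g] by (simp add: algebra_simps)

lemma free_product_map_sum: "free_product_map (\<Sum>x\<in>T. f x) = (\<Sum>x\<in>T. free_product_map (f x))"
  by (induction T rule: infinite_finite_induct) (auto simp: free_product_map_zero free_product_map_add)

lemma section_scale_1: "section_scale 1 s = s"
  by (simp add: section_scale_def)

lemma free_product_map_relations:
  assumes "x \<in> bilinear_relations V W" shows "free_product_map x = 0"
  using assms unfolding bilinear_relations_def Let_def
  by (auto simp: free_product_map_diff free_product_map_single free_product_map_scale section_scale_1)
    (auto simp: section_prod_def section_scale_def fun_eq_iff algebra_simps)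

lemma free_product_map_span:
  assumes "x \<in> module.span free_scale (bilinear_relations V W)" shows "free_product_map x = 0"
proof -
  interpret vs: vector_space free_scale by (rule vector_space_free_scale)
  show ?thesis using assms
  proof (induction rule: vs.span_induct_alt)
    case base then show ?case by (rule free_product_map_zero)
  next
    case (step c x y)
    then show ?case by (auto simp: free_product_map_add free_product_map_scale
        free_product_map_relations section_scale_def fun_eq_iff)
  qed
qed

text \<open>The span of the bilinearity relations is mapped to zero, so the image of a coset is a
  single element and \<open>the_elem\<close> is meaningful.\<close>

lemma product_of_sections_coset:
  "product_of_sections ((+) f ` module.span free_scale (bilinear_relations V W)) = free_product_map f"
proof -
  interpret vs: vector_space free_scale by (rule vector_space_free_scale)
  have "free_product_map ` (+) f ` vs.span (bilinear_relations V W) = {free_product_map f}"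
  proof (rule subset_antisym)
    show "free_product_map ` (+) f ` vs.span (bilinear_relations V W) \<subseteq> {free_product_map f}"
      using free_product_map_span[of _ V W] by (auto simp: free_product_map_add)
    have "free_product_map (f + 0) \<in> free_product_map ` (+) f ` vs.span (bilinear_relations V W)"
      using vs.span_zero by (intro imageI)
    then show "{free_product_map f} \<subseteq> free_product_map ` (+) f ` vs.span (bilinear_relations V W)" by simp
  qed
  then show ?thesis by (simp add: product_of_sections_def)
qed

context smooth_fan
begin

lemma global_sections_zero:
  assumes "trivialization L \<Phi> \<mu>" shows "0 \<in> global_sections \<Delta> L"
proof -
  have "regular_on \<Delta> (cover L i) 0" if i: "i \<in> index L" for i
  proof (rule regular_onI)
    fix B assume B: "B \<in> max_cones"
    have "regular_poly B (chart_pt B -` cover L i) (\<lambda>z. 0 z * (\<Phi> B i \<circ> chart_pt B) z)"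
      by (rule regular_poly_scale[OF trivializationD(2)[OF assms B i] polyfun_zero])
    then show "regular_poly B (chart_pt B -` cover L i) (0 \<circ> chart_pt B)" by (simp add: comp_def)
  qed
  then show ?thesis unfolding global_sections_def by simp
qed

lemma global_sections_add:
  assumes "s \<in> global_sections \<Delta> L" "t \<in> global_sections \<Delta> L"
  shows "s + t \<in> global_sections \<Delta> L"
  unfolding global_sections_def
proof (intro CollectI conjI ballI allI impI)
  fix i assume i: "i \<in> index L"
  show "regular_on \<Delta> (cover L i) ((s + t) i)"
  proof (rule regular_onI)
    fix B assume B: "B \<in> max_cones"
    from regular_poly_add[OF regular_on_chart[OF global_sectionsD(1)[OF assms(1) i] B]
        regular_on_chart[OF global_sectionsD(1)[OF assms(2) i] B]]
    show "regular_poly B (chart_pt B -` cover L i) ((s + t) i \<circ> chart_pt B)" by (simp add: comp_def)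
  qed
next
  fix i j p assume "i \<in> index L" "j \<in> index L" "p \<in> cover L i \<inter> cover L j"
  then show "(s + t) i p = transition L i j p * (s + t) j p"
    using global_sectionsD(2)[OF assms(1), of i j p] global_sectionsD(2)[OF assms(2), of i j p]
    by (simp add: algebra_simps)
next
  fix i p assume "i \<notin> index L \<or> p \<notin> cover L i"
  then show "(s + t) i p = 0"
    using global_sectionsD(3)[OF assms(1), of i p] global_sectionsD(3)[OF assms(2), of i p] by simp
qed

lemma global_sections_scale:
  assumes "s \<in> global_sections \<Delta> L" shows "section_scale c s \<in> global_sections \<Delta> L"
  unfolding global_sections_def
proof (intro CollectI conjI ballI allI impI)
  fix i assume i: "i \<in> index L"
  show "regular_on \<Delta> (cover L i) (section_scale c s i)"
  proof (rule regular_onI)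
    fix B assume B: "B \<in> max_cones"
    from regular_poly_scale[OF regular_on_chart[OF global_sectionsD(1)[OF assms i] B] polyfun_const[of c]]
    show "regular_poly B (chart_pt B -` cover L i) (section_scale c s i \<circ> chart_pt B)"
      by (simp add: comp_def section_scale_def)
  qed
next
  fix i j p assume "i \<in> index L" "j \<in> index L" "p \<in> cover L i \<inter> cover L j"
  then show "section_scale c s i p = transition L i j p * section_scale c s j p"
    using global_sectionsD(2)[OF assms, of i j p] by (simp add: section_scale_def)
next
  fix i p assume "i \<notin> index L \<or> p \<notin> cover L i"
  then show "section_scale c s i p = 0" using global_sectionsD(3)[OF assms] by (simp add: section_scale_def)
qed

lemma global_sections_prod:
  fixes L :: "('l toric_point, 'i) cocycle" and L' :: "('l toric_point, 'j) cocycle"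
  assumes "s \<in> global_sections \<Delta> L" "t \<in> global_sections \<Delta> L'"
  shows "section_prod s t \<in> global_sections \<Delta> (bundle_tensor L L')"
  unfolding global_sections_def
proof (intro CollectI conjI ballI allI impI)
  fix ij assume "ij \<in> index (bundle_tensor L L')"
  then obtain i j where ij: "ij = (i, j)" "i \<in> index L" "j \<in> index L'" by (auto simp: bundle_tensor_def)
  show "regular_on \<Delta> (cover (bundle_tensor L L') ij) (section_prod s t ij)"
  proof (rule regular_onI)
    fix B assume B: "B \<in> max_cones"
    have cov: "chart_pt B -` cover (bundle_tensor L L') (i, j) = chart_pt B -` cover L i \<inter> chart_pt B -` cover L' j"
      by (auto simp: bundle_tensor_def)
    from regular_poly_mult[OF regular_on_chart[OF global_sectionsD(1)[OF assms(1) ij(2)] B]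
        regular_on_chart[OF global_sectionsD(1)[OF assms(2) ij(3)] B]]
    show "regular_poly B (chart_pt B -` cover (bundle_tensor L L') ij) (section_prod s t ij \<circ> chart_pt B)"
      unfolding ij(1) cov by (simp add: comp_def section_prod_def)
  qed
next
  fix ij ij' p assume "ij \<in> index (bundle_tensor L L')" "ij' \<in> index (bundle_tensor L L')"
    and p: "p \<in> cover (bundle_tensor L L') ij \<inter> cover (bundle_tensor L L') ij'"
  then obtain i j i' j' where ij: "ij = (i, j)" "i \<in> index L" "j \<in> index L'"
    and ij': "ij' = (i', j')" "i' \<in> index L" "j' \<in> index L'" by (auto simp: bundle_tensor_def)
  have p': "p \<in> cover L i" "p \<in> cover L i'" "p \<in> cover L' j" "p \<in> cover L' j'"
    using p unfolding ij ij' by (auto simp: bundle_tensor_def)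
  show "section_prod s t ij p = transition (bundle_tensor L L') ij ij' p * section_prod s t ij' p"
    using global_sectionsD(2)[OF assms(1) ij(2) ij'(2) p'(1,2)] global_sectionsD(2)[OF assms(2) ij(3) ij'(3) p'(3,4)]
    unfolding ij ij' by (simp add: bundle_tensor_def section_prod_def)
next
  fix ij p assume a: "ij \<notin> index (bundle_tensor L L') \<or> p \<notin> cover (bundle_tensor L L') ij"
  obtain i j where ij: "ij = (i, j)" by (cases ij)
  have "(i \<notin> index L \<or> p \<notin> cover L i) \<or> (j \<notin> index L' \<or> p \<notin> cover L' j)"
    using a unfolding ij by (auto simp: bundle_tensor_def)
  then show "section_prod s t ij p = 0"
    using global_sectionsD(3)[OF assms(1), of i p] global_sectionsD(3)[OF assms(2), of j p]
    unfolding ij by (auto simp: section_prod_def)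
qed

text \<open>A section of the tensor bundle is a combination of characters from its polytope. Each of
  them splits by hypothesis, and a product of character sections is the character section of the sum
  of the exponents, so a preimage can be written down term by term.\<close>

theorem product_of_sections_image:
  fixes L :: "('l toric_point, 'i) cocycle" and L' :: "('l toric_point, 'j) cocycle"
  assumes t: "trivialization L \<Phi> \<mu>" and t': "trivialization L' \<Psi> \<nu>"
    and split: "\<And>m. m \<in> section_polytope (\<lambda>B. \<mu> B + \<nu> B) \<Longrightarrow> \<exists>m1\<in>section_polytope \<mu>. \<exists>m2\<in>section_polytope \<nu>. m = m1 + m2"
  shows "product_of_sections ` tensor_space (global_sections \<Delta> L) (global_sections \<Delta> L')
    = global_sections \<Delta> (bundle_tensor L L')"
proof (intro equalityI subsetI)
  note tt = trivialization_tensor[OF t t']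
  fix \<sigma> assume "\<sigma> \<in> product_of_sections ` tensor_space (global_sections \<Delta> L) (global_sections \<Delta> L')"
  then obtain f where f: "Poly_Mapping.keys f \<subseteq> global_sections \<Delta> L \<times> global_sections \<Delta> L'"
    "\<sigma> = free_product_map f"
    unfolding tensor_space_def using product_of_sections_coset by auto
  have "(\<Sum>(s, t)\<in>T. section_scale (Poly_Mapping.lookup f (s, t)) (section_prod s t))
      \<in> global_sections \<Delta> (bundle_tensor L L')" if "finite T" "T \<subseteq> global_sections \<Delta> L \<times> global_sections \<Delta> L'" for T
    using that
  proof (induction T)
    case empty then show ?case using global_sections_zero[OF tt] by (simp only: sum.empty)
  next
    case (insert x T)
    obtain u v where x: "x = (u, v)" by (cases x)
    have uv: "u \<in> global_sections \<Delta> L" "v \<in> global_sections \<Delta> L'" using insert.prems x by auto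
    have T: "T \<subseteq> global_sections \<Delta> L \<times> global_sections \<Delta> L'" using insert.prems by blast
    show ?case unfolding sum.insert[OF insert.hyps] unfolding x prod.case
      by (intro global_sections_add global_sections_scale global_sections_prod uv insert.IH[OF T])
  qed
  then show "\<sigma> \<in> global_sections \<Delta> (bundle_tensor L L')"
    unfolding f(2) free_product_map_def using f(1) by simp
next
  note tt = trivialization_tensor[OF t t']
  fix \<sigma> assume "\<sigma> \<in> global_sections \<Delta> (bundle_tensor L L')"
  from section_expansion[OF tt this] obtain S c where S: "finite S" "S \<subseteq> section_polytope (\<lambda>B. \<mu> B + \<nu> B)"
    and \<sigma>: "\<And>ij p. \<sigma> ij p = (\<Sum>m\<in>S. c m * char_section (bundle_tensor L L')
      (\<lambda>B (i, j) p. \<Phi> B i p * \<Psi> B j p) (\<lambda>B. \<mu> B + \<nu> B) m ij p)" by blast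
  have "\<forall>m\<in>S. \<exists>m12. fst m12 \<in> section_polytope \<mu> \<and> snd m12 \<in> section_polytope \<nu> \<and> m = fst m12 + snd m12"
    using split S(2) by fastforce
  from bchoice[OF this] obtain d where d: "\<forall>m\<in>S. fst (d m) \<in> section_polytope \<mu> \<and> snd (d m) \<in> section_polytope \<nu> \<and>
    m = fst (d m) + snd (d m)" ..
  define x where "x = (\<lambda>m. (char_section L \<Phi> \<mu> (fst (d m)), char_section L' \<Psi> \<nu> (snd (d m))))"
  define f where "f = (\<Sum>m\<in>S. Poly_Mapping.single (x m) (c m))"
  have xV: "x m \<in> global_sections \<Delta> L \<times> global_sections \<Delta> L'" if "m \<in> S" for m
    using d that char_section_global[OF t] char_section_global[OF t'] by (auto simp: x_def)
  have "Poly_Mapping.keys f \<subseteq> (\<Union>m\<in>S. Poly_Mapping.keys (Poly_Mapping.single (x m) (c m)))"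
    unfolding f_def by (rule keys_sum)
  also have "\<dots> \<subseteq> global_sections \<Delta> L \<times> global_sections \<Delta> L'"
  proof (rule UN_least)
    fix m assume m: "m \<in> S"
    have "Poly_Mapping.keys (Poly_Mapping.single (x m) (c m)) \<subseteq> {x m}" by simp
    also have "{x m} \<subseteq> global_sections \<Delta> L \<times> global_sections \<Delta> L'" by (simp only: insert_subset xV[OF m] empty_subsetI simp_thms)
    finally show "Poly_Mapping.keys (Poly_Mapping.single (x m) (c m)) \<subseteq>
      global_sections \<Delta> L \<times> global_sections \<Delta> L'" .
  qed
  finally have keys: "Poly_Mapping.keys f \<subseteq> global_sections \<Delta> L \<times> global_sections \<Delta> L'" .
  have single: "free_product_map (Poly_Mapping.single (x m) (c m)) =
      section_scale (c m) (section_prod (fst (x m)) (snd (x m)))" for m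
    unfolding free_product_map_single[symmetric] prod.collapse ..
  have "free_product_map f = (\<Sum>m\<in>S. section_scale (c m) (section_prod (fst (x m)) (snd (x m))))"
    unfolding f_def free_product_map_sum single ..
  also have "\<dots> = (\<Sum>m\<in>S. section_scale (c m) (char_section (bundle_tensor L L')
      (\<lambda>B (i, j) p. \<Phi> B i p * \<Psi> B j p) (\<lambda>B. \<mu> B + \<nu> B) m))"
  proof (rule sum.cong)
    fix m assume "m \<in> S"
    then have dm: "fst (d m) \<in> section_polytope \<mu>" "snd (d m) \<in> section_polytope \<nu>" "fst (d m) + snd (d m) = m"
      using d by auto
    show "section_scale (c m) (section_prod (fst (x m)) (snd (x m))) = section_scale (c m)
      (char_section (bundle_tensor L L') (\<lambda>B (i, j) p. \<Phi> B i p * \<Psi> B j p) (\<lambda>B. \<mu> B + \<nu> B) m)"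
      using char_section_mult[OF t t' dm(1,2)] dm(3) by (simp add: x_def)
  qed simp
  also have "\<dots> = \<sigma>" by (intro ext) (simp add: sum_fun_apply section_scale_def \<sigma>)
  finally have "product_of_sections ((+) f ` module.span free_scale
      (bilinear_relations (global_sections \<Delta> L) (global_sections \<Delta> L'))) = \<sigma>"
    unfolding product_of_sections_coset .
  then show "\<sigma> \<in> product_of_sections ` tensor_space (global_sections \<Delta> L) (global_sections \<Delta> L')"
    unfolding tensor_space_def using keys by blast
qed

end

section \<open>Simplicial cones\<close>

text \<open>Uniqueness is imposed for nonnegative coefficients, the form obtained later; it is
  equivalent to linear independence, since a relation can be separated by signs. An entry 1 in each
  generator makes it primitive.\<close>

definition simplicial :: "(int ^ ('l::finite)) set \<Rightarrow> bool" where
  "simplicial A \<longleftrightarrow> finite A \<and> (\<forall>C D. (\<forall>r\<in>A. 0 \<le> C r \<and> 0 \<le> D r) \<longrightarrow>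
     (\<Sum>r\<in>A. C r *\<^sub>R real_vec r) = (\<Sum>r\<in>A. D r *\<^sub>R real_vec r) \<longrightarrow> (\<forall>r\<in>A. C r = D r)) \<and>
     (\<forall>r\<in>A. \<exists>k. r $ k = 1)"

lemma simplicial_unique:
  assumes "simplicial A" "\<And>r. r \<in> A \<Longrightarrow> 0 \<le> C r" "\<And>r. r \<in> A \<Longrightarrow> 0 \<le> D r"
    "(\<Sum>r\<in>A. C r *\<^sub>R real_vec r) = (\<Sum>r\<in>A. D r *\<^sub>R real_vec r)" "r \<in> A"
  shows "C r = D r"
  using assms unfolding simplicial_def by blast

lemma cone_gen_mono: "A \<subseteq> B \<Longrightarrow> cone_gen A \<subseteq> cone_gen B"
  unfolding cone_gen_def by (intro hull_mono image_mono)

lemma cone_gen_subset_repr: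
  assumes "finite A" "B \<subseteq> A" "x \<in> cone_gen B"
  obtains C where "\<And>r. 0 \<le> C r" "\<And>r. r \<notin> B \<Longrightarrow> C r = 0" "x = (\<Sum>r\<in>A. C r *\<^sub>R real_vec r)"
proof -
  obtain c where c: "\<forall>r\<in>B. 0 \<le> c r" "x = (\<Sum>r\<in>B. c r *\<^sub>R real_vec r)"
    using assms mem_cone_gen_iff finite_subset by metis
  let ?C = "\<lambda>r. if r \<in> B then c r else 0"
  have "(\<Sum>r\<in>B. c r *\<^sub>R real_vec r) = (\<Sum>r\<in>A. ?C r *\<^sub>R real_vec r)"
    by (rule sum.mono_neutral_cong_left) (use assms in auto)
  then show ?thesis using c that[of ?C] by auto
qed

lemma cone_gen_face:
  assumes "simplicial A" "B \<subseteq> A"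
  shows "cone_gen B face_of cone_gen A"
  unfolding face_of_def
proof (intro conjI ballI impI)
  have fin: "finite A" using assms by (simp add: simplicial_def)
  show "cone_gen B \<subseteq> cone_gen A" using assms cone_gen_mono by blast
  show "convex (cone_gen B)" by (simp add: cone_gen_def convex_convex_cone_hull)
  fix a b x assume a: "a \<in> cone_gen A" and b: "b \<in> cone_gen A" and x: "x \<in> cone_gen B" "x \<in> open_segment a b"
  obtain Ca where Ca: "\<And>r. 0 \<le> Ca r" "a = (\<Sum>r\<in>A. Ca r *\<^sub>R real_vec r)"
    using cone_gen_subset_repr[OF fin order.refl a] by metis
  obtain Cb where Cb: "\<And>r. 0 \<le> Cb r" "b = (\<Sum>r\<in>A. Cb r *\<^sub>R real_vec r)"
    using cone_gen_subset_repr[OF fin order.refl b] by metis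
  obtain Cx where Cx: "\<And>r. 0 \<le> Cx r" "\<And>r. r \<notin> B \<Longrightarrow> Cx r = 0" "x = (\<Sum>r\<in>A. Cx r *\<^sub>R real_vec r)"
    using cone_gen_subset_repr[OF fin assms(2) x(1)] by metis
  obtain u where u: "0 < u" "u < 1" "x = (1 - u) *\<^sub>R a + u *\<^sub>R b"
    using x(2) by (auto simp: in_segment)
  have "x = (\<Sum>r\<in>A. ((1 - u) * Ca r + u * Cb r) *\<^sub>R real_vec r)"
    unfolding u(3) Ca(2) Cb(2) by (simp add: scaleR_sum_right sum.distrib scaleR_add_left)
  then have eq: "(\<Sum>r\<in>A. Cx r *\<^sub>R real_vec r) = (\<Sum>r\<in>A. ((1 - u) * Ca r + u * Cb r) *\<^sub>R real_vec r)"
    using Cx(3) by simp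
  have "Cx r = (1 - u) * Ca r + u * Cb r" if "r \<in> A" for r
    by (rule simplicial_unique[OF assms(1) _ _ eq that]) (use Ca Cb Cx u in auto)
  then have zero: "Ca r = 0 \<and> Cb r = 0" if "r \<in> A - B" for r
  proof -
    have e: "(1 - u) * Ca r + u * Cb r = 0" using that Cx(2)[of r] \<open>\<And>r. r \<in> A \<Longrightarrow> _ r = _\<close> by auto
    have "0 \<le> (1 - u) * Ca r" "0 \<le> u * Cb r" using u Ca(1) Cb(1) by auto
    then have "(1 - u) * Ca r = 0" "u * Cb r = 0" using e by linarith+
    then show ?thesis using u by auto
  qed
  have finB: "finite B" using fin assms finite_subset by blast
  have aB: "a = (\<Sum>r\<in>B. Ca r *\<^sub>R real_vec r)" and bB: "b = (\<Sum>r\<in>B. Cb r *\<^sub>R real_vec r)"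
    unfolding Ca(2) Cb(2) using zero fin assms(2) by (auto intro!: sum.mono_neutral_right)
  show "a \<in> cone_gen B" unfolding mem_cone_gen_iff[OF finB] by (intro exI[of _ Ca] conjI ballI Ca(1) aB)
  show "b \<in> cone_gen B" unfolding mem_cone_gen_iff[OF finB] by (intro exI[of _ Cb] conjI ballI Cb(1) bB)
qed

text \<open>A point of the face is the midpoint of twice its \<open>r\<close>-component and twice
  the sum of the others; a face containing an interior point of a segment in the cone contains its
  ends.\<close>

lemma face_splits_ray:
  assumes "finite A" "\<tau> face_of cone_gen A" "\<And>r. r \<in> A \<Longrightarrow> 0 \<le> C r"
    "(\<Sum>r\<in>A. C r *\<^sub>R real_vec r) \<in> \<tau>" "r \<in> A"
  shows "(2 * C r) *\<^sub>R real_vec r \<in> \<tau>"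
proof -
  let ?y = "\<Sum>r\<in>A. C r *\<^sub>R real_vec r"
  define a b where "a = (2 * C r) *\<^sub>R real_vec r" and "b = (\<Sum>s\<in>A. (if s = r then 0 else 2 * C s) *\<^sub>R real_vec s)"
  have a_sum: "a = (\<Sum>s\<in>A. (if s = r then 2 * C r else 0) *\<^sub>R real_vec s)"
  proof -
    have "(\<Sum>s\<in>A. (if s = r then 2 * C r else 0) *\<^sub>R real_vec s) = (\<Sum>s\<in>A. if s = r then a else 0)"
      by (rule sum.cong) (auto simp: a_def)
    then show ?thesis using assms(1,5) by simp
  qed
  have "a \<in> cone_gen A" unfolding mem_cone_gen_iff[OF assms(1)]
    by (intro exI[of _ "\<lambda>s. if s = r then 2 * C r else 0"] conjI a_sum) (use assms(3) assms(5) in simp)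
  moreover have "b \<in> cone_gen A" unfolding mem_cone_gen_iff[OF assms(1)]
    by (intro exI[of _ "\<lambda>s. if s = r then 0 else 2 * C s"] conjI b_def) (use assms(3) in simp)
  ultimately have ab: "a \<in> cone_gen A" "b \<in> cone_gen A" .
  have "a + b = (\<Sum>s\<in>A. 2 *\<^sub>R (C s *\<^sub>R real_vec s))"
    unfolding a_sum b_def sum.distrib[symmetric] by (rule sum.cong) auto
  then have "a + b = 2 *\<^sub>R ?y" unfolding scaleR_sum_right .
  then have y: "?y = (1 / 2) *\<^sub>R (a + b)" by simp
  show ?thesis
  proof (cases "a = b")
    case True
    then have "?y = a" unfolding y by (simp add: scaleR_2[symmetric])
    then show ?thesis using assms(4) by (simp add: a_def)
  next
    case False
    have "?y \<in> open_segment a b" unfolding y in_segment using False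
      by (auto intro!: exI[of _ "1/2"] simp: scaleR_add_right)
    then have "a \<in> \<tau>" using assms(2,4) ab unfolding face_of_def by blast
    then show ?thesis by (simp add: a_def)
  qed
qed

lemma cone_gen_singleton: "x \<in> cone_gen {v} \<longleftrightarrow> (\<exists>t\<ge>0. x = t *\<^sub>R real_vec v)"
proof -
  have *: "x \<in> cone_gen {v} \<longleftrightarrow> (\<exists>c. 0 \<le> c v \<and> x = c v *\<^sub>R real_vec v)" by (simp add: mem_cone_gen_iff)
  show ?thesis unfolding *
  proof
    assume "\<exists>t\<ge>0. x = t *\<^sub>R real_vec v"
    then obtain t where "0 \<le> t" "x = t *\<^sub>R real_vec v" by blast
    then show "\<exists>c. 0 \<le> c v \<and> x = c v *\<^sub>R real_vec v" by (intro exI[of _ "\<lambda>_. t"]) simp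
  qed blast
qed

text \<open>A primitive \<open>v\<close> spanning a face is a positive multiple of some generator
  \<open>r\<close>. At an entry where \<open>r\<close> is 1 the factor is an integer entry of
  \<open>v\<close>; it divides all entries of \<open>v\<close>, so it is 1.\<close>

lemma primitive_gens_simplicial:
  assumes "simplicial A"
  shows "primitive_gens (cone_gen A) = A"
proof (intro equalityI subsetI)
  fix r assume r: "r \<in> A"
  then obtain k where "r $ k = 1" using assms unfolding simplicial_def by blast
  then have "1 \<in> range (\<lambda>i. r $ i)" by (metis rangeI)
  then have "Gcd (range (\<lambda>i. r $ i)) = 1" by (rule Gcd_eq_1_I[rotated]) simp
  then have "primitive_vec r" unfolding primitive_vec_def .
  then show "r \<in> primitive_gens (cone_gen A)"
    using cone_gen_face[OF assms, of "{r}"] r by (simp add: primitive_gens_def)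
next
  fix v assume "v \<in> primitive_gens (cone_gen A)"
  then have v: "Gcd (range (\<lambda>i. v $ i)) = 1" "cone_gen {v} face_of cone_gen A"
    by (auto simp: primitive_gens_def primitive_vec_def)
  have fin: "finite A" using assms by (simp add: simplicial_def)
  have v_in: "real_vec v \<in> cone_gen {v}" unfolding cone_gen_singleton by (rule exI[of _ 1]) simp
  then have "real_vec v \<in> cone_gen A" using v(2) face_of_imp_subset by blast
  then obtain C where C: "\<forall>r\<in>A. 0 \<le> C r" "real_vec v = (\<Sum>r\<in>A. C r *\<^sub>R real_vec r)"
    using mem_cone_gen_iff[OF fin] by blast
  have "\<exists>i. v $ i \<noteq> 0"
  proof (rule ccontr)
    assume "\<not> ?thesis"
    then have "range (\<lambda>i. v $ i) = {0}" by auto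
    then show False using v(1) by simp
  qed
  then have "real_vec v \<noteq> 0" by (auto simp: real_vec_def vec_eq_iff)
  then have "\<exists>r\<in>A. C r \<noteq> 0" unfolding C(2) by (metis (no_types, lifting) scaleR_eq_0_iff sum.neutral)
  then obtain r where r: "r \<in> A" "C r > 0" using C(1) by force
  have "(2 * C r) *\<^sub>R real_vec r \<in> cone_gen {v}"
    using face_splits_ray[OF fin v(2) _ _ r(1), of C] C v_in by simp
  then obtain t where t: "t \<ge> 0" "(2 * C r) *\<^sub>R real_vec r = t *\<^sub>R real_vec v"
    unfolding cone_gen_singleton by blast
  obtain k where k: "r $ k = 1" using assms r unfolding simplicial_def by blast
  have comp: "2 * C r * of_int (r $ i) = t * of_int (v $ i)" for i
    using arg_cong[OF t(2), of "\<lambda>x. x $ i"] by (simp add: real_vec_def)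
  have t0: "t > 0" using comp[of k] k r(2) t(1) by (cases "t = 0") auto
  define c where "c = 2 * C r / t"
  have c: "c > 0" "of_int (v $ i) = c * of_int (r $ i)" for i
    using r t0 comp[of i] by (auto simp: c_def field_simps)
  have ck: "c = of_int (v $ k)" using c(2)[of k] k by simp
  then have vi: "v $ i = v $ k * r $ i" for i using c(2)[of i] by (metis of_int_eq_iff of_int_mult)
  have "v $ k dvd v $ i" for i using vi[of i] dvd_triv_left by metis
  then have "v $ k dvd Gcd (range (\<lambda>i. v $ i))" by (intro Gcd_greatest) blast
  then have "v $ k = 1" using v(1) c(1) ck by auto
  then have "v $ i = r $ i" for i using vi[of i] by simp
  then have "v = r" unfolding vec_eq_iff by blast
  then show "v \<in> A" using r by simp
qed

text \<open>The generators lying in the face span it: any generator with positive coefficient in a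
  point of the face lies in the face itself.\<close>

lemma face_of_simplicial:
  assumes fin: "finite A" and \<tau>: "\<tau> face_of cone_gen A" "\<tau> \<noteq> {}"
  shows "\<exists>B\<subseteq>A. \<tau> = cone_gen B"
proof (intro exI conjI)
  let ?B = "{r \<in> A. real_vec r \<in> \<tau>}"
  show "?B \<subseteq> A" by blast
  have sub: "\<tau> \<subseteq> cone_gen A" using \<tau>(1) face_of_imp_subset by blast
  have cA: "convex_cone (cone_gen A)" by (simp add: cone_gen_def convex_cone_convex_cone_hull)
  have scale: "k *\<^sub>R y \<in> \<tau>" if y: "y \<in> \<tau>" and k: "0 \<le> k" for y k
  proof (cases "y = 0")
    case True then show ?thesis using y by simp
  next
    case False
    \<comment> \<open>The factor exceeds both 1 and \<open>k\<close>, so \<open>y\<close> is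
      interior to the segment from 0 to \<open>?z\<close>, and the multiple of \<open>y\<close> by
      \<open>k\<close> lies on that segment as well.\<close>
    let ?z = "(k + 2) *\<^sub>R y"
    have "0 \<in> cone_gen A" "?z \<in> cone_gen A"
      using y k sub by (auto simp: cone_gen_def convex_cone_hull_contains_0 intro!: convex_cone_hull_mul)
    moreover have "y \<in> open_segment 0 ?z" unfolding in_segment using False k
      by (auto intro!: exI[of _ "1 / (k + 2)"])
    ultimately have "0 \<in> \<tau>" "?z \<in> \<tau>" using \<tau>(1) y unfolding face_of_def by blast+
    moreover have "convex \<tau>" using \<tau>(1) face_of_imp_convex by blast
    ultimately have "(1 - k / (k + 2)) *\<^sub>R 0 + (k / (k + 2)) *\<^sub>R ?z \<in> \<tau>"
      using k by (intro convexD) auto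
    then show ?thesis using k by simp
  qed
  have "convex_cone \<tau>" unfolding convex_cone_def conic_def
    using \<tau> face_of_imp_convex scale by blast
  then have "cone_gen ?B \<subseteq> \<tau>" unfolding cone_gen_def by (intro hull_minimal) auto
  moreover have "y \<in> cone_gen ?B" if y: "y \<in> \<tau>" for y
  proof -
    obtain C where C: "\<forall>r\<in>A. 0 \<le> C r" "y = (\<Sum>r\<in>A. C r *\<^sub>R real_vec r)"
      using y sub mem_cone_gen_iff[OF fin] by blast
    have "r \<in> ?B" if r: "r \<in> A" "C r \<noteq> 0" for r
    proof -
      have "(2 * C r) *\<^sub>R real_vec r \<in> \<tau>" using face_splits_ray[OF fin \<tau>(1) _ _ r(1), of C] C y by simp
      then have "(1 / (2 * C r)) *\<^sub>R ((2 * C r) *\<^sub>R real_vec r) \<in> \<tau>" using C(1) r(1) by (intro scale[of "(2 * C r) *\<^sub>R real_vec r"]) simp_all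
      moreover have "(1 / (2 * C r)) *\<^sub>R ((2 * C r) *\<^sub>R real_vec r) = real_vec r"
        unfolding scaleR_scaleR using r(2) by simp
      ultimately show ?thesis using r by (simp only: mem_Collect_eq simp_thms)
    qed
    then have "y = (\<Sum>r\<in>?B. C r *\<^sub>R real_vec r)"
      unfolding C(2) using fin by (intro sum.mono_neutral_right) auto
    then show ?thesis using C(1) fin by (subst mem_cone_gen_iff) (auto intro!: exI[of _ C])
  qed
  ultimately show "\<tau> = cone_gen ?B" by blast
qed

section \<open>The fan of the iterated blow-up\<close>

definition coord_rays :: "'l \<Rightarrow> (int ^ ('l::finite)) set" where
  "coord_rays q = (\<lambda>j. axis j 1) ` (UNIV - {q})"

definition blow_ray :: "'l \<Rightarrow> nat \<Rightarrow> int ^ ('l::finite)" where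
  "blow_ray q i = int i *s (\<Sum>j\<in>UNIV - {q}. axis j 1) + axis q 1"

definition blow_rays :: "'l \<Rightarrow> nat \<Rightarrow> (int ^ ('l::finite)) set" where
  "blow_rays q n = coord_rays q \<union> blow_ray q ` {..n}"

text \<open>Write u_i for \<open>blow_ray q i\<close>; u_0 is the coordinate vector e_q itself, so
  \<open>n\<close> counts the blow-ups. Only consecutive u_i occur together in a cone, and all the
  e_j with j other than q are joined to no u_i but the last, the earlier cones of that kind having
  been subdivided.\<close>

definition blow_simplices :: "'l \<Rightarrow> nat \<Rightarrow> (int ^ ('l::finite)) set set" where
  "blow_simplices q n = {A. A \<subseteq> blow_rays q n \<and>
     (coord_rays q \<subseteq> A \<longrightarrow> A \<inter> range (blow_ray q) \<subseteq> {blow_ray q n}) \<and>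
     (\<exists>i. A \<inter> range (blow_ray q) \<subseteq> {blow_ray q i, blow_ray q (Suc i)})}"

lemma axis_nth_if: "axis j (1::int) $ k = (if k = j then 1 else 0)"
  by (simp add: axis_def)

lemma blow_ray_nth: "blow_ray q i $ k = (if k = q then 1 else int i)"
proof -
  have "(\<Sum>j\<in>UNIV - {q}. axis j (1::int) $ k) = (\<Sum>j\<in>UNIV - {q}. if k = j then 1 else 0)"
    by (simp add: axis_nth_if)
  also have "\<dots> = (if k = q then 0 else 1)" by simp
  finally show ?thesis by (simp add: blow_ray_def sum_component axis_nth_if)
qed

context
  fixes q :: "'l::finite"
  assumes card2: "CARD('l) \<ge> 2"
begin

lemma ex_other: "\<exists>j. j \<noteq> q"
proof (rule ccontr)
  assume "\<not> ?thesis"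
  then have "(UNIV :: 'l set) = {q}" by auto
  then have "CARD('l) = 1" by (metis card_1_singleton_iff One_nat_def)
  then show False using card2 by simp
qed

lemma blow_ray_inj: "blow_ray q i = blow_ray q i' \<longleftrightarrow> i = i'"
proof
  assume e: "blow_ray q i = blow_ray q i'"
  obtain j where "j \<noteq> q" using ex_other by blast
  then show "i = i'" using arg_cong[OF e, of "\<lambda>v. v $ j"] by (simp add: blow_ray_nth)
qed simp

lemma coord_blow_disjoint: "coord_rays q \<inter> range (blow_ray q) = {}"
proof -
  have "r $ q = 0" if r: "r \<in> coord_rays q" for r
  proof -
    obtain j where "j \<noteq> q" "r = axis j 1" using r unfolding coord_rays_def by blast
    then show ?thesis by (simp add: axis_nth_if)
  qed
  moreover have "r $ q = 1" if "r \<in> range (blow_ray q)" for r using that by (auto simp: blow_ray_nth)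
  ultimately show ?thesis by fastforce
qed

lemma finite_blow_rays: "finite (blow_rays q n)"
  by (simp add: blow_rays_def coord_rays_def)

lemma sum_blow_rays:
  "(\<Sum>r\<in>blow_rays q n. f r) = (\<Sum>j\<in>UNIV - {q}. f (axis j 1)) + (\<Sum>i\<le>n. f (blow_ray q i))"
  for f :: "int ^ 'l \<Rightarrow> 'b::comm_monoid_add"
proof -
  have "(\<Sum>r\<in>blow_rays q n. f r) = (\<Sum>r\<in>coord_rays q. f r) + (\<Sum>r\<in>blow_ray q ` {..n}. f r)"
    unfolding blow_rays_def
    by (rule sum.union_disjoint) (use coord_blow_disjoint in \<open>auto simp: coord_rays_def\<close>)
  moreover have "(\<Sum>r\<in>coord_rays q. f r) = (\<Sum>j\<in>UNIV - {q}. f (axis j 1))"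
    unfolding coord_rays_def by (rule sum.reindex_cong[OF _ refl]) (auto simp: inj_on_def axis_eq_axis)
  moreover have "(\<Sum>r\<in>blow_ray q ` {..n}. f r) = (\<Sum>i\<le>n. f (blow_ray q i))"
    by (rule sum.reindex_cong[OF _ refl]) (auto simp: inj_on_def blow_ray_inj)
  ultimately show ?thesis by simp
qed

text \<open>The coefficients of a point with respect to the rays of a cone containing it: with
  \<open>w = min (Min\<^sub>j x\<^sub>j) (n x\<^sub>q)\<close> they are \<open>x\<^sub>j - w\<close> for \<open>e\<^sub>j\<close> and the hat function
  \<open>max 0 (x\<^sub>q - \<bar>w - k x\<^sub>q\<bar>)\<close> for the \<open>k\<close>-th blow-up ray. In particular they do not depend on the cone.\<close>

definition weight :: "nat \<Rightarrow> real ^ 'l \<Rightarrow> real" where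
  "weight n x = min (Min ((\<lambda>j. x $ j) ` (UNIV - {q}))) (real n * x $ q)"

lemma blow_coefficients:
  assumes A: "A \<in> blow_simplices q n" and C: "\<And>r. 0 \<le> C r" "\<And>r. r \<notin> A \<Longrightarrow> C r = 0"
    and x: "x = (\<Sum>r\<in>blow_rays q n. C r *\<^sub>R real_vec r)"
  shows "j \<noteq> q \<Longrightarrow> C (axis j 1) = x $ j - weight n x"
    and "k \<le> n \<Longrightarrow> C (blow_ray q k) = max 0 (x $ q - \<bar>weight n x - real k * x $ q\<bar>)"
proof -
  have x': "x $ k = (\<Sum>j\<in>UNIV - {q}. if k = j then C (axis j 1) else 0) +
      (\<Sum>i\<le>n. C (blow_ray q i) * (if k = q then 1 else real i))" for k
  proof -
    have "(C (axis j 1) *\<^sub>R real_vec (axis j 1)) $ k = (if k = j then C (axis j 1) else 0)" for j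
      by (simp add: real_vec_def axis_nth_if)
    moreover have "(C (blow_ray q i) *\<^sub>R real_vec (blow_ray q i)) $ k =
        C (blow_ray q i) * (if k = q then 1 else real i)" for i
      by (simp add: real_vec_def blow_ray_nth)
    ultimately show ?thesis unfolding x sum_blow_rays vector_add_component sum_component by (simp only:)
  qed
  have xq: "x $ q = (\<Sum>i\<le>n. C (blow_ray q i))" unfolding x'[of q] by simp
  have xj: "x $ j = C (axis j 1) + (\<Sum>i\<le>n. C (blow_ray q i) * real i)" if "j \<noteq> q" for j
    unfolding x'[of j] using that by simp
  obtain i where i: "A \<inter> range (blow_ray q) \<subseteq> {blow_ray q i, blow_ray q (Suc i)}"
    using A unfolding blow_simplices_def by blast
  have Cn: "C (blow_ray q k) = 0" if "k > n" for k
  proof -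
    have "blow_ray q k \<notin> blow_rays q n" using that coord_blow_disjoint blow_ray_inj
      unfolding blow_rays_def by fastforce
    then show ?thesis using A C(2) unfolding blow_simplices_def by blast
  qed
  have Ci: "C (blow_ray q k) = 0" if "k \<noteq> i" "k \<noteq> Suc i" for k
    using C(2)[of "blow_ray q k"] i that blow_ray_inj by blast
  \<comment> \<open>At most two consecutive blow-up rays occur; \<open>a\<close> and
    \<open>b\<close> are their coefficients.\<close>
  define a b where "a = C (blow_ray q i)" and "b = C (blow_ray q (Suc i))"
  have ab: "a \<ge> 0" "b \<ge> 0" using C(1) by (auto simp: a_def b_def)
  have sum_ab: "(\<Sum>k\<le>n. C (blow_ray q k) * g k) = a * g i + b * g (Suc i)" for g :: "nat \<Rightarrow> real"
  proof -
    have "(\<Sum>k\<le>n. C (blow_ray q k) * g k) = (\<Sum>k\<in>{..n} \<union> {i, Suc i}. C (blow_ray q k) * g k)"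
      by (rule sum.mono_neutral_left) (auto simp: Cn)
    also have "\<dots> = (\<Sum>k\<in>{i, Suc i}. C (blow_ray q k) * g k)"
      by (rule sum.mono_neutral_right) (auto simp: Ci)
    finally show ?thesis by (simp add: a_def b_def)
  qed
  \<comment> \<open>The blow-up rays add the same amount \<open>W\<close> to every coordinate other
    than \<open>q\<close>; the point is to recognize it as the weight.\<close>
  define W where "W = (\<Sum>k\<le>n. C (blow_ray q k) * real k)"
  have W_ab: "W = a * real i + b * (real i + 1)" using sum_ab[of real] by (simp add: W_def)
  have xq_ab: "x $ q = a + b" using sum_ab[of "\<lambda>_. 1"] xq by simp
  have W_le: "W \<le> real n * x $ q"
  proof -
    have "W \<le> (\<Sum>k\<le>n. C (blow_ray q k) * real n)" unfolding W_def
      using C(1) by (intro sum_mono mult_left_mono) auto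
    then show ?thesis unfolding xq by (simp add: sum_distrib_left mult.commute)
  qed
  have W_lej: "W \<le> x $ j" if "j \<noteq> q" for j using xj[OF that] C(1)[of "axis j 1"] by (simp add: W_def)
  have fin: "finite ((\<lambda>j. x $ j) ` (UNIV - {q}))" "(\<lambda>j. x $ j) ` (UNIV - {q}) \<noteq> {}"
    using ex_other by auto
  \<comment> \<open>If some e_j is missing, the coordinate \<open>x $ j\<close> equals
    \<open>W\<close> and attains the minimum. If none is missing, u_n is the only blow-up ray and
    \<open>W\<close> is \<open>n\<close> times \<open>x $ q\<close>.\<close>
  have "weight n x = W"
  proof (cases "coord_rays q \<subseteq> A")
    case False
    then obtain j where j: "j \<noteq> q" "axis j 1 \<notin> A" unfolding coord_rays_def by blast
    then have "x $ j = W" using xj[OF j(1)] C(2) by (simp add: W_def)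
    moreover have "Min ((\<lambda>j. x $ j) ` (UNIV - {q})) = x $ j"
      using W_lej j(1) \<open>x $ j = W\<close> by (intro Min_eqI) auto
    ultimately show ?thesis using W_le by (simp add: weight_def)
  next
    case True
    then have "A \<inter> range (blow_ray q) \<subseteq> {blow_ray q n}" using A unfolding blow_simplices_def by blast
    then have "C (blow_ray q k) = 0" if "k \<noteq> n" for k
      using C(2)[of "blow_ray q k"] that blow_ray_inj by blast
    then have "C (blow_ray q k) * real k = real n * C (blow_ray q k)" for k by (cases "k = n") auto
    then have "W = real n * x $ q" unfolding W_def xq sum_distrib_left by (intro sum.cong refl)
    moreover have "W \<le> Min ((\<lambda>j. x $ j) ` (UNIV - {q}))" using fin W_lej by auto
    ultimately show ?thesis by (simp add: weight_def)
  qed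
  then show "j \<noteq> q \<Longrightarrow> C (axis j 1) = x $ j - weight n x" using xj by (simp add: W_def)
  assume "k \<le> n"
  \<comment> \<open>\<open>W\<close> lies between \<open>i\<close> and \<open>i + 1\<close> times
    \<open>x $ q\<close>, so the hat functions at these two indices return \<open>a\<close> and
    \<open>b\<close> and all others return zero.\<close>
  consider "k = i" | "k = Suc i" | "k < i" | "k > Suc i" by linarith
  then show "C (blow_ray q k) = max 0 (x $ q - \<bar>weight n x - real k * x $ q\<bar>)"
    unfolding \<open>weight n x = W\<close> W_ab xq_ab
  proof cases
    case 1
    then have "a * real i + b * (real i + 1) - real k * (a + b) = b" by (simp add: algebra_simps)
    then show "C (blow_ray q k) = max 0 (a + b - \<bar>a * real i + b * (real i + 1) - real k * (a + b)\<bar>)"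
      using 1 ab by (simp add: a_def)
  next
    case 2
    then have "a * real i + b * (real i + 1) - real k * (a + b) = - a" by (simp add: algebra_simps)
    then show "C (blow_ray q k) = max 0 (a + b - \<bar>a * real i + b * (real i + 1) - real k * (a + b)\<bar>)"
      using 2 ab by (simp add: b_def)
  next
    case 3
    have "a * real i + b * (real i + 1) - real k * (a + b) = a * (real i - real k) + b * (real i + 1 - real k)"
      by (simp add: algebra_simps)
    moreover have "a * 1 \<le> a * (real i - real k)" "b * 1 \<le> b * (real i + 1 - real k)"
      by (rule mult_left_mono; use 3 ab in linarith)+
    ultimately have "a + b \<le> \<bar>a * real i + b * (real i + 1) - real k * (a + b)\<bar>" by simp
    then show "C (blow_ray q k) = max 0 (a + b - \<bar>a * real i + b * (real i + 1) - real k * (a + b)\<bar>)"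
      using 3 Ci by simp
  next
    case 4
    have "- (a * real i + b * (real i + 1) - real k * (a + b)) = a * (real k - real i) + b * (real k - real i - 1)"
      by (simp add: algebra_simps)
    moreover have "a * 1 \<le> a * (real k - real i)" "b * 1 \<le> b * (real k - real i - 1)"
      by (rule mult_left_mono; use 4 ab in linarith)+
    ultimately have "a + b \<le> \<bar>a * real i + b * (real i + 1) - real k * (a + b)\<bar>" by simp
    then show "C (blow_ray q k) = max 0 (a + b - \<bar>a * real i + b * (real i + 1) - real k * (a + b)\<bar>)"
      using 4 Ci by simp
  qed
qed

lemma blow_coefficients_unique:
  assumes "A \<in> blow_simplices q n" "\<And>r. 0 \<le> C r" "\<And>r. r \<notin> A \<Longrightarrow> C r = 0"
    and "B \<in> blow_simplices q n" "\<And>r. 0 \<le> D r" "\<And>r. r \<notin> B \<Longrightarrow> D r = 0"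
    and "(\<Sum>r\<in>blow_rays q n. C r *\<^sub>R real_vec r) = (\<Sum>r\<in>blow_rays q n. D r *\<^sub>R real_vec r)"
    and "r \<in> blow_rays q n"
  shows "C r = D r"
proof -
  consider j where "j \<noteq> q" "r = axis j 1" | k where "k \<le> n" "r = blow_ray q k"
    using assms(8) unfolding blow_rays_def coord_rays_def by blast
  then show ?thesis
  proof cases
    case 1
    then show ?thesis
      using blow_coefficients(1)[where C = C, OF assms(1-3) refl 1(1)]
        blow_coefficients(1)[where C = D, OF assms(4-6) refl 1(1)] assms(7) by simp
  next
    case 2
    then show ?thesis
      using blow_coefficients(2)[where C = C, OF assms(1-3) refl 2(1)]
        blow_coefficients(2)[where C = D, OF assms(4-6) refl 2(1)] assms(7) by simp
  qed
qed

lemma blow_simplicesI: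
  "A \<subseteq> blow_rays q n \<Longrightarrow> (coord_rays q \<subseteq> A \<Longrightarrow> A \<inter> range (blow_ray q) \<subseteq> {blow_ray q n}) \<Longrightarrow>
   A \<inter> range (blow_ray q) \<subseteq> {blow_ray q i, blow_ray q (Suc i)} \<Longrightarrow> A \<in> blow_simplices q n"
  unfolding blow_simplices_def by blast

lemma blow_simplices_top:
  "A \<in> blow_simplices q n \<Longrightarrow> coord_rays q \<subseteq> A \<Longrightarrow> A \<inter> range (blow_ray q) \<subseteq> {blow_ray q n}"
  unfolding blow_simplices_def by blast

lemma centre_simplex: "insert (blow_ray q n) (coord_rays q) \<in> blow_simplices q n"
proof (rule blow_simplicesI[of _ _ n])
  show "insert (blow_ray q n) (coord_rays q) \<subseteq> blow_rays q n" unfolding blow_rays_def by blast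
  have "insert (blow_ray q n) (coord_rays q) \<inter> range (blow_ray q) \<subseteq> {blow_ray q n}"
    using coord_blow_disjoint by blast
  then show "insert (blow_ray q n) (coord_rays q) \<inter> range (blow_ray q) \<subseteq> {blow_ray q n}"
    "insert (blow_ray q n) (coord_rays q) \<inter> range (blow_ray q) \<subseteq> {blow_ray q n, blow_ray q (Suc n)}"
    by blast+
qed

lemma blow_simplices_rays: "A \<in> blow_simplices q n \<Longrightarrow> A \<subseteq> blow_rays q n"
  by (simp add: blow_simplices_def)

lemma blow_simplices_subset: "A \<in> blow_simplices q n \<Longrightarrow> B \<subseteq> A \<Longrightarrow> B \<in> blow_simplices q n"
  unfolding blow_simplices_def by blast

lemma blow_simplicial:
  assumes A: "A \<in> blow_simplices q n" shows "simplicial A"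
  unfolding simplicial_def
proof (intro conjI allI impI ballI)
  note sub = blow_simplices_rays[OF A]
  show "finite A" using sub finite_blow_rays finite_subset by blast
  fix r assume r: "r \<in> A"
  then consider j where "r = axis j 1" | k where "r = blow_ray q k"
    using sub unfolding blow_rays_def coord_rays_def by blast
  then show "\<exists>k. r $ k = 1" by cases (auto simp: axis_nth_if blow_ray_nth)
next
  note sub = blow_simplices_rays[OF A]
  fix C D r assume CD: "\<forall>r\<in>A. 0 \<le> C r \<and> 0 \<le> D r"
    and eq: "(\<Sum>r\<in>A. C r *\<^sub>R real_vec r) = (\<Sum>r\<in>A. D r *\<^sub>R real_vec r)" and r: "r \<in> A"
  have ext: "(\<Sum>r\<in>blow_rays q n. (if r \<in> A then F r else 0) *\<^sub>R real_vec r) = (\<Sum>r\<in>A. F r *\<^sub>R real_vec r)"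
    for F :: "int ^ 'l \<Rightarrow> real"
    by (rule sum.mono_neutral_cong_right) (use sub finite_blow_rays in auto)
  have "(if r \<in> A then C r else 0) = (if r \<in> A then D r else 0)"
    by (rule blow_coefficients_unique[OF A _ _ A])
      (use CD eq r sub in \<open>auto simp: ext\<close>)
  then show "C r = D r" using r by simp
qed

text \<open>A common point has the same coefficients with respect to both cones, so only common rays
  carry nonzero ones.\<close>

lemma blow_inter:
  assumes A: "A \<in> blow_simplices q n" and B: "B \<in> blow_simplices q n"
  shows "cone_gen A \<inter> cone_gen B = cone_gen (A \<inter> B)"
proof (intro equalityI subsetI)
  fix x assume x: "x \<in> cone_gen A \<inter> cone_gen B"
  obtain C where C: "\<And>r. 0 \<le> C r" "\<And>r. r \<notin> A \<Longrightarrow> C r = 0" "x = (\<Sum>r\<in>blow_rays q n. C r *\<^sub>R real_vec r)"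
    using cone_gen_subset_repr[OF finite_blow_rays blow_simplices_rays[OF A]] x by (metis IntD1)
  obtain D where D: "\<And>r. 0 \<le> D r" "\<And>r. r \<notin> B \<Longrightarrow> D r = 0" "x = (\<Sum>r\<in>blow_rays q n. D r *\<^sub>R real_vec r)"
    using cone_gen_subset_repr[OF finite_blow_rays blow_simplices_rays[OF B]] x by (metis IntD2)
  have eq: "C r = D r" if "r \<in> blow_rays q n" for r
    using blow_coefficients_unique[where C = C and D = D, OF A C(1,2) B D(1,2) _ that] C(3) D(3) by simp
  have "C r = 0" if "r \<in> blow_rays q n - A \<inter> B" for r
    using that eq[of r] C(2)[of r] D(2)[of r] by auto
  then have xC: "x = (\<Sum>r\<in>A \<inter> B. C r *\<^sub>R real_vec r)"
    unfolding C(3) using blow_simplices_rays[OF A] finite_blow_rays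
    by (intro sum.mono_neutral_right) auto
  have fin: "finite (A \<inter> B)" using blow_simplices_rays[OF A] finite_blow_rays finite_subset by blast
  show "x \<in> cone_gen (A \<inter> B)"
    unfolding mem_cone_gen_iff[OF fin] by (intro exI[of _ C] conjI ballI C(1) xC)
next
  fix x assume "x \<in> cone_gen (A \<inter> B)"
  then show "x \<in> cone_gen A \<inter> cone_gen B" using cone_gen_mono[of "A \<inter> B"] by blast
qed

lemma cone_gen_subset_iff:
  assumes A: "A \<in> blow_simplices q n" and B: "B \<in> blow_simplices q n"
  shows "cone_gen A \<subseteq> cone_gen B \<longleftrightarrow> A \<subseteq> B"
proof
  assume "cone_gen A \<subseteq> cone_gen B"
  then have "cone_gen (A \<inter> B) = cone_gen A" using blow_inter[OF A B] by blast
  then have "primitive_gens (cone_gen (A \<inter> B)) = primitive_gens (cone_gen A)" by simp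
  then have "A \<inter> B = A"
    using primitive_gens_simplicial blow_simplicial[OF A] blow_simplicial[OF blow_simplices_subset[OF A, of "A \<inter> B"]]
    by auto
  then show "A \<subseteq> B" by blast
qed (rule cone_gen_mono)

lemma blow_ray_Suc: "(\<Sum>v\<in>insert (blow_ray q n) (coord_rays q). v) = blow_ray q (Suc n)"
proof -
  have "blow_ray q n \<notin> coord_rays q" using coord_blow_disjoint by blast
  moreover have "finite (coord_rays q)" by (simp add: coord_rays_def)
  moreover have "(\<Sum>v\<in>coord_rays q. v) = (\<Sum>j\<in>UNIV - {q}. axis j 1)"
    unfolding coord_rays_def by (rule sum.reindex_cong[OF _ refl]) (auto simp: inj_on_def axis_eq_axis)
  ultimately show ?thesis by (simp add: blow_ray_def vec_eq_iff algebra_simps)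
qed

text \<open>Star subdivision on the level of vertex sets. The centre \<open>c n\<close> is a maximal
  simplex, as all the e_j together admit no blow-up ray other than u_n; the simplices replacing it
  consist of vertices of the centre, not all of them, and possibly u_(n+1).\<close>

lemma blow_simplices_Suc:
  defines "c n \<equiv> insert (blow_ray q n) (coord_rays q)"
  shows "blow_simplices q (Suc n) = {A \<in> blow_simplices q n. \<not> c n \<subseteq> A} \<union>
    {A. \<exists>B\<in>blow_simplices q n. c n \<subseteq> B \<and> A \<subseteq> insert (blow_ray q (Suc n)) B \<and> \<not> c n \<subseteq> A}"
proof (intro equalityI subsetI)
  have c: "c n \<in> blow_simplices q n" unfolding c_def by (rule centre_simplex)
  fix A assume A: "A \<in> blow_simplices q (Suc n)"
  obtain i where i: "A \<inter> range (blow_ray q) \<subseteq> {blow_ray q i, blow_ray q (Suc i)}"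
    using A unfolding blow_simplices_def by blast
  have mem: "k = i \<or> k = Suc i" if "blow_ray q k \<in> A" for k
    using subsetD[OF i, of "blow_ray q k"] that by (simp add: blow_ray_inj)
  have R: "A \<subseteq> coord_rays q \<union> blow_ray q ` {..Suc n}" using A unfolding blow_simplices_def blow_rays_def by blast
  have cn: "\<not> c n \<subseteq> A"
  proof
    assume "c n \<subseteq> A"
    then have "coord_rays q \<subseteq> A" "blow_ray q n \<in> A" by (auto simp: c_def)
    then have "blow_ray q n = blow_ray q (Suc n)" using blow_simplices_top[OF A] by blast
    then show False by (simp add: blow_ray_inj)
  qed
  show "A \<in> {A \<in> blow_simplices q n. \<not> c n \<subseteq> A} \<union>
    {A. \<exists>B\<in>blow_simplices q n. c n \<subseteq> B \<and> A \<subseteq> insert (blow_ray q (Suc n)) B \<and> \<not> c n \<subseteq> A}"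
  proof (cases "blow_ray q (Suc n) \<in> A")
    case False
    have "A \<in> blow_simplices q n"
    proof (rule blow_simplicesI[OF _ _ i])
      show "A \<subseteq> blow_rays q n" using R False unfolding blow_rays_def by (auto simp: atMost_Suc)
      show "A \<inter> range (blow_ray q) \<subseteq> {blow_ray q n}" if "coord_rays q \<subseteq> A"
      proof
        fix r assume "r \<in> A \<inter> range (blow_ray q)"
        then have "r = blow_ray q (Suc n)" "r \<in> A" using blow_simplices_top[OF A that] by auto
        then show "r \<in> {blow_ray q n}" using False by simp
      qed
    qed
    then show ?thesis using cn by blast
  next
    case True
    then have "Suc n = i \<or> Suc n = Suc i" by (rule mem)
    \<comment> \<open>u_(n+1) can be accompanied by no blow-up ray but u_n: the other neighbouring
      index, n + 2, is beyond the available rays.\<close>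
    have "A \<subseteq> insert (blow_ray q (Suc n)) (c n)"
    proof
      fix r assume r: "r \<in> A"
      consider "r \<in> coord_rays q" | k where "k \<le> Suc n" "r = blow_ray q k" using R r by auto
      then show "r \<in> insert (blow_ray q (Suc n)) (c n)"
      proof cases
        case 1 then show ?thesis by (simp add: c_def)
      next
        case 2
        then have "k = i \<or> k = Suc i" using mem[of k] r by simp
        then have "k = n \<or> k = Suc n" using \<open>Suc n = i \<or> Suc n = Suc i\<close> 2(1) by auto
        then show ?thesis using 2 by (auto simp: c_def)
      qed
    qed
    then show ?thesis using c cn by blast
  qed
next
  fix A assume "A \<in> {A \<in> blow_simplices q n. \<not> c n \<subseteq> A} \<union>
    {A. \<exists>B\<in>blow_simplices q n. c n \<subseteq> B \<and> A \<subseteq> insert (blow_ray q (Suc n)) B \<and> \<not> c n \<subseteq> A}"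
  then consider "A \<in> blow_simplices q n" "\<not> c n \<subseteq> A"
    | B where "B \<in> blow_simplices q n" "c n \<subseteq> B" "A \<subseteq> insert (blow_ray q (Suc n)) B" "\<not> c n \<subseteq> A" by blast
  then show "A \<in> blow_simplices q (Suc n)"
  proof cases
    case 1
    obtain i where i: "A \<inter> range (blow_ray q) \<subseteq> {blow_ray q i, blow_ray q (Suc i)}"
      using 1(1) unfolding blow_simplices_def by blast
    show ?thesis
    proof (rule blow_simplicesI[OF _ _ i])
      show "A \<subseteq> blow_rays q (Suc n)" using blow_simplices_rays[OF 1(1)] unfolding blow_rays_def by (auto simp: atMost_Suc)
      show "A \<inter> range (blow_ray q) \<subseteq> {blow_ray q (Suc n)}" if "coord_rays q \<subseteq> A"
      proof
        fix r assume "r \<in> A \<inter> range (blow_ray q)"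
        then have "r = blow_ray q n" "r \<in> A" using blow_simplices_top[OF 1(1) that] by auto
        then show "r \<in> {blow_ray q (Suc n)}" using 1(2) that by (simp add: c_def)
      qed
    qed
  next
    case 2
    have "coord_rays q \<subseteq> B" using 2(2) by (simp add: c_def)
    then have "B \<inter> range (blow_ray q) \<subseteq> {blow_ray q n}" by (rule blow_simplices_top[OF 2(1)])
    then have AU: "A \<inter> range (blow_ray q) \<subseteq> {blow_ray q n, blow_ray q (Suc n)}" using 2(3) by auto
    show ?thesis
    proof (rule blow_simplicesI[OF _ _ AU])
      show "A \<inter> range (blow_ray q) \<subseteq> {blow_ray q (Suc n)}" if "coord_rays q \<subseteq> A"
      proof
        fix r assume r: "r \<in> A \<inter> range (blow_ray q)"
        then have "r = blow_ray q n \<or> r = blow_ray q (Suc n)" using AU by auto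
        moreover have "blow_ray q n \<notin> A" using 2(4) that by (simp add: c_def)
        ultimately show "r \<in> {blow_ray q (Suc n)}" using r by auto
      qed
      show "A \<subseteq> blow_rays q (Suc n)"
        using 2(3) blow_simplices_rays[OF 2(1)] unfolding blow_rays_def by (auto simp: atMost_Suc)
    qed
  qed
qed

lemma range_axis_eq: "range (\<lambda>j. axis j 1) = blow_rays q 0"
proof -
  have "blow_ray q 0 = axis q 1" by (simp add: vec_eq_iff blow_ray_nth axis_nth_if)
  then show ?thesis unfolding blow_rays_def coord_rays_def by auto
qed

lemma blow_simplices_0: "blow_simplices q 0 = Pow (blow_rays q 0)"
proof (intro equalityI subsetI)
  fix A assume "A \<in> Pow (blow_rays q 0)"
  then have "A \<subseteq> blow_rays q 0" by blast
  moreover have "A \<inter> range (blow_ray q) \<subseteq> {blow_ray q 0}"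
    using calculation coord_blow_disjoint unfolding blow_rays_def by auto
  ultimately show "A \<in> blow_simplices q 0" unfolding blow_simplices_def by blast
qed (simp add: blow_simplices_def)

text \<open>The cones are simplicial with primitive generators, so \<open>primitive_gens\<close>
  returns the vertex set and the geometric star subdivision becomes the combinatorial one. The
  starting fan consists of the faces of the orthant.\<close>

theorem blowup_fan_eq: "blowup_fan q n = cone_gen ` blow_simplices q n"
proof (induction n)
  case 0
  have top: "blow_rays q 0 \<in> blow_simplices q 0" by (simp add: blow_simplices_0)
  have "affine_space_fan = cone_gen ` Pow (blow_rays q 0)"
    unfolding affine_space_fan_def range_axis_eq
  proof (intro equalityI subsetI)
    fix \<tau> assume "\<tau> \<in> {\<tau>. \<tau> face_of cone_gen (blow_rays q 0) \<and> \<tau> \<noteq> {}}"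
    then show "\<tau> \<in> cone_gen ` Pow (blow_rays q 0)" using face_of_simplicial[OF finite_blow_rays] by blast
  next
    fix \<tau> :: "(real ^ 'l) set" assume "\<tau> \<in> cone_gen ` Pow (blow_rays q 0)"
    then obtain B where "B \<subseteq> blow_rays q 0" "\<tau> = cone_gen B" by blast
    moreover have "cone_gen B \<noteq> {}" by (simp add: cone_gen_def convex_cone_hull_nonempty)
    ultimately show "\<tau> \<in> {\<tau>. \<tau> face_of cone_gen (blow_rays q 0) \<and> \<tau> \<noteq> {}}"
      using cone_gen_face[OF blow_simplicial[OF top]] by blast
  qed
  then show ?case by (simp add: blow_simplices_0)
next
  case (Suc n)
  define c where "c = insert (blow_ray q n) (coord_rays q)"
  have c: "c \<in> blow_simplices q n" unfolding c_def by (rule centre_simplex)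
  have centre: "centre_cone q n = cone_gen c"
    by (simp add: centre_cone_def c_def blow_ray_def coord_rays_def)
  have pg: "primitive_gens (cone_gen A) = A" if "A \<in> blow_simplices q n" for A
    using primitive_gens_simplicial blow_simplicial that by blast
  have "star_subdivision (blowup_fan q n) (centre_cone q n) =
      cone_gen ` ({A \<in> blow_simplices q n. \<not> c \<subseteq> A} \<union>
        {A. \<exists>B\<in>blow_simplices q n. c \<subseteq> B \<and> A \<subseteq> insert (blow_ray q (Suc n)) B \<and> \<not> c \<subseteq> A})"
    unfolding star_subdivision_def centre Suc image_Un
  proof (rule arg_cong2[of _ _ _ _ "(\<union>)"])
    show "{\<sigma> \<in> cone_gen ` blow_simplices q n. \<not> cone_gen c \<subseteq> \<sigma>} =
        cone_gen ` {A \<in> blow_simplices q n. \<not> c \<subseteq> A}"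
      using cone_gen_subset_iff[OF c] by auto
    have u: "(\<Sum>v\<in>c. v) = blow_ray q (Suc n)" unfolding c_def by (rule blow_ray_Suc)
    show "{cone_gen A |A \<sigma>. \<sigma> \<in> cone_gen ` blow_simplices q n \<and> cone_gen c \<subseteq> \<sigma> \<and>
        A \<subseteq> insert (\<Sum>v\<in>primitive_gens (cone_gen c). v) (primitive_gens \<sigma>) \<and>
        \<not> primitive_gens (cone_gen c) \<subseteq> A} =
      cone_gen ` {A. \<exists>B\<in>blow_simplices q n. c \<subseteq> B \<and> A \<subseteq> insert (blow_ray q (Suc n)) B \<and> \<not> c \<subseteq> A}"
      unfolding pg[OF c] u
    proof (intro equalityI subsetI)
      fix \<tau> assume "\<tau> \<in> {cone_gen A |A \<sigma>. \<sigma> \<in> cone_gen ` blow_simplices q n \<and> cone_gen c \<subseteq> \<sigma> \<and>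
        A \<subseteq> insert (blow_ray q (Suc n)) (primitive_gens \<sigma>) \<and> \<not> c \<subseteq> A}"
      then obtain A B where AB: "\<tau> = cone_gen A" "B \<in> blow_simplices q n" "cone_gen c \<subseteq> cone_gen B"
        "A \<subseteq> insert (blow_ray q (Suc n)) (primitive_gens (cone_gen B))" "\<not> c \<subseteq> A" by blast
      then have "c \<subseteq> B" "A \<subseteq> insert (blow_ray q (Suc n)) B"
        using cone_gen_subset_iff[OF c AB(2)] pg[OF AB(2)] by auto
      then show "\<tau> \<in> cone_gen ` {A. \<exists>B\<in>blow_simplices q n. c \<subseteq> B \<and> A \<subseteq> insert (blow_ray q (Suc n)) B \<and> \<not> c \<subseteq> A}"
        using AB by blast
    next
      fix \<tau> assume "\<tau> \<in> cone_gen ` {A. \<exists>B\<in>blow_simplices q n. c \<subseteq> B \<and> A \<subseteq> insert (blow_ray q (Suc n)) B \<and> \<not> c \<subseteq> A}"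
      then obtain A B where AB: "\<tau> = cone_gen A" "B \<in> blow_simplices q n" "c \<subseteq> B"
        "A \<subseteq> insert (blow_ray q (Suc n)) B" "\<not> c \<subseteq> A" by blast
      then have "cone_gen c \<subseteq> cone_gen B" "A \<subseteq> insert (blow_ray q (Suc n)) (primitive_gens (cone_gen B))"
        using cone_gen_mono[OF AB(3)] AB(4) pg[OF AB(2)] by simp_all
      then show "\<tau> \<in> {cone_gen A |A \<sigma>. \<sigma> \<in> cone_gen ` blow_simplices q n \<and> cone_gen c \<subseteq> \<sigma> \<and>
        A \<subseteq> insert (blow_ray q (Suc n)) (primitive_gens \<sigma>) \<and> \<not> c \<subseteq> A}" using AB by blast
    qed
  qed
  then show ?case using blow_simplices_Suc[of n] by (simp add: c_def)
qed

end

section \<open>Lattice bases for the maximal cones of the blow-up\<close>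

lemma pairing_axis [simp]: "pairing (axis j 1) r = r $ j" "pairing m (axis j 1) = m $ j"
proof -
  have "(\<Sum>i\<in>UNIV. axis j 1 $ i * r $ i) = (\<Sum>i\<in>UNIV. if i = j then r $ j else 0)"
    "(\<Sum>i\<in>UNIV. m $ i * axis j 1 $ i) = (\<Sum>i\<in>UNIV. if i = j then m $ j else 0)"
    by (rule sum.cong; simp add: axis_nth_if)+
  then show "pairing (axis j 1) r = r $ j" "pairing m (axis j 1) = m $ j" by (simp_all add: pairing_def)
qed

context
  fixes q :: "'l::finite"
  assumes card2: "CARD('l) \<ge> 2"
begin

lemma pairing_blow_ray: "pairing m (blow_ray q i) = int i * (\<Sum>j\<in>UNIV - {q}. m $ j) + m $ q"
proof -
  have "pairing m (blow_ray q i) = m $ q * 1 + (\<Sum>j\<in>UNIV - {q}. m $ j * int i)"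
    unfolding pairing_def by (subst sum.remove[of _ q]) (auto simp: blow_ray_nth intro!: sum.cong)
  then show ?thesis by (simp add: sum_distrib_left mult.commute)
qed

text \<open>Besides the cone on u_n and all the e_j, these are the maximal cones, for
  \<open>i < n\<close>: two consecutive blow-up rays together with all the e_j except e_p.\<close>

definition edge_simplex :: "'l \<Rightarrow> nat \<Rightarrow> (int ^ 'l) set" where
  "edge_simplex p i = insert (blow_ray q i) (insert (blow_ray q (Suc i)) (coord_rays q - {axis p 1}))"

lemma coord_rays_sum: "(\<Sum>r\<in>coord_rays q. f r) = (\<Sum>j\<in>UNIV - {q}. f (axis j 1))"
  for f :: "int ^ 'l \<Rightarrow> 'b::comm_monoid_add"
  unfolding coord_rays_def by (rule sum.reindex_cong[OF _ refl]) (auto simp: inj_on_def axis_eq_axis)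

lemma blow_ray_notin_coord: "blow_ray q i \<notin> coord_rays q"
  using coord_blow_disjoint[OF card2] by blast

lemma axis_neq_blow_ray: "j \<noteq> q \<Longrightarrow> axis j 1 \<noteq> blow_ray q k"
proof
  assume j: "j \<noteq> q" and eq: "axis j 1 = blow_ray q k"
  have "axis j (1::int) $ q = blow_ray q k $ q" unfolding eq by (rule refl)
  then show False using j by (simp add: axis_nth_if blow_ray_nth)
qed

lemma finite_coord_rays: "finite (coord_rays q)"
  by (simp add: coord_rays_def)

lemma axis_sum_nth:
  "(\<Sum>j\<in>UNIV - {q}. m $ j * axis j (1::int) $ k) = (if k = q then 0 else m $ k)"
proof -
  have "(\<Sum>j\<in>UNIV - {q}. m $ j * axis j (1::int) $ k) = (\<Sum>j\<in>UNIV - {q}. if k = j then m $ k else 0)"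
    by (rule sum.cong) (auto simp: axis_nth_if)
  then show ?thesis by simp
qed

lemma axis_sum_shift_nth:
  "(\<Sum>j\<in>UNIV - {q}. m $ j *s (axis j 1 - w)) $ k =
     (if k = q then 0 else m $ k) - (\<Sum>j\<in>UNIV - {q}. m $ j) * (w $ k :: int)"
  unfolding axis_sum_nth[symmetric]
  by (simp only: sum_component vector_smult_component vector_minus_component right_diff_distrib
      sum_subtractf sum_distrib_right)

lemma dual_family_top: "\<exists>d. dual_family (insert (blow_ray q n) (coord_rays q)) d"
proof -
  let ?B = "insert (blow_ray q n) (coord_rays q)"
  \<comment> \<open>Read off from the coefficients of \<open>x\<close> in this basis: x_q at u_n and
    x_j - n x_q at e_j.\<close>
  define d where "d = (\<lambda>r. if r = blow_ray q n then axis q 1 else r - int n *s axis q 1)"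
  have d_coord: "d (axis j 1) = axis j 1 - int n *s axis q 1" if "j \<noteq> q" for j
    using axis_neq_blow_ray[OF that] by (simp add: d_def)
  have "pairing (d r) s = (if r = s then 1 else 0)" if rs: "r \<in> ?B" "s \<in> ?B" for r s
  proof -
    consider "r = blow_ray q n" "s = blow_ray q n"
      | j where "r = blow_ray q n" "s = axis j 1" "j \<noteq> q"
      | j where "r = axis j 1" "j \<noteq> q" "s = blow_ray q n"
      | j k where "r = axis j 1" "j \<noteq> q" "s = axis k 1" "k \<noteq> q"
      using rs unfolding coord_rays_def by blast
    then show ?thesis
    proof cases
      case 1 then show ?thesis by (simp add: d_def blow_ray_nth)
    next
      case 2
      then have "r \<noteq> s" using axis_neq_blow_ray by metis
      then show ?thesis using 2 by (simp add: d_def axis_nth_if)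
    next
      case 3
      then have "r \<noteq> s" using axis_neq_blow_ray by metis
      then show ?thesis using 3 by (simp add: d_coord pairing_diff pairing_smult blow_ray_nth)
    next
      case 4
      then show ?thesis by (simp add: d_coord pairing_diff pairing_smult axis_nth_if axis_eq_axis)
    qed
  qed
  moreover have "m = (\<Sum>r\<in>?B. pairing m r *s d r)" for m
  proof -
    have "(\<Sum>r\<in>?B. pairing m r *s d r) $ k = m $ k" for k
    proof -
      let ?S = "\<Sum>j\<in>UNIV - {q}. m $ j"
      have eq: "(\<Sum>r\<in>?B. pairing m r *s d r) =
          (int n * ?S + m $ q) *s axis q 1 + (\<Sum>j\<in>UNIV - {q}. m $ j *s (axis j 1 - int n *s axis q 1))"
        using blow_ray_notin_coord finite_coord_rays
        by (simp add: coord_rays_sum pairing_blow_ray d_coord) (simp add: d_def)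
      show ?thesis
        unfolding eq vector_add_component axis_sum_shift_nth vector_smult_component
        by (simp add: axis_nth_if algebra_simps)
    qed
    then show ?thesis by (simp add: vec_eq_iff)
  qed
  ultimately show ?thesis unfolding dual_family_def by blast
qed

lemma dual_family_edge:
  assumes p: "p \<noteq> q" shows "\<exists>d. dual_family (edge_simplex p i) d"
proof -
  let ?u = "blow_ray q i" and ?u' = "blow_ray q (Suc i)" and ?E = "coord_rays q - {axis p 1}"
  have uu': "?u \<noteq> ?u'" using blow_ray_inj[OF card2] by simp
  \<comment> \<open>Solved from x_q = a + b and x_p = i a + (i + 1) b, with a and b the coefficients
    at u_i and u_(i+1); the coefficient at e_j is then x_j - x_p.\<close>
  define d where "d = (\<lambda>r. if r = ?u then (int i + 1) *s axis q 1 - axis p 1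
    else if r = ?u' then axis p 1 - int i *s axis q 1 else r - axis p 1)"
  have du: "d ?u = (int i + 1) *s axis q 1 - axis p 1" "d ?u' = axis p 1 - int i *s axis q 1"
    using uu' by (auto simp: d_def)
  note ax = axis_neq_blow_ray
  have d_coord: "d (axis j 1) = axis j 1 - axis p 1" if "j \<noteq> q" for j
    using ax[OF that] by (simp add: d_def)
  have "pairing (d r) s = (if r = s then 1 else 0)" if r: "r \<in> edge_simplex p i" and s: "s \<in> edge_simplex p i" for r s
  proof -
    have cases: "x = ?u \<or> x = ?u' \<or> (\<exists>j. x = axis j 1 \<and> j \<noteq> q \<and> j \<noteq> p)" if "x \<in> edge_simplex p i" for x
      using that unfolding edge_simplex_def coord_rays_def by auto
    from cases[OF r] show ?thesis
    proof (elim disjE exE conjE)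
      assume r: "r = ?u"
      from cases[OF s] show ?thesis
        using p uu' ax by (elim disjE exE conjE)
          (auto simp: r du ax[symmetric] distrib_right pairing_add pairing_diff pairing_smult blow_ray_nth axis_nth_if)
    next
      assume r: "r = ?u'"
      from cases[OF s] show ?thesis
        using p uu' ax by (elim disjE exE conjE)
          (auto simp: r du ax[symmetric] distrib_right pairing_add pairing_diff pairing_smult blow_ray_nth axis_nth_if)
    next
      fix j assume r: "r = axis j 1" "j \<noteq> q" "j \<noteq> p"
      from cases[OF s] show ?thesis
        using p uu' ax r by (elim disjE exE conjE)
          (auto simp: d_coord pairing_diff pairing_smult blow_ray_nth axis_nth_if axis_eq_axis)
    qed
  qed
  moreover have "m = (\<Sum>r\<in>edge_simplex p i. pairing m r *s d r)" for m
  proof -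
    have "(\<Sum>r\<in>edge_simplex p i. pairing m r *s d r) $ k = m $ k" for k
    proof -
      let ?S = "\<Sum>j\<in>UNIV - {q}. m $ j"
      have E: "(\<Sum>r\<in>?E. pairing m r *s d r) = (\<Sum>j\<in>UNIV - {q}. m $ j *s (axis j 1 - axis p 1))"
      proof -
        have pE: "axis p 1 \<in> coord_rays q" using p by (auto simp: coord_rays_def)
        have "(\<Sum>r\<in>coord_rays q. pairing m r *s (r - axis p 1)) = (\<Sum>r\<in>?E. pairing m r *s (r - axis p 1))"
          by (subst sum.remove[OF finite_coord_rays pE]) simp
        moreover have "(\<Sum>r\<in>?E. pairing m r *s d r) = (\<Sum>r\<in>?E. pairing m r *s (r - axis p 1))"
          by (rule sum.cong[OF refl], unfold coord_rays_def, elim DiffE imageE) (simp only: d_coord simp_thms singleton_iff)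
        ultimately show ?thesis by (simp add: coord_rays_sum)
      qed
      have eq: "(\<Sum>r\<in>edge_simplex p i. pairing m r *s d r) = pairing m ?u *s d ?u + (pairing m ?u' *s d ?u' +
          (\<Sum>r\<in>?E. pairing m r *s d r))"
        unfolding edge_simplex_def using uu' blow_ray_notin_coord finite_coord_rays by simp
      show ?thesis
        unfolding eq E du pairing_blow_ray vector_add_component axis_sum_shift_nth vector_smult_component
          vector_minus_component
        using p by (simp add: axis_nth_if algebra_simps)
    qed
    then show ?thesis by (simp add: vec_eq_iff)
  qed
  ultimately show ?thesis unfolding dual_family_def by blast
qed

lemma edge_simplex_mem:
  assumes "p \<noteq> q" "i < n" shows "edge_simplex p i \<in> blow_simplices q n"
proof (rule blow_simplicesI[where q = q and n = n and i = i, OF card2])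
  show "edge_simplex p i \<subseteq> blow_rays q n" using assms unfolding edge_simplex_def blow_rays_def by auto
  have "axis p 1 \<in> coord_rays q" using assms by (auto simp: coord_rays_def)
  moreover have "axis p 1 \<notin> edge_simplex p i"
    using calculation blow_ray_notin_coord unfolding edge_simplex_def by auto
  ultimately show "edge_simplex p i \<inter> range (blow_ray q) \<subseteq> {blow_ray q n}" if "coord_rays q \<subseteq> edge_simplex p i"
    using that by blast
  show "edge_simplex p i \<inter> range (blow_ray q) \<subseteq> {blow_ray q i, blow_ray q (Suc i)}"
    using coord_blow_disjoint[OF card2] unfolding edge_simplex_def by blast
qed

text \<open>A simplex outside the cone on u_n and the e_j contains some u_k with k < n. It therefore
  omits an e_p, and its blow-up rays are among u_i and u_(i+1) with i < n.\<close>

lemma blow_simplices_basis: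
  assumes A: "A \<in> blow_simplices q n"
  shows "\<exists>B\<in>blow_simplices q n. A \<subseteq> B \<and> (\<exists>d. dual_family B d)"
proof -
  have R: "A \<subseteq> coord_rays q \<union> blow_ray q ` {..n}" using blow_simplices_rays[OF card2 A] by (simp add: blow_rays_def)
  show ?thesis
  proof (cases "A \<subseteq> insert (blow_ray q n) (coord_rays q)")
    case True
    then show ?thesis using centre_simplex[OF card2] dual_family_top by blast
  next
    case False
    then obtain k where k: "blow_ray q k \<in> A" "k < n" using R by force
    obtain i where i: "A \<inter> range (blow_ray q) \<subseteq> {blow_ray q i, blow_ray q (Suc i)}"
      using A unfolding blow_simplices_def by blast
    then have "k = i \<or> k = Suc i" using subsetD[OF i, of "blow_ray q k"] k by (simp add: blow_ray_inj[OF card2])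
    then have "i < n" using k by auto
    have "\<not> coord_rays q \<subseteq> A"
    proof
      assume "coord_rays q \<subseteq> A"
      then have "blow_ray q k = blow_ray q n" using blow_simplices_top[OF card2 A] k by blast
      then show False using k by (simp add: blow_ray_inj[OF card2])
    qed
    then obtain p where p: "p \<noteq> q" "axis p 1 \<notin> A" by (auto simp: coord_rays_def)
    have "A \<subseteq> edge_simplex p i"
    proof
      fix r assume r: "r \<in> A"
      then consider "r \<in> coord_rays q" | "r \<in> range (blow_ray q)" using R by blast
      then show "r \<in> edge_simplex p i"
        using r p(2) i unfolding edge_simplex_def by cases auto
    qed
    then show ?thesis using edge_simplex_mem[OF p(1) \<open>i < n\<close>] dual_family_edge[OF p(1)] by blast
  qed
qed

lemma smooth_fan_blowup: "smooth_fan (blow_rays q n) (blow_simplices q n) (blowup_fan q n)"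
proof
  show "finite (blow_rays q n)" by (rule finite_blow_rays[OF card2])
  show "A \<subseteq> blow_rays q n" if "A \<in> blow_simplices q n" for A using blow_simplices_rays[OF card2 that] .
  show "B \<in> blow_simplices q n" if "A \<in> blow_simplices q n" "B \<subseteq> A" for A B
    using blow_simplices_subset[OF card2 that] .
  show "\<exists>B\<in>blow_simplices q n. A \<subseteq> B \<and> (\<exists>d. dual_family B d)" if "A \<in> blow_simplices q n" for A
    using blow_simplices_basis[OF that] .
  show "cone_gen A \<inter> cone_gen B = cone_gen (A \<inter> B)" if "A \<in> blow_simplices q n" "B \<in> blow_simplices q n" for A B
    using blow_inter[OF card2 that] .
  show "blowup_fan q n = cone_gen ` blow_simplices q n" by (rule blowup_fan_eq[OF card2])
  show "blow_simplices q n \<noteq> {}" using centre_simplex[OF card2] by blast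
qed

end

section \<open>Decomposition of lattice points\<close>

text \<open>Discrete intermediate values, assigned greedily: each entry takes the least value from
  which the remaining upper bounds can still reach \<open>s\<close>.\<close>

lemma sum_between:
  fixes lo hi :: "'a \<Rightarrow> int"
  assumes "finite J" "\<And>j. j \<in> J \<Longrightarrow> lo j \<le> hi j" "(\<Sum>j\<in>J. lo j) \<le> s" "s \<le> (\<Sum>j\<in>J. hi j)"
  shows "\<exists>y. (\<forall>j\<in>J. lo j \<le> y j \<and> y j \<le> hi j) \<and> (\<Sum>j\<in>J. y j) = s"
  using assms
proof (induction J arbitrary: s)
  case (insert i J)
  define t where "t = max (lo i) (s - (\<Sum>j\<in>J. hi j))"
  have lh: "(\<Sum>j\<in>J. lo j) \<le> (\<Sum>j\<in>J. hi j)" using insert.prems(1) by (intro sum_mono) auto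
  have "lo i \<le> hi i" using insert.prems by blast
  then have t: "lo i \<le> t" "t \<le> hi i" using insert by (auto simp: t_def)
  have "(\<Sum>j\<in>J. lo j) \<le> s - t" "s - t \<le> (\<Sum>j\<in>J. hi j)" using insert lh by (auto simp: t_def)
  then obtain y where y: "\<forall>j\<in>J. lo j \<le> y j \<and> y j \<le> hi j" "(\<Sum>j\<in>J. y j) = s - t"
    using insert.IH insert.prems(1) by blast
  have "(\<Sum>j\<in>J. (y(i := t)) j) = (\<Sum>j\<in>J. y j)" using insert.hyps by (intro sum.cong) auto
  then show ?case using y t insert.hyps by (intro exI[of _ "y(i := t)"]) auto
qed auto

text \<open>The plane case: \<open>\<beta>\<close> bounds the pairings with the blow-up rays, and \<open>S 0 \<ge> S 1 \<ge> \<dots> \<ge> S n\<close> are the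
  first coordinates of the vertices of the polygon. A point whose first coordinate lies between two
  consecutive vertices of the sum is split along the corresponding edges of the summands.\<close>

lemma edge_bound:
  fixes \<beta> S :: "nat \<Rightarrow> int"
  assumes V: "\<And>i k. i \<le> n \<Longrightarrow> k \<le> n \<Longrightarrow> \<beta> k - \<beta> i \<le> (int k - int i) * S i"
    and i: "i \<le> n" "k \<le> n" and lo: "S i \<le> x"
    and hi: "\<And>j. i = Suc j \<Longrightarrow> x \<le> S j \<and> \<beta> (Suc j) - \<beta> j = S j"
    and y: "\<beta> i - int i * x \<le> y"
  shows "\<beta> k \<le> int k * x + y"
\<comment> \<open>Constraints after \<open>i\<close> follow from the vertex with abscissa
  \<open>S i\<close> to the left of \<open>x\<close>, those before \<open>i\<close> from the
  preceding vertex to its right.\<close>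
proof (cases "i \<le> k")
  case True
  have "(int k - int i) * S i \<le> (int k - int i) * x" using True lo by (intro mult_left_mono) auto
  then show ?thesis using V[OF i] y by (simp add: algebra_simps)
next
  case False
  then obtain j where j: "i = Suc j" by (cases i) auto
  have "(int i - int k) * x \<le> (int i - int k) * S j" using False hi[OF j] by (intro mult_left_mono) auto
  moreover have "\<beta> k - \<beta> j \<le> (int k - int j) * S j" using V[of j k] i j by simp
  ultimately show ?thesis using hi[OF j] y j by (simp add: algebra_simps)
qed

lemma polygon_split:
  fixes \<beta> \<beta>' S S' :: "nat \<Rightarrow> int"
  assumes V: "\<And>i k. i \<le> n \<Longrightarrow> k \<le> n \<Longrightarrow> \<beta> k - \<beta> i \<le> (int k - int i) * S i"
    and V': "\<And>i k. i \<le> n \<Longrightarrow> k \<le> n \<Longrightarrow> \<beta>' k - \<beta>' i \<le> (int k - int i) * S' i"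
    and S: "\<And>i. i < n \<Longrightarrow> \<beta> (Suc i) - \<beta> i = S i" and S': "\<And>i. i < n \<Longrightarrow> \<beta>' (Suc i) - \<beta>' i = S' i"
    and a: "\<And>i. i \<le> n \<Longrightarrow> S n \<le> S i" and a': "\<And>i. i \<le> n \<Longrightarrow> S' n \<le> S' i"
    and s: "S n + S' n \<le> s" and st: "\<And>k. k \<le> n \<Longrightarrow> \<beta> k + \<beta>' k \<le> int k * s + t"
  shows "\<exists>x y. S n \<le> x \<and> S' n \<le> s - x \<and> (\<forall>k\<le>n. \<beta> k \<le> int k * x + y) \<and>
    (\<forall>k\<le>n. \<beta>' k \<le> int k * (s - x) + (t - y))"
proof -
  \<comment> \<open>The first index whose vertex in the sum is not to the right of \<open>s\<close>;
    the preceding one, if any, is to the right, so \<open>s\<close> lies over the edge between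
    them.\<close>
  define i where "i = (LEAST i. i \<le> n \<and> S i + S' i \<le> s)"
  have i: "i \<le> n" "S i + S' i \<le> s" using LeastI[of "\<lambda>i. i \<le> n \<and> S i + S' i \<le> s" n] s by (auto simp: i_def)
  have "\<exists>x. S i \<le> x \<and> S' i \<le> s - x \<and> (\<forall>j. i = Suc j \<longrightarrow> x \<le> S j \<and> s - x \<le> S' j)"
  proof (cases i)
    case 0
    then show ?thesis using i by (intro exI[of _ "S i"]) auto
  next
    case (Suc j)
    then have j: "j < n" "S j + S' j > s"
      using i(1) not_less_Least[of j "\<lambda>i. i \<le> n \<and> S i + S' i \<le> s"] by (auto simp: i_def)
    \<comment> \<open>Convexity of the bounds at three consecutive indices; at the last index, which
      has no following difference, the separate hypothesis on \<open>S n\<close> takes its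
      place.\<close>
    have "S i \<le> S j"
    proof (cases "i = n")
      case True then show ?thesis using a[of j] j by simp
    next
      case False
      then have "i < n" using i by simp
      then show ?thesis using V[of j "Suc i"] S[of i] S[of j] j Suc by simp
    qed
    moreover have "S' i \<le> S' j"
    proof (cases "i = n")
      case True then show ?thesis using a'[of j] j by simp
    next
      case False
      then have "i < n" using i by simp
      then show ?thesis using V'[of j "Suc i"] S'[of i] S'[of j] j Suc by simp
    qed
    \<comment> \<open>The abscissa of the first summand is taken as large as its own edge and the
      lower end of the other edge allow.\<close>
    ultimately show ?thesis using i j Suc by (intro exI[of _ "min (S j) (s - S' i)"]) auto
  qed
  then obtain x where x: "S i \<le> x" "S' i \<le> s - x" "\<And>j. i = Suc j \<Longrightarrow> x \<le> S j \<and> s - x \<le> S' j" by blast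
  \<comment> \<open>The first point is put on its \<open>i\<close>-th supporting line, so that the
    whole slack of the given point remains for the second.\<close>
  define y where "y = \<beta> i - int i * x"
  have "\<beta> k \<le> int k * x + y" if "k \<le> n" for k
    by (rule edge_bound[of n \<beta> S i]) (use V i that x S in \<open>auto simp: y_def\<close>)
  moreover have "\<beta>' i - int i * (s - x) \<le> t - y" using st[OF i(1)] by (simp add: y_def algebra_simps)
  then have "\<beta>' k \<le> int k * (s - x) + (t - y)" if "k \<le> n" for k
    by (rule edge_bound[of n \<beta>' S' i, rotated -1]) (use V' i that x S' in auto)
  moreover have "S n \<le> x" "S' n \<le> s - x" using a[OF i(1)] a'[OF i(1)] x by auto
  ultimately show ?thesis by blast
qed

section \<open>Support numbers and the projected polygon\<close>

context
  fixes q :: "'l::finite" and n :: nat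
  assumes card2: "CARD('l) \<ge> 2"
begin

interpretation F: smooth_fan "blow_rays q n" "blow_simplices q n" "blowup_fan q n"
  by (rule smooth_fan_blowup[OF card2])

text \<open>The support number of the ray \<open>r\<close>; under \<open>nef\<close> every maximal
  cone containing \<open>r\<close> gives the same value, so the choice is immaterial.\<close>

definition bound :: "((int ^ 'l) set \<Rightarrow> int ^ 'l) \<Rightarrow> int ^ 'l \<Rightarrow> int" where
  "bound \<mu> r = pairing (\<mu> (SOME B. B \<in> F.max_cones \<and> r \<in> B)) r"

text \<open>Collects what the polytope argument uses of a globally generated bundle: vertices given
  by the \<open>\<mu> B\<close>, and weights that fit together to a piecewise linear function on the
  fan.\<close>

definition nef :: "((int ^ 'l) set \<Rightarrow> int ^ 'l) \<Rightarrow> bool" where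
  "nef \<mu> \<longleftrightarrow> (\<forall>B\<in>F.max_cones. \<mu> B \<in> F.section_polytope \<mu>) \<and>
     (\<forall>A\<in>F.max_cones. \<forall>B\<in>F.max_cones. \<forall>r\<in>A \<inter> B. pairing (\<mu> A) r = pairing (\<mu> B) r)"

lemma bound_eq:
  assumes "nef \<mu>" "B \<in> F.max_cones" "r \<in> B" shows "pairing (\<mu> B) r = bound \<mu> r"
proof -
  let ?A = "SOME A. A \<in> F.max_cones \<and> r \<in> A"
  have "?A \<in> F.max_cones \<and> r \<in> ?A" by (rule someI[of _ B]) (use assms in blast)
  then show ?thesis using assms unfolding nef_def bound_def by blast
qed

lemma ray_in_max:
  assumes "r \<in> blow_rays q n" obtains B where "B \<in> F.max_cones" "r \<in> B"
proof -
  obtain i where i: "r \<in> coord_rays q \<or> r = blow_ray q i"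
    using assms unfolding blow_rays_def by auto
  have "{r} \<in> blow_simplices q n"
  proof (rule blow_simplicesI[where q = q and n = n and i = i, OF card2])
    show "{r} \<subseteq> blow_rays q n" using assms by simp
    show "{r} \<inter> range (blow_ray q) \<subseteq> {blow_ray q i, blow_ray q (Suc i)}"
      using i coord_blow_disjoint[OF card2] by blast
    obtain j where "j \<noteq> q" using ex_other[OF card2] by blast
    then have "axis j 1 \<in> coord_rays q" by (auto simp: coord_rays_def)
    then show "{r} \<inter> range (blow_ray q) \<subseteq> {blow_ray q n}" if "coord_rays q \<subseteq> {r}"
      using that coord_blow_disjoint[OF card2] by blast
  qed
  then show ?thesis using F.max_above that by blast
qed

lemma polytope_bound:
  assumes "nef \<mu>"
  shows "m \<in> F.section_polytope \<mu> \<longleftrightarrow> (\<forall>r\<in>blow_rays q n. bound \<mu> r \<le> pairing m r)"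
proof
  assume m: "m \<in> F.section_polytope \<mu>"
  show "\<forall>r\<in>blow_rays q n. bound \<mu> r \<le> pairing m r"
  proof
    fix r assume "r \<in> blow_rays q n"
    then obtain B where B: "B \<in> F.max_cones" "r \<in> B" by (rule ray_in_max)
    then have "0 \<le> pairing (m - \<mu> B) r" using F.section_polytopeD[OF m B(1)] by blast
    then show "bound \<mu> r \<le> pairing m r" using bound_eq[OF assms B] by (simp add: pairing_diff)
  qed
next
  assume b: "\<forall>r\<in>blow_rays q n. bound \<mu> r \<le> pairing m r"
  show "m \<in> F.section_polytope \<mu>" unfolding F.section_polytope_def
  proof (intro CollectI ballI)
    fix B r assume B: "B \<in> F.max_cones" and r: "r \<in> B"
    then have "r \<in> blow_rays q n" using F.max_conesD by blast
    then show "0 \<le> pairing (m - \<mu> B) r" using b bound_eq[OF assms B r] by (auto simp: pairing_diff)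
  qed
qed

text \<open>Abscissas of the vertices of the projected polygon. With b_i the bound at u_i, the lines
  i x + y = b_i and (i + 1) x + y = b_(i+1) meet at x = b_(i+1) - b_i; the last vertex is cut out by
  the e_j, whose bounds add up to the least value of x.\<close>

definition slope :: "((int ^ 'l) set \<Rightarrow> int ^ 'l) \<Rightarrow> nat \<Rightarrow> int" where
  "slope \<mu> i = (if i < n then bound \<mu> (blow_ray q (Suc i)) - bound \<mu> (blow_ray q i)
     else (\<Sum>j\<in>UNIV - {q}. bound \<mu> (axis j 1)))"

lemma blow_ray_mem: "k \<le> n \<Longrightarrow> blow_ray q k \<in> blow_rays q n" and
  axis_mem: "j \<noteq> q \<Longrightarrow> axis j 1 \<in> blow_rays q n"
  by (auto simp: blow_rays_def coord_rays_def)

text \<open>The lattice point \<open>\<mu> B\<close> of a suitable maximal cone projects to the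
  \<open>i\<close>-th vertex; that it satisfies every other inequality of the polytope gives both
  estimates.\<close>

lemma nef_slopes:
  assumes nef: "nef \<mu>" and i: "i \<le> n"
  shows "slope \<mu> n \<le> slope \<mu> i"
    and "k \<le> n \<Longrightarrow> bound \<mu> (blow_ray q k) - bound \<mu> (blow_ray q i) \<le> (int k - int i) * slope \<mu> i"
proof -
  have vertex: "\<exists>v. (\<forall>r\<in>blow_rays q n. bound \<mu> r \<le> pairing v r) \<and> (\<Sum>j\<in>UNIV - {q}. v $ j) = slope \<mu> i \<and>
    pairing v (blow_ray q i) = bound \<mu> (blow_ray q i)"
  proof (cases "i = n")
    case True
    let ?B = "insert (blow_ray q n) (coord_rays q)"
    have B: "?B \<in> F.max_cones" unfolding F.max_cones_def
      using centre_simplex[OF card2] dual_family_top[OF card2] by blast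
    have "\<mu> ?B $ j = bound \<mu> (axis j 1)" if "j \<noteq> q" for j
      using bound_eq[OF nef B, of "axis j 1"] that by (simp add: coord_rays_def)
    then have "(\<Sum>j\<in>UNIV - {q}. \<mu> ?B $ j) = slope \<mu> i" using True by (simp add: slope_def)
    moreover have "\<forall>r\<in>blow_rays q n. bound \<mu> r \<le> pairing (\<mu> ?B) r"
      using nef B polytope_bound[OF nef] unfolding nef_def by blast
    moreover have "pairing (\<mu> ?B) (blow_ray q i) = bound \<mu> (blow_ray q i)"
      using bound_eq[OF nef B, of "blow_ray q n"] True by simp
    ultimately show ?thesis by blast
  next
    case False
    then have i: "i < n" using assms by simp
    \<comment> \<open>Any e_p may be left out of the cone: the projection only sees u_i and
      u_(i+1).\<close>
    obtain p where p: "p \<noteq> q" using ex_other[OF card2] by blast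
    let ?B = "edge_simplex q p i"
    have B: "?B \<in> F.max_cones" unfolding F.max_cones_def
      using edge_simplex_mem[OF card2 p i] dual_family_edge[OF card2 p] by blast
    have u: "pairing (\<mu> ?B) (blow_ray q i) = bound \<mu> (blow_ray q i)"
      "pairing (\<mu> ?B) (blow_ray q (Suc i)) = bound \<mu> (blow_ray q (Suc i))"
      by (rule bound_eq[OF nef B]; simp add: edge_simplex_def[OF card2])+
    have "(\<Sum>j\<in>UNIV - {q}. \<mu> ?B $ j) = slope \<mu> i"
      using u i unfolding pairing_blow_ray[OF card2] slope_def by (simp add: algebra_simps)
    moreover have "\<forall>r\<in>blow_rays q n. bound \<mu> r \<le> pairing (\<mu> ?B) r"
      using nef B polytope_bound[OF nef] unfolding nef_def by blast
    ultimately show ?thesis using u by blast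
  qed
  then obtain v where v: "\<And>r. r \<in> blow_rays q n \<Longrightarrow> bound \<mu> r \<le> pairing v r"
    "(\<Sum>j\<in>UNIV - {q}. v $ j) = slope \<mu> i" "pairing v (blow_ray q i) = bound \<mu> (blow_ray q i)" by blast
  have "bound \<mu> (axis j 1) \<le> v $ j" if "j \<noteq> q" for j using v(1)[OF axis_mem[OF that]] by simp
  then show "slope \<mu> n \<le> slope \<mu> i" unfolding v(2)[symmetric] by (auto simp: slope_def intro!: sum_mono)
  show "bound \<mu> (blow_ray q k) - bound \<mu> (blow_ray q i) \<le> (int k - int i) * slope \<mu> i" if "k \<le> n"
    using v(1)[OF blow_ray_mem[OF that]] v(3) unfolding pairing_blow_ray[OF card2] v(2)
    by (simp add: algebra_simps)
qed

lemma polytope_split: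
  assumes nef: "nef \<mu>" "nef \<nu>" and m: "m \<in> F.section_polytope (\<lambda>B. \<mu> B + \<nu> B)"
  shows "\<exists>m1\<in>F.section_polytope \<mu>. \<exists>m2\<in>F.section_polytope \<nu>. m = m1 + m2"
proof -
  have b: "bound \<mu> r + bound \<nu> r \<le> pairing m r" if r: "r \<in> blow_rays q n" for r
  proof -
    obtain B where B: "B \<in> F.max_cones" "r \<in> B" using ray_in_max[OF r] .
    have "0 \<le> pairing (m - (\<mu> B + \<nu> B)) r" using F.section_polytopeD[OF m B(1)] B(2) by blast
    then show ?thesis using bound_eq[OF nef(1) B] bound_eq[OF nef(2) B] by (simp add: pairing_diff pairing_add)
  qed
  define s where "s = (\<Sum>j\<in>UNIV - {q}. m $ j)"
  have bj: "bound \<mu> (axis j 1) + bound \<nu> (axis j 1) \<le> m $ j" if "j \<noteq> q" for j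
    using b[OF axis_mem[OF that]] by simp
  have "(\<Sum>j\<in>UNIV - {q}. bound \<mu> (axis j 1) + bound \<nu> (axis j 1)) \<le> s"
    unfolding s_def using bj by (intro sum_mono) auto
  then have "slope \<mu> n + slope \<nu> n \<le> s" by (simp add: slope_def sum.distrib)
  moreover have "bound \<mu> (blow_ray q k) + bound \<nu> (blow_ray q k) \<le> int k * s + m $ q" if "k \<le> n" for k
    using b[OF blow_ray_mem[OF that]] unfolding pairing_blow_ray[OF card2] s_def .
  ultimately obtain x y where xy: "slope \<mu> n \<le> x" "slope \<nu> n \<le> s - x"
    "\<And>k. k \<le> n \<Longrightarrow> bound \<mu> (blow_ray q k) \<le> int k * x + y"
    "\<And>k. k \<le> n \<Longrightarrow> bound \<nu> (blow_ray q k) \<le> int k * (s - x) + (m $ q - y)"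
    using polygon_split[of n "\<lambda>k. bound \<mu> (blow_ray q k)" "slope \<mu>" "\<lambda>k. bound \<nu> (blow_ray q k)" "slope \<nu>" s "m $ q"]
      nef_slopes[OF nef(1)] nef_slopes[OF nef(2)] by (auto simp: slope_def)
  \<comment> \<open>Each \<open>z j\<close> must respect the bound of \<open>\<mu>\<close> and leave
    enough of \<open>m $ j\<close> for \<open>\<nu>\<close>; the plane conditions on
    \<open>x\<close> and \<open>s - x\<close> say that \<open>x\<close> lies between the two
    totals.\<close>
  have "\<exists>z. (\<forall>j\<in>UNIV - {q}. bound \<mu> (axis j 1) \<le> z j \<and> z j \<le> m $ j - bound \<nu> (axis j 1)) \<and>
    (\<Sum>j\<in>UNIV - {q}. z j) = x"
  proof (rule sum_between)
    show "bound \<mu> (axis j 1) \<le> m $ j - bound \<nu> (axis j 1)" if "j \<in> UNIV - {q}" for j using bj[of j] that by simp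
    show "(\<Sum>j\<in>UNIV - {q}. bound \<mu> (axis j 1)) \<le> x" using xy(1) by (simp add: slope_def)
    show "x \<le> (\<Sum>j\<in>UNIV - {q}. m $ j - bound \<nu> (axis j 1))"
      using xy(2) by (simp add: slope_def sum_subtractf s_def)
  qed simp
  then obtain z where z: "\<And>j. j \<noteq> q \<Longrightarrow> bound \<mu> (axis j 1) \<le> z j \<and> z j \<le> m $ j - bound \<nu> (axis j 1)"
    "(\<Sum>j\<in>UNIV - {q}. z j) = x" by auto
  define m1 where "m1 = (\<chi> j. if j = q then y else z j)"
  have m1: "m1 $ q = y" "(\<Sum>j\<in>UNIV - {q}. m1 $ j) = x" "\<And>j. j \<noteq> q \<Longrightarrow> m1 $ j = z j"
    using z(2) by (auto simp: m1_def)
  have rays: "(\<forall>r\<in>blow_rays q n. f r \<le> pairing v r) \<longleftrightarrow>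
      (\<forall>j. j \<noteq> q \<longrightarrow> f (axis j 1) \<le> v $ j) \<and> (\<forall>k\<le>n. f (blow_ray q k) \<le> int k * (\<Sum>j\<in>UNIV - {q}. v $ j) + v $ q)"
    for f :: "int ^ 'l \<Rightarrow> int" and v
    unfolding blow_rays_def coord_rays_def ball_Un by (auto simp: pairing_blow_ray[OF card2])
  have "m1 \<in> F.section_polytope \<mu>" unfolding polytope_bound[OF nef(1)] rays using m1 xy(3) z(1) by simp
  moreover have "m - m1 \<in> F.section_polytope \<nu>" unfolding polytope_bound[OF nef(2)] rays
  proof (intro conjI allI impI)
    show "bound \<nu> (axis j 1) \<le> (m - m1) $ j" if "j \<noteq> q" for j using z(1)[OF that] m1(3)[OF that] by simp
    show "bound \<nu> (blow_ray q k) \<le> int k * (\<Sum>j\<in>UNIV - {q}. (m - m1) $ j) + (m - m1) $ q" if "k \<le> n" for k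
      using xy(4)[OF that] m1(1,2) by (simp add: sum_subtractf s_def)
  qed
  ultimately show ?thesis by (intro bexI[of _ m1] bexI[of _ "m - m1"]) auto
qed

lemma globally_generated_nef:
  assumes "F.trivialization L \<Phi> \<mu>" "globally_generated (blowup_fan q n) L"
  shows "nef \<mu>"
  unfolding nef_def
  using F.globally_generated_vertex[OF assms] F.trivialization_weight_eq[OF assms(1)] by blast

end

theorem proposition6p5:
  fixes q :: "'l::finite" and n :: nat
    and L\<^sub>h :: "('l toric_point, 'i) cocycle"
    and L\<^sub>k :: "('l toric_point, 'j) cocycle"
  assumes "CARD('l) \<ge> 2" and "n \<ge> 1"
    and "line_bundle (blowup_fan q n) L\<^sub>h"
    and "line_bundle (blowup_fan q n) L\<^sub>k"
    and "globally_generated (blowup_fan q n) L\<^sub>h"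
    and "globally_generated (blowup_fan q n) L\<^sub>k"
  shows "product_of_sections `
           tensor_space (global_sections (blowup_fan q n) L\<^sub>h) (global_sections (blowup_fan q n) L\<^sub>k)
         = global_sections (blowup_fan q n) (bundle_tensor L\<^sub>h L\<^sub>k)"
proof -
  interpret F: smooth_fan "blow_rays q n" "blow_simplices q n" "blowup_fan q n"
    by (rule smooth_fan_blowup[OF assms(1)])
  obtain \<Phi> \<mu> where t: "F.trivialization L\<^sub>h \<Phi> \<mu>" using F.trivialization_exists[OF assms(3)] by blast
  obtain \<Psi> \<nu> where t': "F.trivialization L\<^sub>k \<Psi> \<nu>" using F.trivialization_exists[OF assms(4)] by blast
  show ?thesis
    using polytope_split[OF assms(1) globally_generated_nef[OF assms(1) t assms(5)]
        globally_generated_nef[OF assms(1) t' assms(6)]]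
    by (intro F.product_of_sections_image[OF t t'])
qed

end
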